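(* For every $\beta\in(0,2]$ there is a constant $C_\beta>0$ depending only on $\beta$, and there are absolute constants $C>0$ and $\mathsf C>0$, such that the following holds. Consider a sequence, indexed by the sample size $n$, of one-sample problems as in the context ($d,\Sigma,\mathcal J,P^\circ,\Gamma^\circ,s_1,s_2$ may depend on $n$) satisfying, with $\beta$ and $c$ fixed: (1) $v^\top P_{\mathcal J}XX^\top P_{\mathcal J}\tilde v$ and $w^\top (I_d-P_{\mathcal J})XX^\top (I_d-P_{\mathcal J})\tilde w$ are uncorrelated for all $v,\tilde v,w,\tilde w\in\mathbb R^d$; (2) $\sup_{u\in S^{d-1}}\|u^\top\Sigma^{-1/2}X\|_{\psi_\beta}\le c<\infty$; (3) $\psi_n\max_{r\in\mathcal J}\mathbf r_r(\Sigma)\le 1/12$ and $\widetilde\psi_n\max_{r\in\mathcal J}\mathbf r_r(\Sigma)\le 1/12$. Assume that (under the alternative $P_{\mathcal J}\ne P^\circ$) $$\|P_{\mathcal J}-P^\circ\|_{(P^\circ,\Gamma^\circ,s_1,s_2)}\ge\lambda_n/\sqrt n,$$ where $\lambda_n$ satisfies $$\liminf_{n\to\infty}\frac{\lambda_n}{\sqrt n\big((\psi_n+\widetilde\psi_n)\overline{\mathsf d}^{1/2}+(\psi_n+\widetilde\psi_n)^2\mathsf d^{3/2}\big)}\ge\mathsf C.$$ Let $\mathcal Q^{(1)}=\sqrt n\|\widehat P_{\mathcal J}-P^\circ\|_{(P^\circ,\Gamma^\circ,s_1,s_2)}$, and for fixed $\alpha\in(0,1)$ and $\#\in\{B,F\}$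 let $q^{(1)}_\#(\alpha)=\inf\{\gamma>0:\Pr[\mathcal Q^{(1)}_\#>\gamma\mid\mathbf X]\le\alpha\}$ with $\mathcal Q^{(1)}_\#=\sqrt n\|P^\#_{\mathcal J}-\widehat P_{\mathcal J}\|_{(P^\circ,\Gamma^\circ,s_1,s_2)}$. Then (i) $\Pr[\mathcal Q^{(1)}>q^{(1)}_B(\alpha)]\to1$ as $n\to\infty$; (ii) $\Pr[\mathcal Q^{(1)}>q^{(1)}_F(\alpha)]\to1$ as $n\to\infty$.
   Context: Notation: $[k]=\{1,\dots,k\}$; $\|\cdot\|$ is the Euclidean norm of vectors and the spectral norm of matrices; $S^{k-1}$ is the unit sphere of $\mathbb R^k$; $A_{[i:j],[k:l]}$ is the submatrix with rows $i,\dots,j$ and columns $k,\dots,l$; $\|W\|_{\psi_\beta}=\inf\{\eta>0:\mathbb E e^{(|W|/\eta)^\beta}-1\le1\}$. "Projector" means orthogonal projector. Setup. $X_1,\dots,X_n$ are i.i.d. copies of a mean zero random vector $X\in\mathbb R^d$, $\mathbf X=[X_1,\dots,X_n]$. $\Sigma=\mathbb E[XX^\top]$ has strictly positive eigenvalues, with distinct values $\mu_1>\dots>\mu_q$; $\mathcal I_r$ is the set of indices $j\in[d]$ such that the $j$-th largest eigenvalue (with multiplicity) equals $\mu_r$, $m_r=|\mathcal I_r|$, and $P_r$ is the projector onto the eigenspace of $\mu_r$. $\mathcal J=\{r_1,\dots,r_2\}\subsetneq[q]$ is a nonempty set of consecutive indices, $\mathcal I_{\mathcal J}=\bigcup_{r\in\mathcal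 J}\mathcal I_r$, $m=|\mathcal I_{\mathcal J}|$, $P_{\mathcal J}=\sum_{r\in\mathcal J}P_r$. For a symmetric matrix, "the corresponding projector" is the projector onto the span of its eigenvectors with indices in $\mathcal I_{\mathcal J}$ (eigenvalues in decreasing order, assumed distinct with probability one for the random matrices below). $\widehat P_{\mathcal J}$ is the corresponding projector of $\widehat\Sigma=\frac1n\sum_iX_iX_i^\top$. $P^\circ$ is a given projector of rank $m$. Resampling. (B) $\eta_1,\dots,\eta_n$ are i.i.d. $\mathcal N(1,1)$, independent of the data; $\Sigma^B=\frac1n\sum_i\eta_iX_iX_i^\top$; $P^B_{\mathcal J}$ is its corresponding projector. (F) Conditionally on the data, $Z_1,\dots,Z_n$ are i.i.d. $\mathcal N(0,\widehat\Sigma)$; $\Sigma^F=\frac1n\sum_iZ_iZ_i^\top$; $P^F_{\mathcal J}$ is its corresponding projector. Norm. For a projector $P\in\mathbb R^{d\times d}$ of rank $m$, and $\Gamma=[\Gamma_1\ \Gamma_2]$ with $\Gamma_1\in\mathbb R^{d\times m}$, $\Gamma_2\in\mathbb R^{d\times(d-m)}$, $\Gamma_1\Gamma_1^\top=P$, $\Gamma_1^\top\Gamma_1=I_m$, $\Gamma_2\Gamma_2^\top=I_d-P$, $\Gamma_2^\top\Gamma_2=I_{d-m}$, and $s_1\in[m]$, $s_2\in[d-m]$, define for symmetric $A$ $$\|A\|_{(P,\Gamma,s_1,s_2)}=\tfrac12\|\Gamma_1^\top A\Gamma_1\|+\tfrac12\|\Gamma_2^\top A\Gamma_2\|+\max_{k\in[m-s_1+1],\,l\in[d-m-s_2+1]}\big\|[\Gamma_1^\top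 A\Gamma_2]_{[k:(k+s_1-1)],[l:(l+s_2-1)]}\big\|.$$ $\Gamma^\circ$ is any fixed matrix satisfying these relations for $P^\circ$. Quantities. With conventions $\mu_0=+\infty$, $\mu_{q+1}=0$: $\mathbf r_r(\Sigma)=\sum_{s\ne r}\frac{m_s\mu_s}{|\mu_r-\mu_s|}+\frac{m_r\mu_r}{\min(\mu_{r-1}-\mu_r,\mu_r-\mu_{r+1})}$; $\mathsf d=\Big(\sum_{r\in\mathcal J}\mathbf r_r(\Sigma)\sqrt{\sum_{s\ne r}\frac{m_r\mu_rm_s\mu_s}{(\mu_r-\mu_s)^2}}\Big)^{2/3}$; $\overline{\mathsf d}=\sum_{r\in\mathcal J}\sum_{s\notin\mathcal J}\frac{m_r\mu_rm_s\mu_s}{(\mu_r-\mu_s)^2}$; $\psi_n=C_\beta c^2\Big(\sqrt{\frac{\log n+\log d}{n}}+\frac{(\log n)^{1/\beta}(\log n+\log d)^{2/\beta}}{n}\Big)$; $\widetilde\psi_n=Cc^2\frac{(\log n+\log(2d^2))^{2/\beta+1/2}}{\sqrt n}$. *)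

theory Defs
  imports
    "HOL-Probability.Probability"
    "Jordan_Normal_Form.Spectral_Radius"
    "Jordan_Normal_Form.DL_Rank"
    "Jordan_Normal_Form.DL_Submatrix"
begin

no_notation inner (infix \<open>\<bullet>\<close> 70)
no_notation vec_nth (infixl \<open>$\<close> 90)

text \<open>
  Dimensions vary along the sequence of problems, hence vectors and matrices are those of
  Jordan_Normal_Form, whose coordinates are numbered from 0. All other indices (eigenvalues,
  spectral groups, observations, block positions) are numbered from 1, as on paper.
\<close>

definition vnorm :: "real vec \<Rightarrow> real" where
  "vnorm v = sqrt (v \<bullet> v)"

definition spectral_norm :: "real mat \<Rightarrow> real" where
  "spectral_norm A = (SUP v \<in> {v \<in> carrier_vec (dim_col A). vnorm v \<le> 1}. vnorm (A *\<^sub>v v))"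

definition outer :: "real vec \<Rightarrow> real vec \<Rightarrow> real mat" where
  "outer x y = mat (dim_vec x) (dim_vec y) (\<lambda>(i, j). x $ i * y $ j)"

definition is_projector :: "nat \<Rightarrow> real mat \<Rightarrow> bool" where
  "is_projector d P \<longleftrightarrow> P \<in> carrier_mat d d \<and> transpose_mat P = P \<and> P * P = P"

definition proj_onto :: "nat \<Rightarrow> real vec set \<Rightarrow> real mat" where
  "proj_onto d V = (THE P. is_projector d P \<and> (\<lambda>v. P *\<^sub>v v) ` carrier_vec d = V)"

definition vspan :: "nat \<Rightarrow> real vec set \<Rightarrow> real vec set" where
  "vspan d V = LinearCombinations.module.span class_ring (module_vec TYPE(real) d) V"

definition is_psd :: "nat \<Rightarrow> real mat \<Rightarrow> bool" where
  "is_psd d A \<longleftrightarrow> A \<in> carrier_mat d d \<and> transpose_mat A = A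
     \<and> (\<forall>v \<in> carrier_vec d. 0 \<le> v \<bullet> (A *\<^sub>v v))"

definition psd_sqrt :: "nat \<Rightarrow> real mat \<Rightarrow> real mat" where
  "psd_sqrt d A = (THE R. is_psd d R \<and> R * R = A)"

definition inv_mat :: "nat \<Rightarrow> real mat \<Rightarrow> real mat" where
  "inv_mat d A = (THE B. B \<in> carrier_mat d d \<and> A * B = 1\<^sub>m d \<and> B * A = 1\<^sub>m d)"

text \<open>All eigenvalues with multiplicity, in decreasing order; \<open>eig A j\<close> is the \<open>j\<close>-th largest.\<close>

definition eigs :: "real mat \<Rightarrow> real list" where
  "eigs A = (THE as. sorted_wrt (\<ge>) as \<and> char_poly A = (\<Prod>a\<leftarrow>as. [:- a, 1:]))"

definition eig :: "real mat \<Rightarrow> nat \<Rightarrow> real" where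
  "eig A j = eigs A ! (j - 1)"

text \<open>For a simple spectrum the vectors spanned are, up to scaling, the eigenvectors with index in
  \<open>I\<close>. At ties entire eigenspaces are taken, so that the map remains well defined (and Borel).\<close>

definition index_proj :: "nat \<Rightarrow> real mat \<Rightarrow> nat set \<Rightarrow> real mat" where
  "index_proj d A I = proj_onto d (vspan d {v. \<exists>j\<in>I. eigenvector A v (eig A j)})"

definition num_groups :: "real mat \<Rightarrow> nat" where
  "num_groups S = card (spectrum S)"

definition mu :: "real mat \<Rightarrow> nat \<Rightarrow> real" where
  "mu S r = rev (sorted_list_of_set (spectrum S)) ! (r - 1)"

definition grp :: "nat \<Rightarrow> real mat \<Rightarrow> nat \<Rightarrow> nat set" where
  "grp d S r = {j \<in> {1..d}. eig S j = mu S r}"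

definition mult :: "nat \<Rightarrow> real mat \<Rightarrow> nat \<Rightarrow> nat" where
  "mult d S r = card (grp d S r)"

definition grp_proj :: "nat \<Rightarrow> real mat \<Rightarrow> nat \<Rightarrow> real mat" where
  "grp_proj d S r = proj_onto d {v \<in> carrier_vec d. S *\<^sub>v v = mu S r \<cdot>\<^sub>v v}"

text \<open>The conventions are \<open>\<mu>\<^sub>0 = \<infinity>\<close> and \<open>\<mu>\<^bsub>q+1\<^esub> = 0\<close>.\<close>

definition gap :: "real mat \<Rightarrow> nat \<Rightarrow> real" where
  "gap S r =
    (let lower = mu S r - (if r = num_groups S then 0 else mu S (r + 1))
     in if r = 1 then lower else min (mu S (r - 1) - mu S r) lower)"

definition rel_rank :: "nat \<Rightarrow> real mat \<Rightarrow> nat \<Rightarrow> real" where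
  "rel_rank d S r =
    (\<Sum>s\<in>{1..num_groups S} - {r}. mult d S s * mu S s / \<bar>mu S r - mu S s\<bar>)
    + mult d S r * mu S r / gap S r"

definition pair_term :: "nat \<Rightarrow> real mat \<Rightarrow> nat \<Rightarrow> nat \<Rightarrow> real" where
  "pair_term d S r s = mult d S r * mu S r * mult d S s * mu S s / (mu S r - mu S s)\<^sup>2"

definition dsf :: "nat \<Rightarrow> real mat \<Rightarrow> nat set \<Rightarrow> real" where
  "dsf d S J =
    (\<Sum>r\<in>J. rel_rank d S r * sqrt (\<Sum>s\<in>{1..num_groups S} - {r}. pair_term d S r s)) powr (2/3)"

definition dbar :: "nat \<Rightarrow> real mat \<Rightarrow> nat set \<Rightarrow> real" where
  "dbar d S J = (\<Sum>r\<in>J. \<Sum>s\<in>{1..num_groups S} - J. pair_term d S r s)"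

definition psi :: "real \<Rightarrow> real \<Rightarrow> real \<Rightarrow> nat \<Rightarrow> nat \<Rightarrow> real" where
  "psi C\<beta> \<beta> c n d = C\<beta> * c\<^sup>2 *
    (sqrt ((ln n + ln d) / n) + ln n powr (1/\<beta>) * (ln n + ln d) powr (2/\<beta>) / n)"

definition psi_tilde :: "real \<Rightarrow> real \<Rightarrow> real \<Rightarrow> nat \<Rightarrow> nat \<Rightarrow> real" where
  "psi_tilde C \<beta> c n d = C * c\<^sup>2 * (ln n + ln (2 * real d ^ 2)) powr (2/\<beta> + 1/2) / sqrt n"

definition adapted_frame :: "nat \<Rightarrow> nat \<Rightarrow> real mat \<Rightarrow> real mat \<Rightarrow> real mat \<Rightarrow> bool" where
  "adapted_frame d m P G1 G2 \<longleftrightarrow>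
     G1 \<in> carrier_mat d m \<and> G2 \<in> carrier_mat d (d - m)
     \<and> G1 * transpose_mat G1 = P \<and> transpose_mat G1 * G1 = 1\<^sub>m m
     \<and> G2 * transpose_mat G2 = 1\<^sub>m d - P \<and> transpose_mat G2 * G2 = 1\<^sub>m (d - m)"

text \<open>Here \<open>m\<close> and \<open>d - m\<close> are the numbers of columns of \<open>G1\<close> and \<open>G2\<close>.\<close>

definition frame_norm :: "real mat \<Rightarrow> real mat \<Rightarrow> nat \<Rightarrow> nat \<Rightarrow> real mat \<Rightarrow> real" where
  "frame_norm G1 G2 s1 s2 A =
     1/2 * spectral_norm (transpose_mat G1 * A * G1)
     + 1/2 * spectral_norm (transpose_mat G2 * A * G2)
     + Max ((\<lambda>(k, l). spectral_norm
               (submatrix (transpose_mat G1 * A * G2) {k - 1..<k - 1 + s1} {l - 1..<l - 1 + s2}))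
            ` ({1..dim_col G1 - s1 + 1} \<times> {1..dim_col G2 - s2 + 1}))"

definition borel_vec :: "nat \<Rightarrow> real vec measure" where
  "borel_vec d = vimage_algebra (carrier_vec d) (\<lambda>v. \<lambda>i\<in>{..<d}. v $ i) (\<Pi>\<^sub>M i\<in>{..<d}. borel)"

definition cov_mat :: "nat \<Rightarrow> real vec measure \<Rightarrow> real mat" where
  "cov_mat d D = mat d d (\<lambda>(i, j). \<integral>x. x $ i * x $ j \<partial>D)"

text \<open>The expectation is a nonnegative integral, so that it may be infinite; an empty infimum
  is \<open>\<infinity>\<close>.\<close>

definition psi_norm :: "real \<Rightarrow> 'a measure \<Rightarrow> ('a \<Rightarrow> real) \<Rightarrow> ennreal" where
  "psi_norm \<beta> M W =
     Inf {ennreal \<eta> | \<eta>. 0 < \<eta> \<and> (\<integral>\<^sup>+x. ennreal (exp ((\<bar>W x\<bar> / \<eta>) powr \<beta>)) \<partial>M) - 1 \<le> 1}"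

definition uncorrelated :: "'a measure \<Rightarrow> ('a \<Rightarrow> real) \<Rightarrow> ('a \<Rightarrow> real) \<Rightarrow> bool" where
  "uncorrelated M V W \<longleftrightarrow>
     integrable M V \<and> integrable M W \<and> integrable M (\<lambda>x. V x * W x)
     \<and> (\<integral>x. V x * W x \<partial>M) = (\<integral>x. V x \<partial>M) * (\<integral>x. W x \<partial>M)"

definition std_gauss :: "real measure" where
  "std_gauss = density lborel (\<lambda>x. ennreal (std_normal_density x))"

text \<open>The centred normal law on \<open>d\<close>-vectors with a possibly singular covariance matrix \<open>S\<close>.\<close>

definition gauss_vec :: "nat \<Rightarrow> real mat \<Rightarrow> real vec measure" where
  "gauss_vec d S = distr (\<Pi>\<^sub>M i\<in>{..<d}. std_gauss) (borel_vec d) (\<lambda>g. psd_sqrt d S *\<^sub>v vec d g)"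

definition upper_quantile :: "'a measure \<Rightarrow> ('a \<Rightarrow> real) \<Rightarrow> real \<Rightarrow> real" where
  "upper_quantile M W \<alpha> = Inf {\<gamma>. 0 < \<gamma> \<and> \<P>(\<omega> in M. W \<omega> > \<gamma>) \<le> \<alpha>}"

definition weighted_cov :: "nat \<Rightarrow> nat \<Rightarrow> (nat \<Rightarrow> real) \<Rightarrow> (nat \<Rightarrow> real vec) \<Rightarrow> real mat" where
  "weighted_cov n d w x = mat d d (\<lambda>jk. 1 / n * (\<Sum>i=1..n. w i * outer (x i) (x i) $$ jk))"

definition sample_cov :: "nat \<Rightarrow> nat \<Rightarrow> (nat \<Rightarrow> real vec) \<Rightarrow> real mat" where
  "sample_cov n d x = weighted_cov n d (\<lambda>_. 1) x"

text \<open>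
  \<open>law\<close> is the law of \<open>X\<close>. The index set is \<open>{rlo..rhi}\<close>; \<open>P0\<close>, \<open>[G1 G2]\<close> are the
  hypothesised projector and its frame.
\<close>

record problem =
  dim :: nat
  law :: "real vec measure"
  rlo :: nat
  rhi :: nat
  P0 :: "real mat"
  G1 :: "real mat"
  G2 :: "real mat"
  s1 :: nat
  s2 :: nat

definition Cov :: "problem \<Rightarrow> real mat" where
  "Cov p = cov_mat (dim p) (law p)"

definition grps :: "problem \<Rightarrow> nat set" where
  "grps p = {rlo p..rhi p}"

definition idx :: "problem \<Rightarrow> nat set" where
  "idx p = (\<Union>r\<in>grps p. grp (dim p) (Cov p) r)"

definition PJ :: "problem \<Rightarrow> real mat" where
  "PJ p = mat (dim p) (dim p) (\<lambda>ij. \<Sum>r\<in>grps p. grp_proj (dim p) (Cov p) r $$ ij)"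

definition pnorm :: "problem \<Rightarrow> real mat \<Rightarrow> real" where
  "pnorm p A = frame_norm (G1 p) (G2 p) (s1 p) (s2 p) A"

definition valid_problem :: "problem \<Rightarrow> bool" where
  "valid_problem p \<longleftrightarrow>
     prob_space (law p) \<and> sets (law p) = sets (borel_vec (dim p))
     \<and> (\<forall>i<dim p. integrable (law p) (\<lambda>x. x $ i) \<and> (\<integral>x. x $ i \<partial>law p) = 0)
     \<and> (\<forall>i<dim p. \<forall>j<dim p. integrable (law p) (\<lambda>x. x $ i * x $ j))
     \<and> (\<forall>a\<in>spectrum (Cov p). 0 < a)
     \<and> 1 \<le> rlo p \<and> rlo p \<le> rhi p \<and> grps p \<subset> {1..num_groups (Cov p)}
     \<and> is_projector (dim p) (P0 p) \<and> vec_space.rank (dim p) (P0 p) = card (idx p)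
     \<and> adapted_frame (dim p) (card (idx p)) (P0 p) (G1 p) (G2 p)
     \<and> s1 p \<in> {1..card (idx p)} \<and> s2 p \<in> {1..dim p - card (idx p)}"

definition uncorrelated_blocks :: "problem \<Rightarrow> bool" where
  "uncorrelated_blocks p \<longleftrightarrow>
     (let d = dim p; P = PJ p; Pc = 1\<^sub>m d - P in
      \<forall>v\<in>carrier_vec d. \<forall>v'\<in>carrier_vec d. \<forall>w\<in>carrier_vec d. \<forall>w'\<in>carrier_vec d.
        uncorrelated (law p)
          (\<lambda>x. v \<bullet> ((P * outer x x * P) *\<^sub>v v'))
          (\<lambda>x. w \<bullet> ((Pc * outer x x * Pc) *\<^sub>v w')))"

definition psi_norm_sup :: "real \<Rightarrow> problem \<Rightarrow> ennreal" where
  "psi_norm_sup \<beta> p =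
     (SUP u \<in> {u \<in> carrier_vec (dim p). vnorm u = 1}.
        psi_norm \<beta> (law p) (\<lambda>x. u \<bullet> (psd_sqrt (dim p) (inv_mat (dim p) (Cov p)) *\<^sub>v x)))"

definition max_rel_rank :: "problem \<Rightarrow> real" where
  "max_rel_rank p = Max (rel_rank (dim p) (Cov p) ` grps p)"

text \<open>The observations are the coordinates of a product space, hence i.i.d. copies of \<open>X\<close>.\<close>

definition data_law :: "nat \<Rightarrow> problem \<Rightarrow> (nat \<Rightarrow> real vec) measure" where
  "data_law n p = (\<Pi>\<^sub>M i\<in>{1..n}. law p)"

text \<open>
  The two conditional laws given the data \<open>x\<close>. The multipliers are independent of the data, so
  their conditional law is their law.
\<close>

definition multiplier_law :: "nat \<Rightarrow> (nat \<Rightarrow> real) measure" where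
  "multiplier_law n = (\<Pi>\<^sub>M i\<in>{1..n}. density lborel (\<lambda>t. ennreal (normal_density 1 1 t)))"

definition gauss_sample_law :: "nat \<Rightarrow> problem \<Rightarrow> (nat \<Rightarrow> real vec) \<Rightarrow> (nat \<Rightarrow> real vec) measure" where
  "gauss_sample_law n p x = (\<Pi>\<^sub>M i\<in>{1..n}. gauss_vec (dim p) (sample_cov n (dim p) x))"

definition P_hat :: "nat \<Rightarrow> problem \<Rightarrow> (nat \<Rightarrow> real vec) \<Rightarrow> real mat" where
  "P_hat n p x = index_proj (dim p) (sample_cov n (dim p) x) (idx p)"

definition P_B :: "nat \<Rightarrow> problem \<Rightarrow> (nat \<Rightarrow> real vec) \<Rightarrow> (nat \<Rightarrow> real) \<Rightarrow> real mat" where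
  "P_B n p x \<eta> = index_proj (dim p) (weighted_cov n (dim p) \<eta> x) (idx p)"

definition P_F :: "nat \<Rightarrow> problem \<Rightarrow> (nat \<Rightarrow> real vec) \<Rightarrow> real mat" where
  "P_F n p z = index_proj (dim p) (sample_cov n (dim p) z) (idx p)"

definition simple_spectra :: "nat \<Rightarrow> problem \<Rightarrow> bool" where
  "simple_spectra n p \<longleftrightarrow>
     (AE x in data_law n p. distinct (eigs (sample_cov n (dim p) x)))
     \<and> (AE x in data_law n p. AE \<eta> in multiplier_law n.
          distinct (eigs (weighted_cov n (dim p) \<eta> x)))
     \<and> (AE x in data_law n p. AE z in gauss_sample_law n p x.
          distinct (eigs (sample_cov n (dim p) z)))"

definition Q1 :: "nat \<Rightarrow> problem \<Rightarrow> (nat \<Rightarrow> real vec) \<Rightarrow> real" where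
  "Q1 n p x = sqrt n * pnorm p (P_hat n p x - P0 p)"

definition q_B :: "nat \<Rightarrow> problem \<Rightarrow> real \<Rightarrow> (nat \<Rightarrow> real vec) \<Rightarrow> real" where
  "q_B n p \<alpha> x =
     upper_quantile (multiplier_law n) (\<lambda>\<eta>. sqrt n * pnorm p (P_B n p x \<eta> - P_hat n p x)) \<alpha>"

definition q_F :: "nat \<Rightarrow> problem \<Rightarrow> real \<Rightarrow> (nat \<Rightarrow> real vec) \<Rightarrow> real" where
  "q_F n p \<alpha> x =
     upper_quantile (gauss_sample_law n p x) (\<lambda>z. sqrt n * pnorm p (P_F n p z - P_hat n p x)) \<alpha>"

end

theory Submission
  imports Defs
begin

text \<open>
  Work in an eigenbasis of \<open>\<Sigma>\<close>. If \<open>|E i j| \<le> x sqrt (\<lambda> i * \<lambda> j)\<close> for all entries of the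
  perturbation and \<open>x\<close> times the relative rank is small, then no eigenvalue crosses a threshold
  half a gap away from \<open>\<mu> r\<close>; hence the perturbed spectral projector differs from the unperturbed
  one by a first-order term of size \<open>x\<close> times the square root of \<open>dbar\<close> and a remainder of size
  \<open>x\<^sup>2 dsf\<^sup>3\<^sup>/\<^sup>2\<close>. This applies to \<open>\<Sigma>\<close> against the sample covariance and to \<open>\<Sigma>\<close> against either
  resampled covariance.

  The entrywise bound holds with \<open>x\<close> of order \<open>c\<^sup>2 sqrt (ln n / n)\<close>, outside an event of probability
  \<open>O(d\<^sup>2 / n\<^sup>3)\<close>: truncation and a Chernoff bound for the data, Gaussian moment generating functions
  for the multipliers, and again truncation for the Gaussian samples. Simplicity of the spectrum of
  the sample covariance forces \<open>d \<le> n + 1\<close>, so this probability is \<open>O(1 / n)\<close>. On the good event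
  both quantiles are at most twice the perturbation bound, while the separation from \<open>P0\<close>
  exceeds three times that bound.
\<close>

section \<open>Eigensystems of symmetric matrices\<close>

text \<open>The hypotheses control the relative rank of \<open>\<Sigma>\<close> alone, so the
  resampled covariance is also compared with \<open>\<Sigma>\<close>; perturbing the sample
  covariance instead would require its spectral gaps. Bounds relative to
  \<open>sqrt (\<lambda> i * \<lambda> j)\<close> let the relative rank be the only smallness
  parameter: neither an operator norm nor a condition number enters. \<open>C\<beta>\<close> may be
  chosen large: the value \<open>288 * kappa \<beta>\<close> puts the whole error far below the rate
  in the separation condition. Since the union over matrix entries costs only a power of
  \<open>n\<close>, a fixed number of moments, extracted from the \<psi>-norm with a constant
  depending on \<beta>, yields every tail bound on the data. A lower bound for the probability of
  \<open>Q1 > q\<close> requires that event to be measurable. Eigenvectors admit no canonical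
  choice, so spectral projectors are rewritten as functions of the matrix and its sorted
  eigenvalues, and the Gaussian resampling law, which varies with the data, is pulled back to a
  fixed product space.\<close>

lemma ex_nonzero_orthogonal:
  assumes "finite I" "card I < d" "\<And>i. i \<in> I \<Longrightarrow> y i \<in> carrier_vec d"
  obtains x :: "real vec" where "x \<in> carrier_vec d" "x \<noteq> 0\<^sub>v d" "\<And>i. i \<in> I \<Longrightarrow> y i \<bullet> x = 0"
proof -
  obtain l where l: "distinct l" "set l = I" using finite_distinct_list[OF assms(1)] by auto
  have len: "length l < d" using l assms(2) distinct_card by fastforce
  \<comment> \<open>Row \<open>length l\<close> is zero, and it exists because there are fewer than
    \<open>d\<close> vectors. It forces the determinant to vanish and so supplies a kernel vector;
    its separate case matches the form of \<open>det_row_0\<close>.\<close>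
  define A where "A = mat\<^sub>r d d (\<lambda>k. if k = length l then 0\<^sub>v d else if k < length l then y (l!k) else 0\<^sub>v d)"
  have A: "A \<in> carrier_mat d d" unfolding A_def by auto
  have c: "(\<lambda>k. if k < length l then y (l!k) else 0\<^sub>v d) \<in> {0..<d} \<rightarrow> carrier_vec d"
    using assms(3) nth_mem[of _ l] unfolding l(2) by (auto simp: Pi_def)
  have rowA: "row A k = y (l!k)" if "k < length l" for k
  proof -
    have "y (l!k) \<in> carrier_vec d" using assms(3) nth_mem[OF that] unfolding l(2) by blast
    then show ?thesis using that len unfolding A_def by (subst row_mat_of_row_fun) auto
  qed
  have "det A = 0" unfolding A_def by (rule det_row_0[OF len c])
  then obtain x where "x \<in> carrier_vec d" "x \<noteq> 0\<^sub>v d" and Ax: "A *\<^sub>v x = 0\<^sub>v d"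
    using det_0_iff_vec_prod_zero[OF A] by auto
  moreover have "y i \<bullet> x = 0" if i: "i \<in> I" for i
  proof -
    obtain k where k: "k < length l" "l!k = i" using i unfolding l(2)[symmetric] by (auto simp: in_set_conv_nth)
    have "(A *\<^sub>v x) $ k = y i \<bullet> x" using k len A rowA by auto
    then show ?thesis using Ax k len by auto
  qed
  ultimately show thesis using that by blast
qed

section \<open>Orthonormal bases and the spectral theorem for real symmetric matrices\<close>

definition onb :: "nat \<Rightarrow> (nat \<Rightarrow> real vec) \<Rightarrow> bool" where
  "onb d v \<longleftrightarrow> (\<forall>k<d. v k \<in> carrier_vec d) \<and> (\<forall>i<d. \<forall>j<d. v i \<bullet> v j = of_bool (i = j))"

lemma onb_carrier: "onb d v \<Longrightarrow> k < d \<Longrightarrow> v k \<in> carrier_vec d"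
  and onb_prod: "onb d v \<Longrightarrow> i < d \<Longrightarrow> j < d \<Longrightarrow> v i \<bullet> v j = of_bool (i = j)"
  by (auto simp: onb_def)

text \<open>Orthonormality says \<open>V * V\<^sup>T = 1\<close> for the square matrix
  \<open>V\<close> with rows \<open>v k\<close>. A one-sided inverse of a square matrix is
  two-sided, so the rows also span.\<close>

lemma parseval:
  assumes v: "onb d v" and x: "x \<in> carrier_vec d" and y: "y \<in> carrier_vec d"
  shows "x \<bullet> y = (\<Sum>k<d. (x \<bullet> v k) * (y \<bullet> v k))"
proof -
  define V where "V = mat_of_rows d (map v [0..<d])"
  have V: "V \<in> carrier_mat d d" unfolding V_def by auto
  have row: "row V k = v k" if "k < d" for k
    unfolding V_def using that onb_carrier[OF v] by (subst mat_of_rows_row) auto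
  have "V * V\<^sup>T = 1\<^sub>m d"
    using V row onb_prod[OF v] by (intro eq_matI) auto
  then have "V\<^sup>T * V = 1\<^sub>m d"
    using mat_mult_left_right_inverse[of V d "V\<^sup>T"] V by auto
  then have "x = V\<^sup>T *\<^sub>v (V *\<^sub>v x)"
    using V x by (metis assoc_mult_mat_vec one_mult_mat_vec transpose_carrier_mat)
  then have "x \<bullet> y = y \<bullet> (V\<^sup>T *\<^sub>v (V *\<^sub>v x))" using comm_scalar_prod[OF x y] by simp
  also have "\<dots> = (V\<^sup>T *\<^sub>v (V *\<^sub>v x)) \<bullet> y"
    using V x y by (intro comm_scalar_prod[of _ d]) auto
  also have "\<dots> = (V *\<^sub>v x) \<bullet> (V *\<^sub>v y)"
    using transpose_vec_mult_scalar[of V d d y "V *\<^sub>v x"] V x y by simp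
  also have "\<dots> = (V *\<^sub>v y) \<bullet> (V *\<^sub>v x)" using V x y by (intro comm_scalar_prod[of _ d]) auto
  also have "\<dots> = (\<Sum>k<d. (v k \<bullet> y) * (v k \<bullet> x))"
    using V x y row by (auto simp: scalar_prod_def[of "V *\<^sub>v y"] lessThan_atLeast0)
  also have "\<dots> = (\<Sum>k<d. (x \<bullet> v k) * (y \<bullet> v k))"
    using onb_carrier[OF v] x y by (intro sum.cong) (auto simp: comm_scalar_prod[of _ d] mult.commute)
  finally show ?thesis .
qed

lemma scalar_prod_self_nonneg: "0 \<le> x \<bullet> (x :: real vec)"
  by (auto simp: scalar_prod_def intro: sum_nonneg)

lemma scalar_prod_self_eq_0: "x \<in> carrier_vec d \<Longrightarrow> x \<bullet> x = 0 \<longleftrightarrow> x = 0\<^sub>v d" for x :: "real vec"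
proof -
 assume a: "x \<in> carrier_vec d" then show ?thesis
  using conjugate_square_eq_0_vec[OF a] by simp
qed

lemma scalar_prod_self_pos: "x \<in> carrier_vec d \<Longrightarrow> x \<noteq> 0\<^sub>v d \<Longrightarrow> 0 < x \<bullet> x" for x :: "real vec"
proof -
  assume a: "x \<in> carrier_vec d" "x \<noteq> 0\<^sub>v d" then show ?thesis
  using scalar_prod_self_nonneg[of x] scalar_prod_self_eq_0[OF a(1)] by linarith
qed

lemma onb_eqI:
  assumes v: "onb d v" and x: "x \<in> carrier_vec d" and y: "y \<in> carrier_vec d"
    and eq: "\<And>k. k < d \<Longrightarrow> x \<bullet> v k = y \<bullet> v k"
  shows "x = y"
proof -
  have "(x - y) \<bullet> v k = 0" if "k < d" for k
    using eq[OF that] x y onb_carrier[OF v that] by (simp add: minus_scalar_prod_distrib[of _ d])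
  then have "(x - y) \<bullet> (x - y) = 0" using parseval[OF v, of "x - y" "x - y"] x y by simp
  then have "x - y = 0\<^sub>v d" using scalar_prod_self_eq_0[of "x - y" d] x y by simp
  show ?thesis
  proof (rule eq_vecI)
    fix i assume "i < dim_vec y"
    then show "x $ i = y $ i" using arg_cong[OF \<open>x - y = 0\<^sub>v d\<close>, of "\<lambda>z. z $ i"] x y by simp
  qed (use x y in simp)
qed

lemma onb_mat_eqI:
  assumes v: "onb d v" and M: "M \<in> carrier_mat d d" and N: "N \<in> carrier_mat d d"
    and eq: "\<And>k. k < d \<Longrightarrow> M *\<^sub>v v k = N *\<^sub>v v k"
  shows "M = N"
proof (rule eq_matI)
  fix i j assume ij: "i < dim_row N" "j < dim_col N"
  have "row M i = row N i"
  proof (rule onb_eqI[OF v])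
    fix k assume k: "k < d"
    have "(M *\<^sub>v v k) $ i = (N *\<^sub>v v k) $ i" using eq[OF k] by simp
    then show "row M i \<bullet> v k = row N i \<bullet> v k" using M N ij by auto
  qed (use M N ij in auto)
  then show "M $$ (i,j) = N $$ (i,j)" using M N ij by (metis carrier_matD index_row(1))
qed (use M N in auto)

text \<open>Induction on the number of missing vectors: fewer than \<open>d\<close> vectors always
  leave a nonzero vector orthogonal to them, which is then normalised.\<close>

lemma onb_extend:
  assumes "k \<le> d" "\<forall>i<k. v i \<in> carrier_vec d" "\<forall>i<k. \<forall>j<k. v i \<bullet> v j = of_bool (i = j)"
  shows "\<exists>w. onb d w \<and> (\<forall>i<k. w i = v i)"
  using assms
proof (induction "d - k" arbitrary: k v)
  case 0
  then show ?case by (auto simp: onb_def)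
next
  case (Suc n)
  have "card {..<k} < d" using Suc(2) by auto
  then obtain x where x: "x \<in> carrier_vec d" "x \<noteq> 0\<^sub>v d" "\<And>i. i \<in> {..<k} \<Longrightarrow> v i \<bullet> x = 0"
    using ex_nonzero_orthogonal[of "{..<k}" d v] Suc(4) by auto
  define z where "z = (1 / sqrt (x \<bullet> x)) \<cdot>\<^sub>v x"
  have z: "z \<in> carrier_vec d" "z \<bullet> z = 1" "\<And>i. i < k \<Longrightarrow> v i \<bullet> z = 0"
    using x scalar_prod_self_pos[OF x(1,2)] Suc(4)
    by (auto simp: z_def field_simps)
  have z': "z \<bullet> v i = 0" if "i < k" for i
    using z that Suc(4) comm_scalar_prod by metis
  have "\<exists>w. onb d w \<and> (\<forall>i<Suc k. w i = (v(k := z)) i)"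
    using Suc z z' by (intro Suc(1)) (auto simp: less_Suc_eq)
  then show ?case by (metis fun_upd_apply less_SucI nat_neq_iff)
qed

lemma scalar_prod_mult_mat_vec:
  fixes A :: "real mat"
  assumes "A \<in> carrier_mat n m" "x \<in> carrier_vec n" "y \<in> carrier_vec m"
  shows "x \<bullet> (A *\<^sub>v y) = (A\<^sup>T *\<^sub>v x) \<bullet> y"
  using transpose_vec_mult_scalar[OF assms(1) assms(3) assms(2)] by simp

lemma sym_scalar_prod:
  fixes A :: "real mat"
  assumes "A \<in> carrier_mat d d" "A\<^sup>T = A" "x \<in> carrier_vec d" "y \<in> carrier_vec d"
  shows "x \<bullet> (A *\<^sub>v y) = (A *\<^sub>v x) \<bullet> y"
  using scalar_prod_mult_mat_vec[OF assms(1,3,4)] assms(2) by simp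

text \<open>Over the complex numbers the characteristic polynomial has a root \<open>a\<close>. For
  an eigenvector \<open>w\<close>, symmetry of a real matrix lets \<open>A\<close> move across the
  Hermitian product, so that \<open>a\<close> and its conjugate agree on
  \<open>w \<bullet>c w\<close>, which is nonzero.\<close>

lemma symmetric_ex_eigenvalue:
  fixes A :: "real mat"
  assumes A: "A \<in> carrier_mat d d" and s: "A\<^sup>T = A" and d: "0 < d"
  shows "\<exists>e. eigenvalue A e"
proof -
  define B where "B = map_mat complex_of_real A"
  have B: "B \<in> carrier_mat d d" using A by (auto simp: B_def)
  have sB: "B\<^sup>T = B" using s by (metis B_def map_mat_transpose)
  obtain as where as: "char_poly B = (\<Prod>a\<leftarrow>as. [:- a, 1:])" "length as = d"
    using char_poly_factorized[OF B] by auto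
  then obtain a where "a \<in> set as" using d by (metis length_greater_0_conv list.set_sel(1))
  then have root: "poly (char_poly B) a = 0" unfolding as(1) by (auto simp: poly_prod_list prod_list_zero_iff)
  then obtain w where w: "w \<in> carrier_vec d" "w \<noteq> 0\<^sub>v d" "B *\<^sub>v w = a \<cdot>\<^sub>v w"
    using eigenvalue_root_char_poly[OF B] B by (auto simp: eigenvalue_def eigenvector_def)
  have conjB: "conjugate (B *\<^sub>v w) = B *\<^sub>v conjugate w"
  proof (rule eq_vecI)
    fix i assume "i < dim_vec (B *\<^sub>v conjugate w)"
    then have i: "i < d" using B by simp
    show "conjugate (B *\<^sub>v w) $ i = (B *\<^sub>v conjugate w) $ i"
      using i A w(1) by (simp add: B_def scalar_prod_def)
  qed (use B in auto)
  have "a * (w \<bullet>c w) = (B *\<^sub>v w) \<bullet> conjugate w" using w by auto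
  also have "\<dots> = w \<bullet> (B *\<^sub>v conjugate w)"
    using transpose_vec_mult_scalar[OF B, of "conjugate w" w] sB w by auto
  also have "\<dots> = w \<bullet> conjugate (a \<cdot>\<^sub>v w)" using conjB w by simp
  also have "\<dots> = cnj a * (w \<bullet>c w)" using w by (simp add: conjugate_smult_vec)
  finally have "a = cnj a" using conjugate_square_eq_0_vec[OF w(1)] w(2) by auto
  then obtain e where e: "a = complex_of_real e" by (metis Reals_cases Reals_cnj_iff)
  have "complex_of_real (poly (char_poly A) e) = 0"
    using root unfolding e B_def of_real_hom.char_poly_hom[OF A] by simp
  then show ?thesis using eigenvalue_root_char_poly[OF A] by auto
qed

text \<open>The last clause aligns \<open>lam\<close> with \<open>eig\<close>, up to a shift:
  position \<open>k\<close> here is eigenvalue number \<open>Suc k\<close> there.\<close>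

definition eigsys :: "nat \<Rightarrow> real mat \<Rightarrow> (nat \<Rightarrow> real) \<Rightarrow> (nat \<Rightarrow> real vec) \<Rightarrow> bool" where
  "eigsys d A lam v \<longleftrightarrow> A \<in> carrier_mat d d \<and> onb d v \<and> (\<forall>k<d. A *\<^sub>v v k = lam k \<cdot>\<^sub>v v k)
    \<and> (\<forall>i j. i \<le> j \<longrightarrow> j < d \<longrightarrow> lam j \<le> lam i)"

definition lin_comb :: "nat \<Rightarrow> nat \<Rightarrow> (nat \<Rightarrow> real) \<Rightarrow> (nat \<Rightarrow> real vec) \<Rightarrow> real vec" where
  "lin_comb d n y w = vec d (\<lambda>a. \<Sum>j<n. y j * w j $ a)"

lemma lin_comb_carrier [simp]: "lin_comb d n y w \<in> carrier_vec d"
  by (simp add: lin_comb_def)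

lemma lin_comb_scalar_prod:
  assumes "x \<in> carrier_vec d"
  shows "lin_comb d n y w \<bullet> x = (\<Sum>j<n. y j * (w j \<bullet> x))"
proof -
  have "lin_comb d n y w \<bullet> x = (\<Sum>a<d. \<Sum>j<n. y j * (w j $ a * x $ a))"
    using assms by (auto simp: lin_comb_def scalar_prod_def lessThan_atLeast0 sum_distrib_right mult.assoc intro!: sum.cong)
  also have "\<dots> = (\<Sum>j<n. \<Sum>a<d. y j * (w j $ a * x $ a))" by (rule sum.swap)
  also have "\<dots> = (\<Sum>j<n. y j * (w j \<bullet> x))"
    using assms by (auto simp: scalar_prod_def lessThan_atLeast0 sum_distrib_left)
  finally show ?thesis .
qed

text \<open>The orthogonal complement of eigenvectors is invariant under a symmetric matrix. The
  basis \<open>w\<close> extends the eigenvectors found so far, \<open>B\<close> is the compression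
  of \<open>A\<close> to the complement, and an eigenvector of \<open>B\<close>, read as coordinates
  with respect to the new basis vectors, is the next eigenvector of \<open>A\<close>.\<close>

lemma symmetric_orthonormal_eigenvectors:
  fixes A :: "real mat"
  assumes A: "A \<in> carrier_mat d d" and s: "A\<^sup>T = A"
  shows "k \<le> d \<Longrightarrow> \<exists>v. (\<forall>i<k. v i \<in> carrier_vec d) \<and> (\<forall>i<k. \<forall>j<k. v i \<bullet> v j = of_bool (i = j))
    \<and> (\<forall>i<k. \<exists>e. A *\<^sub>v v i = e \<cdot>\<^sub>v v i)"
proof (induction k)
  case 0
  show ?case by auto
next
  case (Suc k)
  then obtain v where v: "\<forall>i<k. v i \<in> carrier_vec d" "\<forall>i<k. \<forall>j<k. v i \<bullet> v j = of_bool (i = j)"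
    "\<forall>i<k. \<exists>e. A *\<^sub>v v i = e \<cdot>\<^sub>v v i" by auto
  obtain w where w: "onb d w" and wv: "\<forall>i<k. w i = v i" using onb_extend[of k d v] v Suc by auto
  define n where "n = d - k"
  have n: "0 < n" "d = k + n" using Suc by (auto simp: n_def)
  have wc: "w (k + j) \<in> carrier_vec d" if "j < n" for j using onb_carrier[OF w] that n by auto
  define B where "B = mat n n (\<lambda>(i,j). w (k + i) \<bullet> (A *\<^sub>v w (k + j)))"
  have B: "B \<in> carrier_mat n n" by (simp add: B_def)
  have "B\<^sup>T = B"
  proof (rule eq_matI)
    fix i j assume "i < dim_row B" "j < dim_col B"
    then have ij: "i < n" "j < n" using B by auto
    have "w (k + j) \<bullet> (A *\<^sub>v w (k + i)) = w (k + i) \<bullet> (A *\<^sub>v w (k + j))"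
      using sym_scalar_prod[OF A s wc[OF ij(2)] wc[OF ij(1)]]
        comm_scalar_prod[of "A *\<^sub>v w (k + j)" d "w (k + i)"] A wc ij by simp
    then show "B\<^sup>T $$ (i, j) = B $$ (i, j)" using ij by (simp add: B_def)
  qed (use B in auto)
  then obtain e where "eigenvalue B e" using symmetric_ex_eigenvalue[OF B] n by auto
  then obtain y where y: "y \<in> carrier_vec n" "y \<noteq> 0\<^sub>v n" "B *\<^sub>v y = e \<cdot>\<^sub>v y"
    using B by (auto simp: eigenvalue_def eigenvector_def)
  define z where "z = lin_comb d n (\<lambda>j. y $ j) (\<lambda>j. w (k + j))"
  have z: "z \<in> carrier_vec d" by (simp add: z_def)
  have z1: "z \<bullet> w l = 0" if "l < k" for l
    unfolding z_def using that n onb_carrier[OF w, of l] onb_prod[OF w]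
    by (subst lin_comb_scalar_prod) (auto intro!: sum.neutral)
  have z2: "z \<bullet> w (k + i) = y $ i" if "i < n" for i
  proof -
    have "z \<bullet> w (k + i) = (\<Sum>j<n. y $ j * of_bool (j = i))"
      unfolding z_def using that n onb_carrier[OF w, of "k + i"] onb_prod[OF w]
      by (subst lin_comb_scalar_prod) (auto intro!: sum.cong)
    also have "\<dots> = y $ i" using that by (simp add: of_bool_def if_distrib cong: if_cong)
    finally show ?thesis .
  qed
  have split: "l < d \<Longrightarrow> l < k \<or> (\<exists>i<n. l = k + i)" for l using n by presburger
  have Az: "A *\<^sub>v z = e \<cdot>\<^sub>v z"
  proof (rule onb_eqI[OF w])
    fix l assume l: "l < d"
    note wl = onb_carrier[OF w l]
    have sw: "(A *\<^sub>v z) \<bullet> w l = z \<bullet> (A *\<^sub>v w l)"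
      using sym_scalar_prod[OF A s z wl] by simp
    consider "l < k" | i where "i < n" "l = k + i" using split[OF l] by auto
    then show "(A *\<^sub>v z) \<bullet> w l = (e \<cdot>\<^sub>v z) \<bullet> w l"
    proof cases
      case 1
      then obtain c where c: "A *\<^sub>v w l = c \<cdot>\<^sub>v w l" using v wv by auto
      show ?thesis unfolding sw c using z wl z1[OF 1] by simp
    next
      case 2
      have "z \<bullet> (A *\<^sub>v w l) = (\<Sum>j<n. y $ j * (w (k + j) \<bullet> (A *\<^sub>v w l)))"
        unfolding z_def using A wl by (subst lin_comb_scalar_prod) auto
      also have "\<dots> = (\<Sum>j<n. B $$ (i, j) * y $ j)"
      proof (rule sum.cong[OF refl])
        fix j assume "j \<in> {..<n}"
        then have j: "j < n" by simp
        have "w (k + j) \<bullet> (A *\<^sub>v w l) = w (k + i) \<bullet> (A *\<^sub>v w (k + j))"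
          unfolding 2(2) using sym_scalar_prod[OF A s wc[OF j] wc[OF 2(1)]]
            comm_scalar_prod[of "A *\<^sub>v w (k + j)" d "w (k + i)"] A wc[OF j] wc[OF 2(1)] by simp
        then show "y $ j * (w (k + j) \<bullet> (A *\<^sub>v w l)) = B $$ (i, j) * y $ j"
          using 2 j by (simp add: B_def)
      qed
      also have "\<dots> = (B *\<^sub>v y) $ i" using B y(1) 2 by (simp add: scalar_prod_def lessThan_atLeast0)
      also have "\<dots> = e * y $ i" using y 2 by simp
      finally show ?thesis unfolding sw using z wl z2[OF 2(1)] 2 by simp
    qed
  qed (use A z in auto)
  have "z \<noteq> 0\<^sub>v d"
  proof
    assume "z = 0\<^sub>v d"
    then have "y $ i = 0" if "i < n" for i using z2[OF that] wc[OF that] by simp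
    then have "y = 0\<^sub>v n" using y(1) by (intro eq_vecI) auto
    then show False using y by simp
  qed
  then have zz: "0 < z \<bullet> z" using scalar_prod_self_pos z by blast
  define u where "u = (1 / sqrt (z \<bullet> z)) \<cdot>\<^sub>v z"
  have u: "u \<in> carrier_vec d" "u \<bullet> u = 1" "\<And>i. i < k \<Longrightarrow> u \<bullet> v i = 0"
    using z zz v(1) z1 wv by (auto simp: u_def field_simps)
  have u': "v i \<bullet> u = 0" if "i < k" for i
    using comm_scalar_prod[of u d "v i"] u v(1) that by simp
  have Au: "A *\<^sub>v u = e \<cdot>\<^sub>v u"
    unfolding u_def using A z Az by (simp add: mult_mat_vec[of _ d d] smult_smult_assoc mult.commute)
  show ?case
    using v u u' Au by (intro exI[of _ "v(k := u)"]) (auto simp: less_Suc_eq)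
qed

theorem symmetric_eigsys:
  assumes A: "A \<in> carrier_mat d d" and s: "A\<^sup>T = A"
  obtains lam v where "eigsys d A lam v"
proof -
  obtain v where v: "\<forall>i<d. v i \<in> carrier_vec d" "\<forall>i<d. \<forall>j<d. v i \<bullet> v j = of_bool (i = j)"
    "\<forall>i<d. \<exists>e. A *\<^sub>v v i = e \<cdot>\<^sub>v v i" using symmetric_orthonormal_eigenvectors[OF A s, of d] by auto
  then obtain e where e: "\<forall>i<d. A *\<^sub>v v i = e i \<cdot>\<^sub>v v i" by metis
  define p where "p = sort_key (\<lambda>i. - e i) [0..<d]"
  have p: "length p = d" "set p = {0..<d}" "distinct p" "sorted (map (\<lambda>i. - e i) p)"
    by (auto simp: p_def)
  have pk: "p ! k < d" if "k < d" for k using p that nth_mem[of k p] by auto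
  have "e (p ! j) \<le> e (p ! i)" if "i \<le> j" "j < d" for i j
    using sorted_nth_mono[OF p(4) that(1)] that p by simp
  then have "eigsys d A (\<lambda>k. e (p ! k)) (\<lambda>k. v (p ! k))"
    using A v e pk p by (auto simp: eigsys_def onb_def nth_eq_iff_index_eq)
  then show thesis using that by blast
qed

lemma eigsysD:
  assumes "eigsys d A lam v"
  shows "A \<in> carrier_mat d d" "onb d v" "\<And>k. k < d \<Longrightarrow> A *\<^sub>v v k = lam k \<cdot>\<^sub>v v k"
    "\<And>i j. i \<le> j \<Longrightarrow> j < d \<Longrightarrow> lam j \<le> lam i" "\<And>k. k < d \<Longrightarrow> v k \<in> carrier_vec d"
  using assms by (auto simp: eigsys_def onb_def)

text \<open>The spectral calculus: if \<open>v\<close> is an eigenbasis of \<open>A\<close>, this is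
  a function of \<open>A\<close>. Projectors, square roots and inverses are all of this form, so
  that identities between them become identities between the numbers \<open>f k\<close>.\<close>

definition fmat :: "nat \<Rightarrow> (nat \<Rightarrow> real) \<Rightarrow> (nat \<Rightarrow> real vec) \<Rightarrow> real mat" where
  "fmat d f v = mat d d (\<lambda>(a, b). \<Sum>k<d. f k * v k $ a * v k $ b)"

lemma fmat_carrier [simp]: "fmat d f v \<in> carrier_mat d d"
  by (simp add: fmat_def)

lemma fmat_sym [simp]: "(fmat d f v)\<^sup>T = fmat d f v"
  by (intro eq_matI) (auto simp: fmat_def mult.assoc mult.commute intro!: sum.cong)

lemma fmat_mult_vec:
  assumes v: "onb d v" and x: "x \<in> carrier_vec d"
  shows "fmat d f v *\<^sub>v x = lin_comb d d (\<lambda>k. f k * (v k \<bullet> x)) v"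
proof (rule eq_vecI)
  fix a assume "a < dim_vec (lin_comb d d (\<lambda>k. f k * (v k \<bullet> x)) v)"
  then have a: "a < d" by (simp add: lin_comb_def)
  have "(fmat d f v *\<^sub>v x) $ a = (\<Sum>b<d. \<Sum>k<d. f k * v k $ a * (v k $ b * x $ b))"
    using a x by (auto simp: fmat_def scalar_prod_def lessThan_atLeast0 sum_distrib_right mult.assoc intro!: sum.cong)
  also have "\<dots> = (\<Sum>k<d. \<Sum>b<d. f k * v k $ a * (v k $ b * x $ b))" by (rule sum.swap)
  also have "\<dots> = lin_comb d d (\<lambda>k. f k * (v k \<bullet> x)) v $ a"
    using a x by (auto simp: lin_comb_def scalar_prod_def lessThan_atLeast0 sum_distrib_left sum_distrib_right ac_simps intro!: sum.cong)
  finally show "(fmat d f v *\<^sub>v x) $ a = lin_comb d d (\<lambda>k. f k * (v k \<bullet> x)) v $ a" .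
qed (simp add: lin_comb_def fmat_def)

lemma fmat_bilinear:
  assumes v: "onb d v" and x: "x \<in> carrier_vec d" and y: "y \<in> carrier_vec d"
  shows "x \<bullet> (fmat d f v *\<^sub>v y) = (\<Sum>k<d. f k * (x \<bullet> v k) * (y \<bullet> v k))"
proof -
  have "x \<bullet> (fmat d f v *\<^sub>v y) = lin_comb d d (\<lambda>k. f k * (v k \<bullet> y)) v \<bullet> x"
    unfolding fmat_mult_vec[OF v y] using x by (intro comm_scalar_prod) auto
  then show ?thesis
    using onb_carrier[OF v] x y by (auto simp: lin_comb_scalar_prod[OF x] comm_scalar_prod[of _ d] intro!: sum.cong)
qed

lemma fmat_scalar:
  assumes v: "onb d v" and x: "x \<in> carrier_vec d" and l: "l < d"
  shows "(fmat d f v *\<^sub>v x) \<bullet> v l = f l * (x \<bullet> v l)"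
proof -
  have "(fmat d f v *\<^sub>v x) \<bullet> v l = v l \<bullet> (fmat d f v *\<^sub>v x)"
    using x onb_carrier[OF v l] by (intro comm_scalar_prod[of _ d] mult_mat_vec_carrier[of _ d d]) auto
  also have "\<dots> = (\<Sum>k<d. f k * of_bool (l = k) * (x \<bullet> v k))"
    unfolding fmat_bilinear[OF v onb_carrier[OF v l] x] using onb_prod[OF v l] by (auto intro!: sum.cong)
  also have "\<dots> = f l * (x \<bullet> v l)" using l by (simp add: of_bool_def if_distrib[of "\<lambda>z. _ * z * _"] cong: if_cong)
  finally show ?thesis .
qed

lemma fmat_eig:
  assumes v: "onb d v" and l: "l < d"
  shows "fmat d f v *\<^sub>v v l = f l \<cdot>\<^sub>v v l"
proof (rule onb_eqI[OF v])
  show "fmat d f v *\<^sub>v v l \<in> carrier_vec d"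
    using onb_carrier[OF v l] by (intro mult_mat_vec_carrier[of _ d d]) auto
  fix k assume k: "k < d"
  show "(fmat d f v *\<^sub>v v l) \<bullet> v k = (f l \<cdot>\<^sub>v v l) \<bullet> v k"
    using onb_carrier[OF v l] onb_carrier[OF v k] onb_prod[OF v l k] l k by (cases "l = k") (simp_all add: fmat_scalar[OF v])
qed (use onb_carrier[OF v l] in simp)

lemma fmat_eqI:
  assumes v: "onb d v" and M: "M \<in> carrier_mat d d" and eq: "\<And>k. k < d \<Longrightarrow> M *\<^sub>v v k = f k \<cdot>\<^sub>v v k"
  shows "M = fmat d f v"
  using eq by (intro onb_mat_eqI[OF v M]) (auto simp: fmat_eig[OF v])

lemma fmat_cong: "(\<And>k. k < d \<Longrightarrow> f k = g k) \<Longrightarrow> fmat d f v = fmat d g v"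
  by (auto simp: fmat_def intro!: eq_matI sum.cong)

lemma fmat_mult:
  assumes v: "onb d v"
  shows "fmat d f v * fmat d g v = fmat d (\<lambda>k. f k * g k) v"
proof (rule fmat_eqI[OF v])
  fix k assume k: "k < d"
  show "(fmat d f v * fmat d g v) *\<^sub>v v k = (f k * g k) \<cdot>\<^sub>v v k"
    using onb_carrier[OF v k] fmat_eig[OF v k]
    by (simp add: assoc_mult_mat_vec[of _ d d _ d] mult_mat_vec[of _ d d] smult_smult_assoc mult.commute)
qed (simp add: mult_carrier_mat[of _ d d])

lemma fmat_one: "onb d v \<Longrightarrow> fmat d (\<lambda>_. 1) v = 1\<^sub>m d"
  by (rule fmat_eqI[symmetric]) (auto dest: onb_carrier)

lemma eigsys_fmat: "eigsys d A lam v \<Longrightarrow> A = fmat d lam v"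
  using fmat_eqI[of d v A lam] eigsysD by blast

lemma eigsys_sym: "eigsys d A lam v \<Longrightarrow> A\<^sup>T = A"
  using eigsys_fmat fmat_sym by metis

section \<open>Sorted eigenvalue lists and spectra\<close>

lemma eigsys_char_poly:
  assumes "eigsys d A lam v"
  shows "char_poly A = (\<Prod>a\<leftarrow>map lam [0..<d]. [:- a, 1:])"
proof -
  note e = eigsysD[OF assms]
  define V where "V = mat_of_cols d (map v [0..<d])"
  define D where "D = mat d d (\<lambda>(i, j). if i = j then lam i else 0)"
  have V: "V \<in> carrier_mat d d" and D: "D \<in> carrier_mat d d" by (auto simp: V_def D_def)
  have col: "col V k = v k" if "k < d" for k
    unfolding V_def using that e(5) by (subst col_mat_of_cols) auto
  have VV: "V\<^sup>T * V = 1\<^sub>m d"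
    using V col onb_prod[OF e(2)] by (intro eq_matI) auto
  then have VV': "V * V\<^sup>T = 1\<^sub>m d"
    using mat_mult_left_right_inverse[of "V\<^sup>T" d V] V by auto
  have AV: "A * V = V * D"
  proof (rule eq_matI)
    fix i j assume "i < dim_row (V * D)" "j < dim_col (V * D)"
    then have ij: "i < d" "j < d" using V D by auto
    have "(A * V) $$ (i, j) = (A *\<^sub>v v j) $ i" using ij e(1) V col by simp
    also have "\<dots> = lam j * v j $ i" using e(3)[OF ij(2)] e(5)[OF ij(2)] ij by simp
    also have "\<dots> = (\<Sum>k<d. V $$ (i, k) * (if k = j then lam j else 0))"
      using ij V col[OF ij(2)] by (simp add: if_distrib cong: if_cong) (metis V carrier_matD(1) carrier_matD(2) index_col)
    also have "\<dots> = (V * D) $$ (i, j)" using ij V by (auto simp: scalar_prod_def D_def lessThan_atLeast0 intro!: sum.cong)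
    finally show "(A * V) $$ (i, j) = (V * D) $$ (i, j)" .
  qed (use e V D in auto)
  have "A = A * (V * V\<^sup>T)" using VV' e(1) by simp
  also have "\<dots> = V * D * V\<^sup>T" using e(1) V AV by (simp flip: assoc_mult_mat[of A d d V d "V\<^sup>T" d])
  finally have "similar_mat A D"
    using e(1) V D VV VV' by (intro similar_matI[of _ _ V "V\<^sup>T" d]) auto
  then have "char_poly A = char_poly D" by (rule char_poly_similar)
  also have "\<dots> = (\<Prod>a\<leftarrow>diag_mat D. [:- a, 1:])"
    using D by (intro char_poly_upper_triangular) (auto simp: D_def upper_triangular_def)
  also have "diag_mat D = map lam [0..<d]" by (auto simp: diag_mat_def D_def)
  finally show ?thesis .
qed

text \<open>\<open>eigs\<close> is a definite description, so uniqueness is the point: the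
  characteristic polynomial determines the multiset of its roots, and a decreasing list is
  determined by its multiset.\<close>

lemma eigs_eq:
  assumes "eigsys d A lam v"
  shows "eigs A = map lam [0..<d]"
  unfolding eigs_def
proof (rule the_equality)
  show "sorted_wrt (\<ge>) (map lam [0..<d]) \<and> char_poly A = (\<Prod>a\<leftarrow>map lam [0..<d]. [:- a, 1:])"
    using eigsys_char_poly[OF assms] eigsysD(4)[OF assms] by (auto simp: sorted_wrt_iff_nth_less)
  have pr: "proots (\<Prod>a\<leftarrow>as. [:- a, 1:]) = mset as" for as :: "real list"
  proof -
    have "proots (\<Prod>p\<leftarrow>map (\<lambda>a. [:- a, 1:]) as. p) = (\<Sum>p\<leftarrow>map (\<lambda>a. [:- a, 1:]) as. proots p)"
      by (rule proots_prod_list) auto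
    also have "\<dots> = mset as" by (induction as) auto
    finally show ?thesis by simp
  qed
  fix as assume as: "sorted_wrt (\<ge>) as \<and> char_poly A = (\<Prod>a\<leftarrow>as. [:- a, 1:])"
  have "mset as = mset (map lam [0..<d])"
    using pr as eigsys_char_poly[OF assms] by metis
  then have m: "mset (rev as) = mset (rev (map lam [0..<d]))" by simp
  have "sorted (rev as)" using as by (simp add: sorted_wrt_rev)
  moreover have "sorted (rev (map lam [0..<d]))"
    unfolding sorted_wrt_rev using eigsysD(4)[OF assms] by (auto simp: sorted_wrt_iff_nth_less)
  ultimately have "rev as = rev (map lam [0..<d])"
    using m properties_for_sort by metis
  then show "as = map lam [0..<d]" by simp
qed

lemma eig_Suc: "eigsys d A lam v \<Longrightarrow> k < d \<Longrightarrow> eig A (Suc k) = lam k"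
  by (simp add: eig_def eigs_eq)

lemma eig_eq: "eigsys d A lam v \<Longrightarrow> j \<in> {1..d} \<Longrightarrow> eig A j = lam (j - 1)"
  using eig_Suc[of d A lam v "j - 1"] by auto

lemma eigsys_eigenvector_orth:
  assumes "eigsys d A lam v" "x \<in> carrier_vec d" "A *\<^sub>v x = e \<cdot>\<^sub>v x" "k < d" "lam k \<noteq> e"
  shows "x \<bullet> v k = 0"
proof -
  note e = eigsysD[OF assms(1)]
  have "e * (x \<bullet> v k) = (A *\<^sub>v x) \<bullet> v k" using assms e(5) by simp
  also have "\<dots> = lam k * (x \<bullet> v k)"
    using sym_scalar_prod[OF e(1) eigsys_sym[OF assms(1)] assms(2) e(5)[OF assms(4)]] e(3,5) assms by simp
  finally show ?thesis using assms(5) by simp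
qed

lemma spectrum_eq:
  assumes "eigsys d A lam v"
  shows "spectrum A = lam ` {..<d}"
proof -
  note e = eigsysD[OF assms]
  show ?thesis
  proof (intro equalityI subsetI)
    fix x assume "x \<in> spectrum A"
    then obtain w where w: "w \<in> carrier_vec d" "w \<noteq> 0\<^sub>v d" "A *\<^sub>v w = x \<cdot>\<^sub>v w"
      using e(1) by (auto simp: spectrum_def eigenvalue_def eigenvector_def)
    show "x \<in> lam ` {..<d}"
    proof (rule ccontr)
      assume "x \<notin> lam ` {..<d}"
      then have "w \<bullet> v k = 0" if "k < d" for k
        using eigsys_eigenvector_orth[OF assms w(1,3) that] that by auto
      then have "w = 0\<^sub>v d" using e(5) w(1) by (intro onb_eqI[OF e(2)]) auto
      then show False using w by simp
    qed
  next
    fix x assume "x \<in> lam ` {..<d}"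
    then obtain k where k: "k < d" "x = lam k" by auto
    have "v k \<noteq> 0\<^sub>v d" using onb_prod[OF e(2), of k k] k e(5)[OF k(1)] by auto
    then show "x \<in> spectrum A" using k e(1) e(3,5)[OF k(1)] by (auto simp: spectrum_def eigenvalue_def eigenvector_def intro!: exI[of _ "v k"])
  qed
qed


section \<open>Spectral projectors, square roots and inverses in an eigenbasis\<close>

lemma fmat_projector_image:
  assumes v: "onb d v"
  shows "(\<lambda>x. fmat d (\<lambda>k. of_bool (K k)) v *\<^sub>v x) ` carrier_vec d
    = {x \<in> carrier_vec d. \<forall>k<d. \<not> K k \<longrightarrow> x \<bullet> v k = 0}" (is "?f ` _ = ?W")
proof (intro equalityI subsetI)
  fix y assume "y \<in> ?f ` carrier_vec d"
  then obtain x where x: "x \<in> carrier_vec d" "y = ?f x" by auto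
  then show "y \<in> ?W" using fmat_scalar[OF v x(1)] by (auto intro!: mult_mat_vec_carrier[of _ d d])
next
  fix x assume x: "x \<in> ?W"
  have "?f x = x"
    using x by (intro onb_eqI[OF v]) (auto simp: fmat_scalar[OF v] intro!: mult_mat_vec_carrier[of _ d d])
  then show "x \<in> ?f ` carrier_vec d" using x by (metis (no_types, lifting) image_eqI mem_Collect_eq)
qed

lemma fmat_is_projector: "onb d v \<Longrightarrow> is_projector d (fmat d (\<lambda>k. of_bool (K k)) v)"
  by (auto simp: is_projector_def fmat_mult simp flip: of_bool_conj)

text \<open>A projector is the identity on its image, hence \<open>P * Q = Q\<close> and
  \<open>Q * P = P\<close>. Transposing the second equation gives \<open>P * Q = P\<close>.\<close>

lemma is_projector_unique:
  assumes P: "is_projector d P" and Q: "is_projector d Q"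
    and im: "(\<lambda>x. P *\<^sub>v x) ` carrier_vec d = (\<lambda>x. Q *\<^sub>v x) ` carrier_vec d"
  shows "P = Q"
proof -
  note p = P[unfolded is_projector_def] and q = Q[unfolded is_projector_def]
  have ab: "A * B = B" if A: "A \<in> carrier_mat d d" "A * A = A" and B: "B \<in> carrier_mat d d"
    and sub: "(\<lambda>x. B *\<^sub>v x) ` carrier_vec d \<subseteq> (\<lambda>x. A *\<^sub>v x) ` carrier_vec d" for A B :: "real mat"
  proof (rule mat_col_eqI)
    fix j assume "j < dim_col B"
    then have j: "j < d" using B by simp
    have "col B j = B *\<^sub>v unit_vec d j" using B j by (intro eq_vecI) auto
    then obtain x where x: "x \<in> carrier_vec d" "col B j = A *\<^sub>v x" using sub by (metis (no_types, lifting) imageE imageI subsetD unit_vec_carrier)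
    have "col (A * B) j = A *\<^sub>v col B j" using A B j by (intro eq_vecI) auto
    also have "\<dots> = (A * A) *\<^sub>v x" using A(1) x by (simp only: assoc_mult_mat_vec[of A d d A d x])
    finally show "col (A * B) j = col B j" using A(2) x by simp
  qed (use A B in auto)
  have "P * Q = Q" "Q * P = P" using ab p q im by auto
  then have "P = (Q * P)\<^sup>T" using p by simp
  also have "\<dots> = P\<^sup>T * Q\<^sup>T" using p q by (intro transpose_mult) auto
  finally show ?thesis using p q \<open>P * Q = Q\<close> by simp
qed

lemma proj_onto_eq:
  assumes "onb d v"
  shows "proj_onto d {x \<in> carrier_vec d. \<forall>k<d. \<not> K k \<longrightarrow> x \<bullet> v k = 0} = fmat d (\<lambda>k. of_bool (K k)) v"
  unfolding proj_onto_def
proof (rule the_equality)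
  show "is_projector d (fmat d (\<lambda>k. of_bool (K k)) v) \<and> (\<lambda>x. fmat d (\<lambda>k. of_bool (K k)) v *\<^sub>v x) ` carrier_vec d
    = {x \<in> carrier_vec d. \<forall>k<d. \<not> K k \<longrightarrow> x \<bullet> v k = 0}"
    using fmat_is_projector fmat_projector_image assms by blast
next
  fix P assume P: "is_projector d P \<and> (\<lambda>x. P *\<^sub>v x) ` carrier_vec d = {x \<in> carrier_vec d. \<forall>k<d. \<not> K k \<longrightarrow> x \<bullet> v k = 0}"
  show "P = fmat d (\<lambda>k. of_bool (K k)) v"
    by (rule is_projector_unique[of d]) (use P fmat_is_projector[OF assms] fmat_projector_image[OF assms] in auto)
qed

text \<open>Eigenvectors for different eigenvalues are orthogonal, which gives one inclusion; the
  other expands a vector in the basis, where only basis vectors with eigenvalue in \<open>S\<close>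
  survive. As \<open>S\<close> consists of values, whole eigenspaces are spanned.\<close>

lemma vspan_eigenvectors:
  assumes es: "eigsys d A lam v"
  shows "vspan d {x. \<exists>e\<in>S. eigenvector A x e}
    = {x \<in> carrier_vec d. \<forall>k<d. lam k \<notin> S \<longrightarrow> x \<bullet> v k = 0}" (is "vspan d ?E = ?W")
proof -
  interpret vec_space "TYPE(real)" d .
  note e = eigsysD[OF es]
  have E: "?E \<subseteq> carrier_vec d" using e(1) by (auto simp: eigenvector_def)
  have EW: "x \<bullet> v k = 0" if "x \<in> ?E" "k < d" "lam k \<notin> S" for x k
    using that eigsys_eigenvector_orth[OF es _ _ that(2), of x] e(1) by (auto simp: eigenvector_def)
  have span: "span ?E = ?W"
  proof (intro equalityI subsetI)
    fix x assume "x \<in> span ?E"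
    then obtain a T where T: "finite T" "T \<subseteq> ?E" and x: "x = lincomb a T"
      by (auto simp: span_def)
    have Tc: "T \<subseteq> carrier_vec d" using T E by auto
    have xc: "x \<in> carrier_vec d" unfolding x using Tc T by (intro lincomb_closed) auto
    have "x \<bullet> v k = 0" if k: "k < d" "lam k \<notin> S" for k
    proof -
      have "x \<bullet> v k = (\<Sum>i<d. (\<Sum>y\<in>T. a y * y $ i) * v k $ i)"
        using e(5)[OF k(1)] lincomb_index[OF _ Tc, of _ a] by (auto simp: scalar_prod_def x lessThan_atLeast0 intro!: sum.cong)
      also have "\<dots> = (\<Sum>i<d. \<Sum>y\<in>T. a y * (y $ i * v k $ i))" by (simp add: sum_distrib_right mult.assoc)
      also have "\<dots> = (\<Sum>y\<in>T. \<Sum>i<d. a y * (y $ i * v k $ i))" by (rule sum.swap)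
      also have "\<dots> = (\<Sum>y\<in>T. a y * (y \<bullet> v k))"
        using e(5)[OF k(1)] by (auto simp: scalar_prod_def lessThan_atLeast0 sum_distrib_left)
      also have "\<dots> = 0"
      proof (rule sum.neutral, rule ballI)
        fix y assume "y \<in> T"
        then have "y \<in> ?E" using T by blast
        then show "a y * (y \<bullet> v k) = 0" using EW[of y k] k by simp
      qed
      finally show ?thesis .
    qed
    then show "x \<in> ?W" using xc by auto
  next
    fix x assume x: "x \<in> ?W"
    define K where "K = {k. k < d \<and> lam k \<in> S}"
    have inj: "inj_on v K"
    proof (rule inj_onI)
      fix i j assume ij: "i \<in> K" "j \<in> K" "v i = v j"
      then have "v i \<bullet> v j = 1" using onb_prod[OF e(2), of i i] by (auto simp: K_def)
      then show "i = j" using onb_prod[OF e(2), of i j] ij by (cases "i = j") (auto simp: K_def)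
    qed
    have KE: "v ` K \<subseteq> ?E"
    proof
      fix y assume "y \<in> v ` K"
      then obtain k where k: "k < d" "lam k \<in> S" "y = v k" by (auto simp: K_def)
      then have "v k \<noteq> 0\<^sub>v d" using onb_prod[OF e(2), of k k] e(5)[OF k(1)] by auto
      then show "y \<in> ?E" using k e(1) e(3,5)[OF k(1)] by (auto simp: eigenvector_def)
    qed
    have "x = lincomb (\<lambda>y. x \<bullet> y) (v ` K)"
    proof (rule eq_vecI)
      have fin: "finite (v ` K)" by (simp add: K_def)
      have KC: "v ` K \<subseteq> carrier_vec d" using KE E by (rule order_trans)
      have "x \<in> carrier_vec d" using x by simp
      then show "dim_vec x = dim_vec (lincomb (\<lambda>y. x \<bullet> y) (v ` K))"
        using lincomb_dim[OF fin KC, of "\<lambda>y. x \<bullet> y"] by simp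
      fix i assume "i < dim_vec (lincomb (\<lambda>y. x \<bullet> y) (v ` K))"
      then have i: "i < d" using lincomb_dim[OF fin KC, of "\<lambda>y. x \<bullet> y"] by simp
      have xc: "x \<in> carrier_vec d" using x by auto
      have "x $ i = (fmat d (\<lambda>_. 1) v *\<^sub>v x) $ i" using fmat_one[OF e(2)] x by simp
      also have "\<dots> = (\<Sum>k<d. (v k \<bullet> x) * v k $ i)"
        unfolding fmat_mult_vec[OF e(2) xc] using i by (simp add: lin_comb_def)
      also have "\<dots> = (\<Sum>k\<in>K. (x \<bullet> v k) * v k $ i)"
        using x e(5) by (intro sum.mono_neutral_cong_right) (auto simp: K_def comm_scalar_prod[of _ d])
      also have "\<dots> = lincomb (\<lambda>y. x \<bullet> y) (v ` K) $ i"
        using KE E i by (subst lincomb_index) (auto simp: sum.reindex[OF inj])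
      finally show "x $ i = lincomb (\<lambda>y. x \<bullet> y) (v ` K) $ i" .
    qed
    moreover have "finite (v ` K)" by (simp add: K_def)
    ultimately show "x \<in> span ?E" unfolding span_def using KE by blast
  qed
  show ?thesis unfolding vspan_def using span .
qed

text \<open>The condition is on the value \<open>lam k\<close> and not on the position
  \<open>k\<close>: if an index in \<open>I\<close> ties with one outside, both are counted.
  Locating the perturbed eigenvalues will later turn it back into a condition on positions.\<close>

lemma index_proj_eq:
  assumes es: "eigsys d A lam v"
  shows "index_proj d A I = fmat d (\<lambda>k. of_bool (lam k \<in> eig A ` I)) v"
proof -
  have "index_proj d A I = proj_onto d (vspan d {x. \<exists>e\<in>eig A ` I. eigenvector A x e})"
    by (simp add: index_proj_def)
  then show ?thesis unfolding vspan_eigenvectors[OF es] proj_onto_eq[OF eigsysD(2)[OF es], of "\<lambda>k. lam k \<in> eig A ` I"] .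
qed

lemma grp_proj_eq:
  assumes es: "eigsys d A lam v"
  shows "grp_proj d A r = fmat d (\<lambda>k. of_bool (lam k = mu A r)) v"
proof -
  note e = eigsysD[OF es]
  have "{x \<in> carrier_vec d. A *\<^sub>v x = mu A r \<cdot>\<^sub>v x} = {x \<in> carrier_vec d. \<forall>k<d. \<not> lam k = mu A r \<longrightarrow> x \<bullet> v k = 0}"
  proof (intro equalityI subsetI)
    fix x assume "x \<in> {x \<in> carrier_vec d. \<forall>k<d. \<not> lam k = mu A r \<longrightarrow> x \<bullet> v k = 0}"
    then have x: "x \<in> carrier_vec d" "\<And>k. k < d \<Longrightarrow> lam k \<noteq> mu A r \<Longrightarrow> x \<bullet> v k = 0" by auto
    have "A *\<^sub>v x = mu A r \<cdot>\<^sub>v x"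
    proof (rule onb_eqI[OF e(2)])
      fix k assume k: "k < d"
      have "(A *\<^sub>v x) \<bullet> v k = lam k * (x \<bullet> v k)"
        using fmat_scalar[OF e(2) x(1) k, of lam] eigsys_fmat[OF es] by simp
      then show "(A *\<^sub>v x) \<bullet> v k = (mu A r \<cdot>\<^sub>v x) \<bullet> v k" using x k e(5)[OF k] by (cases "lam k = mu A r") auto
    qed (use x e in auto)
    then show "x \<in> {x \<in> carrier_vec d. A *\<^sub>v x = mu A r \<cdot>\<^sub>v x}" using x by simp
  qed (use eigsys_eigenvector_orth[OF es] in auto)
  then show ?thesis unfolding grp_proj_def using proj_onto_eq[OF e(2), of "\<lambda>k. lam k = mu A r"] by simp
qed

lemma psd_sqrt_eq:
  assumes es: "eigsys d A lam v" and pos: "\<And>k. k < d \<Longrightarrow> 0 \<le> lam k"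
  shows "psd_sqrt d A = fmat d (\<lambda>k. sqrt (lam k)) v"
  unfolding psd_sqrt_def
proof (rule the_equality)
  note e = eigsysD[OF es]
  have "fmat d (\<lambda>k. sqrt (lam k)) v * fmat d (\<lambda>k. sqrt (lam k)) v = fmat d lam v"
    unfolding fmat_mult[OF e(2)] using pos by (intro fmat_cong) auto
  moreover have "is_psd d (fmat d (\<lambda>k. sqrt (lam k)) v)"
    using pos by (auto simp: is_psd_def fmat_bilinear[OF e(2)] mult.assoc intro!: sum_nonneg)
  ultimately show "is_psd d (fmat d (\<lambda>k. sqrt (lam k)) v) \<and> fmat d (\<lambda>k. sqrt (lam k)) v * fmat d (\<lambda>k. sqrt (lam k)) v = A"
    using eigsys_fmat[OF es] by simp
  fix R assume R: "is_psd d R \<and> R * R = A"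
  then have Rc: "R \<in> carrier_mat d d" and Rs: "R\<^sup>T = R" and Rp: "\<And>x. x \<in> carrier_vec d \<Longrightarrow> 0 \<le> x \<bullet> (R *\<^sub>v x)"
    by (auto simp: is_psd_def)
  show "R = fmat d (\<lambda>k. sqrt (lam k)) v"
  proof (rule fmat_eqI[OF e(2) Rc])
    fix k assume k: "k < d"
    note vk = e(5)[OF k]
    have RR: "R *\<^sub>v (R *\<^sub>v v k) = lam k \<cdot>\<^sub>v v k"
      using R Rc vk e(3)[OF k] by (metis assoc_mult_mat_vec)
    \<comment> \<open>From \<open>R * R = A\<close>, the product of \<open>R + sqrt (lam k)\<close>
      and \<open>R - sqrt (lam k)\<close> annihilates \<open>v k\<close>. So \<open>w\<close> would
      be an eigenvector of \<open>R\<close> for \<open>- sqrt (lam k)\<close>, which positivity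
      excludes unless \<open>lam k = 0\<close>; in that case \<open>w = R *\<^sub>v v k\<close> and
      its norm is computed directly.\<close>
    define w where "w = R *\<^sub>v v k - sqrt (lam k) \<cdot>\<^sub>v v k"
    have wc: "w \<in> carrier_vec d" using Rc vk by (simp add: w_def)
    have Rw: "R *\<^sub>v w = (- sqrt (lam k)) \<cdot>\<^sub>v w"
    proof -
      have "R *\<^sub>v w = lam k \<cdot>\<^sub>v v k - sqrt (lam k) \<cdot>\<^sub>v (R *\<^sub>v v k)"
        unfolding w_def using Rc vk RR by (simp add: mult_minus_distrib_mat_vec[of _ d d] mult_mat_vec[of _ d d])
      also have "\<dots> = (- sqrt (lam k)) \<cdot>\<^sub>v w"
        unfolding w_def using Rc vk pos[OF k] by (intro eq_vecI) (auto simp: algebra_simps)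
      finally show ?thesis .
    qed
    have "w = 0\<^sub>v d"
    proof (cases "lam k = 0")
      case True
      have "w \<bullet> w = (R *\<^sub>v v k) \<bullet> (R *\<^sub>v v k)"
      proof -
        have "w = R *\<^sub>v v k" unfolding w_def True using Rc vk by (intro eq_vecI) auto
        then show ?thesis by simp
      qed
      also have "\<dots> = v k \<bullet> (R *\<^sub>v (R *\<^sub>v v k))" using sym_scalar_prod[OF Rc Rs vk, of "R *\<^sub>v v k"] Rc vk by simp
      also have "\<dots> = 0" using RR True vk by simp
      finally show ?thesis using scalar_prod_self_eq_0[OF wc] by simp
    next
      case False
      then have "0 < sqrt (lam k)" using pos[OF k] by simp
      moreover have "0 \<le> - sqrt (lam k) * (w \<bullet> w)" using Rp[OF wc] wc unfolding Rw by simp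
      ultimately have "w \<bullet> w = 0" using scalar_prod_self_nonneg[of w] by (simp add: mult_le_0_iff)
      then show ?thesis using scalar_prod_self_eq_0[OF wc] by simp
    qed
    then have "w $ i = 0" if "i < d" for i using that by simp
    then show "R *\<^sub>v v k = sqrt (lam k) \<cdot>\<^sub>v v k"
      using Rc vk by (intro eq_vecI) (auto simp: w_def)
  qed
qed

lemma inv_mat_eq:
  assumes es: "eigsys d A lam v" and nz: "\<And>k. k < d \<Longrightarrow> lam k \<noteq> 0"
  shows "inv_mat d A = fmat d (\<lambda>k. 1 / lam k) v"
  unfolding inv_mat_def
proof (rule the_equality)
  note e = eigsysD[OF es]
  have 1: "fmat d (\<lambda>k. lam k * (1 / lam k)) v = 1\<^sub>m d" "fmat d (\<lambda>k. (1 / lam k) * lam k) v = 1\<^sub>m d"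
    unfolding fmat_one[OF e(2), symmetric] by (rule fmat_cong, use nz in simp)+
  let ?B = "fmat d (\<lambda>k. 1 / lam k) v"
  have "A * ?B = fmat d lam v * ?B"
    by (rule arg_cong[OF eigsys_fmat[OF es], of "\<lambda>M. M * ?B"])
  moreover have "?B * A = ?B * fmat d lam v"
    by (rule arg_cong[OF eigsys_fmat[OF es], of "\<lambda>M. ?B * M"])
  ultimately have AB: "A * ?B = 1\<^sub>m d" "?B * A = 1\<^sub>m d"
    using 1 fmat_mult[OF e(2)] by simp_all
  then show "?B \<in> carrier_mat d d \<and> A * ?B = 1\<^sub>m d \<and> ?B * A = 1\<^sub>m d" by simp
  fix B assume B: "B \<in> carrier_mat d d \<and> A * B = 1\<^sub>m d \<and> B * A = 1\<^sub>m d"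
  have Bc: "B \<in> carrier_mat d d" using B by blast
  have "B = ?B * A * B" unfolding AB(2) using Bc by simp
  also have "\<dots> = ?B * (A * B)" using B e(1) by (intro assoc_mult_mat[of _ d d _ d _ d]) auto
  also have "\<dots> = ?B" using B right_mult_one_mat[OF fmat_carrier] by (simp only:)
  finally show "B = ?B" .
qed

section \<open>Relative perturbation of spectral projectors\<close>

lemma weighted_cauchy_schwarz:
  fixes f g w :: "'a \<Rightarrow> real"
  assumes w: "\<And>j. j \<in> S \<Longrightarrow> 0 < w j"
  shows "(\<Sum>j\<in>S. f j * g j)\<^sup>2 \<le> (\<Sum>j\<in>S. (f j)\<^sup>2 / w j) * (\<Sum>j\<in>S. w j * (g j)\<^sup>2)"
proof -
  have "(\<Sum>j\<in>S. f j * g j) = (\<Sum>j\<in>S. (f j / sqrt (w j)) * (sqrt (w j) * g j))"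
  proof (intro sum.cong refl)
    fix j assume "j \<in> S"
    then have "sqrt (w j) \<noteq> 0" using w[of j] by simp
    then show "f j * g j = (f j / sqrt (w j)) * (sqrt (w j) * g j)" by simp
  qed
  then have "(\<Sum>j\<in>S. f j * g j)\<^sup>2 \<le> (\<Sum>j\<in>S. (f j / sqrt (w j))\<^sup>2) * (\<Sum>j\<in>S. (sqrt (w j) * g j)\<^sup>2)"
    by (simp only: Cauchy_Schwarz_ineq_sum)
  also have "\<dots> = (\<Sum>j\<in>S. (f j)\<^sup>2 / w j) * (\<Sum>j\<in>S. w j * (g j)\<^sup>2)"
    using w by (intro arg_cong2[where f = "(*)"] sum.cong) (auto simp: power_divide power_mult_distrib less_imp_le)
  finally show ?thesis .
qed

text \<open>Extending the outer sum from \<open>R\<close> to all rows only enlarges it, and then it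
  is the squared norm of a combination of orthonormal columns.\<close>

lemma bessel_block:
  fixes a :: "nat \<Rightarrow> nat \<Rightarrow> real"
  assumes orth: "\<And>i j. i < d \<Longrightarrow> j < d \<Longrightarrow> (\<Sum>k<d. a k i * a k j) = of_bool (i = j)"
    and R: "R \<subseteq> {..<d}" and L: "L \<subseteq> {..<d}"
  shows "(\<Sum>k\<in>R. (\<Sum>l\<in>L. y l * a k l)\<^sup>2) \<le> (\<Sum>l\<in>L. (y l)\<^sup>2)"
proof -
  have fin: "finite L" using L finite_subset by blast
  have "(\<Sum>k\<in>R. (\<Sum>l\<in>L. y l * a k l)\<^sup>2) \<le> (\<Sum>k<d. (\<Sum>l\<in>L. y l * a k l)\<^sup>2)"
    using R by (intro sum_mono2) auto
  also have "\<dots> = (\<Sum>k<d. \<Sum>l\<in>L. \<Sum>m\<in>L. y l * y m * (a k l * a k m))"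
    by (simp add: power2_eq_square sum_product ac_simps)
  also have "\<dots> = (\<Sum>l\<in>L. \<Sum>k<d. \<Sum>m\<in>L. y l * y m * (a k l * a k m))" by (rule sum.swap)
  also have "\<dots> = (\<Sum>l\<in>L. \<Sum>m\<in>L. \<Sum>k<d. y l * y m * (a k l * a k m))" by (intro sum.cong refl sum.swap)
  also have "\<dots> = (\<Sum>l\<in>L. \<Sum>m\<in>L. y l * y m * of_bool (l = m))"
    using orth L by (intro sum.cong refl) (auto simp: sum_distrib_left[symmetric] subset_iff)
  also have "\<dots> = (\<Sum>l\<in>L. (y l)\<^sup>2)"
    using fin by (auto simp: power2_eq_square of_bool_def if_distrib cong: if_cong intro!: sum.cong)
  finally show ?thesis .
qed

text \<open>Everything is expressed in coordinates: \<open>l\<close> are the unperturbed eigenvalues, \<open>lt\<close> the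
  perturbed ones, \<open>E\<close> is the perturbation in the unperturbed eigenbasis and \<open>a k i\<close> is the
  \<open>i\<close>-th coordinate of the \<open>k\<close>-th perturbed eigenvector. \<open>R\<close> is the group of the eigenvalue \<open>m\<close>
  and \<open>rr\<close> bounds its relative rank.\<close>

lemma group_remainder_bound:
  fixes a E :: "nat \<Rightarrow> nat \<Rightarrow> real" and l lt :: "nat \<Rightarrow> real"
  assumes orth: "\<And>i j. i < d \<Longrightarrow> j < d \<Longrightarrow> (\<Sum>k<d. a k i * a k j) = of_bool (i = j)"
    and eigeq: "\<And>i k. i < d \<Longrightarrow> k < d \<Longrightarrow> (lt k - l i) * a k i = (\<Sum>j<d. E i j * a k j)"
    and E: "\<And>i j. i < d \<Longrightarrow> j < d \<Longrightarrow> (E i j)\<^sup>2 \<le> x\<^sup>2 * (l i * l j)"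
    and l: "\<And>i. i < d \<Longrightarrow> 0 < l i"
    and R: "R = {i. i < d \<and> l i = m}"
    and sep: "\<And>k i. k \<in> R \<Longrightarrow> i < d \<Longrightarrow> i \<notin> R \<Longrightarrow> \<bar>l i - m\<bar> \<le> 2 * \<bar>lt k - l i\<bar>"
    and rr: "(\<Sum>j\<in>{..<d} - R. l j / \<bar>l j - m\<bar>) \<le> rr" and small: "16 * x\<^sup>2 * rr\<^sup>2 \<le> 1"
  shows "(\<Sum>k\<in>R. \<Sum>i\<in>{..<d} - R. 4 / (l i - m)\<^sup>2 * (\<Sum>j\<in>{..<d} - R. E i j * a k j)\<^sup>2)
    \<le> 64 * x^4 * rr\<^sup>2 * (\<Sum>i\<in>{..<d} - R. (\<Sum>j\<in>R. l j) * l i / (l i - m)\<^sup>2)"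
proof -
  define N where "N = {..<d} - R"
  have N: "finite N" "finite R" "R \<subseteq> {..<d}" "N \<subseteq> {..<d}" using R by (auto simp: N_def)
  have lN: "0 < \<bar>l j - m\<bar>" "0 < l j" if "j \<in> N" for j using that R l by (auto simp: N_def)
  have rr0: "0 \<le> rr" using rr l by (intro order_trans[OF _ rr] sum_nonneg) (auto intro!: divide_nonneg_nonneg less_imp_le)
  \<comment> \<open>The weight is matched to the relative rank: in Cauchy-Schwarz the companion
    factor is the sum of \<open>(E i j)\<^sup>2 / \<bar>l j - m\<bar>\<close>, at most
    \<open>x\<^sup>2 * l i * rr\<close>.\<close>
  define w where "w k = (\<Sum>j\<in>N. \<bar>l j - m\<bar> * (a k j)\<^sup>2)" for k
  define M where "M = (\<Sum>j\<in>R. l j)"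
  have M0: "0 \<le> M" unfolding M_def using N l by (intro sum_nonneg) (auto intro: less_imp_le)
  have off: "(\<Sum>j\<in>N. E i j * a k j)\<^sup>2 \<le> x\<^sup>2 * l i * rr * w k" if i: "i < d" for i k
  proof -
    have "(\<Sum>j\<in>N. E i j * a k j)\<^sup>2 \<le> (\<Sum>j\<in>N. (E i j)\<^sup>2 / \<bar>l j - m\<bar>) * w k"
      unfolding w_def using lN by (intro weighted_cauchy_schwarz) auto
    also have "(\<Sum>j\<in>N. (E i j)\<^sup>2 / \<bar>l j - m\<bar>) \<le> (\<Sum>j\<in>N. x\<^sup>2 * l i * (l j / \<bar>l j - m\<bar>))"
      using E[OF i] N(4) by (intro sum_mono) (auto simp: divide_right_mono mult.assoc)
    also have "\<dots> \<le> x\<^sup>2 * l i * rr"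
      unfolding sum_distrib_left[symmetric] using rr l[OF i] by (intro mult_left_mono) (auto simp: N_def)
    finally show ?thesis by (simp add: w_def mult_right_mono sum_nonneg)
  qed
  define W where "W = (\<Sum>k\<in>R. w k)"
  have W0: "0 \<le> W" by (auto simp: W_def w_def intro!: sum_nonneg)
  have diag: "(\<Sum>k\<in>R. (\<Sum>j\<in>R. E i j * a k j)\<^sup>2) \<le> x\<^sup>2 * l i * M" if i: "i < d" for i
  proof -
    have "(\<Sum>k\<in>R. (\<Sum>j\<in>R. E i j * a k j)\<^sup>2) \<le> (\<Sum>j\<in>R. (E i j)\<^sup>2)"
      by (rule bessel_block[OF orth N(3) N(3)])
    also have "\<dots> \<le> (\<Sum>j\<in>R. x\<^sup>2 * (l i * l j))" using E[OF i] N by (intro sum_mono) auto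
    also have "\<dots> = x\<^sup>2 * l i * M" by (simp add: M_def sum_distrib_left mult.assoc)
    finally show ?thesis .
  qed
  \<comment> \<open>A self-bounding estimate. The eigenvector equation bounds \<open>W\<close> by
    the contribution of the group itself plus \<open>8 * x\<^sup>2 * rr\<^sup>2 * W\<close>; by
    \<open>small\<close> the latter is at most \<open>W / 2\<close> and is absorbed on the
    left.\<close>
  have W1: "W \<le> 16 * x\<^sup>2 * M * rr"
  proof -
    have "w k \<le> (\<Sum>i\<in>N. 8 / \<bar>l i - m\<bar> * ((\<Sum>j\<in>R. E i j * a k j)\<^sup>2 + x\<^sup>2 * l i * rr * w k))" if k: "k \<in> R" for k
      unfolding w_def[of k]
    proof (rule sum_mono)
      fix i assume i: "i \<in> N"
      then have id: "i < d" "i \<notin> R" using N by (auto simp: N_def)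
      have "\<bar>l i - m\<bar>\<^sup>2 * (a k i)\<^sup>2 \<le> (2 * \<bar>lt k - l i\<bar>)\<^sup>2 * (a k i)\<^sup>2"
        using sep[OF k id] by (intro mult_right_mono power_mono) auto
      also have "\<dots> = 4 * ((lt k - l i) * a k i)\<^sup>2" by (simp add: power_mult_distrib)
      also have "(lt k - l i) * a k i = (\<Sum>j\<in>R. E i j * a k j) + (\<Sum>j\<in>N. E i j * a k j)"
      proof -
        have "k < d" using k N by auto
        have "(\<Sum>j<d. E i j * a k j) = (\<Sum>j\<in>R \<union> N. E i j * a k j)" using N by (intro sum.cong) (auto simp: N_def)
        also have "\<dots> = (\<Sum>j\<in>R. E i j * a k j) + (\<Sum>j\<in>N. E i j * a k j)"
          using N by (intro sum.union_disjoint) (auto simp: N_def)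
        finally show ?thesis using eigeq[OF id(1) \<open>k < d\<close>] by simp
      qed
      also have "4 * (\<dots>)\<^sup>2 \<le> 8 * ((\<Sum>j\<in>R. E i j * a k j)\<^sup>2 + (\<Sum>j\<in>N. E i j * a k j)\<^sup>2)"
        using sum_squares_ge_zero sum_squares_bound[of "\<Sum>j\<in>R. E i j * a k j" "\<Sum>j\<in>N. E i j * a k j"]
        by (simp add: power2_sum)
      also have "\<dots> \<le> 8 * ((\<Sum>j\<in>R. E i j * a k j)\<^sup>2 + x\<^sup>2 * l i * rr * w k)"
        using off[OF id(1)] by simp
      finally have "\<bar>l i - m\<bar> * (\<bar>l i - m\<bar> * (a k i)\<^sup>2) \<le> 8 * ((\<Sum>j\<in>R. E i j * a k j)\<^sup>2 + x\<^sup>2 * l i * rr * w k)"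
        by (simp add: power2_eq_square mult.assoc)
      then show "\<bar>l i - m\<bar> * (a k i)\<^sup>2 \<le> 8 / \<bar>l i - m\<bar> * ((\<Sum>j\<in>R. E i j * a k j)\<^sup>2 + x\<^sup>2 * l i * rr * (\<Sum>j\<in>N. \<bar>l j - m\<bar> * (a k j)\<^sup>2))"
        using lN[OF i] by (simp add: w_def field_simps)
    qed
    then have "W \<le> (\<Sum>k\<in>R. \<Sum>i\<in>N. 8 / \<bar>l i - m\<bar> * ((\<Sum>j\<in>R. E i j * a k j)\<^sup>2 + x\<^sup>2 * l i * rr * w k))"
      unfolding W_def by (rule sum_mono)
    also have "\<dots> = (\<Sum>i\<in>N. 8 / \<bar>l i - m\<bar> * ((\<Sum>k\<in>R. (\<Sum>j\<in>R. E i j * a k j)\<^sup>2) + x\<^sup>2 * l i * rr * W))"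
      by (subst sum.swap) (simp only: W_def sum_distrib_left[symmetric] sum.distrib)
    also have "\<dots> \<le> (\<Sum>i\<in>N. 8 / \<bar>l i - m\<bar> * (x\<^sup>2 * l i * M + x\<^sup>2 * l i * rr * W))"
      using diag N by (intro sum_mono mult_left_mono add_right_mono) auto
    also have "\<dots> = (8 * x\<^sup>2 * M + 8 * x\<^sup>2 * rr * W) * (\<Sum>i\<in>N. l i / \<bar>l i - m\<bar>)"
      unfolding sum_distrib_left by (intro sum.cong refl) (simp add: algebra_simps add_divide_distrib)
    also have "\<dots> \<le> (8 * x\<^sup>2 * M + 8 * x\<^sup>2 * rr * W) * rr"
      using rr M0 W0 rr0 by (intro mult_left_mono) (auto simp: N_def)
    also have "\<dots> = 8 * x\<^sup>2 * M * rr + (16 * x\<^sup>2 * rr\<^sup>2) * (W / 2)" by (simp add: power2_eq_square algebra_simps)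
    also have "\<dots> \<le> 8 * x\<^sup>2 * M * rr + 1 * (W / 2)" using small W0 by (intro add_left_mono mult_right_mono) auto
    finally show ?thesis by simp
  qed
  have "(\<Sum>k\<in>R. \<Sum>i\<in>N. 4 / (l i - m)\<^sup>2 * (\<Sum>j\<in>N. E i j * a k j)\<^sup>2)
    \<le> (\<Sum>k\<in>R. \<Sum>i\<in>N. 4 / (l i - m)\<^sup>2 * (x\<^sup>2 * l i * rr * w k))"
    using off N by (intro sum_mono mult_left_mono) auto
  also have "\<dots> = (\<Sum>i\<in>N. 4 / (l i - m)\<^sup>2 * (x\<^sup>2 * l i * rr * W))"
    by (subst sum.swap) (simp only: W_def sum_distrib_left[symmetric])
  also have "\<dots> \<le> (\<Sum>i\<in>N. 4 / (l i - m)\<^sup>2 * (x\<^sup>2 * l i * rr * (16 * x\<^sup>2 * M * rr)))"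
    using W1 less_imp_le[OF lN(2)] rr0 by (intro sum_mono mult_left_mono) auto
  also have "\<dots> = 64 * x^4 * rr\<^sup>2 * (\<Sum>i\<in>N. M * l i / (l i - m)\<^sup>2)"
    by (simp add: sum_distrib_left power2_eq_square power4_eq_xxxx mult_ac)
  finally show ?thesis by (simp add: N_def M_def)
qed


text \<open>The eigenvector equation expresses \<open>a k i\<close> as a row of \<open>E\<close>
  applied to the eigenvector, divided by at least half of \<open>\<bar>l i - m r\<bar>\<close>.
  Splitting the row at the group of \<open>k\<close> separates the orders. Inside the group,
  Bessel's inequality leaves a sum over pairs with \<open>i\<close> outside \<open>U\<close>, so
  pairs of groups within \<open>J\<close> do not contribute at first order. Outside the group,
  \<open>group_remainder_bound\<close> applies, at the price of letting \<open>i\<close> range over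
  everything outside the single group.\<close>

lemma projector_perturbation:
  fixes a E :: "nat \<Rightarrow> nat \<Rightarrow> real" and l lt m rr :: "nat \<Rightarrow> real"
  assumes orth: "\<And>i j. i < d \<Longrightarrow> j < d \<Longrightarrow> (\<Sum>k<d. a k i * a k j) = of_bool (i = j)"
    and eigeq: "\<And>i k. i < d \<Longrightarrow> k < d \<Longrightarrow> (lt k - l i) * a k i = (\<Sum>j<d. E i j * a k j)"
    and E: "\<And>i j. i < d \<Longrightarrow> j < d \<Longrightarrow> (E i j)\<^sup>2 \<le> x\<^sup>2 * (l i * l j)"
    and l: "\<And>i. i < d \<Longrightarrow> 0 < l i" and x: "0 \<le> x"
    and J: "finite J" and G: "\<And>r. r \<in> J \<Longrightarrow> G r = {i. i < d \<and> l i = m r}" and inj: "inj_on m J"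
    and sep: "\<And>r k i. r \<in> J \<Longrightarrow> k \<in> G r \<Longrightarrow> i < d \<Longrightarrow> i \<notin> G r \<Longrightarrow> \<bar>l i - m r\<bar> \<le> 2 * \<bar>lt k - l i\<bar>"
    and rr: "\<And>r. r \<in> J \<Longrightarrow> (\<Sum>j\<in>{..<d} - G r. l j / \<bar>l j - m r\<bar>) \<le> rr r"
    and small: "\<And>r. r \<in> J \<Longrightarrow> 16 * x\<^sup>2 * (rr r)\<^sup>2 \<le> 1" and rr0: "\<And>r. r \<in> J \<Longrightarrow> 0 \<le> rr r"
  defines "U \<equiv> (\<Union>r\<in>J. G r)"
  shows "sqrt (\<Sum>k\<in>U. \<Sum>i\<in>{..<d} - U. (a k i)\<^sup>2) \<le>
     12 * (x * sqrt (\<Sum>r\<in>J. \<Sum>k\<in>G r. \<Sum>i\<in>{..<d} - U. l k * l i / (l i - m r)\<^sup>2)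
      + x\<^sup>2 * (\<Sum>r\<in>J. rr r * sqrt (\<Sum>i\<in>{..<d} - G r. (\<Sum>j\<in>G r. l j) * l i / (l i - m r)\<^sup>2)))"
proof -
  define T where "T r = (\<Sum>i\<in>{..<d} - G r. (\<Sum>j\<in>G r. l j) * l i / (l i - m r)\<^sup>2)" for r
  define D where "D = (\<Sum>r\<in>J. \<Sum>k\<in>G r. \<Sum>i\<in>{..<d} - U. l k * l i / (l i - m r)\<^sup>2)"
  define c where "c r = (\<Sum>k\<in>G r. \<Sum>i\<in>{..<d} - G r. 4 / (l i - m r)\<^sup>2 * (\<Sum>j\<in>{..<d} - G r. E i j * a k j)\<^sup>2)" for r
  have finG: "finite (G r)" "G r \<subseteq> {..<d}" if "r \<in> J" for r using G[OF that] by auto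
  have disj: "G r \<inter> G s = {}" if "r \<in> J" "s \<in> J" "r \<noteq> s" for r s
    using that G inj by (auto simp: inj_on_def)
  have NU: "{..<d} - U \<subseteq> {..<d} - G r" if "r \<in> J" for r using that by (auto simp: U_def)
  have c0: "0 \<le> c r" for r by (auto simp: c_def intro!: sum_nonneg)
  have cb: "c r \<le> 64 * x^4 * (rr r)\<^sup>2 * T r" if r: "r \<in> J" for r
    unfolding c_def T_def using group_remainder_bound[OF orth eigeq E l G[OF r] sep[OF r] rr[OF r] small[OF r]] by simp
  have T0: "0 \<le> T r" if r: "r \<in> J" for r
    unfolding T_def using finG[OF r] l
    by (intro sum_nonneg divide_nonneg_nonneg mult_nonneg_nonneg) (auto intro: less_imp_le)
  have main: "(\<Sum>k\<in>G r. \<Sum>i\<in>{..<d} - U. (a k i)\<^sup>2) \<le> 8 * x\<^sup>2 * (\<Sum>k\<in>G r. \<Sum>i\<in>{..<d} - U. l k * l i / (l i - m r)\<^sup>2) + 2 * c r"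
    if r: "r \<in> J" for r
  proof -
    define p where "p k i = (\<Sum>j\<in>G r. E i j * a k j)" for k i
    define q where "q k i = (\<Sum>j\<in>{..<d} - G r. E i j * a k j)" for k i
    have "(a k i)\<^sup>2 \<le> 8 / (l i - m r)\<^sup>2 * (p k i)\<^sup>2 + 2 * (4 / (l i - m r)\<^sup>2 * (q k i)\<^sup>2)"
      if k: "k \<in> G r" and i: "i \<in> {..<d} - U" for k i
    proof -
      have id: "i < d" "i \<notin> G r" using i NU[OF r] by auto
      have kd: "k < d" using k finG[OF r] by auto
      have nz: "0 < (l i - m r)\<^sup>2" using id G[OF r] by auto
      have "(l i - m r)\<^sup>2 * (a k i)\<^sup>2 = \<bar>l i - m r\<bar>\<^sup>2 * (a k i)\<^sup>2" by simp
      also have "\<dots> \<le> (2 * \<bar>lt k - l i\<bar>)\<^sup>2 * (a k i)\<^sup>2"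
        using sep[OF r k id] by (intro mult_right_mono power_mono) auto
      also have "\<dots> = 4 * ((lt k - l i) * a k i)\<^sup>2" by (simp add: power_mult_distrib)
      also have "(lt k - l i) * a k i = p k i + q k i"
        unfolding eigeq[OF id(1) kd] p_def q_def using finG[OF r] by (simp add: sum.subset_diff[of "G r" "{..<d}"])
      also have "4 * (p k i + q k i)\<^sup>2 \<le> 8 * (p k i)\<^sup>2 + 8 * (q k i)\<^sup>2"
        using sum_squares_bound[of "p k i" "q k i"] by (simp add: power2_sum)
      finally show ?thesis using nz by (simp add: field_simps)
    qed
    then have "(\<Sum>k\<in>G r. \<Sum>i\<in>{..<d} - U. (a k i)\<^sup>2) \<le> (\<Sum>k\<in>G r. \<Sum>i\<in>{..<d} - U. 8 / (l i - m r)\<^sup>2 * (p k i)\<^sup>2 + 2 * (4 / (l i - m r)\<^sup>2 * (q k i)\<^sup>2))"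
      by (intro sum_mono)
    also have "\<dots> = (\<Sum>i\<in>{..<d} - U. 8 / (l i - m r)\<^sup>2 * (\<Sum>k\<in>G r. (p k i)\<^sup>2)) + 2 * (\<Sum>k\<in>G r. \<Sum>i\<in>{..<d} - U. 4 / (l i - m r)\<^sup>2 * (q k i)\<^sup>2)"
      by (simp only: sum.distrib sum_distrib_left sum.swap[of _ "G r" "{..<d} - U"])
    also have "\<dots> \<le> (\<Sum>i\<in>{..<d} - U. 8 / (l i - m r)\<^sup>2 * (x\<^sup>2 * (\<Sum>k\<in>G r. l k * l i))) + 2 * c r"
    proof (intro add_mono sum_mono mult_left_mono)
      fix i assume i: "i \<in> {..<d} - U"
      have "(\<Sum>k\<in>G r. (p k i)\<^sup>2) \<le> (\<Sum>j\<in>G r. (E i j)\<^sup>2)"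
        unfolding p_def by (rule bessel_block[OF orth finG(2)[OF r] finG(2)[OF r]])
      also have "\<dots> \<le> (\<Sum>j\<in>G r. x\<^sup>2 * (l j * l i))"
        using E[of i] i finG[OF r] by (intro sum_mono) (auto simp: mult.commute subset_iff)
      finally show "(\<Sum>k\<in>G r. (p k i)\<^sup>2) \<le> x\<^sup>2 * (\<Sum>k\<in>G r. l k * l i)" by (simp add: sum_distrib_left)
    next
      show "(\<Sum>k\<in>G r. \<Sum>i\<in>{..<d} - U. 4 / (l i - m r)\<^sup>2 * (q k i)\<^sup>2) \<le> c r"
        unfolding c_def q_def using NU[OF r] by (intro sum_mono sum_mono2) auto
    qed auto
    also have "(\<Sum>i\<in>{..<d} - U. 8 / (l i - m r)\<^sup>2 * (x\<^sup>2 * (\<Sum>k\<in>G r. l k * l i))) = 8 * x\<^sup>2 * (\<Sum>k\<in>G r. \<Sum>i\<in>{..<d} - U. l k * l i / (l i - m r)\<^sup>2)"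
      unfolding sum.swap[of _ "{..<d} - U" "G r"] sum_distrib_left
      by (intro sum.cong refl) (simp add: mult_ac)
    finally show ?thesis .
  qed
  have "(\<Sum>k\<in>U. \<Sum>i\<in>{..<d} - U. (a k i)\<^sup>2) = (\<Sum>r\<in>J. \<Sum>k\<in>G r. \<Sum>i\<in>{..<d} - U. (a k i)\<^sup>2)"
    unfolding U_def using J finG disj by (intro sum.UNION_disjoint) auto
  also have "\<dots> \<le> (\<Sum>r\<in>J. 8 * x\<^sup>2 * (\<Sum>k\<in>G r. \<Sum>i\<in>{..<d} - U. l k * l i / (l i - m r)\<^sup>2) + 2 * c r)"
    using main by (intro sum_mono)
  also have "\<dots> = 8 * x\<^sup>2 * D + 2 * (\<Sum>r\<in>J. c r)" by (simp add: D_def sum.distrib sum_distrib_left)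
  finally have "sqrt (\<Sum>k\<in>U. \<Sum>i\<in>{..<d} - U. (a k i)\<^sup>2) \<le> sqrt (8 * x\<^sup>2 * D + 2 * (\<Sum>r\<in>J. c r))" by simp
  also have "\<dots> \<le> sqrt (8 * x\<^sup>2 * D) + sqrt (2 * (\<Sum>r\<in>J. c r))"
  proof (rule sqrt_add_le_add_sqrt)
    show "0 \<le> 8 * x\<^sup>2 * D" unfolding D_def using l finG
      by (intro mult_nonneg_nonneg sum_nonneg divide_nonneg_nonneg) (auto intro: less_imp_le simp: subset_iff)
  qed (auto intro!: sum_nonneg c0)
  \<comment> \<open>The generous 12 is the constant forced by the second-order term below; using it
    here as well lets both terms share one factor.\<close>
  also have "sqrt (8 * x\<^sup>2 * D) \<le> 12 * (x * sqrt D)"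
  proof -
    have "sqrt 8 \<le> sqrt (12\<^sup>2)" by (intro real_sqrt_le_mono) simp
    then have "sqrt 8 \<le> (12::real)" by simp
    moreover have "0 \<le> x * sqrt D"
      unfolding D_def using l finG x
      by (intro mult_nonneg_nonneg real_sqrt_ge_zero sum_nonneg divide_nonneg_nonneg) (auto intro: less_imp_le simp: subset_iff)
    ultimately have "sqrt 8 * (x * sqrt D) \<le> 12 * (x * sqrt D)" by (rule mult_right_mono)
    then show ?thesis using x by (simp add: real_sqrt_mult mult_ac)
  qed
  also have "sqrt (2 * (\<Sum>r\<in>J. c r)) \<le> 12 * (x\<^sup>2 * (\<Sum>r\<in>J. rr r * sqrt (T r)))"
  proof -
    \<comment> \<open>\<open>z r\<close> is the root of the bound on \<open>c r\<close>. The
      Euclidean norm of \<open>z\<close> over \<open>J\<close> is at most its sum, which is why the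
      sum over groups ends up outside the root as in \<open>dsf\<close>. With
      \<open>sqrt 2 \<le> 3/2\<close> the factor 8 becomes 12.\<close>
    define z where "z r = 8 * x\<^sup>2 * (rr r * sqrt (T r))" for r
    have z0: "0 \<le> z r" if "r \<in> J" for r using that rr0 T0 by (auto simp: z_def)
    have cz: "c r \<le> (z r)\<^sup>2" if r: "r \<in> J" for r
    proof -
      have "(z r)\<^sup>2 = 64 * x^4 * (rr r)\<^sup>2 * (sqrt (T r))\<^sup>2"
        by (simp add: z_def power_mult_distrib flip: power_mult)
      then show ?thesis using cb[OF r] T0[OF r] by simp
    qed
    have "2 * (\<Sum>r\<in>J. c r) \<le> 2 * (\<Sum>r\<in>J. (z r)\<^sup>2)" using cz by (intro mult_left_mono sum_mono) auto
    also have "(\<Sum>r\<in>J. (z r)\<^sup>2) \<le> (\<Sum>r\<in>J. z r)\<^sup>2"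
    proof -
      have "(\<Sum>r\<in>J. (z r)\<^sup>2) \<le> (\<Sum>r\<in>J. z r * (\<Sum>s\<in>J. z s))"
        using z0 J by (intro sum_mono) (auto simp: power2_eq_square intro!: mult_left_mono member_le_sum)
      then show ?thesis by (simp add: power2_eq_square sum_distrib_right)
    qed
    also have "2 * (\<Sum>r\<in>J. z r)\<^sup>2 \<le> ((3/2) * (\<Sum>r\<in>J. z r))\<^sup>2" by (simp add: power_mult_distrib power2_eq_square)
    finally have "sqrt (2 * (\<Sum>r\<in>J. c r)) \<le> (3/2) * (\<Sum>r\<in>J. z r)"
      using z0 by (intro real_le_lsqrt) (auto intro!: sum_nonneg c0)
    then show ?thesis by (simp add: z_def sum_distrib_left mult_ac)
  qed
  finally show ?thesis unfolding D_def T_def by (simp add: distrib_left)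
qed

section \<open>Location of perturbed eigenvalues by dimension counting\<close>

lemma quadratic_form:
  assumes es: "eigsys d A lam v" and x: "x \<in> carrier_vec d"
  shows "x \<bullet> (A *\<^sub>v x) = (\<Sum>k<d. lam k * (x \<bullet> v k)\<^sup>2)"
  using fmat_bilinear[OF eigsysD(2)[OF es] x x, of lam] eigsys_fmat[OF es]
  by (simp add: power2_eq_square mult.assoc)

text \<open>Two coordinate subspaces whose dimensions add up to more than \<open>d\<close>
  intersect: membership in both amounts to fewer than \<open>d\<close> orthogonality conditions. The
  conditions are indexed by a sum type to keep the two bases apart.\<close>

lemma ex_common_span:
  assumes u: "onb d u" and v: "onb d v" and S: "S \<subseteq> {..<d}" "T \<subseteq> {..<d}" and card: "d < card S + card T"
  obtains x where "x \<in> carrier_vec d" "x \<noteq> 0\<^sub>v d" "\<And>k. k < d \<Longrightarrow> k \<notin> S \<Longrightarrow> x \<bullet> u k = 0"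
    "\<And>k. k < d \<Longrightarrow> k \<notin> T \<Longrightarrow> x \<bullet> v k = 0"
proof -
  define I where "I = Inl ` ({..<d} - S) \<union> Inr ` ({..<d} - T)"
  define y where "y = case_sum u v"
  have fin: "finite S" "finite T" using S finite_subset by auto
  have "card I = (d - card S) + (d - card T)"
    unfolding I_def using S fin by (subst card_Un_disjoint) (auto simp: card_image card_Diff_subset)
  moreover have "card S \<le> d" "card T \<le> d" using S card_mono[of "{..<d}"] by auto
  ultimately have "card I < d" using card by linarith
  moreover have "finite I" by (simp add: I_def)
  moreover have yc: "y i \<in> carrier_vec d" if "i \<in> I" for i
    using that onb_carrier[OF u] onb_carrier[OF v] by (auto simp: I_def y_def)
  ultimately obtain x where x: "x \<in> carrier_vec d" "x \<noteq> 0\<^sub>v d" "\<And>i. i \<in> I \<Longrightarrow> y i \<bullet> x = 0"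
    using ex_nonzero_orthogonal[of I d y] by blast
  have "x \<bullet> u k = 0" if "k < d" "k \<notin> S" for k
    using x(3)[of "Inl k"] comm_scalar_prod[OF x(1) onb_carrier[OF u that(1)]] that by (auto simp: I_def y_def)
  moreover have "x \<bullet> v k = 0" if "k < d" "k \<notin> T" for k
    using x(3)[of "Inr k"] comm_scalar_prod[OF x(1) onb_carrier[OF v that(1)]] that by (auto simp: I_def y_def)
  ultimately show thesis using that x by blast
qed

lemma parseval_self: "onb d v \<Longrightarrow> x \<in> carrier_vec d \<Longrightarrow> x \<bullet> x = (\<Sum>k<d. (x \<bullet> v k)\<^sup>2)"
  using parseval[of d v x x] by (simp add: power2_eq_square)

lemma onb_ex_nonzero_coord:
  assumes "onb d v" "x \<in> carrier_vec d" "x \<noteq> 0\<^sub>v d"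
  obtains k where "k < d" "x \<bullet> v k \<noteq> 0"
proof -
  have "\<exists>k<d. x \<bullet> v k \<noteq> 0"
  proof (rule ccontr)
    assume "\<not> ?thesis"
    then have "x \<bullet> x = 0" using parseval_self[OF assms(1,2)] by simp
    then show False using scalar_prod_self_pos[OF assms(2,3)] by simp
  qed
  then show thesis using that by blast
qed

text \<open>Weyl's inequality, tested on a common vector of the span of the first
  \<open>k + 1\<close> eigenvectors of \<open>A\<close> and the last \<open>d - k\<close>
  eigenvectors of \<open>B\<close>.\<close>

lemma eig_perturbation:
  assumes A: "eigsys d A lam v" and B: "eigsys d B nu w"
    and bd: "\<And>x. x \<in> carrier_vec d \<Longrightarrow> x \<bullet> (A *\<^sub>v x) \<le> x \<bullet> (B *\<^sub>v x) + \<delta> * (x \<bullet> x)"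
    and k: "k < d"
  shows "lam k \<le> nu k + \<delta>"
proof -
  note a = eigsysD[OF A] and b = eigsysD[OF B]
  have sub: "{..k} \<subseteq> {..<d}" "{k..<d} \<subseteq> {..<d}" "d < card {..k} + card {k..<d}" using k by auto
  then obtain x where x: "x \<in> carrier_vec d" "x \<noteq> 0\<^sub>v d" "\<And>j. j < d \<Longrightarrow> j \<notin> {..k} \<Longrightarrow> x \<bullet> v j = 0"
    "\<And>j. j < d \<Longrightarrow> j \<notin> {k..<d} \<Longrightarrow> x \<bullet> w j = 0"
    using ex_common_span[OF a(2) b(2) sub] by blast
  have "lam k * (x \<bullet> x) \<le> x \<bullet> (A *\<^sub>v x)"
    unfolding quadratic_form[OF A x(1)] parseval_self[OF a(2) x(1)] sum_distrib_left
  proof (rule sum_mono)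
    fix j assume "j \<in> {..<d}"
    then show "lam k * (x \<bullet> v j)\<^sup>2 \<le> lam j * (x \<bullet> v j)\<^sup>2"
      using x(3)[of j] a(4)[of j k] k by (cases "j \<le> k") (auto intro: mult_right_mono)
  qed
  also have "\<dots> \<le> x \<bullet> (B *\<^sub>v x) + \<delta> * (x \<bullet> x)" by (rule bd[OF x(1)])
  also have "x \<bullet> (B *\<^sub>v x) \<le> nu k * (x \<bullet> x)"
    unfolding quadratic_form[OF B x(1)] parseval_self[OF b(2) x(1)] sum_distrib_left
  proof (rule sum_mono)
    fix j assume "j \<in> {..<d}"
    then show "nu j * (x \<bullet> w j)\<^sup>2 \<le> nu k * (x \<bullet> w j)\<^sup>2"
      using x(4)[of j] b(4)[of k j] k by (cases "k \<le> j") (auto intro: mult_right_mono)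
  qed
  finally have "lam k * (x \<bullet> x) \<le> (nu k + \<delta>) * (x \<bullet> x)" by (simp add: distrib_right)
  then show ?thesis using scalar_prod_self_pos[OF x(1,2)] by simp
qed

text \<open>Writing \<open>S\<close> for the first matrix and \<open>E\<close> for the difference, \<open>small\<close> says that
  \<open>|S - t|\<^sup>-\<^sup>1\<^sup>/\<^sup>2 E |S - t|\<^sup>-\<^sup>1\<^sup>/\<^sup>2\<close> has Frobenius norm less than one, so that no eigenvalue can
  cross \<open>t\<close>.\<close>

lemma eig_threshold:
  assumes A: "eigsys d A l u" and B: "eigsys d B lt v"
    and E: "\<And>i j. i < d \<Longrightarrow> j < d \<Longrightarrow> (u i \<bullet> (B *\<^sub>v u j) - u i \<bullet> (A *\<^sub>v u j))\<^sup>2 \<le> x\<^sup>2 * (l i * l j)"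
    and pos: "\<And>i. i < d \<Longrightarrow> 0 < l i"
    and t: "\<And>i. i < d \<Longrightarrow> l i \<noteq> t"
    and small: "x\<^sup>2 * (\<Sum>i<d. l i / \<bar>l i - t\<bar>)\<^sup>2 < 1"
    and k: "k < d"
  shows "lt k > t \<longleftrightarrow> l k > t" "lt k < t \<longleftrightarrow> l k < t"
proof -
  note a = eigsysD[OF A] and b = eigsysD[OF B]
  define e where "e i j = u i \<bullet> (B *\<^sub>v u j) - u i \<bullet> (A *\<^sub>v u j)" for i j
  \<comment> \<open>The quadratic form of \<open>\<bar>A - t\<bar>\<close>, positive definite
    because \<open>t\<close> is not an eigenvalue of \<open>A\<close>. The perturbation is measured
    against it.\<close>
  define W where "W y = (\<Sum>i<d. \<bar>l i - t\<bar> * (y \<bullet> u i)\<^sup>2)" for y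
  have W0: "0 < W y" if y: "y \<in> carrier_vec d" "y \<noteq> 0\<^sub>v d" for y
  proof -
    obtain i where i: "i < d" "y \<bullet> u i \<noteq> 0" using onb_ex_nonzero_coord[OF a(2) y] .
    then show ?thesis unfolding W_def using t by (intro sum_pos2[of _ i]) auto
  qed
  have expand: "y \<bullet> (B *\<^sub>v y) - y \<bullet> (A *\<^sub>v y) = (\<Sum>i<d. \<Sum>j<d. e i j * (y \<bullet> u i) * (y \<bullet> u j))" if y: "y \<in> carrier_vec d" for y
  proof -
    have bil: "y \<bullet> (M *\<^sub>v y) = (\<Sum>i<d. \<Sum>j<d. (u i \<bullet> (M *\<^sub>v u j)) * (y \<bullet> u i) * (y \<bullet> u j))"
      if M: "M \<in> carrier_mat d d" "M\<^sup>T = M" for M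
    proof -
      have My: "M *\<^sub>v y \<in> carrier_vec d" using M y by simp
      have "y \<bullet> (M *\<^sub>v y) = (\<Sum>i<d. (y \<bullet> u i) * ((M *\<^sub>v y) \<bullet> u i))" by (rule parseval[OF a(2) y My])
      also have "\<dots> = (\<Sum>i<d. (y \<bullet> u i) * (\<Sum>j<d. (y \<bullet> u j) * ((M *\<^sub>v u i) \<bullet> u j)))"
      proof (intro sum.cong refl)
        fix i assume "i \<in> {..<d}"
        then have i: "i < d" by simp
        have "(M *\<^sub>v y) \<bullet> u i = y \<bullet> (M *\<^sub>v u i)" using sym_scalar_prod[OF M y a(5)[OF i]] by simp
        also have "\<dots> = (\<Sum>j<d. (y \<bullet> u j) * ((M *\<^sub>v u i) \<bullet> u j))"
          using M a(5)[OF i] by (intro parseval[OF a(2) y]) auto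
        finally show "(y \<bullet> u i) * ((M *\<^sub>v y) \<bullet> u i) = (y \<bullet> u i) * (\<Sum>j<d. (y \<bullet> u j) * ((M *\<^sub>v u i) \<bullet> u j))" by simp
      qed
      also have "\<dots> = (\<Sum>i<d. \<Sum>j<d. (u i \<bullet> (M *\<^sub>v u j)) * (y \<bullet> u i) * (y \<bullet> u j))"
        unfolding sum_distrib_left
        by (intro sum.cong refl) (use sym_scalar_prod[OF M] a(5) in \<open>simp add: mult_ac\<close>)
      finally show ?thesis .
    qed
    show ?thesis
      unfolding bil[OF a(1) eigsys_sym[OF A]] bil[OF b(1) eigsys_sym[OF B]] e_def
      by (simp only: sum_subtractf left_diff_distrib)
  qed
  \<comment> \<open>Cauchy-Schwarz over pairs of indices with product weights. The weighted vector
    side factors into \<open>W y * W y\<close>, the matrix side into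
    \<open>x\<^sup>2 * S\<^sup>2\<close>, which is below one by \<open>small\<close>.\<close>
  have pert: "\<bar>y \<bullet> (B *\<^sub>v y) - y \<bullet> (A *\<^sub>v y)\<bar> < W y" if y: "y \<in> carrier_vec d" "y \<noteq> 0\<^sub>v d" for y
  proof -
    define S where "S = (\<Sum>i<d. l i / \<bar>l i - t\<bar>)"
    have "(\<Sum>i<d. \<Sum>j<d. e i j * (y \<bullet> u i) * (y \<bullet> u j)) = (\<Sum>(i,j)\<in>{..<d}\<times>{..<d}. e i j * ((y \<bullet> u i) * (y \<bullet> u j)))"
      by (simp add: sum.cartesian_product mult.assoc)
    then have "(y \<bullet> (B *\<^sub>v y) - y \<bullet> (A *\<^sub>v y))\<^sup>2 = (\<Sum>p\<in>{..<d}\<times>{..<d}. e (fst p) (snd p) * ((y \<bullet> u (fst p)) * (y \<bullet> u (snd p))))\<^sup>2"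
      unfolding expand[OF y(1)] by (simp add: case_prod_beta)
    also have "\<dots> \<le> (\<Sum>p\<in>{..<d}\<times>{..<d}. (e (fst p) (snd p))\<^sup>2 / (\<bar>l (fst p) - t\<bar> * \<bar>l (snd p) - t\<bar>)) * (\<Sum>p\<in>{..<d}\<times>{..<d}. (\<bar>l (fst p) - t\<bar> * \<bar>l (snd p) - t\<bar>) * ((y \<bullet> u (fst p)) * (y \<bullet> u (snd p)))\<^sup>2)"
      using t by (intro weighted_cauchy_schwarz) (auto intro!: mult_pos_pos)
    also have "(\<Sum>p\<in>{..<d}\<times>{..<d}. (\<bar>l (fst p) - t\<bar> * \<bar>l (snd p) - t\<bar>) * ((y \<bullet> u (fst p)) * (y \<bullet> u (snd p)))\<^sup>2) = W y * W y"
      unfolding W_def sum_product sum.cartesian_product by (intro sum.cong refl) (auto simp: power_mult_distrib mult_ac)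
    finally have c1: "(y \<bullet> (B *\<^sub>v y) - y \<bullet> (A *\<^sub>v y))\<^sup>2 \<le> (\<Sum>p\<in>{..<d}\<times>{..<d}. (e (fst p) (snd p))\<^sup>2 / (\<bar>l (fst p) - t\<bar> * \<bar>l (snd p) - t\<bar>)) * (W y * W y)" .
    have "(\<Sum>p\<in>{..<d}\<times>{..<d}. (e (fst p) (snd p))\<^sup>2 / (\<bar>l (fst p) - t\<bar> * \<bar>l (snd p) - t\<bar>)) \<le>
      (\<Sum>p\<in>{..<d}\<times>{..<d}. x\<^sup>2 * (l (fst p) / \<bar>l (fst p) - t\<bar> * (l (snd p) / \<bar>l (snd p) - t\<bar>)))"
    proof (rule sum_mono)
      fix p assume "p \<in> {..<d}\<times>{..<d}"
      then have p: "fst p < d" "snd p < d" by auto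
      have "(e (fst p) (snd p))\<^sup>2 / (\<bar>l (fst p) - t\<bar> * \<bar>l (snd p) - t\<bar>) \<le> (x\<^sup>2 * (l (fst p) * l (snd p))) / (\<bar>l (fst p) - t\<bar> * \<bar>l (snd p) - t\<bar>)"
        unfolding e_def using E[OF p] by (intro divide_right_mono) auto
      then show "(e (fst p) (snd p))\<^sup>2 / (\<bar>l (fst p) - t\<bar> * \<bar>l (snd p) - t\<bar>) \<le> x\<^sup>2 * (l (fst p) / \<bar>l (fst p) - t\<bar> * (l (snd p) / \<bar>l (snd p) - t\<bar>))"
        by simp
    qed
    also have "\<dots> = x\<^sup>2 * S\<^sup>2"
      unfolding S_def power2_eq_square[of "sum _ _"] sum_product sum.cartesian_product case_prod_beta
      by (simp only: sum_distrib_left)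
    finally have c2: "(\<Sum>p\<in>{..<d}\<times>{..<d}. (e (fst p) (snd p))\<^sup>2 / (\<bar>l (fst p) - t\<bar> * \<bar>l (snd p) - t\<bar>)) \<le> x\<^sup>2 * S\<^sup>2" .
    have "0 \<le> W y * W y" by simp
    have "(y \<bullet> (B *\<^sub>v y) - y \<bullet> (A *\<^sub>v y))\<^sup>2 \<le> x\<^sup>2 * S\<^sup>2 * (W y * W y)"
      by (rule order_trans[OF c1 mult_right_mono[OF c2 \<open>0 \<le> W y * W y\<close>]])
    also have "\<dots> < 1 * (W y * W y)"
      using small W0[OF y] by (intro mult_strict_right_mono) (auto simp: S_def)
    finally have "\<bar>y \<bullet> (B *\<^sub>v y) - y \<bullet> (A *\<^sub>v y)\<bar>\<^sup>2 < (W y)\<^sup>2" by (simp add: power2_eq_square)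
    then show ?thesis by (rule power_less_imp_less_base[OF _ less_imp_le[OF W0[OF y]]])
  qed
  have quad: "y \<bullet> (A *\<^sub>v y) - t * (y \<bullet> y) = (\<Sum>i<d. (l i - t) * (y \<bullet> u i)\<^sup>2)" if "y \<in> carrier_vec d" for y
    unfolding quadratic_form[OF A that] parseval_self[OF a(2) that] by (simp add: sum_distrib_left sum_subtractf left_diff_distrib)
  have quadB: "y \<bullet> (B *\<^sub>v y) - t * (y \<bullet> y) = (\<Sum>i<d. (lt i - t) * (y \<bullet> v i)\<^sup>2)" if "y \<in> carrier_vec d" for y
    unfolding quadratic_form[OF B that] parseval_self[OF b(2) that] by (simp add: sum_distrib_left sum_subtractf left_diff_distrib)
  \<comment> \<open>If \<open>lt k \<le> t < l k\<close>, the first \<open>k + 1\<close>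
    eigenvectors of \<open>A\<close> and the last \<open>d - k\<close> of \<open>B\<close> span a
    common vector. On it the form of \<open>A - t\<close> equals \<open>W y\<close> while that of
    \<open>B - t\<close> is nonpositive, so the two forms differ by at least \<open>W y\<close>,
    against \<open>pert\<close>.\<close>
  have up: "t < lt k" if lk: "t < l k"
  proof (rule ccontr)
    assume "\<not> t < lt k"
    then have ltk: "lt j \<le> t" if "k \<le> j" "j < d" for j using b(4)[OF that] by simp
    have sub: "{..k} \<subseteq> {..<d}" "{k..<d} \<subseteq> {..<d}" "d < card {..k} + card {k..<d}" using k by auto
    then obtain y where y: "y \<in> carrier_vec d" "y \<noteq> 0\<^sub>v d" "\<And>j. j < d \<Longrightarrow> j \<notin> {..k} \<Longrightarrow> y \<bullet> u j = 0"
      "\<And>j. j < d \<Longrightarrow> j \<notin> {k..<d} \<Longrightarrow> y \<bullet> v j = 0"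
      using ex_common_span[OF a(2) b(2) sub] by blast
    have "W y = y \<bullet> (A *\<^sub>v y) - t * (y \<bullet> y)"
      unfolding quad[OF y(1)] W_def
    proof (rule sum.cong[OF refl])
      fix j assume "j \<in> {..<d}"
      then show "\<bar>l j - t\<bar> * (y \<bullet> u j)\<^sup>2 = (l j - t) * (y \<bullet> u j)\<^sup>2"
        using y(3)[of j] a(4)[of j k] k lk by (cases "j \<le> k") auto
    qed
    moreover have "y \<bullet> (B *\<^sub>v y) - t * (y \<bullet> y) \<le> 0"
      unfolding quadB[OF y(1)]
    proof (rule sum_nonpos)
      fix j assume "j \<in> {..<d}"
      then show "(lt j - t) * (y \<bullet> v j)\<^sup>2 \<le> 0"
        using y(4)[of j] ltk[of j] by (cases "k \<le> j") (auto intro!: mult_nonpos_nonneg)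
    qed
    ultimately show False using pert[OF y(1,2)] by linarith
  qed
  have down: "lt k < t" if lk: "l k < t"
  proof (rule ccontr)
    assume "\<not> lt k < t"
    then have ltk: "t \<le> lt j" if "j \<le> k" for j using b(4)[OF that k] by simp
    have sub: "{k..<d} \<subseteq> {..<d}" "{..k} \<subseteq> {..<d}" "d < card {k..<d} + card {..k}" using k by auto
    then obtain y where y: "y \<in> carrier_vec d" "y \<noteq> 0\<^sub>v d" "\<And>j. j < d \<Longrightarrow> j \<notin> {k..<d} \<Longrightarrow> y \<bullet> u j = 0"
      "\<And>j. j < d \<Longrightarrow> j \<notin> {..k} \<Longrightarrow> y \<bullet> v j = 0"
      using ex_common_span[OF a(2) b(2) sub] by blast
    have "W y = - (y \<bullet> (A *\<^sub>v y) - t * (y \<bullet> y))"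
      unfolding quad[OF y(1)] W_def sum_negf[symmetric]
    proof (rule sum.cong[OF refl])
      fix j assume "j \<in> {..<d}"
      then show "\<bar>l j - t\<bar> * (y \<bullet> u j)\<^sup>2 = - ((l j - t) * (y \<bullet> u j)\<^sup>2)"
        using y(3)[of j] a(4)[of k j] k lk by (cases "k \<le> j") (auto simp: algebra_simps)
    qed
    moreover have "0 \<le> y \<bullet> (B *\<^sub>v y) - t * (y \<bullet> y)"
      unfolding quadB[OF y(1)]
    proof (rule sum_nonneg)
      fix j assume "j \<in> {..<d}"
      then show "0 \<le> (lt j - t) * (y \<bullet> v j)\<^sup>2"
        using y(4)[of j] ltk[of j] by (cases "j \<le> k") auto
    qed
    ultimately show False using pert[OF y(1,2)] by linarith
  qed
  show "lt k > t \<longleftrightarrow> l k > t" "lt k < t \<longleftrightarrow> l k < t" using up down t[OF k] by force+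
qed

section \<open>Frobenius distance of spectral projectors\<close>

definition frob2 :: "nat \<Rightarrow> real mat \<Rightarrow> real" where
  "frob2 d M = (\<Sum>i<d. \<Sum>j<d. (M $$ (i, j))\<^sup>2)"

lemma sum_swap_pairs:
  "(\<Sum>a\<in>A. \<Sum>b\<in>B. \<Sum>k\<in>C. \<Sum>i\<in>D. h a b k i) = (\<Sum>k\<in>C. \<Sum>i\<in>D. \<Sum>a\<in>A. \<Sum>b\<in>B. h a b k i)"
  for h :: "_ \<Rightarrow> _ \<Rightarrow> _ \<Rightarrow> _ \<Rightarrow> real"
proof -
  have L: "(\<Sum>x\<in>X. \<Sum>y\<in>Y. F x y) = (\<Sum>p\<in>X \<times> Y. F (fst p) (snd p))" for F :: "'x \<Rightarrow> 'y \<Rightarrow> real" and X Y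
    by (simp add: sum.cartesian_product case_prod_beta)
  have "(\<Sum>a\<in>A. \<Sum>b\<in>B. \<Sum>k\<in>C. \<Sum>i\<in>D. h a b k i) = (\<Sum>p\<in>A \<times> B. \<Sum>k\<in>C. \<Sum>i\<in>D. h (fst p) (snd p) k i)"
    by (rule L)
  also have "\<dots> = (\<Sum>k\<in>C. \<Sum>p\<in>A \<times> B. \<Sum>i\<in>D. h (fst p) (snd p) k i)" by (rule sum.swap)
  also have "\<dots> = (\<Sum>k\<in>C. \<Sum>i\<in>D. \<Sum>p\<in>A \<times> B. h (fst p) (snd p) k i)" by (intro sum.cong refl sum.swap)
  also have "\<dots> = (\<Sum>k\<in>C. \<Sum>i\<in>D. \<Sum>a\<in>A. \<Sum>b\<in>B. h a b k i)" by (intro sum.cong refl L[symmetric])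
  finally show ?thesis .
qed

text \<open>The trace inner product of the rank-one projectors along \<open>v k\<close> and
  \<open>u i\<close> is the squared cosine \<open>(v k \<bullet> u i)\<^sup>2\<close>.\<close>

lemma fmat_inner:
  assumes v: "onb d v" and u: "onb d u"
  shows "(\<Sum>a<d. \<Sum>b<d. fmat d f v $$ (a, b) * fmat d g u $$ (a, b)) = (\<Sum>k<d. \<Sum>i<d. f k * g i * (v k \<bullet> u i)\<^sup>2)"
proof -
  have "(\<Sum>a<d. \<Sum>b<d. fmat d f v $$ (a, b) * fmat d g u $$ (a, b))
    = (\<Sum>a<d. \<Sum>b<d. \<Sum>k<d. \<Sum>i<d. f k * g i * ((v k $ a * u i $ a) * (v k $ b * u i $ b)))"
    by (intro sum.cong refl) (simp add: fmat_def sum_product mult_ac)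
  also have "\<dots> = (\<Sum>k<d. \<Sum>i<d. \<Sum>a<d. \<Sum>b<d. f k * g i * ((v k $ a * u i $ a) * (v k $ b * u i $ b)))"
    by (rule sum_swap_pairs)
  also have "\<dots> = (\<Sum>k<d. \<Sum>i<d. f k * g i * (v k \<bullet> u i)\<^sup>2)"
  proof (intro sum.cong refl)
    fix k i assume "i \<in> {..<d}"
    then have "v k \<bullet> u i = (\<Sum>a<d. v k $ a * u i $ a)"
      using onb_carrier[OF u, of i] by (simp add: scalar_prod_def lessThan_atLeast0)
    then have "(v k \<bullet> u i)\<^sup>2 = (\<Sum>a<d. \<Sum>b<d. (v k $ a * u i $ a) * (v k $ b * u i $ b))"
      by (simp add: power2_eq_square sum_product)
    then show "(\<Sum>a<d. \<Sum>b<d. f k * g i * ((v k $ a * u i $ a) * (v k $ b * u i $ b))) = f k * g i * (v k \<bullet> u i)\<^sup>2"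
      by (simp only: sum_distrib_left)
  qed
  finally show ?thesis .
qed

text \<open>Both projectors have rank \<open>card U\<close>, so the squared distance is twice
  \<open>card U\<close> minus twice the trace of their product. Parseval for each \<open>v k\<close>
  with \<open>k\<close> in \<open>U\<close> writes the difference as the mass of its coordinates
  outside \<open>U\<close>, exactly the quantity that \<open>projector_perturbation\<close>
  bounds.\<close>

lemma frob2_projector_diff:
  assumes v: "onb d v" and u: "onb d u" and U: "U \<subseteq> {..<d}"
  shows "frob2 d (fmat d (\<lambda>k. of_bool (k \<in> U)) v - fmat d (\<lambda>k. of_bool (k \<in> U)) u)
    = 2 * (\<Sum>k\<in>U. \<Sum>i\<in>{..<d} - U. (v k \<bullet> u i)\<^sup>2)"
proof -
  define f where "f k = (of_bool (k \<in> U) :: real)" for k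
  have fin: "finite U" using U finite_subset by blast
  have restr: "(\<Sum>k<d. f k * g k) = (\<Sum>k\<in>U. g k)" for g
    using U by (intro sum.mono_neutral_cong_right) (auto simp: f_def)
  have self: "(\<Sum>a<d. \<Sum>b<d. fmat d f w $$ (a, b) * fmat d f w $$ (a, b)) = card U" if w: "onb d w" for w
  proof -
    have "(\<Sum>k<d. \<Sum>i<d. f k * f i * (w k \<bullet> w i)\<^sup>2) = (\<Sum>k<d. f k * (\<Sum>i<d. f i * (w k \<bullet> w i)\<^sup>2))"
      by (simp add: sum_distrib_left mult.assoc)
    also have "\<dots> = (\<Sum>k\<in>U. \<Sum>i\<in>U. (w k \<bullet> w i)\<^sup>2)" by (simp only: restr)
    also have "\<dots> = (\<Sum>k\<in>U. \<Sum>i\<in>U. of_bool (k = i))"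
      using U onb_prod[OF w] by (intro sum.cong refl) (auto simp: subset_iff)
    also have "\<dots> = (\<Sum>k\<in>U. 1)"
      using fin by (intro sum.cong refl) (simp add: of_bool_def)
    finally show ?thesis unfolding fmat_inner[OF w w] by simp
  qed
  have cross: "(\<Sum>a<d. \<Sum>b<d. fmat d f v $$ (a, b) * fmat d f u $$ (a, b)) = (\<Sum>k\<in>U. \<Sum>i\<in>U. (v k \<bullet> u i)\<^sup>2)"
  proof -
    have "(\<Sum>k<d. \<Sum>i<d. f k * f i * (v k \<bullet> u i)\<^sup>2) = (\<Sum>k<d. f k * (\<Sum>i<d. f i * (v k \<bullet> u i)\<^sup>2))"
      by (simp add: sum_distrib_left mult.assoc)
    also have "\<dots> = (\<Sum>k\<in>U. \<Sum>i\<in>U. (v k \<bullet> u i)\<^sup>2)" by (simp only: restr)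
    finally show ?thesis unfolding fmat_inner[OF v u] .
  qed
  have "card U = (\<Sum>k\<in>U. \<Sum>i<d. (v k \<bullet> u i)\<^sup>2)"
  proof -
    have "(\<Sum>i<d. (v k \<bullet> u i)\<^sup>2) = 1" if "k \<in> U" for k
      using parseval_self[OF u onb_carrier[OF v], of k] onb_prod[OF v, of k k] U that by auto
    then show ?thesis by simp
  qed
  also have "\<dots> = (\<Sum>k\<in>U. \<Sum>i\<in>U. (v k \<bullet> u i)\<^sup>2) + (\<Sum>k\<in>U. \<Sum>i\<in>{..<d} - U. (v k \<bullet> u i)\<^sup>2)"
    unfolding sum.distrib[symmetric] using sum.subset_diff[OF U] by (intro sum.cong refl) (simp add: add.commute)
  finally have c: "real (card U) = \<dots>" .
  have "frob2 d (fmat d f v - fmat d f u) =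
    (\<Sum>a<d. \<Sum>b<d. fmat d f v $$ (a, b) * fmat d f v $$ (a, b) + fmat d f u $$ (a, b) * fmat d f u $$ (a, b)
      - 2 * (fmat d f v $$ (a, b) * fmat d f u $$ (a, b)))"
    unfolding frob2_def
  proof (intro sum.cong refl)
    fix a b assume "a \<in> {..<d}" "b \<in> {..<d}"
    then have "(fmat d f v - fmat d f u) $$ (a, b) = fmat d f v $$ (a, b) - fmat d f u $$ (a, b)"
      by (intro index_minus_mat) (simp_all add: fmat_def)
    then show "((fmat d f v - fmat d f u) $$ (a, b))\<^sup>2 = fmat d f v $$ (a, b) * fmat d f v $$ (a, b) + fmat d f u $$ (a, b) * fmat d f u $$ (a, b)
      - 2 * (fmat d f v $$ (a, b) * fmat d f u $$ (a, b))"
      by (simp only: power2_eq_square) (simp add: left_diff_distrib right_diff_distrib)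
  qed
  also have "\<dots> = card U + card U - 2 * (\<Sum>k\<in>U. \<Sum>i\<in>U. (v k \<bullet> u i)\<^sup>2)"
    by (simp only: sum.distrib sum_subtractf sum_distrib_left[symmetric] self[OF v] self[OF u] cross)
  finally show ?thesis using c unfolding f_def[abs_def] by linarith
qed

section \<open>Groups of equal eigenvalues, gaps and the relative rank\<close>

lemma mu_bij:
  assumes "finite (spectrum A)"
  shows "bij_betw (mu A) {1..num_groups A} (spectrum A)"
    and mu_less: "\<And>r s. 1 \<le> r \<Longrightarrow> r < s \<Longrightarrow> s \<le> num_groups A \<Longrightarrow> mu A s < mu A r"
proof -
  define L where "L = sorted_list_of_set (spectrum A)"
  define q where "q = num_groups A"
  have L: "length L = q" "set L = spectrum A" "sorted_wrt (<) L" "distinct L"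
    using assms by (auto simp: L_def q_def num_groups_def)
  have mu: "mu A r = L ! (q - r)" if "r \<in> {1..q}" for r
  proof -
    have "rev L ! (r - 1) = L ! (length L - Suc (r - 1))"
      using that L by (intro rev_nth) auto
    then show ?thesis using that L by (auto simp: mu_def L_def[symmetric])
  qed
  show less: "mu A s < mu A r" if "1 \<le> r" "r < s" "s \<le> num_groups A" for r s
    using that L(1) mu[of r] mu[of s] sorted_wrt_nth_less[OF L(3), of "q - s" "q - r"] by (auto simp: q_def)
  have "inj_on (mu A) {1..q}"
    using less by (intro linorder_inj_onI) (force simp: q_def)+
  moreover have "mu A ` {1..q} = spectrum A"
  proof -
    have "mu A ` {1..q} = (\<lambda>r. L ! (q - r)) ` {1..q}" using mu by (intro image_cong) auto
    also have "\<dots> = (!) L ` (\<lambda>r. q - r) ` {1..q}" by (simp add: image_image)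
    also have "(\<lambda>r. q - r) ` {1..q} = {..<q}"
    proof (intro equalityI subsetI)
      fix i assume "i \<in> {..<q}"
      then show "i \<in> (\<lambda>r. q - r) ` {1..q}" by (intro image_eqI[of _ _ "q - i"]) auto
    qed auto
    also have "(!) L ` {..<q} = spectrum A" using L by (auto simp: set_conv_nth)
    finally show ?thesis .
  qed
  ultimately show "bij_betw (mu A) {1..num_groups A} (spectrum A)" by (simp add: bij_betw_def q_def)
qed

locale spectral_groups =
  fixes d A l u
  assumes es: "eigsys d A l u" and pos: "\<And>i. i < d \<Longrightarrow> 0 < l i"
begin

abbreviation "q \<equiv> num_groups A"

text \<open>Positions are counted from 0 here and from 1 in \<open>grp\<close>.\<close>

definition "G r = {i. i < d \<and> l i = mu A r}"

lemma finite_spectrum: "finite (spectrum A)"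
  using spectrum_eq[OF es] by simp

lemma grp_eq: "grp d A r = Suc ` G r"
proof (intro equalityI subsetI)
  fix j assume "j \<in> grp d A r"
  then show "j \<in> Suc ` G r" using eig_eq[OF es] by (intro image_eqI[of _ _ "j - 1"]) (auto simp: grp_def G_def)
qed (auto simp: grp_def G_def eig_Suc[OF es])

lemma mult_eq: "mult d A r = card (G r)"
  by (simp add: mult_def grp_eq card_image)

lemma finite_G [simp]: "finite (G r)"
  by (simp add: G_def)

lemma mu_mem: "r \<in> {1..q} \<Longrightarrow> \<exists>i<d. mu A r = l i"
  using mu_bij(1)[OF finite_spectrum] spectrum_eq[OF es] by (auto simp: bij_betw_def)

lemma mu_pos: "r \<in> {1..q} \<Longrightarrow> 0 < mu A r"
  using mu_mem[of r] pos by auto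

lemma mu_inj: "r \<in> {1..q} \<Longrightarrow> s \<in> {1..q} \<Longrightarrow> mu A r = mu A s \<Longrightarrow> r = s"
  using mu_bij(1)[OF finite_spectrum] unfolding bij_betw_def by (meson inj_onD)

lemma ex_group: "i < d \<Longrightarrow> \<exists>r\<in>{1..q}. i \<in> G r"
  using mu_bij(1)[OF finite_spectrum] spectrum_eq[OF es] by (auto simp: bij_betw_def G_def)

lemma G_nonempty: "r \<in> {1..q} \<Longrightarrow> 0 < card (G r)"
  using mu_mem[of r] by (auto simp: card_gt_0_iff G_def)

text \<open>The bridge between the perturbation bounds, indexed by eigenvectors, and
  \<open>rel_rank\<close>, \<open>dbar\<close> and \<open>dsf\<close>, which are sums over distinct
  eigenvalues weighted by multiplicities.\<close>

lemma sum_groups: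
  assumes S: "S \<subseteq> {1..q}"
  shows "(\<Sum>i\<in>(\<Union>r\<in>S. G r). f (l i)) = (\<Sum>s\<in>S. real (mult d A s) * f (mu A s))"
proof -
  have "(\<Sum>i\<in>(\<Union>r\<in>S. G r). f (l i)) = (\<Sum>s\<in>S. \<Sum>i\<in>G s. f (l i))"
  proof (rule sum.UNION_disjoint)
    show "finite S" using S finite_subset by blast
    show "\<forall>i\<in>S. \<forall>j\<in>S. i \<noteq> j \<longrightarrow> G i \<inter> G j = {}"
    proof (intro ballI impI)
      fix i j assume ij: "i \<in> S" "j \<in> S" "i \<noteq> j"
      then have "mu A i \<noteq> mu A j" using mu_inj[of i j] S by blast
      then show "G i \<inter> G j = {}" by (auto simp: G_def)
    qed
  qed simp
  also have "\<dots> = (\<Sum>s\<in>S. \<Sum>i\<in>G s. f (mu A s))"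
    by (intro sum.cong refl) (auto simp: G_def)
  finally show ?thesis by (simp add: mult_eq)
qed

lemma compl_groups: "S \<subseteq> {1..q} \<Longrightarrow> {..<d} - (\<Union>r\<in>S. G r) = (\<Union>r\<in>{1..q} - S. G r)"
proof (intro equalityI subsetI)
  fix i assume S: "S \<subseteq> {1..q}" and i: "i \<in> (\<Union>r\<in>{1..q} - S. G r)"
  then obtain r where r: "r \<in> {1..q}" "r \<notin> S" "i < d" "l i = mu A r" by (auto simp: G_def)
  have "i \<notin> G s" if s: "s \<in> S" for s
  proof
    assume "i \<in> G s"
    then have "mu A r = mu A s" using r by (simp add: G_def)
    moreover have "s \<in> {1..q}" using s S by blast
    ultimately show False using mu_inj[of r s] r s by blast
  qed
  then show "i \<in> {..<d} - (\<Union>r\<in>S. G r)" using r by auto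
next
  fix i assume "i \<in> {..<d} - (\<Union>r\<in>S. G r)"
  then show "i \<in> (\<Union>r\<in>{1..q} - S. G r)" using ex_group[of i] by auto
qed

lemma sum_compl_groups:
  "S \<subseteq> {1..q} \<Longrightarrow> (\<Sum>i\<in>{..<d} - (\<Union>r\<in>S. G r). f (l i)) = (\<Sum>s\<in>{1..q} - S. real (mult d A s) * f (mu A s))"
  using sum_groups[of "{1..q} - S" f] compl_groups by simp

text \<open>For the smallest eigenvalue, the convention that 0 follows it makes the lower gap equal
  to \<open>mu A r\<close>. For the others the next eigenvalue is positive, so the lower gap is
  smaller still.\<close>

lemma gap_pos: "r \<in> {1..q} \<Longrightarrow> 0 < gap A r"
  and gap_le_mu: "r \<in> {1..q} \<Longrightarrow> gap A r \<le> mu A r"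
  and gap_le: "r \<in> {1..q} \<Longrightarrow> s \<in> {1..q} \<Longrightarrow> r \<noteq> s \<Longrightarrow> gap A r \<le> \<bar>mu A r - mu A s\<bar>"
proof -
  assume r: "r \<in> {1..q}"
  note less = mu_less[OF finite_spectrum]
  show "0 < gap A r"
    using less[of r "r + 1"] less[of "r - 1" r] mu_pos[OF r] r by (auto simp: gap_def Let_def)
  show "gap A r \<le> mu A r"
    using mu_pos[of "r + 1"] r by (auto simp: gap_def Let_def)
next
  assume r: "r \<in> {1..q}" and s: "s \<in> {1..q}" and rs: "r \<noteq> s"
  note less = mu_less[OF finite_spectrum]
  consider "s < r" | "r < s" using rs by linarith
  then show "gap A r \<le> \<bar>mu A r - mu A s\<bar>"
  proof cases
    case 1
    then have "mu A (r - 1) \<le> mu A s" using less[of s "r - 1"] r s by (cases "s = r - 1") (auto simp: less_imp_le)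
    moreover have "gap A r \<le> mu A (r - 1) - mu A r" using 1 s by (auto simp: gap_def Let_def)
    ultimately show ?thesis by linarith
  next
    case 2
    then have "mu A s \<le> mu A (r + 1)" using less[of "r + 1" s] r s by (cases "s = r + 1") (auto simp: less_imp_le)
    moreover have "gap A r \<le> mu A r - mu A (r + 1)" using 2 s by (auto simp: gap_def Let_def)
    ultimately show ?thesis by linarith
  qed
qed

lemma gap_le_eigenvalue: "r \<in> {1..q} \<Longrightarrow> i < d \<Longrightarrow> i \<notin> G r \<Longrightarrow> gap A r \<le> \<bar>l i - mu A r\<bar>"
proof -
  assume r: "r \<in> {1..q}" and i: "i < d" "i \<notin> G r"
  obtain s where s: "s \<in> {1..q}" "i \<in> G s" using ex_group[OF i(1)] by blast
  then have "r \<noteq> s" using i by auto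
  then show "gap A r \<le> \<bar>l i - mu A r\<bar>" using gap_le[OF r s(1)] s(2) by (simp add: G_def abs_minus_commute)
qed

lemma rel_rank_eq:
  assumes r: "r \<in> {1..q}"
  shows "rel_rank d A r = (\<Sum>i\<in>{..<d} - G r. l i / \<bar>l i - mu A r\<bar>) + card (G r) * mu A r / gap A r"
  using sum_compl_groups[of "{r}" "\<lambda>y. y / \<bar>y - mu A r\<bar>"] r
  by (simp add: rel_rank_def mult_eq abs_minus_commute)

text \<open>The last term alone suffices, since the gap never exceeds \<open>mu A r\<close> and
  every group is nonempty.\<close>

lemma rel_rank_ge_1: "r \<in> {1..q} \<Longrightarrow> 1 \<le> rel_rank d A r"
proof -
  assume r: "r \<in> {1..q}"
  have "1 \<le> mu A r / gap A r" using gap_le_mu[OF r] gap_pos[OF r] by simp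
  also have "\<dots> \<le> card (G r) * (mu A r / gap A r)"
    using G_nonempty[OF r] mu_pos[OF r] gap_pos[OF r] by (intro mult_right_mono[of 1 "real (card (G r))" "mu A r / gap A r", simplified mult_1]) auto
  also have "\<dots> \<le> rel_rank d A r" unfolding rel_rank_eq[OF r] using pos
    by (auto intro!: sum_nonneg divide_nonneg_nonneg intro: less_imp_le)
  finally show ?thesis .
qed

lemma PJ_eq:
  assumes J: "J \<subseteq> {1..q}"
  shows "mat d d (\<lambda>ij. \<Sum>r\<in>J. grp_proj d A r $$ ij) = fmat d (\<lambda>i. of_bool (i \<in> (\<Union>r\<in>J. G r))) u"
proof (rule eq_matI)
  fix a b assume "a < dim_row (fmat d (\<lambda>i. of_bool (i \<in> (\<Union>r\<in>J. G r))) u)" "b < dim_col (fmat d (\<lambda>i. of_bool (i \<in> (\<Union>r\<in>J. G r))) u)"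
  then have ab: "a < d" "b < d" by (auto simp: fmat_def)
  have "(\<Sum>r\<in>J. of_bool (l k = mu A r)) = (of_bool (k \<in> (\<Union>r\<in>J. G r)) :: real)" if k: "k < d" for k
  proof (cases "k \<in> (\<Union>r\<in>J. G r)")
    case True
    then obtain r where r: "r \<in> J" "l k = mu A r" by (auto simp: G_def)
    have "(\<Sum>s\<in>J. of_bool (l k = mu A s)) = (\<Sum>s\<in>J. (of_bool (s = r) :: real))"
      using mu_inj J r by (intro sum.cong refl) (auto simp: subset_iff)
    also have "\<dots> = 1" using r finite_subset[OF J] by (simp add: of_bool_def)
    finally show ?thesis using True by simp
  next
    case False
    then show ?thesis using k by (auto simp: G_def intro!: sum.neutral)
  qed
  then show "mat d d (\<lambda>ij. \<Sum>r\<in>J. grp_proj d A r $$ ij) $$ (a, b) = fmat d (\<lambda>i. of_bool (i \<in> (\<Union>r\<in>J. G r))) u $$ (a, b)"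
    using ab unfolding grp_proj_eq[OF es]
    by (simp add: fmat_def) (subst sum.swap, simp only: sum_distrib_right[symmetric], auto intro!: sum.cong)
qed (auto simp: fmat_def)

text \<open>Two thresholds per group, at \<open>mu A r\<close> plus and minus half its gap, isolate
  the group; when no eigenvalue crosses them, the positions of the group are preserved and
  \<open>projector_perturbation\<close> applies with the same \<open>G r\<close>. The Frobenius
  identity contributes \<open>sqrt 2 \<le> 2\<close> to the constant 12.\<close>

theorem index_proj_perturbation:
  assumes B: "eigsys d B lt v"
    and E: "\<And>i j. i < d \<Longrightarrow> j < d \<Longrightarrow> \<bar>u i \<bullet> (B *\<^sub>v u j) - u i \<bullet> (A *\<^sub>v u j)\<bar> \<le> x * sqrt (l i * l j)"
    and x: "0 \<le> x" and J: "J \<subseteq> {1..q}" and small: "\<And>r. r \<in> J \<Longrightarrow> 4 * x * rel_rank d A r \<le> 1"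
  shows "sqrt (frob2 d (index_proj d B (\<Union>r\<in>J. grp d A r) - fmat d (\<lambda>i. of_bool (i \<in> (\<Union>r\<in>J. G r))) u))
    \<le> 24 * (x * dbar d A J powr (1/2) + x\<^sup>2 * dsf d A J powr (3/2))"
proof -
  note a = eigsysD[OF es] and b = eigsysD[OF B]
  define U where "U = (\<Union>r\<in>J. G r)"
  define e where "e i j = u i \<bullet> (B *\<^sub>v u j) - u i \<bullet> (A *\<^sub>v u j)" for i j
  have finJ: "finite J" using J finite_subset by blast
  have E2: "(e i j)\<^sup>2 \<le> x\<^sup>2 * (l i * l j)" if "i < d" "j < d" for i j
  proof -
    have "\<bar>e i j\<bar>\<^sup>2 \<le> (x * sqrt (l i * l j))\<^sup>2" using E[OF that] by (intro power_mono) (auto simp: e_def)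
    then show ?thesis using pos that by (simp add: power_mult_distrib less_imp_le)
  qed
  have rel0: "0 \<le> rel_rank d A r" if "r \<in> J" for r using rel_rank_ge_1[of r] that J by auto
  have small2: "16 * x\<^sup>2 * (rel_rank d A r)\<^sup>2 \<le> 1" if r: "r \<in> J" for r
  proof -
    have "(4 * x * rel_rank d A r)\<^sup>2 \<le> 1\<^sup>2" using small[OF r] x rel0[OF r] by (intro power_mono) auto
    then show ?thesis by (simp add: power_mult_distrib)
  qed
  \<comment> \<open>Moving from \<open>mu A r\<close> to \<open>t\<close> at most halves the
    distance to eigenvalues outside the group, and eigenvalues inside it are at distance exactly
    half the gap. Hence the sum in \<open>eig_threshold\<close> is at most
    \<open>2 * rel_rank d A r\<close>, and \<open>small2\<close> makes its square times
    \<open>x\<^sup>2\<close> at most 1/4.\<close>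
  have thr: "(lt k > t \<longleftrightarrow> l k > t) \<and> (lt k < t \<longleftrightarrow> l k < t)"
    if r: "r \<in> J" and t: "\<bar>t - mu A r\<bar> = gap A r / 2" and k: "k < d" for r t k
  proof -
    have rq: "r \<in> {1..q}" using r J by auto
    note g = gap_pos[OF rq]
    have dist: "\<bar>l i - mu A r\<bar> / 2 \<le> \<bar>l i - t\<bar>" if "i < d" "i \<notin> G r" for i
      using gap_le_eigenvalue[OF rq that] t abs_triangle_ineq[of "l i - t" "t - mu A r"] by simp
    have nz: "l i \<noteq> t" if "i < d" for i
    proof (cases "i \<in> G r")
      case True then show ?thesis using t g by (auto simp: G_def)
    next
      case False then show ?thesis using dist[OF that False] gap_le_eigenvalue[OF rq that False] g by auto
    qed
    have "(\<Sum>i<d. l i / \<bar>l i - t\<bar>) = (\<Sum>i\<in>{..<d} - G r. l i / \<bar>l i - t\<bar>) + (\<Sum>i\<in>G r. l i / \<bar>l i - t\<bar>)"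
      by (intro sum.subset_diff) (auto simp: G_def)
    also have "(\<Sum>i\<in>{..<d} - G r. l i / \<bar>l i - t\<bar>) \<le> (\<Sum>i\<in>{..<d} - G r. 2 * (l i / \<bar>l i - mu A r\<bar>))"
    proof (rule sum_mono)
      fix i assume "i \<in> {..<d} - G r"
      then have i: "i < d" "i \<notin> G r" by auto
      have "0 < \<bar>l i - mu A r\<bar> / 2" using gap_le_eigenvalue[OF rq i] g by auto
      then have "l i / \<bar>l i - t\<bar> \<le> l i / (\<bar>l i - mu A r\<bar> / 2)"
        using dist[OF i] pos[OF i(1)] by (intro divide_left_mono mult_pos_pos) auto
      then show "l i / \<bar>l i - t\<bar> \<le> 2 * (l i / \<bar>l i - mu A r\<bar>)" by (simp add: mult.commute)
    qed
    also have "(\<Sum>i\<in>G r. l i / \<bar>l i - t\<bar>) = (\<Sum>i\<in>G r. 2 * (mu A r / gap A r))"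
    proof (intro sum.cong refl)
      have gt: "gap A r = 2 * \<bar>t - mu A r\<bar>" using t by simp
      fix i assume "i \<in> G r"
      then show "l i / \<bar>l i - t\<bar> = 2 * (mu A r / gap A r)" unfolding gt by (simp add: G_def abs_minus_commute)
    qed
    also have "(\<Sum>i\<in>{..<d} - G r. 2 * (l i / \<bar>l i - mu A r\<bar>)) + (\<Sum>i\<in>G r. 2 * (mu A r / gap A r)) = 2 * rel_rank d A r"
      unfolding rel_rank_eq[OF rq] by (simp add: sum_distrib_left)
    finally have S: "(\<Sum>i<d. l i / \<bar>l i - t\<bar>) \<le> 2 * rel_rank d A r" by simp
    have "x\<^sup>2 * (\<Sum>i<d. l i / \<bar>l i - t\<bar>)\<^sup>2 \<le> x\<^sup>2 * (2 * rel_rank d A r)\<^sup>2"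
      using S pos by (intro mult_left_mono power_mono sum_nonneg) (auto simp: less_imp_le)
    also have "\<dots> < 1" using small2[OF r] by (simp add: power_mult_distrib)
    finally show ?thesis
      using eig_threshold[OF es B E2[unfolded e_def] pos nz _ k] by blast
  qed
  have loc: "\<bar>lt k - mu A r\<bar> < gap A r / 2 \<longleftrightarrow> k \<in> G r" if r: "r \<in> J" and k: "k < d" for r k
  proof -
    have rq: "r \<in> {1..q}" using r J by auto
    note g = gap_pos[OF rq]
    show ?thesis
      using thr[OF r _ k, of "mu A r + gap A r / 2"] thr[OF r _ k, of "mu A r - gap A r / 2"] g
        gap_le_eigenvalue[OF rq k] k by (cases "k \<in> G r") (auto simp: G_def abs_if split: if_splits)
  qed
  have "index_proj d B (\<Union>r\<in>J. grp d A r) = fmat d (\<lambda>k. of_bool (k \<in> U)) v"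
  proof -
    have im: "eig B ` (\<Union>r\<in>J. grp d A r) = lt ` U"
      by (auto simp: grp_eq U_def image_UN image_image G_def eig_Suc[OF B])
    \<comment> \<open>No perturbed eigenvalue from outside \<open>U\<close> can tie with one from
      inside, because equal values would fall into the same isolated interval. So the selection by
      value is a selection by position.\<close>
    have "lt k \<in> lt ` U \<longleftrightarrow> k \<in> U" if k: "k < d" for k
    proof
      assume "lt k \<in> lt ` U"
      then obtain j r where j: "lt k = lt j" "r \<in> J" "j \<in> G r" by (auto simp: U_def)
      then have "j < d" by (auto simp: G_def)
      then have "k \<in> G r" using loc[OF j(2) k] loc[OF j(2), of j] j by auto
      then show "k \<in> U" using j by (auto simp: U_def)
    qed auto
    then show ?thesis unfolding index_proj_eq[OF B] im by (intro fmat_cong) auto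
  qed
  then have "frob2 d (index_proj d B (\<Union>r\<in>J. grp d A r) - fmat d (\<lambda>i. of_bool (i \<in> U)) u)
    = 2 * (\<Sum>k\<in>U. \<Sum>i\<in>{..<d} - U. (v k \<bullet> u i)\<^sup>2)"
    using frob2_projector_diff[OF b(2) a(2), of U] by (auto simp: U_def G_def)
  moreover have "sqrt (\<Sum>k\<in>U. \<Sum>i\<in>{..<d} - U. (v k \<bullet> u i)\<^sup>2) \<le>
    12 * (x * sqrt (\<Sum>r\<in>J. \<Sum>k\<in>G r. \<Sum>i\<in>{..<d} - U. l k * l i / (l i - mu A r)\<^sup>2)
      + x\<^sup>2 * (\<Sum>r\<in>J. rel_rank d A r * sqrt (\<Sum>i\<in>{..<d} - G r. (\<Sum>j\<in>G r. l j) * l i / (l i - mu A r)\<^sup>2)))"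
    unfolding U_def
  proof (rule projector_perturbation[where E = e and lt = lt])
    show "(\<Sum>k<d. (v k \<bullet> u i) * (v k \<bullet> u j)) = of_bool (i = j)" if "i < d" "j < d" for i j
      using parseval[OF b(2) a(5)[OF that(1)] a(5)[OF that(2)]] onb_prod[OF a(2) that] a(5) b(5) that
      by (simp add: comm_scalar_prod[of _ d])
    show "(lt k - l i) * (v k \<bullet> u i) = (\<Sum>j<d. e i j * (v k \<bullet> u j))" if i: "i < d" and k: "k < d" for i k
    proof -
      have ex: "u i \<bullet> (M *\<^sub>v v k) = (\<Sum>j<d. (u i \<bullet> (M *\<^sub>v u j)) * (v k \<bullet> u j))" if M: "M \<in> carrier_mat d d" "M\<^sup>T = M" for M
      proof -
        have Mu: "M *\<^sub>v u i \<in> carrier_vec d" using M a(5)[OF i] by simp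
        have "u i \<bullet> (M *\<^sub>v v k) = (M *\<^sub>v u i) \<bullet> v k" by (rule sym_scalar_prod[OF M a(5)[OF i] b(5)[OF k]])
        also have "\<dots> = (\<Sum>j<d. ((M *\<^sub>v u i) \<bullet> u j) * (v k \<bullet> u j))" by (rule parseval[OF a(2) Mu b(5)[OF k]])
        also have "\<dots> = (\<Sum>j<d. (u i \<bullet> (M *\<^sub>v u j)) * (v k \<bullet> u j))"
          using sym_scalar_prod[OF M a(5)[OF i]] a(5) by (intro sum.cong refl) simp
        finally show ?thesis .
      qed
      have "(\<Sum>j<d. e i j * (v k \<bullet> u j)) = u i \<bullet> (B *\<^sub>v v k) - u i \<bullet> (A *\<^sub>v v k)"
        unfolding ex[OF a(1) eigsys_sym[OF es]] ex[OF b(1) eigsys_sym[OF B]] e_def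
        by (simp only: left_diff_distrib sum_subtractf)
      also have "u i \<bullet> (A *\<^sub>v v k) = (A *\<^sub>v u i) \<bullet> v k"
        by (rule sym_scalar_prod[OF a(1) eigsys_sym[OF es] a(5)[OF i] b(5)[OF k]])
      finally show ?thesis
        using a(3)[OF i] b(3)[OF k] a(5)[OF i] b(5)[OF k] comm_scalar_prod[OF a(5)[OF i] b(5)[OF k]] by (simp add: left_diff_distrib)
    qed
    show "inj_on (mu A) J" using mu_inj J by (auto simp: inj_on_def subset_iff)
    show "G r = {i. i < d \<and> l i = mu A r}" for r by (simp add: G_def)
    show "\<bar>l i - mu A r\<bar> \<le> 2 * \<bar>lt k - l i\<bar>" if r: "r \<in> J" and k: "k \<in> G r" and i: "i < d" "i \<notin> G r" for r k i
    proof -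
      have "k < d" using k by (simp add: G_def)
      then have "\<bar>lt k - mu A r\<bar> < gap A r / 2" using loc[OF r] k by simp
      moreover have "gap A r \<le> \<bar>l i - mu A r\<bar>" using gap_le_eigenvalue[of r i] J r i by auto
      ultimately show ?thesis using abs_triangle_ineq[of "l i - lt k" "lt k - mu A r"] abs_minus_commute[of "lt k" "l i"] by simp
    qed
    show "(\<Sum>j\<in>{..<d} - G r. l j / \<bar>l j - mu A r\<bar>) \<le> rel_rank d A r" if r: "r \<in> J" for r
    proof -
      have rq: "r \<in> {1..q}" using r J by auto
      show ?thesis unfolding rel_rank_eq[OF rq] using gap_pos[OF rq] mu_pos[OF rq] by simp
    qed
  qed (use E2 pos x finJ small2 rel0 in auto)
  moreover have "(\<Sum>r\<in>J. \<Sum>k\<in>G r. \<Sum>i\<in>{..<d} - U. l k * l i / (l i - mu A r)\<^sup>2) = dbar d A J"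
    unfolding dbar_def
  proof (rule sum.cong[OF refl])
    fix r assume r: "r \<in> J"
    have "(\<Sum>k\<in>G r. \<Sum>i\<in>{..<d} - U. l k * l i / (l i - mu A r)\<^sup>2) = (\<Sum>k\<in>G r. \<Sum>i\<in>{..<d} - U. mu A r * l i / (l i - mu A r)\<^sup>2)"
      by (intro sum.cong refl) (auto simp: G_def)
    also have "\<dots> = mult d A r * (\<Sum>s\<in>{1..q} - J. mult d A s * (mu A r * mu A s / (mu A s - mu A r)\<^sup>2))"
      unfolding U_def sum_compl_groups[OF J, of "\<lambda>y. mu A r * y / (y - mu A r)\<^sup>2"] by (simp add: mult_eq)
    also have "\<dots> = (\<Sum>s\<in>{1..q} - J. pair_term d A r s)"
      by (simp add: sum_distrib_left pair_term_def power2_commute mult_ac)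
    finally show "(\<Sum>k\<in>G r. \<Sum>i\<in>{..<d} - U. l k * l i / (l i - mu A r)\<^sup>2) = (\<Sum>s\<in>{1..q} - J. pair_term d A r s)" .
  qed
  moreover have "(\<Sum>r\<in>J. rel_rank d A r * sqrt (\<Sum>i\<in>{..<d} - G r. (\<Sum>j\<in>G r. l j) * l i / (l i - mu A r)\<^sup>2)) = dsf d A J powr (3/2)"
  proof -
    have "(\<Sum>i\<in>{..<d} - G r. (\<Sum>j\<in>G r. l j) * l i / (l i - mu A r)\<^sup>2) = (\<Sum>s\<in>{1..q} - {r}. pair_term d A r s)" if r: "r \<in> J" for r
    proof -
      have "(\<Sum>j\<in>G r. l j) = card (G r) * mu A r" by (simp add: G_def)
      then show ?thesis
        using sum_compl_groups[of "{r}" "\<lambda>y. (card (G r) * mu A r) * y / (y - mu A r)\<^sup>2"] r J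
        by (auto simp: pair_term_def mult_eq power2_commute mult_ac)
    qed
    then have "(\<Sum>r\<in>J. rel_rank d A r * sqrt (\<Sum>i\<in>{..<d} - G r. (\<Sum>j\<in>G r. l j) * l i / (l i - mu A r)\<^sup>2)) =
      (\<Sum>r\<in>J. rel_rank d A r * sqrt (\<Sum>s\<in>{1..q} - {r}. pair_term d A r s))" by simp
    \<comment> \<open>The exponent 3/2 undoes the exponent 2/3 in \<open>dsf\<close> only for a
      nonnegative base.\<close>
    moreover have "0 \<le> \<dots>"
      using rel0 J mu_pos by (intro sum_nonneg mult_nonneg_nonneg real_sqrt_ge_zero)
        (auto simp: pair_term_def subset_iff less_imp_le intro!: divide_nonneg_nonneg mult_nonneg_nonneg)
    ultimately show ?thesis by (simp add: dsf_def powr_powr)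
  qed
  moreover have "0 \<le> dbar d A J"
    using J mu_pos by (auto simp: dbar_def pair_term_def subset_iff less_imp_le intro!: sum_nonneg divide_nonneg_nonneg mult_nonneg_nonneg)
  ultimately have "sqrt (frob2 d (index_proj d B (\<Union>r\<in>J. grp d A r) - fmat d (\<lambda>i. of_bool (i \<in> U)) u))
      \<le> sqrt 2 * (12 * (x * dbar d A J powr (1/2) + x\<^sup>2 * dsf d A J powr (3/2)))"
    by (simp add: real_sqrt_mult powr_half_sqrt)
  also have "\<dots> \<le> 2 * (12 * (x * dbar d A J powr (1/2) + x\<^sup>2 * dsf d A J powr (3/2)))"
    using x sqrt2_less_2 by (intro mult_right_mono) (auto intro!: add_nonneg_nonneg)
  finally show ?thesis by (simp add: U_def)
qed

end

section \<open>The block norm of a frame\<close>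

definition frob :: "real mat \<Rightarrow> real" where
  "frob M = sqrt (\<Sum>i<dim_row M. \<Sum>j<dim_col M. (M $$ (i, j))\<^sup>2)"

lemma frob_nonneg [simp]: "0 \<le> frob M"
  by (simp add: frob_def sum_nonneg)

lemma frob_frob2: "M \<in> carrier_mat d d \<Longrightarrow> frob M = sqrt (frob2 d M)"
  by (auto simp: frob_def frob2_def)

lemma vnorm_L2_set: "vnorm v = L2_set (($) v) {..<dim_vec v}"
  by (simp add: vnorm_def L2_set_def scalar_prod_def lessThan_atLeast0 power2_eq_square)

lemma vnorm_nonneg [simp]: "0 \<le> vnorm v"
  by (simp add: vnorm_L2_set)

lemma vnorm_add: "v \<in> carrier_vec n \<Longrightarrow> w \<in> carrier_vec n \<Longrightarrow> vnorm (v + w) \<le> vnorm v + vnorm w"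
proof -
  assume v: "v \<in> carrier_vec n" and w: "w \<in> carrier_vec n"
  have "vnorm (v + w) = L2_set (\<lambda>i. v $ i + w $ i) {..<n}"
    unfolding vnorm_L2_set using v w by (intro L2_set_cong) auto
  also have "\<dots> \<le> L2_set (($) v) {..<n} + L2_set (($) w) {..<n}" by (rule L2_set_triangle_ineq)
  finally show ?thesis using v w by (simp add: vnorm_L2_set)
qed

lemma vnorm_uminus: "vnorm (- v) = vnorm v"
  by (simp add: vnorm_L2_set L2_set_def)

lemma vnorm_mult_le_frob:
  assumes "v \<in> carrier_vec (dim_col A)"
  shows "vnorm (A *\<^sub>v v) \<le> frob A * vnorm v"
proof -
  have "((A *\<^sub>v v) $ i)\<^sup>2 \<le> (\<Sum>j<dim_col A. (A $$ (i, j))\<^sup>2) * (\<Sum>j<dim_col A. (v $ j)\<^sup>2)" if "i < dim_row A" for i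
    using Cauchy_Schwarz_ineq_sum[of "\<lambda>j. A $$ (i, j)" "\<lambda>j. v $ j" "{..<dim_col A}"] that assms
    by (simp add: scalar_prod_def lessThan_atLeast0)
  then have "(\<Sum>i<dim_row A. ((A *\<^sub>v v) $ i)\<^sup>2) \<le> (\<Sum>i<dim_row A. (\<Sum>j<dim_col A. (A $$ (i, j))\<^sup>2) * (\<Sum>j<dim_col A. (v $ j)\<^sup>2))"
    by (intro sum_mono) auto
  then have "sqrt (\<Sum>i<dim_row A. ((A *\<^sub>v v) $ i)\<^sup>2) \<le> sqrt ((\<Sum>i<dim_row A. \<Sum>j<dim_col A. (A $$ (i, j))\<^sup>2) * (\<Sum>j<dim_col A. (v $ j)\<^sup>2))"
    by (simp add: sum_distrib_right)
  then show ?thesis using assms by (simp add: vnorm_L2_set L2_set_def frob_def real_sqrt_mult)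
qed

text \<open>A real supremum is meaningful only for a nonempty set that is bounded above. The zero
  vector and the Frobenius norm provide this once and for all.\<close>

lemma spectral_norm_bounds:
  shows spectral_norm_upper: "v \<in> carrier_vec (dim_col A) \<Longrightarrow> vnorm v \<le> 1 \<Longrightarrow> vnorm (A *\<^sub>v v) \<le> spectral_norm A"
    and spectral_norm_le_frob: "spectral_norm A \<le> frob A"
    and spectral_norm_least: "(\<And>v. v \<in> carrier_vec (dim_col A) \<Longrightarrow> vnorm v \<le> 1 \<Longrightarrow> vnorm (A *\<^sub>v v) \<le> c) \<Longrightarrow> spectral_norm A \<le> c"
proof -
  let ?B = "{v \<in> carrier_vec (dim_col A). vnorm v \<le> 1}"
  have le: "vnorm (A *\<^sub>v v) \<le> frob A" if "v \<in> ?B" for v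
    using order_trans[OF vnorm_mult_le_frob mult_left_le[of "vnorm v" "frob A"]] that by auto
  then have bdd: "bdd_above ((\<lambda>v. vnorm (A *\<^sub>v v)) ` ?B)" by (auto simp: bdd_above_def)
  have ne: "?B \<noteq> {}" by (auto intro!: exI[of _ "0\<^sub>v (dim_col A)"] simp: vnorm_L2_set L2_set_def)
  show "v \<in> carrier_vec (dim_col A) \<Longrightarrow> vnorm v \<le> 1 \<Longrightarrow> vnorm (A *\<^sub>v v) \<le> spectral_norm A"
    unfolding spectral_norm_def using bdd by (intro cSUP_upper) auto
  show "spectral_norm A \<le> frob A" unfolding spectral_norm_def using ne le by (intro cSUP_least) auto
  show "(\<And>v. v \<in> carrier_vec (dim_col A) \<Longrightarrow> vnorm v \<le> 1 \<Longrightarrow> vnorm (A *\<^sub>v v) \<le> c) \<Longrightarrow> spectral_norm A \<le> c"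
    unfolding spectral_norm_def using ne by (intro cSUP_least) auto
qed

lemma spectral_norm_add:
  assumes A: "A \<in> carrier_mat n m" and B: "B \<in> carrier_mat n m"
  shows "spectral_norm (A + B) \<le> spectral_norm A + spectral_norm B"
proof (rule spectral_norm_least)
  fix v assume v: "v \<in> carrier_vec (dim_col (A + B))" "vnorm v \<le> 1"
  have "(A + B) *\<^sub>v v = A *\<^sub>v v + B *\<^sub>v v" using A B v by (intro add_mult_distrib_mat_vec) auto
  also have "vnorm \<dots> \<le> vnorm (A *\<^sub>v v) + vnorm (B *\<^sub>v v)" using A B v by (intro vnorm_add[of _ n]) auto
  also have "\<dots> \<le> spectral_norm A + spectral_norm B"
    using A B v by (intro add_mono spectral_norm_upper) auto
  finally show "vnorm ((A + B) *\<^sub>v v) \<le> spectral_norm A + spectral_norm B" .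
qed

lemma spectral_norm_uminus:
  fixes A :: "real mat"
  shows "spectral_norm (- A) = spectral_norm A"
proof -
  have "(- A) *\<^sub>v v = - (A *\<^sub>v v)" if "v \<in> carrier_vec (dim_col A)" for v
    using that by (intro eq_vecI) auto
  then show ?thesis unfolding spectral_norm_def by (intro SUP_cong) (auto simp: vnorm_uminus)
qed

lemma frob_transpose: "frob (A\<^sup>T) = frob A"
  unfolding frob_def by (subst sum.swap) simp

text \<open>Column by column: \<open>z\<close> is the orthogonal projection of \<open>b\<close> to
  the range of \<open>G\<close>, and expanding \<open>(b - z) \<bullet> (b - z) \<ge> 0\<close>
  shows that the projection does not lengthen \<open>b\<close>.\<close>

lemma frob_isometry:
  fixes G B :: "real mat"
  assumes G: "G \<in> carrier_mat d m" "G\<^sup>T * G = 1\<^sub>m m" and B: "B \<in> carrier_mat d k"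
  shows "frob (G\<^sup>T * B) \<le> frob B"
proof -
  have col: "(\<Sum>i<m. ((G\<^sup>T * B) $$ (i, j))\<^sup>2) \<le> (\<Sum>i<d. (B $$ (i, j))\<^sup>2)" if j: "j < k" for j
  proof -
    define b where "b = col B j"
    define y where "y = G\<^sup>T *\<^sub>v b"
    define z where "z = G *\<^sub>v y"
    have c: "b \<in> carrier_vec d" "y \<in> carrier_vec m" "z \<in> carrier_vec d" using G B j by (auto simp: b_def y_def z_def)
    have zb: "z \<bullet> b = y \<bullet> y"
      using scalar_prod_mult_mat_vec[OF G(1) c(1) c(2)] comm_scalar_prod[OF c(1,3)] by (simp add: y_def z_def)
    have "(G\<^sup>T * G) *\<^sub>v y = G\<^sup>T *\<^sub>v z" unfolding z_def using G(1) c(2) by (intro assoc_mult_mat_vec) auto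
    then have "G\<^sup>T *\<^sub>v z = y" unfolding G(2) using c(2) by simp
    then have "z \<bullet> z = y \<bullet> y"
      using scalar_prod_mult_mat_vec[OF G(1) c(3) c(2)] by (simp add: z_def)
    moreover have "0 \<le> (b - z) \<bullet> (b - z)" by (rule scalar_prod_self_nonneg)
    moreover have "(b - z) \<bullet> (b - z) = b \<bullet> b - 2 * (z \<bullet> b) + z \<bullet> z"
      using c comm_scalar_prod[OF c(1,3)] by (simp add: minus_scalar_prod_distrib[of _ d] scalar_prod_minus_distrib[of _ d])
    ultimately have "y \<bullet> y \<le> b \<bullet> b" using zb by simp
    moreover have "y \<bullet> y = (\<Sum>i<m. ((G\<^sup>T * B) $$ (i, j))\<^sup>2)"
      using G B j by (auto simp: y_def b_def scalar_prod_def[of _ "G\<^sup>T *\<^sub>v col B j"] lessThan_atLeast0 power2_eq_square intro!: sum.cong)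
    moreover have "b \<bullet> b = (\<Sum>i<d. (B $$ (i, j))\<^sup>2)"
      using B j by (auto simp: b_def scalar_prod_def lessThan_atLeast0 power2_eq_square intro!: sum.cong)
    ultimately show ?thesis by simp
  qed
  have "(\<Sum>i<m. \<Sum>j<k. ((G\<^sup>T * B) $$ (i, j))\<^sup>2) \<le> (\<Sum>i<d. \<Sum>j<k. (B $$ (i, j))\<^sup>2)"
    by (subst (1 2) sum.swap) (intro sum_mono col, simp)
  then show ?thesis using G B unfolding frob_def by simp
qed

text \<open>The right factor is handled like the left one after a transposition, which leaves the
  Frobenius norm unchanged.\<close>

lemma frob_compress:
  fixes G H A :: "real mat"
  assumes G: "G \<in> carrier_mat d m" "G\<^sup>T * G = 1\<^sub>m m" and H: "H \<in> carrier_mat d k" "H\<^sup>T * H = 1\<^sub>m k" and A: "A \<in> carrier_mat d d"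
  shows "frob (G\<^sup>T * A * H) \<le> frob A"
proof -
  have GA: "G\<^sup>T * A \<in> carrier_mat m d" using G A by simp
  have "frob (G\<^sup>T * A * H) = frob (H\<^sup>T * (G\<^sup>T * A)\<^sup>T)"
    using frob_transpose[of "G\<^sup>T * A * H"] transpose_mult[OF GA H(1)] by simp
  also have "\<dots> \<le> frob ((G\<^sup>T * A)\<^sup>T)" using GA by (intro frob_isometry[OF H]) simp
  also have "\<dots> \<le> frob A" unfolding frob_transpose using A by (intro frob_isometry[OF G])
  finally show ?thesis .
qed

lemma pick_inj: "inj_on (pick I) {..<card {a. a < n \<and> a \<in> I}}"
proof (rule inj_onI)
  fix i j assume i: "i \<in> {..<card {a. a < n \<and> a \<in> I}}" and j: "j \<in> {..<card {a. a < n \<and> a \<in> I}}" and eq: "pick I i = pick I j"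
  let ?S = "{a. a < n \<and> a \<in> I}"
  have "pick ?S i = pick ?S j" using pick_reduce_set[of i n I] pick_reduce_set[of j n I] i j eq by simp
  moreover have "i < card ?S" "j < card ?S" using i j by auto
  ultimately show "i = j" using card_pick_le[of i ?S] card_pick_le[of j ?S] by simp
qed

lemma frob_submatrix: "frob (submatrix A I J) \<le> frob A"
proof -
  define r c where "r = card {i. i < dim_row A \<and> i \<in> I}" and "c = card {j. j < dim_col A \<and> j \<in> J}"
  have pr: "pick I ` {..<r} \<subseteq> {..<dim_row A}" "pick J ` {..<c} \<subseteq> {..<dim_col A}"
    using pick_le by (auto simp: r_def c_def)
  have "(\<Sum>i<r. \<Sum>j<c. (submatrix A I J $$ (i, j))\<^sup>2) = (\<Sum>i<r. \<Sum>j<c. (A $$ (pick I i, pick J j))\<^sup>2)"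
    by (intro sum.cong refl) (simp add: submatrix_def r_def c_def)
  also have "\<dots> = (\<Sum>i\<in>pick I ` {..<r}. \<Sum>j\<in>pick J ` {..<c}. (A $$ (i, j))\<^sup>2)"
    by (simp add: sum.reindex[OF pick_inj[of I "dim_row A", folded r_def]] sum.reindex[OF pick_inj[of J "dim_col A", folded c_def]])
  also have "\<dots> \<le> (\<Sum>i\<in>pick I ` {..<r}. \<Sum>j<dim_col A. (A $$ (i, j))\<^sup>2)"
    using pr by (intro sum_mono sum_mono2) auto
  also have "\<dots> \<le> (\<Sum>i<dim_row A. \<Sum>j<dim_col A. (A $$ (i, j))\<^sup>2)"
    using pr by (intro sum_mono2) (auto intro!: sum_nonneg)
  finally show ?thesis by (simp add: frob_def dim_submatrix r_def c_def)
qed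

lemma submatrix_add:
  assumes "A \<in> carrier_mat n m" "B \<in> carrier_mat n m"
  shows "submatrix (A + B) I J = submatrix A I J + submatrix B I J"
  using assms pick_le[of _ n I] pick_le[of _ m J] by (intro eq_matI) (auto simp: submatrix_def)

lemma submatrix_uminus:
  fixes A :: "real mat"
  shows "submatrix (- A) I J = - submatrix A I J"
  using pick_le[of _ "dim_row A" I] pick_le[of _ "dim_col A" J] by (intro eq_matI) (auto simp: submatrix_def)

section \<open>The block norm: triangle inequality and domination by the Frobenius norm\<close>

locale frame =
  fixes d m :: nat and P G1 G2 :: "real mat" and s1 s2 :: nat
  assumes frame: "adapted_frame d m P G1 G2"
begin

lemma G1: "G1 \<in> carrier_mat d m" "G1\<^sup>T * G1 = 1\<^sub>m m"
  and G2: "G2 \<in> carrier_mat d (d - m)" "G2\<^sup>T * G2 = 1\<^sub>m (d - m)"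
  using frame by (auto simp: adapted_frame_def)

abbreviation "block A k l \<equiv> submatrix (G1\<^sup>T * A * G2) {k - 1..<k - 1 + s1} {l - 1..<l - 1 + s2}"
abbreviation "ix \<equiv> {1..dim_col G1 - s1 + 1} \<times> {1..dim_col G2 - s2 + 1}"

lemma frame_norm_mono_sum:
  assumes A: "A \<in> carrier_mat d d" and B: "B \<in> carrier_mat d d"
  shows "frame_norm G1 G2 s1 s2 (A + B) \<le> frame_norm G1 G2 s1 s2 A + frame_norm G1 G2 s1 s2 B"
proof -
  have lin: "G\<^sup>T * (A + B) * H = G\<^sup>T * A * H + G\<^sup>T * B * H" if "G \<in> carrier_mat d g" "H \<in> carrier_mat d h" for G H :: "real mat" and g h
    using that A B by (simp add: mult_add_distrib_mat[of _ g d _ d] add_mult_distrib_mat[of _ g d _ _ h])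
  have c1: "G1\<^sup>T * M * G1 \<in> carrier_mat m m" if "M \<in> carrier_mat d d" for M using G1 that by simp
  have c2: "G2\<^sup>T * M * G2 \<in> carrier_mat (d - m) (d - m)" if "M \<in> carrier_mat d d" for M using G2 that by simp
  have c3: "G1\<^sup>T * M * G2 \<in> carrier_mat m (d - m)" if "M \<in> carrier_mat d d" for M using G1 G2 that by simp
  have n1: "spectral_norm (G1\<^sup>T * (A + B) * G1) \<le> spectral_norm (G1\<^sup>T * A * G1) + spectral_norm (G1\<^sup>T * B * G1)"
    unfolding lin[OF G1(1) G1(1)] by (rule spectral_norm_add[OF c1[OF A] c1[OF B]])
  have n2: "spectral_norm (G2\<^sup>T * (A + B) * G2) \<le> spectral_norm (G2\<^sup>T * A * G2) + spectral_norm (G2\<^sup>T * B * G2)"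
    unfolding lin[OF G2(1) G2(1)] by (rule spectral_norm_add[OF c2[OF A] c2[OF B]])
  have n3: "Max ((\<lambda>(k, l). spectral_norm (block (A + B) k l)) ` ix)
    \<le> Max ((\<lambda>(k, l). spectral_norm (block A k l)) ` ix) + Max ((\<lambda>(k, l). spectral_norm (block B k l)) ` ix)"
  proof (rule Max.boundedI)
    fix x assume "x \<in> (\<lambda>(k, l). spectral_norm (block (A + B) k l)) ` ix"
    then obtain k l where kl: "(k, l) \<in> ix" and x: "x = spectral_norm (block (A + B) k l)" by auto
    have "x \<le> spectral_norm (block A k l) + spectral_norm (block B k l)"
      unfolding x lin[OF G1(1) G2(1)] submatrix_add[OF c3[OF A] c3[OF B]]
      using c3[OF A] c3[OF B] by (intro spectral_norm_add[OF carrier_matI carrier_matI]) (auto simp: dim_submatrix)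
    also have "\<dots> \<le> Max ((\<lambda>(k, l). spectral_norm (block A k l)) ` ix) + Max ((\<lambda>(k, l). spectral_norm (block B k l)) ` ix)"
      using kl by (intro add_mono Max_ge) (auto intro!: image_eqI[of _ _ "(k, l)"])
    finally show "x \<le> \<dots>" .
  qed auto
  show ?thesis unfolding frame_norm_def using n1 n2 n3 by linarith
qed

lemma frame_norm_uminus:
  assumes A: "A \<in> carrier_mat d d"
  shows "frame_norm G1 G2 s1 s2 (- A) = frame_norm G1 G2 s1 s2 A"
proof -
  have lin: "G\<^sup>T * (- A) * H = - (G\<^sup>T * A * H)" if "G \<in> carrier_mat d g" "H \<in> carrier_mat d h" for G H :: "real mat" and g h
    using that A by (intro eq_matI) (auto simp: scalar_prod_def sum_negf intro!: sum.cong)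
  show ?thesis
    unfolding frame_norm_def lin[OF G1(1) G1(1)] lin[OF G2(1) G2(1)] lin[OF G1(1) G2(1)] submatrix_uminus spectral_norm_uminus ..
qed

text \<open>Every block is a compression of \<open>A\<close>, possibly followed by passing to a
  submatrix, and neither increases the Frobenius norm. The weights 1/2, 1/2 and 1 add up to 2,
  whatever the block sizes.\<close>

lemma frame_norm_le_frob:
  assumes A: "A \<in> carrier_mat d d"
  shows "frame_norm G1 G2 s1 s2 A \<le> 2 * frob A"
proof -
  have n1: "spectral_norm (G1\<^sup>T * A * G1) \<le> frob A"
    by (rule order_trans[OF spectral_norm_le_frob frob_compress[OF G1 G1 A]])
  have n2: "spectral_norm (G2\<^sup>T * A * G2) \<le> frob A"
    by (rule order_trans[OF spectral_norm_le_frob frob_compress[OF G2 G2 A]])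
  have n3: "Max ((\<lambda>(k, l). spectral_norm (block A k l)) ` ix) \<le> frob A"
  proof (rule Max.boundedI)
    fix x assume "x \<in> (\<lambda>(k, l). spectral_norm (block A k l)) ` ix"
    then obtain k l where x: "x = spectral_norm (block A k l)" by auto
    show "x \<le> frob A" unfolding x
      by (rule order_trans[OF spectral_norm_le_frob order_trans[OF frob_submatrix frob_compress[OF G1 G2 A]]])
  qed auto
  show ?thesis unfolding frame_norm_def using n1 n2 n3 by linarith
qed

lemma frame_norm_diff:
  assumes A: "A \<in> carrier_mat d d" and B: "B \<in> carrier_mat d d"
  shows "\<bar>frame_norm G1 G2 s1 s2 A - frame_norm G1 G2 s1 s2 B\<bar> \<le> frame_norm G1 G2 s1 s2 (A - B)"
proof -
  have AB: "A - B \<in> carrier_mat d d" using B by (rule minus_carrier_mat)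
  have "frame_norm G1 G2 s1 s2 ((A - B) + B) \<le> frame_norm G1 G2 s1 s2 (A - B) + frame_norm G1 G2 s1 s2 B"
    using A B by (intro frame_norm_mono_sum) auto
  moreover have "(A - B) + B = A" using A B by (intro eq_matI) auto
  moreover have "frame_norm G1 G2 s1 s2 (- (A - B) + A) \<le> frame_norm G1 G2 s1 s2 (- (A - B)) + frame_norm G1 G2 s1 s2 A"
    using A B by (intro frame_norm_mono_sum) auto
  moreover have "- (A - B) + A = B" using A B by (intro eq_matI) auto
  ultimately show ?thesis unfolding frame_norm_uminus[OF AB] by (simp add: abs_le_iff)
qed

end

lemma frob_le_sum:
  assumes "M \<in> carrier_mat d d"
  shows "frob M \<le> (\<Sum>p\<in>{..<d} \<times> {..<d}. \<bar>M $$ p\<bar>)"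
proof -
  have "frob M = L2_set (\<lambda>p. M $$ p) ({..<d} \<times> {..<d})"
    using assms by (simp add: frob_def L2_set_def sum.cartesian_product case_prod_beta)
  also have "\<dots> \<le> (\<Sum>p\<in>{..<d} \<times> {..<d}. \<bar>M $$ p\<bar>)" by (rule L2_set_le_sum_abs)
  finally show ?thesis .
qed

section \<open>Concentration of sums\<close>

text \<open>Markov's inequality for the exponential of the sum, whose integral factors over the
  product measure. With nonnegative integrals no separate integrability of the exponentials has to
  be carried along.\<close>

lemma chernoff_PiM:
  fixes M :: "'i \<Rightarrow> 'a measure" and g :: "'i \<Rightarrow> 'a \<Rightarrow> real"
  assumes M: "\<And>i. prob_space (M i)" and I: "finite I"
    and g: "\<And>i. i \<in> I \<Longrightarrow> g i \<in> borel_measurable (M i)" and th: "0 \<le> \<theta>"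
    and mgf: "\<And>i. i \<in> I \<Longrightarrow> (\<integral>\<^sup>+y. ennreal (exp (\<theta> * g i y)) \<partial>M i) \<le> ennreal (exp (b i))"
  shows "measure (Pi\<^sub>M I M) {x \<in> space (Pi\<^sub>M I M). s \<le> (\<Sum>i\<in>I. g i (x i))} \<le> exp ((\<Sum>i\<in>I. b i) - \<theta> * s)"
proof -
  interpret product_prob_space M by (rule product_prob_spaceI[OF M])
  interpret finite_product_prob_space M I by unfold_locales (rule I)
  let ?P = "Pi\<^sub>M I M"
  have gm: "(\<lambda>x. g i (x i)) \<in> borel_measurable ?P" if "i \<in> I" for i
    using g[OF that] that by measurable
  have S: "(\<lambda>x. \<Sum>i\<in>I. g i (x i)) \<in> borel_measurable ?P" using gm by (intro borel_measurable_sum) auto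
  define A where "A = {x \<in> space ?P. s \<le> (\<Sum>i\<in>I. g i (x i))}"
  have A: "A \<in> sets ?P" unfolding A_def using S by measurable
  have "emeasure ?P A = (\<integral>\<^sup>+x. indicator A x \<partial>?P)" using A by simp
  also have "\<dots> \<le> (\<integral>\<^sup>+x. ennreal (exp (- \<theta> * s)) * (\<Prod>i\<in>I. ennreal (exp (\<theta> * g i (x i)))) \<partial>?P)"
  proof (rule nn_integral_mono)
    fix x
    have "1 \<le> exp (- \<theta> * s) * (\<Prod>i\<in>I. exp (\<theta> * g i (x i)))" if "x \<in> A"
    proof -
      have "\<theta> * s \<le> \<theta> * (\<Sum>i\<in>I. g i (x i))" using that th by (intro mult_left_mono) (auto simp: A_def)
      then have "1 \<le> exp (- \<theta> * s + \<theta> * (\<Sum>i\<in>I. g i (x i)))" by simp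
      then show ?thesis using I unfolding exp_add sum_distrib_left exp_sum[OF I] by simp
    qed
    then have "ennreal 1 \<le> ennreal (exp (- \<theta> * s) * (\<Prod>i\<in>I. exp (\<theta> * g i (x i))))" if "x \<in> A"
      using that by (intro ennreal_leI)
    then show "indicator A x \<le> ennreal (exp (- \<theta> * s)) * (\<Prod>i\<in>I. ennreal (exp (\<theta> * g i (x i))))"
      by (auto simp: indicator_def ennreal_mult' prod_ennreal)
  qed
  also have "\<dots> = ennreal (exp (- \<theta> * s)) * (\<integral>\<^sup>+x. (\<Prod>i\<in>I. ennreal (exp (\<theta> * g i (x i)))) \<partial>?P)"
    using gm by (intro nn_integral_cmult) (auto intro!: borel_measurable_prod_ennreal)
  also have "(\<integral>\<^sup>+x. (\<Prod>i\<in>I. ennreal (exp (\<theta> * g i (x i)))) \<partial>?P) = (\<Prod>i\<in>I. \<integral>\<^sup>+y. ennreal (exp (\<theta> * g i y)) \<partial>M i)"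
    using g I by (intro product_nn_integral_prod) auto
  also have "\<dots> \<le> (\<Prod>i\<in>I. ennreal (exp (b i)))" using mgf by (intro prod_mono_ennreal) auto
  also have "ennreal (exp (- \<theta> * s)) * \<dots> = ennreal (exp ((\<Sum>i\<in>I. b i) - \<theta> * s))"
    using I by (simp add: prod_ennreal exp_sum[symmetric] ennreal_mult'[symmetric] exp_add[symmetric] del: exp_sum)
  finally have "emeasure ?P A \<le> ennreal (exp ((\<Sum>i\<in>I. b i) - \<theta> * s))" by (simp add: mult_left_mono)
  then show ?thesis unfolding A_def[symmetric] by (simp add: emeasure_eq_measure)
qed

text \<open>For negative \<open>y = - z\<close>, invert \<open>1 + z \<le> exp z\<close> and use
  that \<open>1 + z\<close> times \<open>1 - z + z\<^sup>2\<close> is \<open>1 + z ^ 3\<close>,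
  hence at least 1.\<close>

lemma exp_le_quadratic: "\<bar>y\<bar> \<le> 1 \<Longrightarrow> exp y \<le> 1 + y + y\<^sup>2" for y :: real
proof (cases "0 \<le> y")
  case False
  assume y: "\<bar>y\<bar> \<le> 1"
  define z where "z = - y"
  have z: "0 < z" "z \<le> 1" using False y by (auto simp: z_def)
  have "1 + z \<le> exp z" by (rule exp_ge_add_one_self)
  then have "inverse (exp z) \<le> inverse (1 + z)" using z by (intro le_imp_inverse_le) auto
  also have "inverse (1 + z) \<le> 1 - z + z\<^sup>2"
    using z by (simp add: field_simps power2_eq_square)
  finally show ?thesis by (simp add: z_def exp_minus)
qed (simp add: exp_bound)

text \<open>Taking the root twice, \<open>ln x\<close> is at most four times
  \<open>sqrt (sqrt x) - 1\<close>, and \<open>sqrt x - 4 * sqrt (sqrt x) + 4\<close> is a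
  square.\<close>

lemma ln_le_sqrt: "1 \<le> x \<Longrightarrow> ln x \<le> sqrt x" for x :: real
proof -
  assume x: "1 \<le> x"
  have s: "0 < sqrt x" "x = (sqrt x)\<^sup>2" using x by auto
  have "ln x = 2 * ln (sqrt x)" using x by (simp add: ln_sqrt)
  also have "ln (sqrt x) = 2 * ln (sqrt (sqrt x))"
    using s(1) by (simp add: ln_sqrt)
  also have "ln (sqrt (sqrt x)) \<le> sqrt (sqrt x) - 1" using s by (intro ln_le_minus_one) auto
  finally have "ln x \<le> 4 * (sqrt (sqrt x) - 1)" by simp
  also have "\<dots> \<le> sqrt x"
  proof -
    have "0 \<le> (sqrt (sqrt x) - 2)\<^sup>2" by simp
    also have "\<dots> = sqrt x - 4 * sqrt (sqrt x) + 4" using s by (simp add: power2_diff)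
    finally show ?thesis by simp
  qed
  finally show ?thesis .
qed

context prob_space
begin

text \<open>Truncation at \<open>B\<close> keeps the exponent within the range of the quadratic
  bound. Centring is at the untruncated mean; the resulting bias is at most the sixteenth moment
  over \<open>B ^ 15\<close>, hence at most \<open>K * \<theta>\<close>. It enters the exponent
  multiplied by \<theta> and is thus of the same order as the variance term: \<open>1 + K\<close>
  from the second moment and \<open>K\<close> from the bias.\<close>

lemma truncated_mgf:
  assumes Y: "Y \<in> borel_measurable M" and int: "integrable M (\<lambda>x. Y x ^ 16)" and K: "expectation (\<lambda>x. Y x ^ 16) \<le> K"
    and th: "0 < \<theta>" "\<theta> * B \<le> 1" "0 < B" "1 \<le> \<theta> * B ^ 15"
  shows "(\<integral>\<^sup>+x. ennreal (exp (\<theta> * (Y x * indicator {y. \<bar>y\<bar> \<le> B} (Y x) - expectation Y))) \<partial>M) \<le> ennreal (exp (\<theta>\<^sup>2 * (1 + 2 * K)))"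
proof -
  define Z where "Z x = Y x * indicator {y. \<bar>y\<bar> \<le> B} (Y x)" for x
  have Zm [measurable]: "Z \<in> borel_measurable M" unfolding Z_def using Y by (intro borel_measurable_times measurable_compose[OF Y] borel_measurable_indicator) auto
  have pw: "\<bar>y\<bar> ^ k \<le> 1 + y ^ 16" if "k \<le> 16" for y :: real and k
  proof (cases "\<bar>y\<bar> \<le> 1")
    case True then show ?thesis by (smt (verit) abs_ge_zero power_le_one zero_le_even_power even_numeral)
  next
    case False
    then have "\<bar>y\<bar> ^ k \<le> \<bar>y\<bar> ^ 16" using that by (intro power_increasing) auto
    then show ?thesis by (simp add: power_even_abs)
  qed
  have intY: "integrable M Y"
    by (rule Bochner_Integration.integrable_bound[of M "\<lambda>x. 1 + Y x ^ 16"]) (use int Y pw[of 1] in auto)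
  have intY2: "integrable M (\<lambda>x. (Y x)\<^sup>2)"
    by (rule Bochner_Integration.integrable_bound[of M "\<lambda>x. 1 + Y x ^ 16"]) (use int Y pw[of 2] in auto)
  have Zle: "\<bar>Z x\<bar> \<le> \<bar>Y x\<bar>" "(Z x)\<^sup>2 \<le> (Y x)\<^sup>2" for x by (auto simp: Z_def indicator_def)
  have intZ: "integrable M Z"
    by (rule Bochner_Integration.integrable_bound[OF intY]) (use Zm Zle in auto)
  have intZ2: "integrable M (\<lambda>x. (Z x)\<^sup>2)"
    by (rule Bochner_Integration.integrable_bound[OF intY2]) (use Zm Zle in auto)
  have "expectation (\<lambda>x. (Z x)\<^sup>2) \<le> expectation (\<lambda>x. 1 + Y x ^ 16)"
    using pw[of 2] int intZ2 by (intro integral_mono) (auto simp: Z_def indicator_def)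
  then have Z2: "expectation (\<lambda>x. (Z x)\<^sup>2) \<le> 1 + K" using int K by (simp add: prob_space)
  have "expectation Z - expectation Y = expectation (\<lambda>x. Z x - Y x)" using intZ intY by simp
  also have "\<dots> \<le> expectation (\<lambda>x. Y x ^ 16 * (1 / B ^ 15))"
  proof (rule integral_mono)
    fix x assume "x \<in> space M"
    show "Z x - Y x \<le> Y x ^ 16 * (1 / B ^ 15)"
    proof (cases "\<bar>Y x\<bar> \<le> B")
      case True
      then show ?thesis using th by (simp add: Z_def)
    next
      case False
      then have "\<bar>Y x\<bar> * B ^ 15 \<le> \<bar>Y x\<bar> * \<bar>Y x\<bar> ^ 15" using th by (intro mult_left_mono power_mono) auto
      also have "\<dots> = Y x ^ 16" by (simp flip: power_Suc add: power_even_abs)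
      finally have "\<bar>Y x\<bar> \<le> Y x ^ 16 * (1 / B ^ 15)" using th by (simp add: field_simps)
      then show ?thesis using False by (simp add: Z_def)
    qed
  qed (use intZ intY int in auto)
  also have "\<dots> \<le> K * \<theta>"
  proof -
    have "1 / B ^ 15 \<le> \<theta>" using th by (simp add: field_simps)
    moreover have E0: "0 \<le> expectation (\<lambda>x. Y x ^ 16)" by simp
    moreover have "0 \<le> K" using E0 K by linarith
    ultimately have "expectation (\<lambda>x. Y x ^ 16) * (1 / B ^ 15) \<le> K * \<theta>" using K th by (intro mult_mono) auto
    then show ?thesis by simp
  qed
  finally have bias: "expectation Z - expectation Y \<le> K * \<theta>" .
  have "(\<integral>\<^sup>+x. ennreal (exp (\<theta> * (Z x - expectation Y))) \<partial>M)
    \<le> (\<integral>\<^sup>+x. ennreal (exp (- \<theta> * expectation Y) * (1 + \<theta> * Z x + \<theta>\<^sup>2 * (Z x)\<^sup>2)) \<partial>M)"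
  proof (intro nn_integral_mono ennreal_leI)
    fix x
    have "\<bar>\<theta> * Z x\<bar> \<le> \<theta> * B" using th by (auto simp: Z_def indicator_def abs_mult)
    then have "exp (\<theta> * Z x) \<le> 1 + \<theta> * Z x + (\<theta> * Z x)\<^sup>2" using th by (intro exp_le_quadratic) auto
    then have "exp (- \<theta> * expectation Y) * exp (\<theta> * Z x) \<le> exp (- \<theta> * expectation Y) * (1 + \<theta> * Z x + \<theta>\<^sup>2 * (Z x)\<^sup>2)"
      by (intro mult_left_mono) (auto simp: power_mult_distrib)
    then show "exp (\<theta> * (Z x - expectation Y)) \<le> exp (- \<theta> * expectation Y) * (1 + \<theta> * Z x + \<theta>\<^sup>2 * (Z x)\<^sup>2)"
      by (simp add: exp_add[symmetric] algebra_simps)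
  qed
  also have "\<dots> = ennreal (expectation (\<lambda>x. exp (- \<theta> * expectation Y) * (1 + \<theta> * Z x + \<theta>\<^sup>2 * (Z x)\<^sup>2)))"
  proof (rule nn_integral_eq_integral)
    have "0 \<le> 1 + y + y\<^sup>2" for y :: real
      using sum_squares_ge_zero[of "1 + y" 1] by (sos)
    then show "AE x in M. 0 \<le> exp (- \<theta> * expectation Y) * (1 + \<theta> * Z x + \<theta>\<^sup>2 * (Z x)\<^sup>2)"
      by (simp flip: power_mult_distrib)
  qed (use intZ intZ2 in auto)
  also have "\<dots> = ennreal (exp (- \<theta> * expectation Y) * (1 + (\<theta> * expectation Z + \<theta>\<^sup>2 * expectation (\<lambda>x. (Z x)\<^sup>2))))"
    using intZ intZ2 by (simp add: prob_space add.assoc)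
  also have "\<dots> \<le> ennreal (exp (- \<theta> * expectation Y) * exp (\<theta> * expectation Z + \<theta>\<^sup>2 * expectation (\<lambda>x. (Z x)\<^sup>2)))"
    by (intro ennreal_leI mult_left_mono exp_ge_add_one_self) auto
  also have "\<dots> \<le> ennreal (exp (\<theta>\<^sup>2 * (1 + 2 * K)))"
  proof (intro ennreal_leI)
    have "\<theta> * (expectation Z - expectation Y) \<le> \<theta> * (K * \<theta>)" using bias th by (intro mult_left_mono) auto
    moreover have "\<theta>\<^sup>2 * expectation (\<lambda>x. (Z x)\<^sup>2) \<le> \<theta>\<^sup>2 * (1 + K)" using Z2 by (intro mult_left_mono) auto
    ultimately show "exp (- \<theta> * expectation Y) * exp (\<theta> * expectation Z + \<theta>\<^sup>2 * expectation (\<lambda>x. (Z x)\<^sup>2)) \<le> exp (\<theta>\<^sup>2 * (1 + 2 * K))"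
      by (simp add: exp_add[symmetric] algebra_simps power2_eq_square)
  qed
  finally show ?thesis by (simp add: Z_def)
qed

lemma iid_deviation_upper:
  assumes Y: "Y \<in> borel_measurable M" and int: "integrable M (\<lambda>x. Y x ^ 16)" and K: "expectation (\<lambda>x. Y x ^ 16) \<le> K"
    and I: "finite I" "card I = n" and n: "3 \<le> n"
  shows "measure (Pi\<^sub>M I (\<lambda>_. M)) {x \<in> space (Pi\<^sub>M I (\<lambda>_. M)).
    (4 + 2 * K) * sqrt (ln n / n) < (\<Sum>i\<in>I. Y (x i)) / n - expectation Y} \<le> (1 + K) / real n ^ 3"
proof -
  interpret PP: product_prob_space "\<lambda>_. M" by (rule product_prob_spaceI) unfold_locales
  have fm: "finite_measure (Pi\<^sub>M I (\<lambda>_. M))"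
    by (rule prob_space.finite_measure) (intro prob_space_PiM prob_space_axioms)
  let ?P = "Pi\<^sub>M I (\<lambda>_. M)"
  txt \<open>Truncating at \<open>n\<^sup>1\<^sup>/\<^sup>4\<close> keeps \<open>\<theta> * B \<le> 1\<close>, while sixteen moments bound the probability that
    one summand is cut off by \<open>K / n\<^sup>4\<close>.\<close>
  define B where "B = real n powr (1/4)"
  define \<theta> where "\<theta> = sqrt (ln n / n)"
  have n0: "0 < real n" using n by simp
  have ln1: "1 \<le> ln (real n)"
  proof -
    have "exp 1 \<le> real n" using exp_le n by simp
    then show ?thesis using n0 by (simp add: ln_ge_iff)
  qed
  have B4: "B ^ 4 = n" using n0 by (simp add: B_def powr_power)
  have B1: "1 \<le> B" using n by (simp add: B_def ge_one_powr_ge_zero)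
  have lnn: "0 < ln (real n) / real n" using ln1 n0 by (intro divide_pos_pos) linarith+
  then have th: "0 < \<theta>" by (simp add: \<theta>_def)
  have th2: "\<theta>\<^sup>2 = ln n / n" using lnn unfolding \<theta>_def by simp
  have "\<theta> * B \<le> 1"
  proof (rule power2_le_imp_le)
    have B2: "B\<^sup>2 = sqrt n" using B4 B1 by (intro real_sqrt_unique[symmetric]) (simp_all flip: power_mult)
    have "ln n * sqrt n \<le> sqrt n * sqrt n" using ln_le_sqrt[of "real n"] n by (intro mult_right_mono) auto
    then show "(\<theta> * B)\<^sup>2 \<le> 1\<^sup>2" using n0 by (simp add: power_mult_distrib th2 B2 field_simps)
  qed simp
  moreover have "1 \<le> \<theta> * B ^ 15"
  proof -
    have "1 / sqrt n \<le> \<theta>" unfolding \<theta>_def real_sqrt_divide using ln1 n0 by (intro divide_right_mono) auto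
    moreover have "sqrt n = B\<^sup>2" using B4 B1 by (intro real_sqrt_unique) (simp_all flip: power_mult)
    ultimately have "1 \<le> \<theta> * B\<^sup>2" using B1 by (simp add: field_simps)
    also have "\<dots> \<le> \<theta> * B ^ 15" using B1 th by (intro mult_left_mono power_increasing) auto
    finally show ?thesis .
  qed
  ultimately have mgf: "(\<integral>\<^sup>+x. ennreal (exp (\<theta> * (Y x * indicator {y. \<bar>y\<bar> \<le> B} (Y x) - expectation Y))) \<partial>M) \<le> ennreal (exp (\<theta>\<^sup>2 * (1 + 2 * K)))"
    using th B1 by (intro truncated_mgf[OF Y int K]) auto
  define g where "g x = Y x * indicator {y. \<bar>y\<bar> \<le> B} (Y x) - expectation Y" for x
  have gm: "g \<in> borel_measurable M" unfolding g_def
    by (intro borel_measurable_diff borel_measurable_times Y measurable_compose[OF Y] borel_measurable_indicator) auto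
  \<comment> \<open>The constant \<open>4 + 2 * K\<close> exceeds the \<open>1 + 2 * K\<close> of
    the exponential moment by 3, so that the Chernoff exponent is
    \<open>- 3 * n * \<theta>\<^sup>2\<close>, which is \<open>- 3 * ln n\<close>.\<close>
  define s where "s = real n * ((4 + 2 * K) * \<theta>)"
  define D where "D = {x \<in> space ?P. s \<le> (\<Sum>i\<in>I. g (x i))}"
  define F where "F i = {x \<in> space ?P. B < \<bar>Y (x i)\<bar>}" for i
  have "measure ?P D \<le> exp ((\<Sum>i\<in>I. \<theta>\<^sup>2 * (1 + 2 * K)) - \<theta> * s)"
    unfolding D_def using mgf th gm I prob_space_axioms by (intro chernoff_PiM) (auto simp: g_def[abs_def])
  also have "(\<Sum>i\<in>I. \<theta>\<^sup>2 * (1 + 2 * K)) - \<theta> * s = - 3 * (real n * \<theta>\<^sup>2)"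
    using I by (simp add: s_def power2_eq_square algebra_simps)
  also have "exp \<dots> = 1 / real n ^ 3"
  proof -
    have "exp (- 3 * (real n * \<theta>\<^sup>2)) = exp (- (3 * ln n))" using n0 by (simp add: th2)
    also have "\<dots> = 1 / exp (of_nat 3 * ln n)" by (simp add: exp_minus inverse_eq_divide)
    also have "exp (of_nat 3 * ln (real n)) = real n ^ 3" using n0 by (subst exp_of_nat_mult) simp
    finally show ?thesis .
  qed
  finally have D: "measure ?P D \<le> 1 / real n ^ 3" .
  have gmI: "(\<lambda>x. g (x i)) \<in> borel_measurable ?P" if "i \<in> I" for i using gm that by measurable
  have YmI: "(\<lambda>x. Y (x i)) \<in> borel_measurable ?P" if "i \<in> I" for i using Y that by measurable
  have DM: "D \<in> sets ?P" unfolding D_def using gmI by measurable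
  have FM: "F i \<in> sets ?P" if "i \<in> I" for i unfolding F_def using YmI[OF that] by measurable
  have Fb: "measure ?P (F i) \<le> K / real n ^ 4" if i: "i \<in> I" for i
  proof -
    have "measure ?P (F i) = measure M {y \<in> space M. B < \<bar>Y y\<bar>}"
    proof -
      have "measure M {y \<in> space M. B < \<bar>Y y\<bar>} = measure (distr ?P M (\<lambda>x. x i)) {y \<in> space M. B < \<bar>Y y\<bar>}"
        using PP.PiM_component[OF i] by simp
      also have "\<dots> = measure ?P (F i)"
        using i Y by (subst measure_distr) (auto simp: F_def space_PiM intro!: arg_cong[where f = "measure _"])
      finally show ?thesis by simp
    qed
    also have "{y \<in> space M. B < \<bar>Y y\<bar>} \<subseteq> {y \<in> space M. B ^ 16 \<le> Y y ^ 16}"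
    proof safe
      fix y assume "B < \<bar>Y y\<bar>"
      then have "B ^ 16 \<le> \<bar>Y y\<bar> ^ 16" using B1 by (intro power_mono) auto
      then show "B ^ 16 \<le> Y y ^ 16" by (simp add: power_even_abs)
    qed
    then have "measure M {y \<in> space M. B < \<bar>Y y\<bar>} \<le> measure M {y \<in> space M. B ^ 16 \<le> Y y ^ 16}"
      using Y by (intro finite_measure_mono) auto
    also have "\<dots> \<le> expectation (\<lambda>x. Y x ^ 16) / B ^ 16"
      using int B1 by (intro integral_Markov_inequality_measure[where A = "{}"]) auto
    also have "\<dots> \<le> K / B ^ 16" using K B1 by (intro divide_right_mono) auto
    also have "B ^ 16 = real n ^ 4" unfolding B4[symmetric] by (simp flip: power_mult)
    finally show ?thesis .
  qed
  \<comment> \<open>Outside every \<open>F i\<close> nothing is cut off, so \<open>g\<close>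
    coincides with the centred summand and a deviation of the mean is one of the truncated sum. The
    \<open>n\<close> events \<open>F i\<close> together cost \<open>K / n ^ 3\<close>.\<close>
  have "{x \<in> space ?P. (4 + 2 * K) * sqrt (ln n / n) < (\<Sum>i\<in>I. Y (x i)) / n - expectation Y} \<subseteq> D \<union> (\<Union>i\<in>I. F i)"
  proof safe
    fix x assume x: "x \<in> space ?P" and dev: "(4 + 2 * K) * sqrt (ln n / n) < (\<Sum>i\<in>I. Y (x i)) / n - expectation Y"
      and nF: "x \<notin> (\<Union>i\<in>I. F i)"
    have "(\<Sum>i\<in>I. g (x i)) = (\<Sum>i\<in>I. Y (x i) - expectation Y)"
      using nF x by (intro sum.cong) (auto simp: g_def F_def)
    also have "\<dots> = n * ((\<Sum>i\<in>I. Y (x i)) / n - expectation Y)"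
      using I n0 by (simp add: sum_subtractf right_diff_distrib)
    also have "\<dots> \<ge> s" unfolding s_def using dev n0 by (intro mult_left_mono) (auto simp: \<theta>_def)
    finally show "x \<in> D" using x by (simp add: D_def)
  qed
  then have "measure ?P {x \<in> space ?P. (4 + 2 * K) * sqrt (ln n / n) < (\<Sum>i\<in>I. Y (x i)) / n - expectation Y} \<le> measure ?P (D \<union> (\<Union>i\<in>I. F i))"
    using DM FM I by (intro finite_measure.finite_measure_mono[OF fm]) auto
  also have "\<dots> \<le> measure ?P D + measure ?P (\<Union>i\<in>I. F i)" using DM FM I by (intro measure_Un_le) auto
  also have "measure ?P (\<Union>i\<in>I. F i) \<le> (\<Sum>i\<in>I. measure ?P (F i))" using FM I by (intro finite_measure.finite_measure_subadditive_finite[OF fm]) auto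
  also have "\<dots> \<le> (\<Sum>i\<in>I. K / real n ^ 4)" using Fb by (intro sum_mono) auto
  also have "\<dots> = K / real n ^ 3" using I n0 by (simp add: power_def numeral_eq_Suc)
  finally show ?thesis using D by (simp add: add_divide_distrib)
qed

lemma iid_deviation:
  assumes Y: "Y \<in> borel_measurable M" and int: "integrable M (\<lambda>x. Y x ^ 16)" and K: "expectation (\<lambda>x. Y x ^ 16) \<le> K"
    and I: "finite I" "card I = n" and n: "3 \<le> n"
  shows "measure (Pi\<^sub>M I (\<lambda>_. M)) {x \<in> space (Pi\<^sub>M I (\<lambda>_. M)).
    (4 + 2 * K) * sqrt (ln n / n) < \<bar>(\<Sum>i\<in>I. Y (x i)) / n - expectation Y\<bar>} \<le> 2 * (1 + K) / real n ^ 3"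
proof -
  interpret PP: product_prob_space "\<lambda>_. M" by (rule product_prob_spaceI) unfold_locales
  have fm: "finite_measure (Pi\<^sub>M I (\<lambda>_. M))"
    by (rule prob_space.finite_measure) (intro prob_space_PiM prob_space_axioms)
  let ?P = "Pi\<^sub>M I (\<lambda>_. M)"
  define A where "A Z = {x \<in> space ?P. (4 + 2 * K) * sqrt (ln n / n) < (\<Sum>i\<in>I. Z (x i)) / n - expectation Z}" for Z
  have AM: "A Z \<in> sets ?P" if Z: "Z \<in> borel_measurable M" for Z
  proof -
    have "(\<lambda>x. Z (x i)) \<in> borel_measurable ?P" if "i \<in> I" for i using Z that by measurable
    then show ?thesis unfolding A_def by measurable
  qed
  have "{x \<in> space ?P. (4 + 2 * K) * sqrt (ln n / n) < \<bar>(\<Sum>i\<in>I. Y (x i)) / n - expectation Y\<bar>} = A Y \<union> A (\<lambda>x. - Y x)"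
    by (auto simp: A_def sum_negf abs_if split: if_splits)
  then have "measure ?P {x \<in> space ?P. (4 + 2 * K) * sqrt (ln n / n) < \<bar>(\<Sum>i\<in>I. Y (x i)) / n - expectation Y\<bar>} \<le> measure ?P (A Y) + measure ?P (A (\<lambda>x. - Y x))"
    using AM Y by (auto intro!: measure_Un_le)
  also have "measure ?P (A Y) \<le> (1 + K) / real n ^ 3"
    unfolding A_def by (rule iid_deviation_upper[OF Y int K I n])
  also have "measure ?P (A (\<lambda>x. - Y x)) \<le> (1 + K) / real n ^ 3"
    unfolding A_def using Y int K by (intro iid_deviation_upper[OF _ _ _ I n]) auto
  finally show ?thesis by simp
qed

end

section \<open>Gaussian moments and deviations; exponential tilting shifts the mean\<close>

lemma normal_density_tilt:
  "exp (\<theta> * (t - m)) * normal_density m 1 t = exp (\<theta>\<^sup>2 / 2) * normal_density (m + \<theta>) 1 t"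
proof -
  have "exp (\<theta> * (t - m)) * exp (- (t - m)\<^sup>2 / 2) = exp (\<theta>\<^sup>2 / 2) * exp (- (t - (m + \<theta>))\<^sup>2 / 2)"
    unfolding exp_add[symmetric] by (intro arg_cong[where f = exp]) (simp add: power2_eq_square field_simps)
  then show ?thesis by (simp add: normal_density_def field_simps)
qed

lemma normal_mgf:
  "(\<integral>\<^sup>+t. ennreal (exp (\<theta> * (t - m))) \<partial>density lborel (\<lambda>t. ennreal (normal_density m 1 t))) = ennreal (exp (\<theta>\<^sup>2 / 2))"
proof -
  have "(\<integral>\<^sup>+t. ennreal (exp (\<theta> * (t - m))) \<partial>density lborel (\<lambda>t. ennreal (normal_density m 1 t)))
    = (\<integral>\<^sup>+t. ennreal (normal_density m 1 t) * ennreal (exp (\<theta> * (t - m))) \<partial>lborel)"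
    by (intro nn_integral_density) auto
  also have "\<dots> = (\<integral>\<^sup>+t. ennreal (exp (\<theta>\<^sup>2 / 2)) * ennreal (normal_density (m + \<theta>) 1 t) \<partial>lborel)"
    by (intro nn_integral_cong) (metis ennreal_mult normal_density_tilt normal_density_nonneg exp_ge_zero mult.commute)
  also have "\<dots> = ennreal (exp (\<theta>\<^sup>2 / 2)) * (\<integral>\<^sup>+t. ennreal (normal_density (m + \<theta>) 1 t) \<partial>lborel)"
    by (intro nn_integral_cmult) auto
  also have "(\<integral>\<^sup>+t. ennreal (normal_density (m + \<theta>) 1 t) \<partial>lborel) = 1"
    using prob_space.emeasure_space_1[OF prob_space_normal_density[of 1 "m + \<theta>"]] by (simp add: emeasure_density)
  finally show ?thesis by simp
qed

lemma power_le_fact_exp: "y ^ n \<le> fact n * exp y" if "0 \<le> y" for y :: real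
proof -
  have "y ^ n /\<^sub>R fact n \<le> exp y"
    using sum_le_suminf[OF summable_exp_generic[of y], of "{n}"] that by (simp add: exp_def)
  then show ?thesis by (simp add: field_simps)
qed

lemma even_power_le_exp: "y ^ n \<le> fact n * (exp y + exp (- y))" if "even n" for y :: real
proof -
  have "y ^ n = \<bar>y\<bar> ^ n" using that by (simp add: power_even_abs)
  also have "\<dots> \<le> fact n * exp \<bar>y\<bar>" by (rule power_le_fact_exp) simp
  also have "\<dots> \<le> fact n * (exp y + exp (- y))" by (intro mult_left_mono) (auto simp: abs_if)
  finally show ?thesis .
qed

lemma prob_space_std_gauss: "prob_space std_gauss"
  unfolding std_gauss_def by (rule prob_space_normal_density) simp

lemma sets_std_gauss [measurable_cong, simp]: "sets std_gauss = sets borel"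
  by (simp add: std_gauss_def)

lemma space_std_gauss [simp]: "space std_gauss = UNIV"
  by (simp add: std_gauss_def)

abbreviation gauss_prod :: "nat \<Rightarrow> (nat \<Rightarrow> real) measure" where
  "gauss_prod d \<equiv> Pi\<^sub>M {..<d} (\<lambda>_. std_gauss)"

lemma prob_space_gauss_prod: "prob_space (gauss_prod d)"
  by (intro prob_space_PiM prob_space_std_gauss)

lemma gauss_linear_measurable [measurable]: "(\<lambda>g. \<Sum>j<d. a j * g j) \<in> borel_measurable (gauss_prod d)"
  by measurable

lemma gauss_linear_mgf:
  "(\<integral>\<^sup>+g. ennreal (exp (\<Sum>j<d. a j * g j)) \<partial>gauss_prod d) = ennreal (exp ((\<Sum>j<d. (a j)\<^sup>2) / 2))"
proof -
  interpret product_prob_space "\<lambda>_::nat. std_gauss" by (rule product_prob_spaceI[OF prob_space_std_gauss])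
  have "(\<integral>\<^sup>+g. ennreal (exp (\<Sum>j<d. a j * g j)) \<partial>gauss_prod d) = (\<integral>\<^sup>+g. (\<Prod>j<d. ennreal (exp (a j * g j))) \<partial>gauss_prod d)"
    by (simp add: exp_sum prod_ennreal)
  also have "\<dots> = (\<Prod>j<d. \<integral>\<^sup>+t. ennreal (exp (a j * t)) \<partial>std_gauss)"
    by (intro product_nn_integral_prod) auto
  also have "\<dots> = (\<Prod>j<d. ennreal (exp ((a j)\<^sup>2 / 2)))"
    using normal_mgf[where m = 0] by (simp add: std_gauss_def)
  finally show ?thesis by (simp add: prod_ennreal exp_sum[symmetric] sum_divide_distrib)
qed

text \<open>An even power is dominated by the exponentials of the form and of its negative, whose
  integrals are explicit. Only the Euclidean norm of the coefficients enters, so the bound is free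
  of the dimension.\<close>

lemma gauss_linear_moment:
  assumes a: "(\<Sum>j<d. (a j)\<^sup>2) \<le> 1" and n: "even n"
  shows "integrable (gauss_prod d) (\<lambda>g. (\<Sum>j<d. a j * g j) ^ n)"
    and "(\<integral>g. (\<Sum>j<d. a j * g j) ^ n \<partial>gauss_prod d) \<le> 2 * fact n * exp (1 / 2)"
proof -
  have "(\<integral>\<^sup>+g. ennreal ((\<Sum>j<d. a j * g j) ^ n) \<partial>gauss_prod d)
    \<le> (\<integral>\<^sup>+g. ennreal (fact n) * (ennreal (exp (\<Sum>j<d. a j * g j)) + ennreal (exp (\<Sum>j<d. (- a j) * g j))) \<partial>gauss_prod d)"
  proof (rule nn_integral_mono)
    fix g :: "nat \<Rightarrow> real"
    have "(\<Sum>j<d. a j * g j) ^ n \<le> fact n * (exp (\<Sum>j<d. a j * g j) + exp (\<Sum>j<d. (- a j) * g j))"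
      using even_power_le_exp[OF n, of "\<Sum>j<d. a j * g j"] by (simp add: sum_negf)
    from ennreal_leI[OF this] show "ennreal ((\<Sum>j<d. a j * g j) ^ n)
      \<le> ennreal (fact n) * (ennreal (exp (\<Sum>j<d. a j * g j)) + ennreal (exp (\<Sum>j<d. (- a j) * g j)))"
      by (simp add: ennreal_mult ennreal_plus)
  qed
  also have "\<dots> = ennreal (fact n) * (ennreal (exp ((\<Sum>j<d. (a j)\<^sup>2) / 2)) + ennreal (exp ((\<Sum>j<d. (- a j)\<^sup>2) / 2)))"
    unfolding gauss_linear_mgf[symmetric]
    by (subst nn_integral_cmult, measurable, subst nn_integral_add, measurable)
  also have "\<dots> = ennreal (fact n * (exp ((\<Sum>j<d. (a j)\<^sup>2) / 2) + exp ((\<Sum>j<d. (- a j)\<^sup>2) / 2)))"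
    by (simp only: ennreal_mult' ennreal_plus exp_ge_zero fact_ge_zero)
  also have "\<dots> \<le> ennreal (2 * fact n * exp (1 / 2))"
    using a by (intro ennreal_leI) simp
  finally have *: "(\<integral>\<^sup>+g. ennreal ((\<Sum>j<d. a j * g j) ^ n) \<partial>gauss_prod d) \<le> ennreal (2 * fact n * exp (1 / 2))" .
  have nn: "0 \<le> (\<Sum>j<d. a j * g j) ^ n" for g using n by (simp add: zero_le_even_power)
  show int: "integrable (gauss_prod d) (\<lambda>g. (\<Sum>j<d. a j * g j) ^ n)"
    using * nn by (intro integrableI_nonneg) (auto simp: le_less_trans[OF _ ennreal_less_top])
  show "(\<integral>g. (\<Sum>j<d. a j * g j) ^ n \<partial>gauss_prod d) \<le> 2 * fact n * exp (1 / 2)"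
    using * nn_integral_eq_integral[OF int] nn by (auto simp: ennreal_le_iff)
qed

lemma std_gauss_moments:
  "integrable std_gauss (\<lambda>t. t)" "(\<integral>t. t \<partial>std_gauss) = 0"
  "integrable std_gauss (\<lambda>t. t * t)" "(\<integral>t. t * t \<partial>std_gauss) = 1"
  using integrable_normal_moment[of 1 0 1] integral_normal_moment_odd[of 1 0 0]
    integrable_normal_moment[of 1 0 2] integral_normal_moment_even[of 1 0 1]
  by (simp_all add: std_gauss_def integrable_density integral_density power2_eq_square)

lemma gauss_prod_cov:
  assumes ij: "i < d" "j < d"
  shows "integrable (gauss_prod d) (\<lambda>g. g i * g j)" "(\<integral>g. g i * g j \<partial>gauss_prod d) = of_bool (i = j)"
proof -
  interpret product_prob_space "\<lambda>_::nat. std_gauss" by (rule product_prob_spaceI[OF prob_space_std_gauss])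
  \<comment> \<open>Writes the product of two coordinates as a full product over all coordinates, to
    which the product integral formula applies. For \<open>i = j\<close> both factors sit at the
    same coordinate and give the square.\<close>
  define f where "f k t = (if k = i then t else 1) * (if k = j then t else (1::real))" for k t
  have g: "g i * g j = (\<Prod>k<d. f k (g k))" for g
  proof -
    have "(\<Prod>k<d. f k (g k)) = (\<Prod>k<d. if k = i then g k else 1) * (\<Prod>k<d. if k = j then g k else 1)"
      unfolding f_def prod.distrib[symmetric] by (intro prod.cong) auto
    then show ?thesis using ij by simp
  qed
  have int: "integrable std_gauss (f k)" for k
    using std_gauss_moments prob_space.finite_measure[OF prob_space_std_gauss]
    by (cases "k = i"; cases "k = j") (auto simp: f_def[abs_def] finite_measure.integrable_const)
  show "integrable (gauss_prod d) (\<lambda>g. g i * g j)"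
    unfolding g by (rule product_integrable_prod) (use int in auto)
  have "(\<integral>g. g i * g j \<partial>gauss_prod d) = (\<Prod>k<d. integral\<^sup>L std_gauss (f k))"
    unfolding g by (rule product_integral_prod) (use int in auto)
  also have "\<dots> = of_bool (i = j)"
  proof (cases "i = j")
    case True
    have "integral\<^sup>L std_gauss (f k) = 1" for k
      using std_gauss_moments prob_space.prob_space[OF prob_space_std_gauss] True by (cases "k = i") (auto simp: f_def[abs_def])
    then show ?thesis using True by simp
  next
    case False
    then have "integral\<^sup>L std_gauss (f i) = 0" using std_gauss_moments by (simp add: f_def[abs_def])
    then show ?thesis using False ij by (auto intro!: prod_zero)
  qed
  finally show "(\<integral>g. g i * g j \<partial>gauss_prod d) = of_bool (i = j)" .
qed

lemma gauss_bilinear: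
  shows "(\<integral>g. (\<Sum>j<d. a j * g j) * (\<Sum>j<d. b j * g j) \<partial>gauss_prod d) = (\<Sum>j<d. a j * b j)"
proof -
  have "(\<integral>g. (\<Sum>j<d. a j * g j) * (\<Sum>j<d. b j * g j) \<partial>gauss_prod d)
    = (\<integral>g. (\<Sum>i<d. \<Sum>j<d. (a i * b j) * (g i * g j)) \<partial>gauss_prod d)"
    by (simp add: sum_product mult_ac)
  also have "\<dots> = (\<Sum>i<d. \<integral>g. (\<Sum>j<d. (a i * b j) * (g i * g j)) \<partial>gauss_prod d)"
    by (intro Bochner_Integration.integral_sum Bochner_Integration.integrable_sum integrable_mult_right gauss_prod_cov) auto
  also have "\<dots> = (\<Sum>i<d. \<Sum>j<d. \<integral>g. (a i * b j) * (g i * g j) \<partial>gauss_prod d)"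
    by (intro sum.cong refl Bochner_Integration.integral_sum integrable_mult_right gauss_prod_cov) auto
  also have "\<dots> = (\<Sum>i<d. \<Sum>j<d. (a i * b j) * of_bool (i = j))"
    by (intro sum.cong refl) (simp add: gauss_prod_cov)
  also have "\<dots> = (\<Sum>j<d. a j * b j)" by (simp add: of_bool_def if_distrib cong: if_cong)
  finally show ?thesis .
qed

text \<open>Two moments of order 32, each at most \<open>2 * fact 32 * exp (1 / 2)\<close>; they
  dominate the sixteenth moment of a product of two normalised linear forms.\<close>

definition gauss_const :: real where "gauss_const = 4 * fact 32 * exp (1 / 2)"

text \<open>Dividing the forms by \<open>\<alpha>\<close> and \<open>\<beta>\<close>, which bound
  their coefficient norms, reduces to a universal moment bound. Scaling back puts
  \<open>\<alpha> * \<beta>\<close> in front of the deviation and leaves the probability free of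
  both.\<close>

lemma gauss_sample_deviation:
  assumes a: "(\<Sum>j<d. (a j)\<^sup>2) \<le> \<alpha>\<^sup>2" "0 < \<alpha>" and b: "(\<Sum>j<d. (b j)\<^sup>2) \<le> \<beta>\<^sup>2" "0 < \<beta>"
    and I: "finite I" "card I = n" and n: "3 \<le> n"
  shows "measure (Pi\<^sub>M I (\<lambda>_. gauss_prod d)) {x \<in> space (Pi\<^sub>M I (\<lambda>_. gauss_prod d)).
    \<alpha> * \<beta> * (4 + 2 * gauss_const) * sqrt (ln n / n) < \<bar>(\<Sum>i\<in>I. (\<Sum>j<d. a j * x i j) * (\<Sum>j<d. b j * x i j)) / n - (\<Sum>j<d. a j * b j)\<bar>}
    \<le> 2 * (1 + gauss_const) / real n ^ 3"
proof -
  interpret prob_space "gauss_prod d" by (rule prob_space_gauss_prod)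
  define a' where "a' j = a j / \<alpha>" for j
  define b' where "b' j = b j / \<beta>" for j
  have a': "(\<Sum>j<d. (a' j)\<^sup>2) \<le> 1" using a by (simp add: a'_def power_divide sum_divide_distrib[symmetric])
  have b': "(\<Sum>j<d. (b' j)\<^sup>2) \<le> 1" using b by (simp add: b'_def power_divide sum_divide_distrib[symmetric])
  define Y where "Y g = (\<Sum>j<d. a' j * g j) * (\<Sum>j<d. b' j * g j)" for g :: "nat \<Rightarrow> real"
  have Y: "Y \<in> borel_measurable (gauss_prod d)" unfolding Y_def by measurable
  have le: "Y g ^ 16 \<le> (\<Sum>j<d. a' j * g j) ^ 32 + (\<Sum>j<d. b' j * g j) ^ 32" for g
  proof -
    define s t where "s = (\<Sum>j<d. a' j * g j) ^ 16" and "t = (\<Sum>j<d. b' j * g j) ^ 16"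
    have "2 * (s * t) \<le> s\<^sup>2 + t\<^sup>2" using sum_squares_bound[of s t] by simp
    moreover have "0 \<le> s * t" by (simp add: s_def t_def)
    ultimately have "s * t \<le> s\<^sup>2 + t\<^sup>2" by linarith
    then show ?thesis by (simp add: Y_def s_def t_def power_mult_distrib flip: power_mult)
  qed
  note ma = gauss_linear_moment[OF a', of 32] and mb = gauss_linear_moment[OF b', of 32]
  have int: "integrable (gauss_prod d) (\<lambda>g. Y g ^ 16)"
    by (rule Bochner_Integration.integrable_bound[OF Bochner_Integration.integrable_add[OF ma(1) mb(1)]]) (use Y le in \<open>auto intro: order_trans\<close>)
  have "expectation (\<lambda>g. Y g ^ 16) \<le> expectation (\<lambda>g. (\<Sum>j<d. a' j * g j) ^ 32 + (\<Sum>j<d. b' j * g j) ^ 32)"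
    using int ma(1) mb(1) le by (intro integral_mono) auto
  also have "\<dots> \<le> gauss_const" using ma mb by (simp add: gauss_const_def)
  finally have K: "expectation (\<lambda>g. Y g ^ 16) \<le> gauss_const" .
  have E: "expectation Y = (\<Sum>j<d. a j * b j) / (\<alpha> * \<beta>)"
    unfolding Y_def gauss_bilinear by (simp add: a'_def b'_def sum_divide_distrib)
  have Y': "Y g = (\<Sum>j<d. a j * g j) * (\<Sum>j<d. b j * g j) / (\<alpha> * \<beta>)" for g
    by (simp add: Y_def a'_def b'_def sum_divide_distrib[symmetric])
  have eq: "(4 + 2 * gauss_const) * sqrt (ln n / n) < \<bar>(\<Sum>i\<in>I. Y (x i)) / n - expectation Y\<bar>
    \<longleftrightarrow> \<alpha> * \<beta> * (4 + 2 * gauss_const) * sqrt (ln n / n) < \<bar>(\<Sum>i\<in>I. (\<Sum>j<d. a j * x i j) * (\<Sum>j<d. b j * x i j)) / n - (\<Sum>j<d. a j * b j)\<bar>" for x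
  proof -
    have "(\<Sum>i\<in>I. Y (x i)) / n - expectation Y = ((\<Sum>i\<in>I. (\<Sum>j<d. a j * x i j) * (\<Sum>j<d. b j * x i j)) / n - (\<Sum>j<d. a j * b j)) / (\<alpha> * \<beta>)"
      unfolding E Y' sum_divide_distrib[symmetric] by (simp add: diff_divide_distrib)
    then have "\<bar>(\<Sum>i\<in>I. Y (x i)) / n - expectation Y\<bar> = \<bar>(\<Sum>i\<in>I. (\<Sum>j<d. a j * x i j) * (\<Sum>j<d. b j * x i j)) / n - (\<Sum>j<d. a j * b j)\<bar> / (\<alpha> * \<beta>)"
      using a(2) b(2) by (simp add: abs_divide abs_mult)
    then show ?thesis using a(2) b(2) by (simp only: pos_less_divide_eq mult_pos_pos) (simp add: mult_ac)
  qed
  show ?thesis using iid_deviation[OF Y int K I n] unfolding eq .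
qed

lemma multiplier_deviation:
  assumes V: "(\<Sum>i\<in>I. (y i)\<^sup>2) \<le> n * V" "0 < V" and I: "finite I" and n: "1 \<le> n"
  shows "measure (Pi\<^sub>M I (\<lambda>_. density lborel (\<lambda>t. ennreal (normal_density 1 1 t)))) {\<eta> \<in> space (Pi\<^sub>M I (\<lambda>_. density lborel (\<lambda>t. ennreal (normal_density 1 1 t)))).
    sqrt (6 * V) * sqrt (ln n / n) < \<bar>(\<Sum>i\<in>I. (\<eta> i - 1) * y i) / n\<bar>} \<le> 2 / real n ^ 3"
proof -
  define N where "N = density lborel (\<lambda>t. ennreal (normal_density 1 1 t))"
  have N: "prob_space N" unfolding N_def by (rule prob_space_normal_density) simp
  let ?P = "Pi\<^sub>M I (\<lambda>_. N)"
  have fm: "finite_measure ?P" by (rule prob_space.finite_measure) (intro prob_space_PiM N)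
  have sN: "sets N = sets borel" by (simp add: N_def)
  have n0: "0 < real n" using n by simp
  have lnn: "0 \<le> ln n / n" using n by simp
  define t where "t = sqrt (6 * V) * sqrt (ln n / n)"
  have t0: "0 \<le> t" using V lnn by (simp add: t_def)
  have t2: "n * t\<^sup>2 = 6 * V * ln n" using V lnn n0 by (simp add: t_def power_mult_distrib)
  define A where "A z = {\<eta> \<in> space ?P. n * t \<le> (\<Sum>i\<in>I. (\<eta> i - 1) * z i)}" for z
  have AM: "A z \<in> sets ?P" for z
  proof -
    have "(\<lambda>\<eta>. \<eta> i) \<in> borel_measurable ?P" if "i \<in> I" for i
      using measurable_component_singleton[OF that, of "\<lambda>_. N"] by (simp add: measurable_cong_sets[OF refl sN])
    then show ?thesis unfolding A_def by measurable
  qed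
  have one: "measure ?P (A z) \<le> 1 / real n ^ 3" if z: "(\<Sum>i\<in>I. (z i)\<^sup>2) \<le> n * V" for z
  proof -
    \<comment> \<open>The minimiser of
      \<open>\<theta>\<^sup>2 / 2 * n * V - \<theta> * n * t\<close>, with minimum
      \<open>- n * t\<^sup>2 / (2 * V)\<close>. The factor 6 in \<open>t\<close> makes this
      \<open>- 3 * ln n\<close>.\<close>
    define \<theta> where "\<theta> = t / V"
    have th: "0 \<le> \<theta>" using t0 V by (simp add: \<theta>_def)
    have "measure ?P (A z) \<le> exp ((\<Sum>i\<in>I. (\<theta> * z i)\<^sup>2 / 2) - \<theta> * (n * t))"
      unfolding A_def
    proof (rule chernoff_PiM[OF N I _ th])
      show "(\<integral>\<^sup>+\<eta>. ennreal (exp (\<theta> * ((\<eta> - 1) * z i))) \<partial>N) \<le> ennreal (exp ((\<theta> * z i)\<^sup>2 / 2))" for i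
        using normal_mgf[where \<theta> = "\<theta> * z i" and m = 1] by (simp add: N_def mult_ac)
    qed (simp add: measurable_cong_sets[OF sN refl])
    also have "\<dots> \<le> exp (- (3 * ln n))"
    proof -
      have "(\<Sum>i\<in>I. (\<theta> * z i)\<^sup>2 / 2) = \<theta>\<^sup>2 / 2 * (\<Sum>i\<in>I. (z i)\<^sup>2)" by (simp add: power_mult_distrib sum_distrib_left)
      also have "\<dots> \<le> \<theta>\<^sup>2 / 2 * (n * V)" using z by (intro mult_left_mono) auto
      also have "\<dots> = n * t\<^sup>2 / (2 * V)" using V(2) by (simp add: \<theta>_def power_divide power2_eq_square mult_ac)
      finally have "(\<Sum>i\<in>I. (\<theta> * z i)\<^sup>2 / 2) - \<theta> * (n * t) \<le> n * t\<^sup>2 / (2 * V) - n * t\<^sup>2 / V"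
        by (simp add: \<theta>_def power2_eq_square mult_ac)
      also have "\<dots> = - (3 * ln n)" unfolding t2 using V(2) by (simp add: field_simps)
      finally show ?thesis by simp
    qed
    also have "\<dots> = 1 / exp (of_nat 3 * ln n)" by (simp add: exp_minus inverse_eq_divide)
    also have "exp (of_nat 3 * ln (real n)) = real n ^ 3" using n0 by (subst exp_of_nat_mult) simp
    finally show ?thesis .
  qed
  have "{\<eta> \<in> space ?P. t < \<bar>(\<Sum>i\<in>I. (\<eta> i - 1) * y i) / n\<bar>} \<subseteq> A y \<union> A (\<lambda>i. - y i)"
  proof safe
    fix \<eta> assume \<eta>: "\<eta> \<in> space ?P" "t < \<bar>(\<Sum>i\<in>I. (\<eta> i - 1) * y i) / n\<bar>" "\<eta> \<notin> A (\<lambda>i. - y i)"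
    define S where "S = (\<Sum>i\<in>I. (\<eta> i - 1) * y i)"
    have "n * t < \<bar>S\<bar>" using \<eta>(2) n0 by (simp add: S_def field_simps)
    moreover have "\<not> n * t \<le> - S" using \<eta>(1,3) by (simp add: A_def S_def sum_negf)
    ultimately have "n * t \<le> S" by linarith
    then show "\<eta> \<in> A y" using \<eta>(1) by (simp add: A_def S_def)
  qed
  then have "measure ?P {\<eta> \<in> space ?P. t < \<bar>(\<Sum>i\<in>I. (\<eta> i - 1) * y i) / n\<bar>} \<le> measure ?P (A y \<union> A (\<lambda>i. - y i))"
    using AM by (intro finite_measure.finite_measure_mono[OF fm]) auto
  also have "\<dots> \<le> measure ?P (A y) + measure ?P (A (\<lambda>i. - y i))"
    using AM by (intro measure_Un_le) auto
  also have "\<dots> \<le> 1 / real n ^ 3 + 1 / real n ^ 3" using V by (intro add_mono one) auto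
  finally show ?thesis by (simp add: t_def N_def)
qed

section \<open>Measurability of spectral functions\<close>

text \<open>A function that is Lipschitz in finitely many coordinates is continuous in the product
  topology, hence Borel. The same bound shows that it ignores all other coordinates, so
  \<open>\<phi>\<close> may be replaced by zero there, which makes every coordinate
  measurable.\<close>

lemma lipschitz_entries_measurable:
  fixes h :: "('i::countable \<Rightarrow> real) \<Rightarrow> real" and \<phi> :: "'a \<Rightarrow> 'i \<Rightarrow> real"
  assumes S: "finite S" and L: "\<And>F G. \<bar>h F - h G\<bar> \<le> L * (\<Sum>p\<in>S. \<bar>F p - G p\<bar>)"
    and m: "\<And>p. p \<in> S \<Longrightarrow> (\<lambda>x. \<phi> x p) \<in> borel_measurable N"
  shows "(\<lambda>x. h (\<phi> x)) \<in> borel_measurable N"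
proof -
  have "continuous_on UNIV h"
    unfolding continuous_on_def
  proof
    fix F :: "'i \<Rightarrow> real"
    have "continuous_on UNIV (\<lambda>G :: 'i \<Rightarrow> real. L * (\<Sum>p\<in>S. \<bar>G p - F p\<bar>))"
      by (intro continuous_intros continuous_on_product_coordinates)
    then have "((\<lambda>G. L * (\<Sum>p\<in>S. \<bar>G p - F p\<bar>)) \<longlongrightarrow> L * (\<Sum>p\<in>S. \<bar>F p - F p\<bar>)) (at F within UNIV)"
      unfolding continuous_on_def by blast
    then have lim: "((\<lambda>G. L * (\<Sum>p\<in>S. \<bar>G p - F p\<bar>)) \<longlongrightarrow> 0) (at F within UNIV)" by simp
    have "((\<lambda>G. h G - h F) \<longlongrightarrow> 0) (at F within UNIV)"
      by (rule Lim_null_comparison[OF _ lim]) (use L in auto)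
    then show "(h \<longlongrightarrow> h F) (at F within UNIV)" by (rule LIM_zero_cancel)
  qed
  then have h: "h \<in> borel_measurable borel" by (rule borel_measurable_continuous_onI)
  define \<phi>' where "\<phi>' x p = (if p \<in> S then \<phi> x p else 0)" for x p
  have "\<phi>' \<in> borel_measurable N"
  proof (rule measurable_coordinatewise_then_product)
    fix i show "(\<lambda>x. \<phi>' x i) \<in> borel_measurable N" using m[of i] by (cases "i \<in> S") (auto simp: \<phi>'_def)
  qed
  then have "(\<lambda>x. h (\<phi>' x)) \<in> borel_measurable N" using h by (rule measurable_compose)
  moreover have "h (\<phi>' x) = h (\<phi> x)" for x
    using L[of "\<phi>' x" "\<phi> x"] by (simp add: \<phi>'_def)
  ultimately show ?thesis by simp
qed

text \<open>Entrywise measurability takes the place of a Borel structure on matrices of variable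
  size; the shape is prescribed on the space of \<open>N\<close> only.\<close>

definition mmat :: "'a measure \<Rightarrow> nat \<Rightarrow> ('a \<Rightarrow> real mat) \<Rightarrow> bool" where
  "mmat N d f \<longleftrightarrow> (\<forall>x\<in>space N. f x \<in> carrier_mat d d) \<and> (\<forall>a<d. \<forall>b<d. (\<lambda>x. f x $$ (a, b)) \<in> borel_measurable N)"

lemma mmatD: "mmat N d f \<Longrightarrow> x \<in> space N \<Longrightarrow> f x \<in> carrier_mat d d"
  "mmat N d f \<Longrightarrow> a < d \<Longrightarrow> b < d \<Longrightarrow> (\<lambda>x. f x $$ (a, b)) \<in> borel_measurable N"
  by (auto simp: mmat_def)

lemma mmat_cong:
  assumes "\<And>x. x \<in> space N \<Longrightarrow> f x = g x" "mmat N d f"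
  shows "mmat N d g"
  using assms measurable_cong[of N] by (auto simp: mmat_def cong: measurable_cong)

lemma mmat_lipschitz:
  assumes f: "mmat N d f" and L: "\<And>A B. A \<in> carrier_mat d d \<Longrightarrow> B \<in> carrier_mat d d \<Longrightarrow> \<bar>h A - h B\<bar> \<le> L * (\<Sum>p\<in>{..<d} \<times> {..<d}. \<bar>A $$ p - B $$ p\<bar>)"
  shows "(\<lambda>x. h (f x)) \<in> borel_measurable N"
proof -
  have "(\<lambda>x. h (mat d d (\<lambda>p. f x $$ p))) \<in> borel_measurable N"
  proof (rule lipschitz_entries_measurable[where h = "\<lambda>F. h (mat d d F)" and S = "{..<d} \<times> {..<d}" and L = L])
    fix F G :: "nat \<times> nat \<Rightarrow> real"
    have "(\<Sum>p\<in>{..<d} \<times> {..<d}. \<bar>mat d d F $$ p - mat d d G $$ p\<bar>) = (\<Sum>p\<in>{..<d} \<times> {..<d}. \<bar>F p - G p\<bar>)"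
      by (intro sum.cong) auto
    then show "\<bar>h (mat d d F) - h (mat d d G)\<bar> \<le> L * (\<Sum>p\<in>{..<d} \<times> {..<d}. \<bar>F p - G p\<bar>)"
      using L[of "mat d d F" "mat d d G"] by simp
  qed (use mmatD(2)[OF f] in auto)
  moreover have "mat d d (\<lambda>p. f x $$ p) = f x" if "x \<in> space N" for x
    using mmatD(1)[OF f that] by (intro eq_matI) auto
  ultimately show ?thesis by (simp cong: measurable_cong)
qed

section \<open>Ordered eigenvalues as Lipschitz functions of the entries\<close>

lemma quadratic_form_le_entries:
  fixes E :: "real mat"
  assumes E: "E \<in> carrier_mat d d" and x: "x \<in> carrier_vec d"
  shows "x \<bullet> (E *\<^sub>v x) \<le> (\<Sum>p\<in>{..<d} \<times> {..<d}. \<bar>E $$ p\<bar>) * (x \<bullet> x)"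
proof -
  have xx: "x \<bullet> x = (\<Sum>i<d. (x $ i)\<^sup>2)" using x by (simp add: scalar_prod_def lessThan_atLeast0 power2_eq_square)
  have "x \<bullet> (E *\<^sub>v x) = (\<Sum>i<d. \<Sum>j<d. E $$ (i, j) * (x $ i * x $ j))"
    using E x by (simp add: scalar_prod_def lessThan_atLeast0 sum_distrib_left mult.left_commute)
  also have "\<dots> \<le> (\<Sum>i<d. \<Sum>j<d. \<bar>E $$ (i, j)\<bar> * (x \<bullet> x))"
  proof (intro sum_mono)
    fix i j assume "i \<in> {..<d}" "j \<in> {..<d}"
    then have "(x $ i)\<^sup>2 \<le> x \<bullet> x" "(x $ j)\<^sup>2 \<le> x \<bullet> x" unfolding xx by (auto intro!: member_le_sum)
    moreover have "2 * \<bar>x $ i * x $ j\<bar> \<le> (x $ i)\<^sup>2 + (x $ j)\<^sup>2"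
      using sum_squares_bound[of "\<bar>x $ i\<bar>" "\<bar>x $ j\<bar>"] by (simp add: abs_mult)
    ultimately have "\<bar>x $ i * x $ j\<bar> \<le> x \<bullet> x" by linarith
    then have "\<bar>E $$ (i, j)\<bar> * \<bar>x $ i * x $ j\<bar> \<le> \<bar>E $$ (i, j)\<bar> * (x \<bullet> x)" by (intro mult_left_mono) auto
    then show "E $$ (i, j) * (x $ i * x $ j) \<le> \<bar>E $$ (i, j)\<bar> * (x \<bullet> x)"
      using abs_ge_self[of "E $$ (i, j) * (x $ i * x $ j)"] by (simp add: abs_mult)
  qed
  also have "\<dots> = (\<Sum>p\<in>{..<d} \<times> {..<d}. \<bar>E $$ p\<bar>) * (x \<bullet> x)"
    by (simp add: sum.cartesian_product case_prod_beta sum_distrib_right)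
  finally show ?thesis .
qed

lemma eig_lipschitz:
  assumes A: "A \<in> carrier_mat d d" "A\<^sup>T = A" and B: "B \<in> carrier_mat d d" "B\<^sup>T = B" and k: "k < d"
  shows "\<bar>eig A (Suc k) - eig B (Suc k)\<bar> \<le> (\<Sum>p\<in>{..<d} \<times> {..<d}. \<bar>A $$ p - B $$ p\<bar>)"
proof -
  have one: "eig A (Suc k) \<le> eig B (Suc k) + (\<Sum>p\<in>{..<d} \<times> {..<d}. \<bar>A $$ p - B $$ p\<bar>)"
    if A: "A \<in> carrier_mat d d" "A\<^sup>T = A" and B: "B \<in> carrier_mat d d" "B\<^sup>T = B" for A B :: "real mat"
  proof -
    obtain l v where a: "eigsys d A l v" by (rule symmetric_eigsys[OF A])
    obtain m w where b: "eigsys d B m w" by (rule symmetric_eigsys[OF B])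
    have "l k \<le> m k + (\<Sum>p\<in>{..<d} \<times> {..<d}. \<bar>A $$ p - B $$ p\<bar>)"
    proof (rule eig_perturbation[OF a b _ k])
      fix x :: "real vec" assume x: "x \<in> carrier_vec d"
      have AB: "A - B \<in> carrier_mat d d" using B(1) by (rule minus_carrier_mat)
      have "(A - B) *\<^sub>v x = A *\<^sub>v x - B *\<^sub>v x" using A(1) B(1) x by (rule minus_mult_distrib_mat_vec)
      then have "x \<bullet> ((A - B) *\<^sub>v x) = x \<bullet> (A *\<^sub>v x) - x \<bullet> (B *\<^sub>v x)"
        using A B x by (simp add: scalar_prod_minus_distrib[of _ d])
      moreover have "(\<Sum>p\<in>{..<d} \<times> {..<d}. \<bar>(A - B) $$ p\<bar>) = (\<Sum>p\<in>{..<d} \<times> {..<d}. \<bar>A $$ p - B $$ p\<bar>)"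
        using A B by (intro sum.cong refl) auto
      ultimately show "x \<bullet> (A *\<^sub>v x) \<le> x \<bullet> (B *\<^sub>v x) + (\<Sum>p\<in>{..<d} \<times> {..<d}. \<bar>A $$ p - B $$ p\<bar>) * (x \<bullet> x)"
        using quadratic_form_le_entries[OF AB x] by simp
    qed
    then show ?thesis using eig_Suc[OF a k] eig_Suc[OF b k] by simp
  qed
  have "(\<Sum>p\<in>{..<d} \<times> {..<d}. \<bar>A $$ p - B $$ p\<bar>) = (\<Sum>p\<in>{..<d} \<times> {..<d}. \<bar>B $$ p - A $$ p\<bar>)"
    by (simp add: abs_minus_commute)
  then show ?thesis using one[OF A B] one[OF B A] by linarith
qed

lemma eig_measurable:
  assumes f: "mmat N d f" and s: "\<And>x. x \<in> space N \<Longrightarrow> (f x)\<^sup>T = f x" and k: "k < d"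
  shows "(\<lambda>x. eig (f x) (Suc k)) \<in> borel_measurable N"
proof -
  \<comment> \<open>Eigenvalues are Lipschitz on symmetric matrices only. Symmetrising the argument
    extends the function to all matrices with the same Lipschitz constant and changes nothing at
    symmetric ones.\<close>
  define h where "h A = eig (mat d d (\<lambda>(i, j). (A $$ (i, j) + A $$ (j, i)) / 2)) (Suc k)" for A :: "real mat"
  have "(\<lambda>x. h (f x)) \<in> borel_measurable N"
  proof (rule mmat_lipschitz[OF f, where L = 1])
    fix A B :: "real mat" assume A: "A \<in> carrier_mat d d" and B: "B \<in> carrier_mat d d"
    have "\<bar>h A - h B\<bar> \<le> (\<Sum>p\<in>{..<d} \<times> {..<d}. \<bar>(A $$ p + A $$ (snd p, fst p)) / 2 - (B $$ p + B $$ (snd p, fst p)) / 2\<bar>)"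
      unfolding h_def by (rule order_trans[OF eig_lipschitz[OF _ _ _ _ k]]) (auto intro!: eq_matI sum_mono simp: add.commute)
    also have "\<dots> \<le> (\<Sum>p\<in>{..<d} \<times> {..<d}. \<bar>A $$ p - B $$ p\<bar> / 2 + \<bar>A $$ (snd p, fst p) - B $$ (snd p, fst p)\<bar> / 2)"
      by (intro sum_mono) (simp add: field_simps abs_if split: if_splits)
    also have "\<dots> = (\<Sum>p\<in>{..<d} \<times> {..<d}. \<bar>A $$ p - B $$ p\<bar>) / 2 + (\<Sum>p\<in>{..<d} \<times> {..<d}. \<bar>A $$ (snd p, fst p) - B $$ (snd p, fst p)\<bar>) / 2"
      by (simp only: sum.distrib sum_divide_distrib)
    also have "(\<Sum>p\<in>{..<d} \<times> {..<d}. \<bar>A $$ (snd p, fst p) - B $$ (snd p, fst p)\<bar>) = (\<Sum>p\<in>{..<d} \<times> {..<d}. \<bar>A $$ p - B $$ p\<bar>)"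
      by (rule sum.reindex_bij_witness[of _ "\<lambda>p. (snd p, fst p)" "\<lambda>p. (snd p, fst p)"]) auto
    finally show "\<bar>h A - h B\<bar> \<le> 1 * (\<Sum>p\<in>{..<d} \<times> {..<d}. \<bar>A $$ p - B $$ p\<bar>)" by simp
  qed
  moreover have "h (f x) = eig (f x) (Suc k)" if x: "x \<in> space N" for x
  proof -
    have "f x $$ (j, i) = f x $$ (i, j)" if "i < d" "j < d" for i j
      using arg_cong[OF s[OF x], of "\<lambda>M. M $$ (i, j)"] mmatD(1)[OF f x] that by simp
    then have "mat d d (\<lambda>(i, j). (f x $$ (i, j) + f x $$ (j, i)) / 2) = f x"
      using mmatD(1)[OF f x] by (intro eq_matI) auto
    then show ?thesis by (simp add: h_def)
  qed
  ultimately show ?thesis by (simp cong: measurable_cong)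
qed

text \<open>Lagrange interpolation expresses the projector onto an eigenspace through the matrix
  and its eigenvalues, which makes it a Borel function even at ties.\<close>

fun lagrange_proj :: "nat \<Rightarrow> real mat \<Rightarrow> (nat \<Rightarrow> real) \<Rightarrow> real \<Rightarrow> nat \<Rightarrow> real mat" where
  "lagrange_proj d A l t 0 = 1\<^sub>m d"
| "lagrange_proj d A l t (Suc m) = lagrange_proj d A l t m *
    mat d d (\<lambda>(a, b). if l m = t then of_bool (a = b) else (A $$ (a, b) - l m * of_bool (a = b)) / (t - l m))"

text \<open>Each factor is a spectral function of \<open>A\<close>. At an eigenvalue different from
  \<open>lam k\<close> the factor belonging to its own position vanishes; at \<open>lam k\<close>
  all factors are 1, those with \<open>lam m = lam k\<close> having been set to the identity to
  avoid division by zero.\<close>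

lemma lagrange_proj_eq:
  assumes es: "eigsys d A lam v" and k: "k < d"
  shows "lagrange_proj d A lam (lam k) d = fmat d (\<lambda>j. of_bool (lam j = lam k)) v"
proof -
  note e = eigsysD[OF es]
  define c where "c i j = (if lam i = lam k then 1 else (lam j - lam i) / (lam k - lam i))" for i j
  have step: "mat d d (\<lambda>(a, b). if lam m = lam k then of_bool (a = b) else (A $$ (a, b) - lam m * of_bool (a = b)) / (lam k - lam m)) = fmat d (c m) v" for m
  proof -
    have one: "1\<^sub>m d = fmat d (\<lambda>_. 1) v" using fmat_one[OF e(2)] by simp
    have ob: "of_bool (a = b) = fmat d (\<lambda>_. 1) v $$ (a, b)" if "a < d" "b < d" for a b
      unfolding one[symmetric] using that by simp
    have Ae: "A $$ (a, b) = fmat d lam v $$ (a, b)" for a b using eigsys_fmat[OF es] by simp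
    show ?thesis
    proof (rule eq_matI)
      fix a b assume "a < dim_row (fmat d (c m) v)" "b < dim_col (fmat d (c m) v)"
      then have ab: "a < d" "b < d" by (auto simp: fmat_def)
      show "mat d d (\<lambda>(a, b). if lam m = lam k then of_bool (a = b) else (A $$ (a, b) - lam m * of_bool (a = b)) / (lam k - lam m)) $$ (a, b) = fmat d (c m) v $$ (a, b)"
      proof (cases "lam m = lam k")
        case True
        then show ?thesis using ab ob[OF ab] by (simp add: c_def[abs_def])
      next
        case False
        have "(fmat d lam v $$ (a, b) - lam m * fmat d (\<lambda>_. 1) v $$ (a, b)) / (lam k - lam m) = fmat d (c m) v $$ (a, b)"
          using ab False by (simp add: fmat_def c_def sum_distrib_left sum_subtractf[symmetric] sum_divide_distrib left_diff_distrib mult.assoc)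
        then show ?thesis using ab False ob[OF ab] Ae by simp
      qed
    qed (auto simp: fmat_def)
  qed
  have "lagrange_proj d A lam (lam k) m = fmat d (\<lambda>j. \<Prod>i<m. c i j) v" for m
  proof (induction m)
    case 0
    show ?case using fmat_one[OF e(2)] by simp
  next
    case (Suc m)
    then show ?case by (simp add: step fmat_mult[OF e(2)])
  qed
  moreover have "(\<Prod>i<d. c i j) = of_bool (lam j = lam k)" if j: "j < d" for j
  proof (cases "lam j = lam k")
    case True
    then show ?thesis by (auto simp: c_def intro!: prod.neutral)
  next
    case False
    then have "c j j = 0" by (simp add: c_def)
    then show ?thesis using False j by (auto intro!: prod_zero)
  qed
  ultimately show ?thesis by (simp cong: fmat_cong)
qed

lemma mmat_mult:
  assumes A: "mmat N d A" and B: "mmat N d B"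
  shows "mmat N d (\<lambda>x. A x * B x)"
  unfolding mmat_def
proof (intro conjI ballI allI impI)
  fix x assume x: "x \<in> space N"
  show "A x * B x \<in> carrier_mat d d" by (rule mult_carrier_mat[OF mmatD(1)[OF A x] mmatD(1)[OF B x]])
next
  fix a b assume ab: "a < d" "b < d"
  have S: "(\<lambda>x. \<Sum>j<d. A x $$ (a, j) * B x $$ (j, b)) \<in> borel_measurable N"
  proof (rule borel_measurable_sum)
    fix j assume "j \<in> {..<d}"
    then have j: "j < d" by simp
    have "(\<lambda>x. A x $$ (a, j)) \<in> borel_measurable N" by (rule mmatD(2)[OF A ab(1) j])
    moreover have "(\<lambda>x. B x $$ (j, b)) \<in> borel_measurable N" by (rule mmatD(2)[OF B j ab(2)])
    ultimately show "(\<lambda>x. A x $$ (a, j) * B x $$ (j, b)) \<in> borel_measurable N" by (rule borel_measurable_times)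
  qed
  have "(\<lambda>x. (A x * B x) $$ (a, b)) \<in> borel_measurable N \<longleftrightarrow> (\<lambda>x. \<Sum>j<d. A x $$ (a, j) * B x $$ (j, b)) \<in> borel_measurable N"
  proof (rule measurable_cong)
    fix x assume x: "x \<in> space N"
    show "(A x * B x) $$ (a, b) = (\<Sum>j<d. A x $$ (a, j) * B x $$ (j, b))"
      using mmatD(1)[OF A x] mmatD(1)[OF B x] ab by (simp add: scalar_prod_def lessThan_atLeast0)
  qed
  then show "(\<lambda>x. (A x * B x) $$ (a, b)) \<in> borel_measurable N" using S by (rule iffD2)
qed

lemma mmat_matI:
  assumes "\<And>a b. a < d \<Longrightarrow> b < d \<Longrightarrow> (\<lambda>x. g x (a, b)) \<in> borel_measurable N"
  shows "mmat N d (\<lambda>x. mat d d (g x))"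
  unfolding mmat_def
proof (intro conjI ballI allI impI)
  fix a b assume ab: "a < d" "b < d"
  have "(\<lambda>x. mat d d (g x) $$ (a, b)) = (\<lambda>x. g x (a, b))" using ab by (intro ext) simp
  then show "(\<lambda>x. mat d d (g x) $$ (a, b)) \<in> borel_measurable N" using assms[OF ab] by (simp only:)
qed simp

lemma lagrange_factor_mmat:
  assumes f: "mmat N d f" and u: "u \<in> borel_measurable N" and t: "t \<in> borel_measurable N"
  shows "mmat N d (\<lambda>x. mat d d (\<lambda>(a, b). if u x = t x then of_bool (a = b) else (f x $$ (a, b) - u x * of_bool (a = b)) / (t x - u x)))"
proof (rule mmat_matI)
  fix a b assume ab: "a < d" "b < d"
  define c where "c = (of_bool (a = b) :: real)"
  have cm: "(\<lambda>x. c) \<in> borel_measurable N" by simp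
  have fm: "(\<lambda>x. f x $$ (a, b)) \<in> borel_measurable N" by (rule mmatD(2)[OF f ab])
  have "(\<lambda>x. u x * c) \<in> borel_measurable N" using u cm by (rule borel_measurable_times)
  with fm have h1: "(\<lambda>x. f x $$ (a, b) - u x * c) \<in> borel_measurable N" by (rule borel_measurable_diff)
  have "(\<lambda>x. t x - u x) \<in> borel_measurable N" using t u by (rule borel_measurable_diff)
  with h1 have h2: "(\<lambda>x. (f x $$ (a, b) - u x * c) / (t x - u x)) \<in> borel_measurable N" by (rule borel_measurable_divide)
  have "{x \<in> space N. u x = t x} \<in> sets N" using u t by (rule borel_measurable_eq)
  with cm h2 have "(\<lambda>x. if u x = t x then c else (f x $$ (a, b) - u x * c) / (t x - u x)) \<in> borel_measurable N"
    by (rule measurable_If)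
  then show "(\<lambda>x. case (a, b) of (a, b) \<Rightarrow> if u x = t x then of_bool (a = b) else (f x $$ (a, b) - u x * of_bool (a = b)) / (t x - u x)) \<in> borel_measurable N"
    unfolding c_def prod.case .
qed

lemma lagrange_proj_mmat:
  assumes f: "mmat N d f" and l: "\<And>i. i < d \<Longrightarrow> (\<lambda>x. l x i) \<in> borel_measurable N" and t: "t \<in> borel_measurable N"
  shows "m \<le> d \<Longrightarrow> mmat N d (\<lambda>x. lagrange_proj d (f x) (l x) (t x) m)"
proof (induction m)
  case 0
  have "mmat N d (\<lambda>x. 1\<^sub>m d)" unfolding one_mat_def by (rule mmat_matI) simp
  then show ?case by (simp only: lagrange_proj.simps)
next
  case (Suc m)
  then have IH: "mmat N d (\<lambda>x. lagrange_proj d (f x) (l x) (t x) m)" and m: "m < d" by auto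
  show ?case unfolding lagrange_proj.simps
    by (rule mmat_mult[OF IH lagrange_factor_mmat[OF f l[OF m] t]])
qed

lemma lagrange_proj_cong:
  "(\<And>i. i < m \<Longrightarrow> l1 i = l2 i) \<Longrightarrow> lagrange_proj d A l1 t m = lagrange_proj d A l2 t m"
proof (induction m)
  case (Suc m)
  have "l1 m = l2 m" using Suc.prems[of m] by simp
  moreover have "lagrange_proj d A l1 t m = lagrange_proj d A l2 t m" using Suc by simp
  ultimately show ?case by (simp only: lagrange_proj.simps)
qed simp

text \<open>An eigenspace is met once for each position carrying its eigenvalue, hence the division
  by the multiplicity. When \<open>w\<close> is constant on ties this is the spectral calculus,
  written without eigenvectors.\<close>

definition spectral_sum :: "nat \<Rightarrow> real mat \<Rightarrow> (nat \<Rightarrow> real) \<Rightarrow> (nat \<Rightarrow> real) \<Rightarrow> real mat" where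
  "spectral_sum d A l w = mat d d (\<lambda>ab. \<Sum>k<d. w k / (\<Sum>j<d. if l j = l k then 1 else 0) * lagrange_proj d A l (l k) d $$ ab)"

lemma spectral_sum_eq:
  assumes es: "eigsys d A lam v" and w: "\<And>k j. k < d \<Longrightarrow> j < d \<Longrightarrow> lam k = lam j \<Longrightarrow> w k = w j"
  shows "spectral_sum d A lam w = fmat d w v"
proof (rule eq_matI)
  fix a b assume "a < dim_row (fmat d w v)" "b < dim_col (fmat d w v)"
  then have ab: "a < d" "b < d" by (auto simp: fmat_def)
  define mlt where "mlt k = (\<Sum>j<d. if lam j = lam k then 1 else (0::real))" for k
  have "(\<Sum>k<d. w k / mlt k * lagrange_proj d A lam (lam k) d $$ (a, b)) = (\<Sum>k<d. \<Sum>j<d. w k / mlt k * (of_bool (lam j = lam k) * v j $ a * v j $ b))"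
    using ab by (intro sum.cong refl) (simp add: lagrange_proj_eq[OF es] fmat_def sum_distrib_left)
  also have "\<dots> = (\<Sum>j<d. \<Sum>k<d. w k / mlt k * (of_bool (lam j = lam k) * v j $ a * v j $ b))" by (rule sum.swap)
  also have "\<dots> = (\<Sum>j<d. w j * v j $ a * v j $ b)"
  proof (rule sum.cong[OF refl])
    fix j assume "j \<in> {..<d}"
    then have j: "j < d" by simp
    have pos: "0 < mlt j" unfolding mlt_def using j by (intro sum_pos2[of _ j]) auto
    have "(\<Sum>k<d. w k / mlt k * (of_bool (lam j = lam k) * v j $ a * v j $ b)) = (\<Sum>k<d. (if lam k = lam j then 1 else 0) * (w j / mlt j * (v j $ a * v j $ b)))"
    proof (rule sum.cong[OF refl])
      fix k assume "k \<in> {..<d}"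
      then have k: "k < d" by simp
      show "w k / mlt k * (of_bool (lam j = lam k) * v j $ a * v j $ b) = (if lam k = lam j then 1 else 0) * (w j / mlt j * (v j $ a * v j $ b))"
      proof (cases "lam k = lam j")
        case True
        have "w k = w j" by (rule w[OF k j True])
        moreover have "mlt k = mlt j" using True by (simp add: mlt_def)
        ultimately show ?thesis using True by simp
      qed auto
    qed
    also have "\<dots> = mlt j * (w j / mlt j * (v j $ a * v j $ b))" by (simp only: mlt_def sum_distrib_right)
    also have "\<dots> = w j * v j $ a * v j $ b" using pos by simp
    finally show "(\<Sum>k<d. w k / mlt k * (of_bool (lam j = lam k) * v j $ a * v j $ b)) = w j * v j $ a * v j $ b" .
  qed
  finally show "spectral_sum d A lam w $$ (a, b) = fmat d w v $$ (a, b)"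
    using ab by (simp add: spectral_sum_def mlt_def fmat_def)
qed (auto simp: spectral_sum_def fmat_def)

lemma spectral_sum_cong:
  "(\<And>i. i < d \<Longrightarrow> l1 i = l2 i) \<Longrightarrow> spectral_sum d A l1 w = spectral_sum d A l2 w"
  unfolding spectral_sum_def
  by (intro arg_cong[where f = "mat d d"] ext sum.cong refl arg_cong2[where f = "(*)"] arg_cong2[where f = "(/)"] arg_cong2[where f = "($$)"])
    (auto intro: lagrange_proj_cong)

lemma spectral_sum_mmat:
  assumes f: "mmat N d f" and l: "\<And>i. i < d \<Longrightarrow> (\<lambda>x. l x i) \<in> borel_measurable N"
    and w: "\<And>k. k < d \<Longrightarrow> (\<lambda>x. w x k) \<in> borel_measurable N"
  shows "mmat N d (\<lambda>x. spectral_sum d (f x) (l x) (w x))"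
proof -
  have Q: "mmat N d (\<lambda>x. lagrange_proj d (f x) (l x) (l x k) d)" if "k < d" for k
    by (rule lagrange_proj_mmat[OF f l l[OF that] order_refl])
  have m: "(\<lambda>x. \<Sum>k<d. w x k / (\<Sum>j<d. if l x j = l x k then 1 else 0) * lagrange_proj d (f x) (l x) (l x k) d $$ (a, b)) \<in> borel_measurable N"
    if ab: "a < d" "b < d" for a b
  proof (intro borel_measurable_sum borel_measurable_times borel_measurable_divide measurable_If borel_measurable_const)
    fix k assume "k \<in> {..<d}"
    then have k: "k < d" by simp
    show "(\<lambda>x. w x k) \<in> borel_measurable N" by (rule w[OF k])
    show "(\<lambda>x. lagrange_proj d (f x) (l x) (l x k) d $$ (a, b)) \<in> borel_measurable N" by (rule mmatD(2)[OF Q[OF k] ab])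
    fix j assume "j \<in> {..<d}"
    then have j: "j < d" by simp
    show "{x \<in> space N. l x j = l x k} \<in> sets N" by (rule borel_measurable_eq[OF l[OF j] l[OF k]])
  qed
  show ?thesis unfolding mmat_def
  proof (intro conjI ballI allI impI)
    fix a b assume ab: "a < d" "b < d"
    have "spectral_sum d (f x) (l x) (w x) $$ (a, b) = (\<Sum>k<d. w x k / (\<Sum>j<d. if l x j = l x k then 1 else 0) * lagrange_proj d (f x) (l x) (l x k) d $$ (a, b))" for x
      using ab by (simp add: spectral_sum_def)
    then show "(\<lambda>x. spectral_sum d (f x) (l x) (w x) $$ (a, b)) \<in> borel_measurable N" using m[OF ab] by simp
  qed (simp add: spectral_sum_def)
qed

text \<open>Eigenvectors are used only pointwise, to identify the projector with
  \<open>spectral_sum\<close>. The latter depends on the matrix and its ordered eigenvalues, and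
  equality of two eigenvalues is a measurable event, so ties do no harm.\<close>

lemma index_proj_mmat:
  assumes f: "mmat N d f" and s: "\<And>x. x \<in> space N \<Longrightarrow> (f x)\<^sup>T = f x" and I: "I \<subseteq> {1..d}"
  shows "mmat N d (\<lambda>x. index_proj d (f x) I)"
proof (rule mmat_cong)
  define l where "l x i = eig (f x) (Suc i)" for x i
  define w where "w x k = (if (\<exists>i\<in>I. l x k = l x (i - 1)) then 1 else (0::real))" for x k
  have l: "(\<lambda>x. l x i) \<in> borel_measurable N" if "i < d" for i
    unfolding l_def by (rule eig_measurable[OF f s that])
  have fin: "finite I" using I finite_subset by blast
  show "mmat N d (\<lambda>x. spectral_sum d (f x) (l x) (w x))"
  proof (rule spectral_sum_mmat[OF f l])
    fix k assume k: "k < d"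
    have "{x \<in> space N. \<exists>i\<in>I. l x k = l x (i - 1)} \<in> sets N"
      using fin
    proof (rule sets.sets_Collect_finite_Ex[rotated])
      fix i assume "i \<in> I"
      then have "i \<in> {1..d}" using I by blast
      then have i: "i - 1 < d" by (simp add: atLeastAtMost_iff) linarith
      show "{x \<in> space N. l x k = l x (i - 1)} \<in> sets N" by (rule borel_measurable_eq[OF l[OF k] l[OF i]])
    qed
    then show "(\<lambda>x. w x k) \<in> borel_measurable N" unfolding w_def by (intro measurable_If borel_measurable_const)
  qed
  fix x assume x: "x \<in> space N"
  obtain lam v where es: "eigsys d (f x) lam v" by (rule symmetric_eigsys[OF mmatD(1)[OF f x] s[OF x]])
  have ll: "l x i = lam i" if "i < d" for i using eig_Suc[OF es that] by (simp add: l_def)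
  have "spectral_sum d (f x) (l x) (w x) = spectral_sum d (f x) lam (w x)" by (rule spectral_sum_cong[OF ll])
  also have "\<dots> = fmat d (w x) v" by (rule spectral_sum_eq[OF es]) (simp add: w_def ll)
  also have "\<dots> = fmat d (\<lambda>k. of_bool (lam k \<in> eig (f x) ` I)) v"
  proof (rule fmat_cong)
    fix k assume k: "k < d"
    have "eig (f x) i = l x (i - 1)" if "i \<in> I" for i using that I by (auto simp: l_def)
    then have "eig (f x) ` I = (\<lambda>i. l x (i - 1)) ` I" by (rule image_cong[OF refl])
    then show "w x k = of_bool (lam k \<in> eig (f x) ` I)" using ll[OF k] by (auto simp: w_def)
  qed
  also have "\<dots> = index_proj d (f x) I" by (rule index_proj_eq[OF es, symmetric])
  finally show "spectral_sum d (f x) (l x) (w x) = index_proj d (f x) I" .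
qed

lemma psd_sqrt_mmat:
  assumes f: "mmat N d f" and s: "\<And>x. x \<in> space N \<Longrightarrow> is_psd d (f x)"
  shows "mmat N d (\<lambda>x. psd_sqrt d (f x))"
proof (rule mmat_cong)
  define l where "l x i = eig (f x) (Suc i)" for x i
  define w where "w x k = sqrt (l x k)" for x k
  have sym: "(f x)\<^sup>T = f x" if "x \<in> space N" for x using s[OF that] by (simp add: is_psd_def)
  have l: "(\<lambda>x. l x i) \<in> borel_measurable N" if "i < d" for i
    unfolding l_def by (rule eig_measurable[OF f sym that])
  show "mmat N d (\<lambda>x. spectral_sum d (f x) (l x) (w x))"
  proof (rule spectral_sum_mmat[OF f l])
    fix k assume k: "k < d"
    show "(\<lambda>x. w x k) \<in> borel_measurable N" unfolding w_def by (rule measurable_compose[OF l[OF k] borel_measurable_sqrt])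
  qed
  fix x assume x: "x \<in> space N"
  obtain lam v where es: "eigsys d (f x) lam v" by (rule symmetric_eigsys[OF mmatD(1)[OF f x] sym[OF x]])
  note e = eigsysD[OF es]
  have ll: "l x i = lam i" if "i < d" for i using eig_Suc[OF es that] by (simp add: l_def)
  have pos: "0 \<le> lam k" if k: "k < d" for k
  proof -
    have "0 \<le> v k \<bullet> (f x *\<^sub>v v k)" using s[OF x] e(5)[OF k] by (simp add: is_psd_def)
    then show ?thesis using e(3)[OF k] e(5)[OF k] onb_prod[OF e(2) k k] by simp
  qed
  have "spectral_sum d (f x) (l x) (w x) = spectral_sum d (f x) lam (w x)" by (rule spectral_sum_cong[OF ll])
  also have "\<dots> = fmat d (w x) v" by (rule spectral_sum_eq[OF es]) (simp add: w_def ll)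
  also have "\<dots> = fmat d (\<lambda>k. sqrt (lam k)) v" by (rule fmat_cong) (simp add: w_def ll)
  also have "\<dots> = psd_sqrt d (f x)" by (rule psd_sqrt_eq[OF es pos, symmetric])
  finally show "spectral_sum d (f x) (l x) (w x) = psd_sqrt d (f x)" .
qed

text \<open>The tail \<open>F x \<gamma>\<close> is measurable in \<open>x\<close> as the measure of
  a section and decreases in \<open>\<gamma>\<close>; hence the infimum lies below \<open>a\<close>
  iff some rational below \<open>a\<close> is admissible, a countable union of measurable events.
  Positivity of \<open>\<alpha>\<close> keeps the admissible set nonempty, because the tails tend to
  zero.\<close>

lemma upper_quantile_measurable:
  assumes P: "prob_space P" and W: "(\<lambda>(x, y). W x y) \<in> borel_measurable (N \<Otimes>\<^sub>M P)" and \<alpha>: "0 < \<alpha>"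
  shows "(\<lambda>x. upper_quantile P (W x) \<alpha>) \<in> borel_measurable N"
proof -
  interpret prob_space P by (rule P)
  define F where "F x \<gamma> = measure P {y \<in> space P. \<gamma> < W x y}" for x \<gamma>
  have Wx: "W x \<in> borel_measurable P" if "x \<in> space N" for x
    using measurable_Pair2[OF W that] by simp
  have Am: "{y \<in> space P. \<gamma> < W x y} \<in> sets P" if "x \<in> space N" for x \<gamma>
    by (rule borel_measurable_less[OF borel_measurable_const Wx[OF that]])
  have Fm: "(\<lambda>x. F x \<gamma>) \<in> borel_measurable N" for \<gamma>
  proof -
    define Q where "Q = {p \<in> space (N \<Otimes>\<^sub>M P). \<gamma> < (case p of (x, y) \<Rightarrow> W x y)}"
    have "Q \<in> sets (N \<Otimes>\<^sub>M P)" unfolding Q_def by (rule borel_measurable_less[OF borel_measurable_const W])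
    then have "(\<lambda>x. enn2real (emeasure P (Pair x -` Q))) \<in> borel_measurable N"
      by (intro borel_measurable_enn2real measurable_emeasure_Pair)
    moreover have "F x \<gamma> = enn2real (emeasure P (Pair x -` Q))" if "x \<in> space N" for x
    proof -
      have "Pair x -` Q = {y \<in> space P. \<gamma> < W x y}" using that by (auto simp: Q_def space_pair_measure)
      then show ?thesis by (simp add: F_def measure_def)
    qed
    ultimately show ?thesis using measurable_cong[of N "\<lambda>x. F x \<gamma>" "\<lambda>x. enn2real (emeasure P (Pair x -` Q))" borel] by simp
  qed
  have mono: "F x \<gamma>' \<le> F x \<gamma>" if "x \<in> space N" "\<gamma> \<le> \<gamma>'" for x \<gamma> \<gamma>'
    unfolding F_def using that by (intro finite_measure_mono Am) auto
  have ne: "\<exists>\<gamma>>0. F x \<gamma> \<le> \<alpha>" if x: "x \<in> space N" for x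
  proof -
    have "(\<lambda>n. measure P {y \<in> space P. real n < W x y}) \<longlonglongrightarrow> measure P (\<Inter>n. {y \<in> space P. real n < W x y})"
      using Am[OF x] by (intro finite_Lim_measure_decseq) (auto simp: decseq_def)
    moreover have "(\<Inter>n. {y \<in> space P. real n < W x y}) = {}"
    proof (rule equals0I)
      fix y assume y: "y \<in> (\<Inter>n. {y \<in> space P. real n < W x y})"
      obtain n where "W x y < real n" using reals_Archimedean2 by blast
      moreover have "real n < W x y" using y by blast
      ultimately show False by simp
    qed
    ultimately have "(\<lambda>n. F x (real n)) \<longlonglongrightarrow> 0" by (simp add: F_def)
    then have "\<forall>\<^sub>F n in sequentially. F x (real n) < \<alpha>" using \<alpha> by (rule order_tendstoD)
    then have "\<forall>\<^sub>F n in sequentially. 0 < n \<and> F x (real n) < \<alpha>" by (intro eventually_conj eventually_gt_at_top)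
    then obtain n where "0 < n" "F x (real n) < \<alpha>" by (auto dest: eventually_happens)
    then show ?thesis by (intro exI[of _ "real n"]) auto
  qed
  have iff: "upper_quantile P (W x) \<alpha> < a \<longleftrightarrow> (\<exists>\<gamma>\<in>\<rat>. 0 < \<gamma> \<and> \<gamma> < a \<and> F x \<gamma> \<le> \<alpha>)" if x: "x \<in> space N" for x a
  proof -
    define S where "S = {\<gamma>. 0 < \<gamma> \<and> F x \<gamma> \<le> \<alpha>}"
    have S: "S \<noteq> {}" "bdd_below S" using ne[OF x] by (auto simp: S_def intro!: bdd_belowI[of _ 0])
    have "upper_quantile P (W x) \<alpha> < a \<longleftrightarrow> (\<exists>\<gamma>\<in>S. \<gamma> < a)"
      using cInf_less_iff[OF S] by (simp add: upper_quantile_def S_def F_def)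
    also have "\<dots> \<longleftrightarrow> (\<exists>\<gamma>\<in>\<rat>. 0 < \<gamma> \<and> \<gamma> < a \<and> F x \<gamma> \<le> \<alpha>)"
    proof
      assume "\<exists>\<gamma>\<in>S. \<gamma> < a"
      then obtain \<gamma> where g: "0 < \<gamma>" "F x \<gamma> \<le> \<alpha>" "\<gamma> < a" by (auto simp: S_def)
      obtain r where r: "r \<in> \<rat>" "\<gamma> < r" "r < a" using Rats_dense_in_real[OF g(3)] by blast
      have "F x r \<le> F x \<gamma>" using mono[OF x] r(2) by simp
      then show "\<exists>\<gamma>\<in>\<rat>. 0 < \<gamma> \<and> \<gamma> < a \<and> F x \<gamma> \<le> \<alpha>" using r g by (intro bexI[of _ r]) auto
    qed (auto simp: S_def)
    finally show ?thesis .
  qed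
  show ?thesis
  proof (rule borel_measurable_iff_less[THEN iffD2], rule allI)
    fix a
    have "{x \<in> space N. upper_quantile P (W x) \<alpha> < a} = (\<Union>\<gamma>\<in>{\<gamma>\<in>\<rat>. 0 < \<gamma> \<and> \<gamma> < a}. {x \<in> space N. F x \<gamma> \<le> \<alpha>})"
      using iff by auto
    moreover have "countable {\<gamma>\<in>\<rat>. 0 < \<gamma> \<and> \<gamma> < a}" by (rule countable_subset[OF _ countable_rat]) auto
    moreover have "{x \<in> space N. F x \<gamma> \<le> \<alpha>} \<in> sets N" for \<gamma>
      by (rule borel_measurable_le[OF Fm borel_measurable_const])
    ultimately show "{x \<in> space N. upper_quantile P (W x) \<alpha> < a} \<in> sets N" by auto
  qed
qed

section \<open>Covariances in the sampling model\<close>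

lemma space_borel_vec: "space (borel_vec d) = carrier_vec d"
  by (simp add: borel_vec_def)

lemma borel_vec_coord: "i < d \<Longrightarrow> (\<lambda>v. v $ i) \<in> borel_measurable (borel_vec d)"
proof -
  assume i: "i < d"
  have "(\<lambda>v. \<lambda>i\<in>{..<d}. v $ i) \<in> measurable (borel_vec d) (\<Pi>\<^sub>M i\<in>{..<d}. (borel :: real measure))"
    unfolding borel_vec_def by (rule measurable_vimage_algebra1) (auto simp: space_PiM)
  then have "(\<lambda>v. (\<lambda>i\<in>{..<d}. v $ i) i) \<in> borel_measurable (borel_vec d)"
    by (rule measurable_compose[OF _ measurable_component_singleton]) (use i in simp)
  then show ?thesis using i by simp
qed

lemma measurable_borel_vec:
  assumes "\<And>x. x \<in> space M \<Longrightarrow> f x \<in> carrier_vec d" "\<And>i. i < d \<Longrightarrow> (\<lambda>x. f x $ i) \<in> borel_measurable M"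
  shows "f \<in> measurable M (borel_vec d)"
  unfolding borel_vec_def
proof (rule measurable_vimage_algebra2)
  show "f \<in> space M \<rightarrow> carrier_vec d" using assms(1) by auto
  show "(\<lambda>x. \<lambda>i\<in>{..<d}. f x $ i) \<in> measurable M (\<Pi>\<^sub>M i\<in>{..<d}. borel)"
    by (rule measurable_restrict) (use assms(2) in simp)
qed

lemma scalar_prod_sum: "x \<in> carrier_vec d \<Longrightarrow> a \<bullet> x = (\<Sum>i<d. a $ i * x $ i)"
  by (simp add: scalar_prod_def lessThan_atLeast0)

lemma borel_vec_scalar_prod: "(\<lambda>x. a \<bullet> x) \<in> borel_measurable (borel_vec d)" for a :: "real vec"
proof -
  have "(\<lambda>x. \<Sum>i<d. a $ i * x $ i) \<in> borel_measurable (borel_vec d)"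
  proof (rule borel_measurable_sum)
    fix i assume "i \<in> {..<d}"
    then have "(\<lambda>x. x $ i) \<in> borel_measurable (borel_vec d)" by (intro borel_vec_coord) simp
    with borel_measurable_const show "(\<lambda>x. a $ i * x $ i) \<in> borel_measurable (borel_vec d)" by (rule borel_measurable_times)
  qed
  moreover have "(\<lambda>x. a \<bullet> x) \<in> borel_measurable (borel_vec d) \<longleftrightarrow> (\<lambda>x. \<Sum>i<d. a $ i * x $ i) \<in> borel_measurable (borel_vec d)"
    by (rule measurable_cong) (simp add: space_borel_vec scalar_prod_sum)
  ultimately show ?thesis by simp
qed

text \<open>Deviation bounds use sixteen moments and are applied to fourth powers of scores, hence
  the 64th moment.\<close>

definition moment_const :: "real \<Rightarrow> real" where
  "moment_const \<beta> = 2 * (1 + fact (nat \<lceil>64 / \<beta>\<rceil>))"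

text \<open>Choosing an integer \<open>k\<close> with \<open>\<beta> * k \<ge> 64\<close> bounds
  \<open>y ^ 64\<close> by the \<open>k\<close>-th power of \<open>y powr \<beta>\<close> when
  \<open>y\<close> exceeds 1, and a power is dominated by a factorial times an exponential. The
  summand 1 covers small \<open>y\<close>.\<close>

lemma power64_le_exp:
  fixes y \<beta> :: real
  assumes b: "0 < \<beta>" and y: "0 \<le> y"
  shows "y ^ 64 \<le> (1 + fact (nat \<lceil>64 / \<beta>\<rceil>)) * exp (y powr \<beta>)"
proof -
  define k where "k = nat \<lceil>64 / \<beta>\<rceil>"
  have k: "64 \<le> \<beta> * k"
  proof -
    have "64 / \<beta> \<le> real k" unfolding k_def by (rule real_nat_ceiling_ge)
    then show ?thesis using b by (simp add: field_simps)
  qed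
  have "y ^ 64 \<le> 1 + (y powr \<beta>) ^ k"
  proof (cases "y \<le> 1")
    case True
    then have "y ^ 64 \<le> 1" using y by (simp add: power_le_one)
    then show ?thesis by (simp add: add_increasing2)
  next
    case False
    have "y ^ 64 = y powr 64" using False by simp
    also have "\<dots> \<le> y powr (\<beta> * k)" using False k by (intro powr_mono) auto
    also have "\<dots> = (y powr \<beta>) ^ k" using False by (simp add: powr_powr[symmetric] powr_realpow)
    finally show ?thesis by simp
  qed
  also have "(y powr \<beta>) ^ k \<le> fact k * exp (y powr \<beta>)" by (rule power_le_fact_exp) simp
  also have "1 \<le> exp (y powr \<beta>)" by simp
  finally show ?thesis by (simp add: k_def distrib_right)
qed

text \<open>The \<psi>-norm is an infimum that need not be attained, so the scale \<open>e\<close>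
  is taken strictly above its bound \<open>c\<close>; then some admissible scale \<open>h\<close>
  lies below \<open>e\<close>, and the exponential moment at \<open>h\<close> is at most 2.\<close>

lemma psi_norm_moment:
  fixes c e :: real
  assumes P: "prob_space M" and W: "W \<in> borel_measurable M" and b: "0 < \<beta>"
    and c: "psi_norm \<beta> M W \<le> ennreal c" and e: "c < e" "0 < e"
  shows "integrable M (\<lambda>x. (W x / e) ^ 64)" "(\<integral>x. (W x / e) ^ 64 \<partial>M) \<le> moment_const \<beta>"
proof -
  define C where "C = 1 + (fact (nat \<lceil>64 / \<beta>\<rceil>) :: real)"
  have C: "0 \<le> C" "moment_const \<beta> = C * 2" by (simp_all add: C_def moment_const_def)
  have "psi_norm \<beta> M W < ennreal e" using c e by (meson ennreal_lessI le_less_trans)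
  then obtain h where h: "0 < h" "ennreal h < ennreal e" and E: "(\<integral>\<^sup>+ x. ennreal (exp ((\<bar>W x\<bar> / h) powr \<beta>)) \<partial>M) - 1 \<le> 1"
    unfolding psi_norm_def by (auto simp: Inf_less_iff)
  have he: "h < e" using h by (simp add: ennreal_less_iff)
  have E2: "(\<integral>\<^sup>+ x. ennreal (exp ((\<bar>W x\<bar> / h) powr \<beta>)) \<partial>M) \<le> 2"
    using E by (metis ennreal_minus_le_iff one_add_one)
  have "(\<integral>\<^sup>+x. ennreal ((W x / e) ^ 64) \<partial>M) \<le> (\<integral>\<^sup>+x. ennreal C * ennreal (exp ((\<bar>W x\<bar> / h) powr \<beta>)) \<partial>M)"
  proof (rule nn_integral_mono)
    fix x
    have "(W x / e) ^ 64 = (\<bar>W x\<bar> / e) ^ 64" by (simp add: power_divide)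
    also have "\<dots> \<le> (\<bar>W x\<bar> / h) ^ 64" using h he by (intro power_mono divide_left_mono) auto
    also have "\<dots> \<le> C * exp ((\<bar>W x\<bar> / h) powr \<beta>)" unfolding C_def using h by (intro power64_le_exp[OF b]) auto
    finally show "ennreal ((W x / e) ^ 64) \<le> ennreal C * ennreal (exp ((\<bar>W x\<bar> / h) powr \<beta>))"
      using C(1) by (simp add: ennreal_leI ennreal_mult[symmetric])
  qed
  also have "\<dots> = ennreal C * (\<integral>\<^sup>+x. ennreal (exp ((\<bar>W x\<bar> / h) powr \<beta>)) \<partial>M)"
    using W by (intro nn_integral_cmult) simp
  also have "\<dots> \<le> ennreal C * 2" using E2 by (intro mult_left_mono) auto
  also have "\<dots> = ennreal (moment_const \<beta>)"
    unfolding C(2) using C(1) by (simp add: ennreal_mult')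
  finally have le: "(\<integral>\<^sup>+x. ennreal ((W x / e) ^ 64) \<partial>M) \<le> ennreal (moment_const \<beta>)" .
  show int: "integrable M (\<lambda>x. (W x / e) ^ 64)"
    using W le by (intro integrableI_nonneg) (auto simp: le_less_trans[OF _ ennreal_less_top])
  show "(\<integral>x. (W x / e) ^ 64 \<partial>M) \<le> moment_const \<beta>"
    using le nn_integral_eq_integral[OF int] by (auto simp: ennreal_le_iff C)
qed

lemma weighted_cov_carrier [simp]: "weighted_cov n d w x \<in> carrier_mat d d"
  by (simp add: weighted_cov_def)

lemma weighted_cov_entry:
  assumes "\<And>k. k \<in> {1..n} \<Longrightarrow> x k \<in> carrier_vec d" "a < d" "b < d"
  shows "weighted_cov n d w x $$ (a, b) = 1 / n * (\<Sum>k=1..n. w k * (x k $ a * x k $ b))"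
proof -
  have "(\<Sum>k=1..n. w k * outer (x k) (x k) $$ (a, b)) = (\<Sum>k=1..n. w k * (x k $ a * x k $ b))"
  proof (rule sum.cong[OF refl])
    fix k assume "k \<in> {1..n}"
    then have "x k \<in> carrier_vec d" using assms(1) by blast
    then show "w k * outer (x k) (x k) $$ (a, b) = w k * (x k $ a * x k $ b)" using assms(2,3) by (simp add: outer_def)
  qed
  then show ?thesis using assms(2,3) by (simp add: weighted_cov_def)
qed

lemma weighted_cov_sym:
  assumes "\<And>k. k \<in> {1..n} \<Longrightarrow> x k \<in> carrier_vec d"
  shows "(weighted_cov n d w x)\<^sup>T = weighted_cov n d w x"
proof (rule eq_matI)
  fix a b assume "a < dim_row (weighted_cov n d w x)" "b < dim_col (weighted_cov n d w x)"
  then have ab: "a < d" "b < d" by (auto simp: weighted_cov_def)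
  have "weighted_cov n d w x $$ (b, a) = weighted_cov n d w x $$ (a, b)"
    using weighted_cov_entry[OF assms ab] weighted_cov_entry[OF assms ab(2,1)] by (simp add: mult.commute)
  then show "(weighted_cov n d w x)\<^sup>T $$ (a, b) = weighted_cov n d w x $$ (a, b)" using ab by (simp add: weighted_cov_def)
qed (auto simp: weighted_cov_def)

lemma weighted_cov_bilinear:
  assumes x: "\<And>k. k \<in> {1..n} \<Longrightarrow> x k \<in> carrier_vec d" and a: "a \<in> carrier_vec d" and b: "b \<in> carrier_vec d"
  shows "a \<bullet> (weighted_cov n d w x *\<^sub>v b) = (\<Sum>k=1..n. w k * ((a \<bullet> x k) * (b \<bullet> x k))) / n"
proof -
  have "a \<bullet> (weighted_cov n d w x *\<^sub>v b) = (\<Sum>i<d. \<Sum>j<d. a $ i * (weighted_cov n d w x $$ (i, j) * b $ j))"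
    using a b by (simp add: scalar_prod_def lessThan_atLeast0 sum_distrib_left weighted_cov_def)
  also have "\<dots> = (\<Sum>i<d. \<Sum>j<d. \<Sum>k=1..n. 1 / n * (w k * ((a $ i * x k $ i) * (b $ j * x k $ j))))"
  proof (intro sum.cong refl)
    fix i j assume "i \<in> {..<d}" "j \<in> {..<d}"
    then have "weighted_cov n d w x $$ (i, j) = 1 / n * (\<Sum>k=1..n. w k * (x k $ i * x k $ j))"
      by (intro weighted_cov_entry x) auto
    then show "a $ i * (weighted_cov n d w x $$ (i, j) * b $ j) = (\<Sum>k=1..n. 1 / n * (w k * ((a $ i * x k $ i) * (b $ j * x k $ j))))"
      by (simp only: sum_distrib_left sum_distrib_right) (intro sum.cong refl, simp)
  qed
  also have "\<dots> = (\<Sum>i<d. \<Sum>k=1..n. \<Sum>j<d. 1 / n * (w k * ((a $ i * x k $ i) * (b $ j * x k $ j))))"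
    by (intro sum.cong refl sum.swap)
  also have "\<dots> = (\<Sum>k=1..n. \<Sum>i<d. \<Sum>j<d. 1 / n * (w k * ((a $ i * x k $ i) * (b $ j * x k $ j))))" by (rule sum.swap)
  also have "\<dots> = (\<Sum>k=1..n. 1 / n * (w k * ((a \<bullet> x k) * (b \<bullet> x k))))"
  proof (rule sum.cong[OF refl])
    fix k assume "k \<in> {1..n}"
    then have "(a \<bullet> x k) * (b \<bullet> x k) = (\<Sum>i<d. \<Sum>j<d. (a $ i * x k $ i) * (b $ j * x k $ j))"
      using x[of k] by (simp add: scalar_prod_sum sum_product)
    then show "(\<Sum>i<d. \<Sum>j<d. 1 / n * (w k * ((a $ i * x k $ i) * (b $ j * x k $ j)))) = 1 / n * (w k * ((a \<bullet> x k) * (b \<bullet> x k)))"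
      by (simp only: sum_distrib_left)
  qed
  finally show ?thesis by (simp add: sum_divide_distrib)
qed

lemma sample_cov_psd:
  assumes x: "\<And>k. k \<in> {1..n} \<Longrightarrow> x k \<in> carrier_vec d"
  shows "is_psd d (sample_cov n d x)"
  unfolding is_psd_def sample_cov_def
  using weighted_cov_sym[OF x] weighted_cov_bilinear[OF x] by (auto intro!: divide_nonneg_nonneg sum_nonneg)

text \<open>A sample covariance has rank at most \<open>n\<close>, so its kernel produces a tie when \<open>d > n + 1\<close>.\<close>

lemma distinct_sample_cov_dim:
  assumes x: "\<And>k. k \<in> {1..n} \<Longrightarrow> x k \<in> carrier_vec d" and dist: "distinct (eigs (sample_cov n d x))"
  shows "d \<le> n + 1"
proof (rule ccontr)
  assume "\<not> d \<le> n + 1"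
  then have dn: "n + 1 < d" by simp
  let ?S = "sample_cov n d x"
  have S: "?S \<in> carrier_mat d d" "?S\<^sup>T = ?S" using weighted_cov_sym[OF x] by (auto simp: sample_cov_def)
  obtain l v where es: "eigsys d ?S l v" by (rule symmetric_eigsys[OF S])
  note e = eigsysD[OF es]
  have quad: "y \<bullet> (?S *\<^sub>v y) = (\<Sum>k=1..n. (y \<bullet> x k)\<^sup>2) / n" if "y \<in> carrier_vec d" for y
    using weighted_cov_bilinear[OF x that that, where w = "\<lambda>_. 1"] by (simp add: sample_cov_def power2_eq_square)
  have nonneg: "0 \<le> l k" if k: "k < d" for k
  proof -
    have "0 \<le> v k \<bullet> (?S *\<^sub>v v k)" unfolding quad[OF e(5)[OF k]] by (intro divide_nonneg_nonneg sum_nonneg) auto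
    then show ?thesis using e(3,5)[OF k] onb_prod[OF e(2) k k] by simp
  qed
  have "\<not> 0 < l n"
  proof
    assume ln: "0 < l n"
    \<comment> \<open>The \<open>n\<close> observations together with the eigenvectors at positions
      \<open>n + 1\<close> and beyond impose \<open>d - 1\<close> conditions. A nonzero vector
      meeting them has vanishing quadratic form yet lies in the span of eigenvectors with positive
      eigenvalues, if \<open>l n\<close> is positive. So \<open>l n = l (n + 1) = 0\<close>, the
      announced tie.\<close>
    define I where "I = Inl ` {1..n} \<union> Inr ` {n+1..<d}"
    define y where "y = case_sum x v"
    have "card I = n + (d - (n + 1))" unfolding I_def by (subst card_Un_disjoint) (auto simp: card_image)
    then have "finite I" "card I < d" using dn by (auto simp: I_def)
    moreover have "y i \<in> carrier_vec d" if "i \<in> I" for i using that x e(5) by (auto simp: I_def y_def)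
    ultimately obtain z where z: "z \<in> carrier_vec d" "z \<noteq> 0\<^sub>v d" "\<And>i. i \<in> I \<Longrightarrow> y i \<bullet> z = 0"
      using ex_nonzero_orthogonal[of I d y] by blast
    have zx: "z \<bullet> x k = 0" if "k \<in> {1..n}" for k
      using z(3)[of "Inl k"] that comm_scalar_prod[OF z(1) x[OF that]] by (auto simp: I_def y_def)
    have zv: "z \<bullet> v k = 0" if "n + 1 \<le> k" "k < d" for k
      using z(3)[of "Inr k"] that comm_scalar_prod[OF z(1) e(5)[OF that(2)]] by (auto simp: I_def y_def)
    have zero: "z \<bullet> (?S *\<^sub>v z) = 0" unfolding quad[OF z(1)] using zx by simp
    obtain k where k: "k < d" "z \<bullet> v k \<noteq> 0" using onb_ex_nonzero_coord[OF e(2) z(1,2)] .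
    then have kn: "k \<le> n" using zv[of k] by (cases "k \<le> n") auto
    then have "0 < l k" using e(4)[OF kn] ln dn by simp
    then have "0 < (\<Sum>k<d. l k * (z \<bullet> v k)\<^sup>2)" using k nonneg by (intro sum_pos2[of _ k]) auto
    then show False using quadratic_form[OF es z(1)] zero by simp
  qed
  then have "l n = 0" using nonneg[of n] dn by simp
  moreover have "l (n + 1) = 0" using e(4)[of n "n + 1"] nonneg[of "n + 1"] dn calculation by simp
  ultimately have "map l [0..<d] ! n = map l [0..<d] ! (n + 1)" using dn by simp
  then show False using dist dn unfolding eigs_eq[OF es] by (simp only: nth_eq_iff_index_eq length_map length_upt)
qed

lemma weighted_cov_mmat:
  assumes x: "\<And>k \<omega>. k \<in> {1..n} \<Longrightarrow> \<omega> \<in> space N \<Longrightarrow> x \<omega> k \<in> carrier_vec d"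
    and xm: "\<And>k a. k \<in> {1..n} \<Longrightarrow> a < d \<Longrightarrow> (\<lambda>\<omega>. x \<omega> k $ a) \<in> borel_measurable N"
    and wm: "\<And>k. k \<in> {1..n} \<Longrightarrow> (\<lambda>\<omega>. w \<omega> k) \<in> borel_measurable N"
  shows "mmat N d (\<lambda>\<omega>. weighted_cov n d (w \<omega>) (x \<omega>))"
  unfolding mmat_def
proof (intro conjI ballI allI impI)
  fix a b assume ab: "a < d" "b < d"
  have "(\<lambda>\<omega>. \<Sum>k=1..n. w \<omega> k * (x \<omega> k $ a * x \<omega> k $ b)) \<in> borel_measurable N"
  proof (rule borel_measurable_sum)
    fix k assume k: "k \<in> {1..n}"
    have "(\<lambda>\<omega>. x \<omega> k $ a * x \<omega> k $ b) \<in> borel_measurable N"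
      using xm[OF k ab(1)] xm[OF k ab(2)] by (rule borel_measurable_times)
    with wm[OF k] show "(\<lambda>\<omega>. w \<omega> k * (x \<omega> k $ a * x \<omega> k $ b)) \<in> borel_measurable N" by (rule borel_measurable_times)
  qed
  with borel_measurable_const have m: "(\<lambda>\<omega>. 1 / n * (\<Sum>k=1..n. w \<omega> k * (x \<omega> k $ a * x \<omega> k $ b))) \<in> borel_measurable N"
    by (rule borel_measurable_times)
  have "(\<lambda>\<omega>. weighted_cov n d (w \<omega>) (x \<omega>) $$ (a, b)) \<in> borel_measurable N \<longleftrightarrow>
    (\<lambda>\<omega>. 1 / n * (\<Sum>k=1..n. w \<omega> k * (x \<omega> k $ a * x \<omega> k $ b))) \<in> borel_measurable N"
  proof (rule measurable_cong)
    fix \<omega> assume w: "\<omega> \<in> space N"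
    show "weighted_cov n d (w \<omega>) (x \<omega>) $$ (a, b) = 1 / n * (\<Sum>k=1..n. w \<omega> k * (x \<omega> k $ a * x \<omega> k $ b))"
      by (rule weighted_cov_entry) (use x w ab in auto)
  qed
  then show "(\<lambda>\<omega>. weighted_cov n d (w \<omega>) (x \<omega>) $$ (a, b)) \<in> borel_measurable N" using m by (rule iffD2)
qed simp

section \<open>One problem in the eigenbasis of its covariance matrix; normalised scores\<close>

locale problem_setting =
  fixes p :: problem and l u
  assumes valid: "valid_problem p" and cov_es: "eigsys (dim p) (Cov p) l u"

sublocale problem_setting \<subseteq> spectral_groups "dim p" "Cov p" l u
proof
  show "eigsys (dim p) (Cov p) l u" by (rule cov_es)
  show "0 < l i" if "i < dim p" for i
    using valid that spectrum_eq[OF cov_es] by (auto simp: valid_problem_def)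
qed

sublocale problem_setting \<subseteq> frame "dim p" "card (idx p)" "P0 p" "G1 p" "G2 p" "s1 p" "s2 p"
  by unfold_locales (use valid in \<open>simp add: valid_problem_def\<close>)

context problem_setting
begin

abbreviation "d \<equiv> dim p"

lemma u_carrier: "i < d \<Longrightarrow> u i \<in> carrier_vec d"
  using eigsysD(5)[OF cov_es] .

lemma grps_subset: "grps p \<subseteq> {1..q}"
  using valid by (auto simp: valid_problem_def)

definition "U = (\<Union>r\<in>grps p. G r)"

lemma PJ_fmat: "PJ p = fmat d (\<lambda>i. of_bool (i \<in> U)) u"
  unfolding PJ_def U_def by (rule PJ_eq[OF grps_subset])

text \<open>The factor 48 is 24 from the perturbation theorem times 2 from the comparison of the
  block norm with the Frobenius norm.\<close>

lemma pnorm_perturbation: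
  assumes B: "B \<in> carrier_mat d d" "B\<^sup>T = B"
    and E: "\<And>i j. i < d \<Longrightarrow> j < d \<Longrightarrow> \<bar>u i \<bullet> (B *\<^sub>v u j) - u i \<bullet> (Cov p *\<^sub>v u j)\<bar> \<le> x * sqrt (l i * l j)"
    and x: "0 \<le> x" and small: "\<And>r. r \<in> grps p \<Longrightarrow> 4 * x * rel_rank d (Cov p) r \<le> 1"
  shows "pnorm p (index_proj d B (idx p) - PJ p) \<le> 48 * (x * dbar d (Cov p) (grps p) powr (1/2) + x\<^sup>2 * dsf d (Cov p) (grps p) powr (3/2))"
    and "index_proj d B (idx p) \<in> carrier_mat d d"
proof -
  obtain lt v where b: "eigsys d B lt v" by (rule symmetric_eigsys[OF B])
  show c: "index_proj d B (idx p) \<in> carrier_mat d d" unfolding index_proj_eq[OF b] by simp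
  have c2: "index_proj d B (idx p) - PJ p \<in> carrier_mat d d" unfolding PJ_fmat by (intro minus_carrier_mat) simp
  have "pnorm p (index_proj d B (idx p) - PJ p) \<le> 2 * frob (index_proj d B (idx p) - PJ p)"
    unfolding pnorm_def by (rule frame_norm_le_frob[OF c2])
  also have "frob (index_proj d B (idx p) - PJ p) = sqrt (frob2 d (index_proj d B (idx p) - PJ p))"
    by (rule frob_frob2[OF c2])
  also have "\<dots> \<le> 24 * (x * dbar d (Cov p) (grps p) powr (1/2) + x\<^sup>2 * dsf d (Cov p) (grps p) powr (3/2))"
    unfolding PJ_fmat U_def idx_def by (rule index_proj_perturbation[OF b E x grps_subset small])
  finally show "pnorm p (index_proj d B (idx p) - PJ p) \<le> 48 * (x * dbar d (Cov p) (grps p) powr (1/2) + x\<^sup>2 * dsf d (Cov p) (grps p) powr (3/2))"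
    by simp
qed

lemma PJ_carrier: "PJ p \<in> carrier_mat d d"
  unfolding PJ_fmat by simp

lemma P0_carrier: "P0 p \<in> carrier_mat d d"
  using valid by (simp add: valid_problem_def is_projector_def)

lemma prob_law: "prob_space (law p)"
  using valid by (simp add: valid_problem_def)

lemma sets_law: "sets (law p) = sets (borel_vec d)"
  using valid by (simp add: valid_problem_def)

lemma space_law: "space (law p) = carrier_vec d"
  using sets_eq_imp_space_eq[OF sets_law] by (simp add: space_borel_vec)

lemma law_scalar_prod: "(\<lambda>x. a \<bullet> x) \<in> borel_measurable (law p)"
  using borel_vec_scalar_prod[of a d] by (simp add: measurable_cong_sets[OF sets_law refl])

lemma cov_bilinear:
  assumes a: "a \<in> carrier_vec d" and b: "b \<in> carrier_vec d"
  shows "integrable (law p) (\<lambda>x. (a \<bullet> x) * (b \<bullet> x))" "(\<integral>x. (a \<bullet> x) * (b \<bullet> x) \<partial>law p) = a \<bullet> (Cov p *\<^sub>v b)"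
proof -
  have int: "integrable (law p) (\<lambda>x. x $ i * x $ j)" if "i < d" "j < d" for i j
    using valid that by (simp add: valid_problem_def)
  have eq: "(a \<bullet> x) * (b \<bullet> x) = (\<Sum>i<d. \<Sum>j<d. (a $ i * b $ j) * (x $ i * x $ j))" if "x \<in> space (law p)" for x
    using that by (simp add: space_law scalar_prod_sum sum_product mult_ac)
  have int2: "integrable (law p) (\<lambda>x. \<Sum>i<d. \<Sum>j<d. (a $ i * b $ j) * (x $ i * x $ j))"
    using int by (intro Bochner_Integration.integrable_sum integrable_mult_right) auto
  have "integrable (law p) (\<lambda>x. (a \<bullet> x) * (b \<bullet> x)) = integrable (law p) (\<lambda>x. \<Sum>i<d. \<Sum>j<d. (a $ i * b $ j) * (x $ i * x $ j))"
    by (rule Bochner_Integration.integrable_cong[OF refl]) (rule eq)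
  then show "integrable (law p) (\<lambda>x. (a \<bullet> x) * (b \<bullet> x))" using int2 by (rule iffD2)
  have "(\<integral>x. (a \<bullet> x) * (b \<bullet> x) \<partial>law p) = (\<integral>x. (\<Sum>i<d. \<Sum>j<d. (a $ i * b $ j) * (x $ i * x $ j)) \<partial>law p)"
    by (rule Bochner_Integration.integral_cong[OF refl]) (rule eq)
  also have "\<dots> = (\<Sum>i<d. \<Sum>j<d. (a $ i * b $ j) * (\<integral>x. x $ i * x $ j \<partial>law p))"
  proof -
    have "(\<integral>x. (\<Sum>i<d. \<Sum>j<d. (a $ i * b $ j) * (x $ i * x $ j)) \<partial>law p) = (\<Sum>i<d. \<integral>x. (\<Sum>j<d. (a $ i * b $ j) * (x $ i * x $ j)) \<partial>law p)"
      using int by (intro Bochner_Integration.integral_sum Bochner_Integration.integrable_sum integrable_mult_right) auto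
    also have "\<dots> = (\<Sum>i<d. \<Sum>j<d. \<integral>x. (a $ i * b $ j) * (x $ i * x $ j) \<partial>law p)"
      using int by (intro sum.cong refl Bochner_Integration.integral_sum integrable_mult_right) auto
    finally show ?thesis by simp
  qed
  also have "\<dots> = a \<bullet> (Cov p *\<^sub>v b)"
    using a b by (simp add: Cov_def cov_mat_def scalar_prod_def lessThan_atLeast0 sum_distrib_left mult_ac)
  finally show "(\<integral>x. (a \<bullet> x) * (b \<bullet> x) \<partial>law p) = a \<bullet> (Cov p *\<^sub>v b)" .
qed

lemma cov_eigen: "i < d \<Longrightarrow> j < d \<Longrightarrow> u i \<bullet> (Cov p *\<^sub>v u j) = of_bool (i = j) * l i"
  using eigsysD(3)[OF cov_es, of j] u_carrier[of i] u_carrier[of j] onb_prod[OF eigsysD(2)[OF cov_es], of i j] by (cases "i = j") simp_all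

text \<open>Turns the \<psi>-norm hypothesis, which concerns the whitened vector in all directions,
  into one on the score of \<open>X\<close> along the eigenvector \<open>u i\<close>, divided by its
  standard deviation.\<close>

lemma whitened:
  assumes i: "i < d" and x: "x \<in> carrier_vec d"
  shows "u i \<bullet> (psd_sqrt d (inv_mat d (Cov p)) *\<^sub>v x) = (u i \<bullet> x) / sqrt (l i)"
proof -
  note e = eigsysD[OF cov_es]
  have nz: "l k \<noteq> 0" if "k < d" for k using pos[OF that] by simp
  define A where "A = fmat d (\<lambda>k. 1 / l k) u"
  have inv: "inv_mat d (Cov p) = A" unfolding A_def by (rule inv_mat_eq[OF cov_es nz])
  txt \<open>The inverse lists its eigenvalues in the reverse order.\<close>
  define r where "r k = d - 1 - k" for k
  have rd: "r k < d" if "k < d" for k using that by (auto simp: r_def)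
  have ar: "eigsys d A (\<lambda>k. 1 / l (r k)) (\<lambda>k. u (r k))"
    unfolding eigsys_def
  proof (intro conjI allI impI)
    show "A \<in> carrier_mat d d" by (simp add: A_def)
    show "onb d (\<lambda>k. u (r k))"
      unfolding onb_def using rd u_carrier onb_prod[OF e(2)] by (auto simp: r_def)
    show "A *\<^sub>v u (r k) = (1 / l (r k)) \<cdot>\<^sub>v u (r k)" if "k < d" for k
      unfolding A_def by (rule fmat_eig[OF e(2) rd[OF that]])
    show "1 / l (r j) \<le> 1 / l (r i)" if "i \<le> j" "j < d" for i j
    proof -
      have "l (r i) \<le> l (r j)" by (rule e(4)) (use that in \<open>auto simp: r_def\<close>)
      then show ?thesis using pos[OF rd[of i]] that by (intro divide_left_mono mult_pos_pos) (auto intro: pos rd)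
    qed
  qed
  have sq: "psd_sqrt d A = fmat d (\<lambda>k. sqrt (1 / l (r k))) (\<lambda>k. u (r k))"
    by (rule psd_sqrt_eq[OF ar]) (use pos rd in \<open>auto intro: less_imp_le\<close>)
  have rr: "r (r i) = i" using i by (auto simp: r_def)
  have onb: "onb d (\<lambda>k. u (r k))" using eigsysD(2)[OF ar] .
  have "u (r (r i)) \<bullet> (psd_sqrt d A *\<^sub>v x) = (psd_sqrt d A *\<^sub>v x) \<bullet> u (r (r i))"
    using x u_carrier[OF rd[OF rd[OF i]]] unfolding sq by (intro comm_scalar_prod[of _ d] mult_mat_vec_carrier[of _ d d]) auto
  also have "\<dots> = sqrt (1 / l (r (r i))) * (x \<bullet> u (r (r i)))"
    unfolding sq by (rule fmat_scalar[OF onb x rd[OF i]])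
  finally show ?thesis unfolding rr inv using comm_scalar_prod[OF x u_carrier[OF i]] by (simp add: real_sqrt_divide)
qed

end

locale problem_moments = problem_setting +
  fixes \<beta> c :: real
  assumes beta: "0 < \<beta>" and psi: "psi_norm_sup \<beta> p \<le> ennreal c"
begin

text \<open>The expectation bound for \<open>2 + score i x ^ 64 + score j x ^ 64\<close>, which
  dominates the sixteenth power of a product of two scores; it also covers the sixteenth power of a
  fourth power.\<close>

definition "K = 2 * (1 + moment_const \<beta>)"

lemma moment_const_nonneg: "0 \<le> moment_const \<beta>"
  by (simp add: moment_const_def)

lemma K_ge: "2 \<le> K" "1 + moment_const \<beta> \<le> K" "2 * moment_const \<beta> \<le> K"
  using moment_const_nonneg by (auto simp: K_def)

lemma score_moment:
  assumes i: "i < d" and e: "c < e" "0 < e"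
  shows "integrable (law p) (\<lambda>x. ((u i \<bullet> x) / (sqrt (l i) * e)) ^ 64)"
    "(\<integral>x. ((u i \<bullet> x) / (sqrt (l i) * e)) ^ 64 \<partial>law p) \<le> moment_const \<beta>"
proof -
  define W where "W x = u i \<bullet> (psd_sqrt d (inv_mat d (Cov p)) *\<^sub>v x)" for x
  have Weq: "W x = (u i \<bullet> x) / sqrt (l i)" if "x \<in> space (law p)" for x
    unfolding W_def using that by (intro whitened[OF i]) (simp add: space_law)
  have "(\<lambda>x. (u i \<bullet> x) / sqrt (l i)) \<in> borel_measurable (law p)"
    using law_scalar_prod[of "u i"] borel_measurable_const by (rule borel_measurable_divide)
  moreover have "W \<in> borel_measurable (law p) \<longleftrightarrow> (\<lambda>x. (u i \<bullet> x) / sqrt (l i)) \<in> borel_measurable (law p)"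
    by (rule measurable_cong) (rule Weq)
  ultimately have Wm: "W \<in> borel_measurable (law p)" by (rule iffD2[rotated])
  have "vnorm (u i) = 1" using onb_prod[OF eigsysD(2)[OF cov_es] i i] by (simp add: vnorm_def)
  then have "psi_norm \<beta> (law p) W \<le> psi_norm_sup \<beta> p"
    unfolding psi_norm_sup_def W_def using u_carrier[OF i] by (intro SUP_upper2[of "u i"]) auto
  then have "psi_norm \<beta> (law p) W \<le> ennreal c" using psi by (rule order_trans)
  note m = psi_norm_moment[OF prob_law Wm beta this e]
  have eq: "(W x / e) ^ 64 = ((u i \<bullet> x) / (sqrt (l i) * e)) ^ 64" if "x \<in> space (law p)" for x
    using Weq[OF that] by simp
  show "integrable (law p) (\<lambda>x. ((u i \<bullet> x) / (sqrt (l i) * e)) ^ 64)"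
    by (rule Bochner_Integration.integrable_cong[THEN iffD1, OF refl _ m(1)]) (rule eq)
  show "(\<integral>x. ((u i \<bullet> x) / (sqrt (l i) * e)) ^ 64 \<partial>law p) \<le> moment_const \<beta>"
  proof -
    have "(\<integral>x. (W x / e) ^ 64 \<partial>law p) = (\<integral>x. ((u i \<bullet> x) / (sqrt (l i) * e)) ^ 64 \<partial>law p)"
      by (rule Bochner_Integration.integral_cong[OF refl]) (rule eq)
    then show ?thesis using m(2) by simp
  qed
qed

text \<open>The standardised score has second moment 1, so after division by \<open>e\<close> it is
  \<open>1 / e\<^sup>2\<close>, while a second moment is at most 1 plus the 64th moment.
  Consequently \<open>c\<close> cannot be small, which later allows constants that do not scale with
  \<open>c\<^sup>2\<close> to be absorbed into a multiple of it.\<close>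

lemma scale_bound:
  assumes d0: "0 < d" and e: "c < e" "0 < e"
  shows "1 \<le> e\<^sup>2 * (1 + moment_const \<beta>)"
proof -
  interpret prob_space "law p" by (rule prob_law)
  define y where "y x = (u 0 \<bullet> x) / (sqrt (l 0) * e)" for x
  have l0: "0 < l 0" using pos[OF d0] .
  have y2: "(y x)\<^sup>2 = (u 0 \<bullet> x) * (u 0 \<bullet> x) * (1 / (l 0 * e\<^sup>2))" for x
    using l0 by (simp add: y_def power_divide power_mult_distrib power2_eq_square)
  have int: "integrable (law p) (\<lambda>x. (y x)\<^sup>2)" unfolding y2
    by (intro integrable_mult_left cov_bilinear u_carrier[OF d0])
  have E: "(\<integral>x. (y x)\<^sup>2 \<partial>law p) = 1 / e\<^sup>2"
    unfolding y2 using l0 cov_bilinear(2)[OF u_carrier[OF d0] u_carrier[OF d0]] cov_eigen[OF d0 d0] by simp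
  have int64: "integrable (law p) (\<lambda>x. y x ^ 64)" unfolding y_def by (rule score_moment(1)[OF d0 e])
  have "(\<integral>x. (y x)\<^sup>2 \<partial>law p) \<le> (\<integral>x. 1 + y x ^ 64 \<partial>law p)"
  proof (rule integral_mono[OF int])
    show "integrable (law p) (\<lambda>x. 1 + y x ^ 64)" using int64 by simp
    fix x
    show "(y x)\<^sup>2 \<le> 1 + y x ^ 64"
    proof (cases "(y x)\<^sup>2 \<le> 1")
      case True then show ?thesis by (simp add: add_increasing2)
    next
      case False
      then have "(y x)\<^sup>2 ^ 1 \<le> (y x)\<^sup>2 ^ 32" by (intro power_increasing) auto
      then show ?thesis by (simp flip: power_mult)
    qed
  qed
  also have "\<dots> = 1 + (\<integral>x. y x ^ 64 \<partial>law p)" using int64 by (simp add: prob_space)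
  also have "\<dots> \<le> 1 + moment_const \<beta>" unfolding y_def using score_moment(2)[OF d0 e] by simp
  finally show ?thesis using e(2) unfolding E by (simp add: field_simps)
qed

text \<open>Otherwise \<open>scale_bound\<close> would hold for every positive \<open>e\<close>. The
  chosen \<open>e\<close> turns its right-hand side into \<open>e / 2\<close>, which is at most
  1/4.\<close>

lemma c_pos:
  assumes d0: "0 < d"
  shows "0 < c"
proof (rule ccontr)
  assume "\<not> 0 < c"
  define M where "M = 1 + moment_const \<beta>"
  define e where "e = 1 / (2 * M)"
  have e0: "0 < e" "c < e" using moment_const_nonneg \<open>\<not> 0 < c\<close>
    by (auto simp: e_def M_def intro!: divide_pos_pos order_le_less_trans[of c 0])
  have "M \<noteq> 0" using moment_const_nonneg unfolding M_def by linarith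
  then have "e\<^sup>2 * (1 + moment_const \<beta>) = e / 2" unfolding M_def[symmetric] by (simp add: e_def power2_eq_square)
  moreover have "e \<le> 1 / 2" using moment_const_nonneg unfolding e_def M_def by (intro divide_left_mono) auto
  ultimately show False using scale_bound[OF d0 e0(2,1)] by simp
qed

text \<open>The scale \<open>2 * c\<close> lies strictly above \<open>c\<close>, as the moment bound
  requires.\<close>

definition "score i x = (u i \<bullet> x) / (sqrt (l i) * (2 * c))"

lemma score_measurable: "score i \<in> borel_measurable (law p)"
  unfolding score_def using law_scalar_prod[of "u i"] borel_measurable_const by (rule borel_measurable_divide)

lemma score_facts:
  assumes d0: "0 < d" and i: "i < d"
  shows "integrable (law p) (\<lambda>x. score i x ^ 64)" "(\<integral>x. score i x ^ 64 \<partial>law p) \<le> moment_const \<beta>"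
  unfolding score_def using score_moment[OF i, of "2 * c"] c_pos[OF d0] by auto

lemma score_cov:
  assumes "i < d" "j < d"
  shows "(\<integral>x. score i x * score j x \<partial>law p) = of_bool (i = j) / (4 * c\<^sup>2)"
proof -
  have "(\<integral>x. score i x * score j x \<partial>law p) = (\<integral>x. (u i \<bullet> x) * (u j \<bullet> x) / (sqrt (l i) * sqrt (l j) * (4 * c\<^sup>2)) \<partial>law p)"
    by (simp add: score_def power2_eq_square mult_ac)
  also have "\<dots> = of_bool (i = j) * l i / (sqrt (l i) * sqrt (l j) * (4 * c\<^sup>2))"
    using cov_bilinear(2)[OF u_carrier u_carrier] cov_eigen assms by simp
  also have "\<dots> = of_bool (i = j) / (4 * c\<^sup>2)"
    using pos[OF assms(1)] by (auto simp: real_sqrt_mult[symmetric] power2_eq_square)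
  finally show ?thesis .
qed

end

lemma measure_double_union_le:
  assumes "\<And>i j. i < d \<Longrightarrow> j < d \<Longrightarrow> A i j \<in> sets M" "\<And>i j. i < d \<Longrightarrow> j < d \<Longrightarrow> measure M (A i j) \<le> b"
  shows "measure M (\<Union>i<d. \<Union>j<d. A i j) \<le> real d ^ 2 * b" "(\<Union>i<d. \<Union>j<d. A i j) \<in> sets M"
proof -
  have "measure M (\<Union>i<d. \<Union>j<d. A i j) \<le> (\<Sum>i<d. measure M (\<Union>j<d. A i j))"
    using assms(1) by (intro measure_UNION_le sets.finite_UN) auto
  also have "\<dots> \<le> (\<Sum>i<d. \<Sum>j<d. measure M (A i j))"
    using assms(1) by (intro sum_mono measure_UNION_le) auto
  also have "\<dots> \<le> (\<Sum>i<d. \<Sum>j<d. b)" using assms(2) by (intro sum_mono) auto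
  finally show "measure M (\<Union>i<d. \<Union>j<d. A i j) \<le> real d ^ 2 * b" by (simp add: power2_eq_square)
  show "(\<Union>i<d. \<Union>j<d. A i j) \<in> sets M" using assms(1) by (intro sets.finite_UN) auto
qed

section \<open>Good events for the data and for the two resampling schemes\<close>

context problem_moments
begin

definition "eps n = sqrt (ln (real n) / real n)"

text \<open>The first clause compares the sample covariance with the truth. The second bounds
  empirical fourth moments, which control the conditional variance of the multiplier sums.\<close>

definition "good n x \<longleftrightarrow>
  (\<forall>i<d. \<forall>j<d. \<bar>(\<Sum>k=1..n. score i (x k) * score j (x k)) / n - of_bool (i = j) / (4 * c\<^sup>2)\<bar> \<le> (4 + 2 * K) * eps n)
  \<and> (\<forall>i<d. (\<Sum>k=1..n. score i (x k) ^ 4) / n \<le> 5 + 3 * K)"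

lemma eps_le_1: "eps n \<le> 1"
proof (cases "n = 0")
  case False
  then have "ln (real n) \<le> real n" using ln_le_minus_one[of "real n"] by simp
  then show ?thesis using False by (simp add: eps_def)
qed (simp add: eps_def)

lemma eps_nonneg: "0 \<le> eps n"
  by (cases "n = 0") (auto simp: eps_def intro!: divide_nonneg_nonneg)

lemma good_event:
  assumes d0: "0 < d" and n: "3 \<le> n"
  obtains Bad where "Bad \<in> sets (data_law n p)" "measure (data_law n p) Bad \<le> real d ^ 2 * (4 * (1 + K) / real n ^ 3)"
    "\<And>x. x \<in> space (data_law n p) \<Longrightarrow> x \<notin> Bad \<Longrightarrow> good n x"
proof -
  interpret prob_space "law p" by (rule prob_law)
  define b where "b = 2 * (1 + K) / real n ^ 3"
  have b0: "0 \<le> b" using K_ge by (simp add: b_def)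
  define dev where "dev Y = {x \<in> space (data_law n p). (4 + 2 * K) * eps n < \<bar>(\<Sum>k=1..n. Y (x k)) / n - (\<integral>x. Y x \<partial>law p)\<bar>}" for Y :: "real vec \<Rightarrow> real"
  have pw: "\<bar>y\<bar> ^ k \<le> 1 + y ^ 64" if "k \<le> 64" for y :: real and k
  proof (cases "\<bar>y\<bar> \<le> 1")
    case True
    then have "\<bar>y\<bar> ^ k \<le> 1" by (simp add: power_le_one)
    then show ?thesis by (simp add: add_increasing2)
  next
    case False
    then have "\<bar>y\<bar> ^ k \<le> \<bar>y\<bar> ^ 64" using that by (intro power_increasing) auto
    then show ?thesis by (simp add: power_even_abs)
  qed
  have dev: "dev Y \<in> sets (data_law n p) \<and> measure (data_law n p) (dev Y) \<le> b"
    if Y: "Y \<in> borel_measurable (law p)" and int: "integrable (law p) (\<lambda>x. Y x ^ 16)" and KY: "(\<integral>x. Y x ^ 16 \<partial>law p) \<le> K" for Y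
  proof
    have "(\<lambda>x. \<Sum>k=1..n. Y (x k)) \<in> borel_measurable (data_law n p)"
      unfolding data_law_def
    proof (rule borel_measurable_sum)
      fix k assume "k \<in> {1..n}"
      from measurable_component_singleton[OF this] Y show "(\<lambda>x. Y (x k)) \<in> borel_measurable (Pi\<^sub>M {1..n} (\<lambda>i. law p))"
        by (rule measurable_compose)
    qed
    then have "(\<lambda>x. \<bar>(\<Sum>k=1..n. Y (x k)) / n - (\<integral>x. Y x \<partial>law p)\<bar>) \<in> borel_measurable (data_law n p)"
      by simp
    with borel_measurable_const show "dev Y \<in> sets (data_law n p)" unfolding dev_def by (rule borel_measurable_less)
    have "card {1..n} = n" by simp
    from iid_deviation[OF Y int KY finite_atLeastAtMost this n]
    show "measure (data_law n p) (dev Y) \<le> b" by (simp add: dev_def data_law_def b_def eps_def)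
  qed
  define Yp where "Yp i j x = score i x * score j x" for i j x
  define Yq where "Yq i x = score i x ^ 4" for i x
  have Yp: "dev (Yp i j) \<in> sets (data_law n p) \<and> measure (data_law n p) (dev (Yp i j)) \<le> b" if ij: "i < d" "j < d" for i j
  proof (rule dev)
    show m: "Yp i j \<in> borel_measurable (law p)"
      unfolding Yp_def using score_measurable[of i] score_measurable[of j] by (rule borel_measurable_times)
    have le: "Yp i j x ^ 16 \<le> 2 + score i x ^ 64 + score j x ^ 64" for x
    proof -
      have "2 * (score i x ^ 16 * score j x ^ 16) \<le> (score i x ^ 16)\<^sup>2 + (score j x ^ 16)\<^sup>2"
        using sum_squares_bound[of "score i x ^ 16" "score j x ^ 16"] by simp
      moreover have "0 \<le> score i x ^ 16 * score j x ^ 16" by simp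
      ultimately have "score i x ^ 16 * score j x ^ 16 \<le> (score i x ^ 16)\<^sup>2 + (score j x ^ 16)\<^sup>2" by linarith
      then have "Yp i j x ^ 16 \<le> (score i x ^ 16)\<^sup>2 + (score j x ^ 16)\<^sup>2" by (simp add: Yp_def power_mult_distrib)
      then show ?thesis using pw[of 32 "score i x"] pw[of 32 "score j x"] by (simp flip: power_mult)
    qed
    have int: "integrable (law p) (\<lambda>x. 2 + score i x ^ 64 + score j x ^ 64)"
      using score_facts(1)[OF d0 ij(1)] score_facts(1)[OF d0 ij(2)] by simp
    show int16: "integrable (law p) (\<lambda>x. Yp i j x ^ 16)"
    proof (rule Bochner_Integration.integrable_bound[OF int])
      show "(\<lambda>x. Yp i j x ^ 16) \<in> borel_measurable (law p)" using m by (rule borel_measurable_power)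
      show "AE x in law p. norm (Yp i j x ^ 16) \<le> norm (2 + score i x ^ 64 + score j x ^ 64)"
        using le by (intro AE_I2) (simp add: abs_of_nonneg)
    qed
    have "(\<integral>x. Yp i j x ^ 16 \<partial>law p) \<le> (\<integral>x. 2 + score i x ^ 64 + score j x ^ 64 \<partial>law p)"
      by (rule integral_mono[OF int16 int le])
    also have "\<dots> \<le> K"
      using score_facts[OF d0 ij(1)] score_facts[OF d0 ij(2)] by (simp add: prob_space K_def)
    finally show "(\<integral>x. Yp i j x ^ 16 \<partial>law p) \<le> K" .
  qed
  have Yq: "dev (Yq i) \<in> sets (data_law n p) \<and> measure (data_law n p) (dev (Yq i)) \<le> b" if i: "i < d" for i
  proof (rule dev)
    show "Yq i \<in> borel_measurable (law p)" unfolding Yq_def using score_measurable[of i] by (rule borel_measurable_power)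
    have eq: "Yq i x ^ 16 = score i x ^ 64" for x by (simp add: Yq_def flip: power_mult)
    show "integrable (law p) (\<lambda>x. Yq i x ^ 16)" "(\<integral>x. Yq i x ^ 16 \<partial>law p) \<le> K"
      unfolding eq using score_facts[OF d0 i] K_ge moment_const_nonneg by auto
  qed
  have EYq: "(\<integral>x. Yq i x \<partial>law p) \<le> K" if i: "i < d" for i
  proof -
    have int: "integrable (law p) (\<lambda>x. 1 + score i x ^ 64)" using score_facts(1)[OF d0 i] by simp
    have le: "Yq i x \<le> 1 + score i x ^ 64" for x using pw[of 4 "score i x"] by (simp add: Yq_def power_even_abs)
    have m: "Yq i \<in> borel_measurable (law p)" unfolding Yq_def using score_measurable[of i] by (rule borel_measurable_power)
    have "integrable (law p) (Yq i)"
      by (rule Bochner_Integration.integrable_bound[OF int m]) (use le in \<open>auto simp: Yq_def abs_of_nonneg\<close>)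
    then have "(\<integral>x. Yq i x \<partial>law p) \<le> (\<integral>x. 1 + score i x ^ 64 \<partial>law p)" using int le by (rule integral_mono)
    also have "\<dots> \<le> 1 + moment_const \<beta>" using score_facts[OF d0 i] by (simp add: prob_space)
    finally show ?thesis using K_ge by linarith
  qed
  \<comment> \<open>The second union repeats each event for every \<open>j\<close>, so that the same
    estimate serves both families and the total is twice \<open>d\<^sup>2 * b\<close>.\<close>
  define Bad where "Bad = (\<Union>i<d. \<Union>j<d. dev (Yp i j)) \<union> (\<Union>i<d. \<Union>j<d. dev (Yq i))"
  note Bp = measure_double_union_le[of d "\<lambda>i j. dev (Yp i j)" "data_law n p" b]
  note Bq = measure_double_union_le[of d "\<lambda>i j. dev (Yq i)" "data_law n p" b]
  show thesis
  proof (rule that[of Bad])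
    show "Bad \<in> sets (data_law n p)" unfolding Bad_def using Bp(2) Bq(2) Yp Yq by (intro sets.Un) auto
    have "measure (data_law n p) Bad \<le> measure (data_law n p) (\<Union>i<d. \<Union>j<d. dev (Yp i j)) + measure (data_law n p) (\<Union>i<d. \<Union>j<d. dev (Yq i))"
      unfolding Bad_def using Bp(2) Bq(2) Yp Yq by (intro measure_Un_le) auto
    also have "\<dots> \<le> real d ^ 2 * b + real d ^ 2 * b"
      using Bp(1) Bq(1) Yp Yq by (intro add_mono) auto
    also have "\<dots> = real d ^ 2 * (4 * (1 + K) / real n ^ 3)" by (simp add: b_def)
    finally show "measure (data_law n p) Bad \<le> real d ^ 2 * (4 * (1 + K) / real n ^ 3)" .
    fix x assume x: "x \<in> space (data_law n p)" "x \<notin> Bad"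
    show "good n x"
      unfolding good_def
    proof (intro conjI allI impI)
      fix i j assume ij: "i < d" "j < d"
      have "x \<notin> dev (Yp i j)" using x(2) ij by (auto simp: Bad_def)
      then show "\<bar>(\<Sum>k=1..n. score i (x k) * score j (x k)) / n - of_bool (i = j) / (4 * c\<^sup>2)\<bar> \<le> (4 + 2 * K) * eps n"
        using x(1) score_cov[OF ij] by (simp add: dev_def Yp_def)
    next
      fix i assume i: "i < d"
      have "i \<in> {..<d}" using i by simp
      then have "x \<notin> dev (Yq i)" using x(2) unfolding Bad_def by blast
      then have "\<bar>(\<Sum>k=1..n. Yq i (x k)) / n - (\<integral>x. Yq i x \<partial>law p)\<bar> \<le> (4 + 2 * K) * eps n"
        using x(1) by (simp add: dev_def)
      also have "\<dots> \<le> (4 + 2 * K) * 1" using eps_le_1 K_ge by (intro mult_left_mono) auto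
      finally have "(\<Sum>k=1..n. Yq i (x k)) / n - (\<integral>x. Yq i x \<partial>law p) \<le> 4 + 2 * K" by (simp only: abs_le_iff mult_1_right)
      then show "(\<Sum>k=1..n. score i (x k) ^ 4) / n \<le> 5 + 3 * K" using EYq[OF i] unfolding Yq_def by linarith
    qed
  qed
qed

lemma data_carrier: "x \<in> space (data_law n p) \<Longrightarrow> k \<in> {1..n} \<Longrightarrow> x k \<in> carrier_vec d"
  by (auto simp: data_law_def space_PiM space_law PiE_iff)

lemma scalar_score: "0 < d \<Longrightarrow> i < d \<Longrightarrow> u i \<bullet> y = 2 * c * sqrt (l i) * score i y"
  using c_pos pos[of i] by (simp add: score_def)

lemma sample_cov_bilinear:
  assumes x: "\<And>k. k \<in> {1..n} \<Longrightarrow> x k \<in> carrier_vec d" and ij: "i < d" "j < d"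
  shows "u i \<bullet> (sample_cov n d x *\<^sub>v u j) = (\<Sum>k=1..n. (u i \<bullet> x k) * (u j \<bullet> x k)) / n"
  using weighted_cov_bilinear[OF x u_carrier[OF ij(1)] u_carrier[OF ij(2)], where w = "\<lambda>_. 1"] by (simp add: sample_cov_def)

lemma good_sample_cov:
  assumes d0: "0 < d" and x: "x \<in> space (data_law n p)" "good n x" and ij: "i < d" "j < d"
  shows "\<bar>u i \<bullet> (sample_cov n d x *\<^sub>v u j) - u i \<bullet> (Cov p *\<^sub>v u j)\<bar> \<le> 4 * c\<^sup>2 * (4 + 2 * K) * eps n * sqrt (l i * l j)"
proof -
  define s where "s = 4 * c\<^sup>2 * sqrt (l i * l j)"
  have s0: "0 \<le> s" using pos ij by (simp add: s_def less_imp_le)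
  have "(\<Sum>k=1..n. (u i \<bullet> x k) * (u j \<bullet> x k)) = s * (\<Sum>k=1..n. score i (x k) * score j (x k))"
    unfolding scalar_score[OF d0 ij(1)] scalar_score[OF d0 ij(2)]
    by (simp add: s_def sum_distrib_left real_sqrt_mult power2_eq_square mult_ac)
  moreover have "u i \<bullet> (Cov p *\<^sub>v u j) = s * (of_bool (i = j) / (4 * c\<^sup>2))"
    using cov_eigen[OF ij] c_pos[OF d0] pos[OF ij(1)] by (auto simp: s_def less_imp_le)
  ultimately have "u i \<bullet> (sample_cov n d x *\<^sub>v u j) - u i \<bullet> (Cov p *\<^sub>v u j)
    = s * ((\<Sum>k=1..n. score i (x k) * score j (x k)) / n - of_bool (i = j) / (4 * c\<^sup>2))"
    using sample_cov_bilinear[OF data_carrier[OF x(1)] ij] by (simp only: right_diff_distrib times_divide_eq_right)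
  then have "\<bar>u i \<bullet> (sample_cov n d x *\<^sub>v u j) - u i \<bullet> (Cov p *\<^sub>v u j)\<bar> = s * \<bar>(\<Sum>k=1..n. score i (x k) * score j (x k)) / n - of_bool (i = j) / (4 * c\<^sup>2)\<bar>"
    using s0 by (simp add: abs_mult)
  also have "\<dots> \<le> s * ((4 + 2 * K) * eps n)" using x(2) ij s0 unfolding good_def by (intro mult_left_mono) auto
  finally show ?thesis by (simp add: s_def mult_ac)
qed

text \<open>On the good event this bounds the empirical mean square of
  \<open>4 * c\<^sup>2 * score i * score j\<close>, that is, the conditional variance of a rescaled
  multiplier sum up to the factor \<open>1 / n\<close>.\<close>

definition "V = 16 * c ^ 4 * (5 + 3 * K)"

text \<open>Given the data, each entry of the difference of the two covariances is linear in the
  standard normal variables \<open>\<eta> k - 1\<close>. A product of two scores has its square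
  bounded by the mean of their fourth powers, which \<open>good\<close> controls.\<close>

lemma multiplier_event:
  assumes d0: "0 < d" and n: "1 \<le> n" and x: "x \<in> space (data_law n p)" "good n x"
  obtains Bad where "Bad \<in> sets (multiplier_law n)" "measure (multiplier_law n) Bad \<le> real d ^ 2 * (2 / real n ^ 3)"
    "\<And>\<eta> i j. \<eta> \<in> space (multiplier_law n) \<Longrightarrow> \<eta> \<notin> Bad \<Longrightarrow> i < d \<Longrightarrow> j < d \<Longrightarrow>
      \<bar>u i \<bullet> (weighted_cov n d \<eta> x *\<^sub>v u j) - u i \<bullet> (sample_cov n d x *\<^sub>v u j)\<bar> \<le> sqrt (6 * V) * eps n * sqrt (l i * l j)"
proof -
  define y where "y i j k = 4 * c\<^sup>2 * (score i (x k) * score j (x k))" for i j k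
  define A where "A i j = {\<eta> \<in> space (multiplier_law n). sqrt (6 * V) * eps n < \<bar>(\<Sum>k=1..n. (\<eta> k - 1) * y i j k) / n\<bar>}" for i j
  have V0: "0 < V" using c_pos[OF d0] K_ge by (simp add: V_def)
  have n0: "0 < real n" using n by simp
  have ysq: "(\<Sum>k=1..n. (y i j k)\<^sup>2) \<le> n * V" if ij: "i < d" "j < d" for i j
  proof -
    have "(\<Sum>k=1..n. (y i j k)\<^sup>2) \<le> (\<Sum>k=1..n. 16 * c ^ 4 * ((score i (x k) ^ 4 + score j (x k) ^ 4) / 2))"
    proof (rule sum_mono)
      fix k
      have "(score i (x k) * score j (x k))\<^sup>2 \<le> (score i (x k) ^ 4 + score j (x k) ^ 4) / 2"
        using sum_squares_bound[of "score i (x k) ^ 2" "score j (x k) ^ 2"] by (simp add: power_mult_distrib flip: power_mult)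
      then have "16 * c ^ 4 * (score i (x k) * score j (x k))\<^sup>2 \<le> 16 * c ^ 4 * ((score i (x k) ^ 4 + score j (x k) ^ 4) / 2)"
        by (intro mult_left_mono) auto
      then show "(y i j k)\<^sup>2 \<le> 16 * c ^ 4 * ((score i (x k) ^ 4 + score j (x k) ^ 4) / 2)"
        by (simp add: y_def power_mult_distrib flip: power_mult)
    qed
    also have "\<dots> = 16 * c ^ 4 * (((\<Sum>k=1..n. score i (x k) ^ 4) + (\<Sum>k=1..n. score j (x k) ^ 4)) / 2)"
      by (simp only: sum_distrib_left[symmetric] sum.distrib sum_divide_distrib[symmetric])
    also have "\<dots> \<le> 16 * c ^ 4 * ((n * (5 + 3 * K) + n * (5 + 3 * K)) / 2)"
    proof -
      have "(\<Sum>k=1..n. score i (x k) ^ 4) \<le> n * (5 + 3 * K)" if "i < d" for i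
      proof -
        have "(\<Sum>k=1..n. score i (x k) ^ 4) / n \<le> 5 + 3 * K" using x(2) that unfolding good_def by blast
        then show ?thesis using n0 by (simp add: pos_divide_le_eq mult.commute)
      qed
      then show ?thesis using ij by (intro mult_left_mono divide_right_mono add_mono) auto
    qed
    also have "(n * (5 + 3 * K) + n * (5 + 3 * K)) / 2 = n * (5 + 3 * K)" by simp
    finally show ?thesis by (simp only: V_def mult.left_commute[of "real n"])
  qed
  have sm: "(\<lambda>\<eta>. \<eta> k) \<in> borel_measurable (multiplier_law n)" if "k \<in> {1..n}" for k
    using measurable_component_singleton[OF that, of "\<lambda>_. density lborel (\<lambda>t. ennreal (normal_density 1 1 t))"]
    by (simp add: multiplier_law_def measurable_cong_sets[OF refl sets_density])
  have Am: "A i j \<in> sets (multiplier_law n)" for i j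
  proof -
    have "(\<lambda>\<eta>. \<Sum>k=1..n. (\<eta> k - 1) * y i j k) \<in> borel_measurable (multiplier_law n)"
      using sm by (intro borel_measurable_sum borel_measurable_times borel_measurable_diff borel_measurable_const)
    then have "(\<lambda>\<eta>. \<bar>(\<Sum>k=1..n. (\<eta> k - 1) * y i j k) / n\<bar>) \<in> borel_measurable (multiplier_law n)" by simp
    with borel_measurable_const show ?thesis unfolding A_def by (rule borel_measurable_less)
  qed
  have Ab: "measure (multiplier_law n) (A i j) \<le> 2 / real n ^ 3" if ij: "i < d" "j < d" for i j
    using multiplier_deviation[OF ysq[OF ij] V0 finite_atLeastAtMost n] by (simp add: A_def multiplier_law_def eps_def)
  show thesis
  proof (rule that[of "\<Union>i<d. \<Union>j<d. A i j"])
    show "(\<Union>i<d. \<Union>j<d. A i j) \<in> sets (multiplier_law n)" using measure_double_union_le(2)[of d A] Am Ab by blast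
    show "measure (multiplier_law n) (\<Union>i<d. \<Union>j<d. A i j) \<le> real d ^ 2 * (2 / real n ^ 3)"
      using Am Ab by (rule measure_double_union_le(1))
    fix \<eta> i j assume h: "\<eta> \<in> space (multiplier_law n)" "\<eta> \<notin> (\<Union>i<d. \<Union>j<d. A i j)" and ij: "i < d" "j < d"
    have nb: "\<bar>(\<Sum>k=1..n. (\<eta> k - 1) * y i j k) / n\<bar> \<le> sqrt (6 * V) * eps n" using h ij by (force simp: A_def)
    define s where "s = sqrt (l i * l j)"
    have s0: "0 \<le> s" using pos ij by (simp add: s_def less_imp_le)
    have uu: "(u i \<bullet> x k) * (u j \<bullet> x k) = s * y i j k" for k
      unfolding scalar_score[OF d0 ij(1)] scalar_score[OF d0 ij(2)] by (simp add: s_def y_def real_sqrt_mult power2_eq_square mult_ac)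
    have "u i \<bullet> (weighted_cov n d \<eta> x *\<^sub>v u j) - u i \<bullet> (sample_cov n d x *\<^sub>v u j)
      = (\<Sum>k=1..n. \<eta> k * (s * y i j k)) / n - (\<Sum>k=1..n. s * y i j k) / n"
      using weighted_cov_bilinear[OF data_carrier[OF x(1)] u_carrier[OF ij(1)] u_carrier[OF ij(2)], where w = \<eta>]
        sample_cov_bilinear[OF data_carrier[OF x(1)] ij] unfolding uu by simp
    also have "\<dots> = s * ((\<Sum>k=1..n. (\<eta> k - 1) * y i j k) / n)"
    proof -
      have "(\<Sum>k=1..n. \<eta> k * (s * y i j k)) - (\<Sum>k=1..n. s * y i j k) = s * (\<Sum>k=1..n. (\<eta> k - 1) * y i j k)"
        unfolding sum_distrib_left sum_subtractf[symmetric] by (intro sum.cong refl) (simp add: algebra_simps)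
      then show ?thesis by (simp only: diff_divide_distrib[symmetric] times_divide_eq_right)
    qed
    finally have "\<bar>u i \<bullet> (weighted_cov n d \<eta> x *\<^sub>v u j) - u i \<bullet> (sample_cov n d x *\<^sub>v u j)\<bar> = s * \<bar>(\<Sum>k=1..n. (\<eta> k - 1) * y i j k) / n\<bar>"
      using s0 by (simp add: abs_mult)
    also have "\<dots> \<le> s * (sqrt (6 * V) * eps n)" using nb s0 by (rule mult_left_mono)
    finally show "\<bar>u i \<bullet> (weighted_cov n d \<eta> x *\<^sub>v u j) - u i \<bullet> (sample_cov n d x *\<^sub>v u j)\<bar> \<le> sqrt (6 * V) * eps n * sqrt (l i * l j)"
      by (simp add: s_def mult_ac)
  qed
qed

end

lemma psd_sqrt_props:
  assumes A: "is_psd d A"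
  shows "is_psd d (psd_sqrt d A)" "psd_sqrt d A * psd_sqrt d A = A"
proof -
  have Ac: "A \<in> carrier_mat d d" "A\<^sup>T = A" using A by (auto simp: is_psd_def)
  obtain l v where es: "eigsys d A l v" by (rule symmetric_eigsys[OF Ac])
  note e = eigsysD[OF es]
  have pos: "0 \<le> l k" if k: "k < d" for k
  proof -
    have "0 \<le> v k \<bullet> (A *\<^sub>v v k)" using A e(5)[OF k] by (simp add: is_psd_def)
    then show ?thesis using e(3)[OF k] e(5)[OF k] onb_prod[OF e(2) k k] by simp
  qed
  note sq = psd_sqrt_eq[OF es pos]
  have "fmat d (\<lambda>k. sqrt (l k)) v * fmat d (\<lambda>k. sqrt (l k)) v = fmat d l v"
    unfolding fmat_mult[OF e(2)] using pos by (intro fmat_cong) auto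
  then show "psd_sqrt d A * psd_sqrt d A = A" using eigsys_fmat[OF es] sq by simp
  have "is_psd d (fmat d (\<lambda>k. sqrt (l k)) v)"
    using pos by (auto simp: is_psd_def fmat_bilinear[OF e(2)] mult.assoc intro!: sum_nonneg)
  then show "is_psd d (psd_sqrt d A)" using sq by simp
qed

lemma gauss_map_measurable:
  assumes R: "R \<in> carrier_mat d d"
  shows "(\<lambda>g. R *\<^sub>v vec d g) \<in> measurable (gauss_prod d) (borel_vec d)"
proof (rule measurable_borel_vec)
  show "R *\<^sub>v vec d g \<in> carrier_vec d" for g using R by simp
  fix i assume i: "i < d"
  have "(R *\<^sub>v vec d g) $ i = (\<Sum>j<d. R $$ (i, j) * g j)" for g
    using R i by (simp add: scalar_prod_def lessThan_atLeast0)
  then show "(\<lambda>g. (R *\<^sub>v vec d g) $ i) \<in> borel_measurable (gauss_prod d)"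
    using gauss_linear_measurable[where d = d and a = "\<lambda>j. R $$ (i, j)"] by simp
qed

text \<open>Represents the Gaussian sample as an image of standard normal arrays whose law does not
  depend on the data. Concentration and measurability are then questions about one fixed product
  space.\<close>

lemma gauss_sample_law_distr:
  fixes x n p
  defines "R \<equiv> psd_sqrt (dim p) (sample_cov n (dim p) x)"
  assumes R: "R \<in> carrier_mat (dim p) (dim p)"
  shows "gauss_sample_law n p x = distr (Pi\<^sub>M {1..n} (\<lambda>_. gauss_prod (dim p))) (Pi\<^sub>M {1..n} (\<lambda>_. borel_vec (dim p)))
    (compose {1..n} (\<lambda>g. R *\<^sub>v vec (dim p) g))"
    and "compose {1..n} (\<lambda>g. R *\<^sub>v vec (dim p) g) \<in> measurable (Pi\<^sub>M {1..n} (\<lambda>_. gauss_prod (dim p))) (Pi\<^sub>M {1..n} (\<lambda>_. borel_vec (dim p)))"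
proof -
  define G where "G = gauss_vec (dim p) (sample_cov n (dim p) x)"
  have Gd: "G = distr (gauss_prod (dim p)) (borel_vec (dim p)) (\<lambda>g. R *\<^sub>v vec (dim p) g)"
    by (simp add: G_def gauss_vec_def R_def)
  note m = gauss_map_measurable[OF R]
  have sG: "sets G = sets (borel_vec (dim p))" by (simp add: Gd)
  have pG: "prob_space G" unfolding Gd by (rule prob_space.prob_space_distr[OF prob_space_gauss_prod m])
  have mG: "(\<lambda>g. R *\<^sub>v vec (dim p) g) \<in> measurable (gauss_prod (dim p)) G"
    using m by (simp add: measurable_cong_sets[OF refl sG])
  \<comment> \<open>The product theorem is applied with the law \<open>G\<close> itself as target,
    since that must be a probability space. \<open>G\<close> and \<open>borel_vec\<close> have the
    same measurable sets, so the target can be exchanged afterwards.\<close>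
  have "distr (Pi\<^sub>M {1..n} (\<lambda>_. gauss_prod (dim p))) (Pi\<^sub>M {1..n} (\<lambda>_. G)) (compose {1..n} (\<lambda>g. R *\<^sub>v vec (dim p) g))
    = Pi\<^sub>M {1..n} (\<lambda>_. distr (gauss_prod (dim p)) G (\<lambda>g. R *\<^sub>v vec (dim p) g))"
    by (rule distr_PiM_finite_prob_space') (use prob_space_gauss_prod pG mG in auto)
  moreover have "distr (gauss_prod (dim p)) G (\<lambda>g. R *\<^sub>v vec (dim p) g) = G"
    unfolding Gd by (rule distr_cong) simp_all
  moreover have "distr (Pi\<^sub>M {1..n} (\<lambda>_. gauss_prod (dim p))) (Pi\<^sub>M {1..n} (\<lambda>_. G)) (compose {1..n} (\<lambda>g. R *\<^sub>v vec (dim p) g))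
    = distr (Pi\<^sub>M {1..n} (\<lambda>_. gauss_prod (dim p))) (Pi\<^sub>M {1..n} (\<lambda>_. borel_vec (dim p))) (compose {1..n} (\<lambda>g. R *\<^sub>v vec (dim p) g))"
    by (intro distr_cong sets_PiM_cong refl sG)
  ultimately show "gauss_sample_law n p x = distr (Pi\<^sub>M {1..n} (\<lambda>_. gauss_prod (dim p))) (Pi\<^sub>M {1..n} (\<lambda>_. borel_vec (dim p)))
    (compose {1..n} (\<lambda>g. R *\<^sub>v vec (dim p) g))"
    by (simp add: gauss_sample_law_def G_def)
  show "compose {1..n} (\<lambda>g. R *\<^sub>v vec (dim p) g) \<in> measurable (Pi\<^sub>M {1..n} (\<lambda>_. gauss_prod (dim p))) (Pi\<^sub>M {1..n} (\<lambda>_. borel_vec (dim p)))"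
    unfolding compose_def
  proof (rule measurable_restrict)
    fix i assume "i \<in> {1..n}"
    from measurable_component_singleton[OF this] m
    show "(\<lambda>g. R *\<^sub>v vec (dim p) (g i)) \<in> measurable (Pi\<^sub>M {1..n} (\<lambda>_. gauss_prod (dim p))) (borel_vec (dim p))"
      by (rule measurable_compose)
  qed
qed

context problem_moments
begin

lemma sample_borel_coord:
  assumes "k \<in> {1..n}" "a < d"
  shows "(\<lambda>z. z k $ a) \<in> borel_measurable (Pi\<^sub>M {1..n} (\<lambda>_. borel_vec d))"
  using measurable_component_singleton[OF assms(1), of "\<lambda>_. borel_vec d"] borel_vec_coord[OF assms(2)] by (rule measurable_compose)

lemma sample_borel_carrier: "z \<in> space (Pi\<^sub>M {1..n} (\<lambda>_. borel_vec d)) \<Longrightarrow> k \<in> {1..n} \<Longrightarrow> z k \<in> carrier_vec d"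
  by (auto simp: space_PiM space_borel_vec PiE_iff)

text \<open>Conditionally on the data, \<open>u i \<bullet> z k\<close> is a linear form in standard
  normals whose squared coefficient norm is the diagonal entry of the sample covariance at
  \<open>u i\<close>. By the good event and \<open>small\<close> this is at most
  \<open>2 * l i\<close>, which explains the factor 2 in the bound.\<close>

lemma gauss_event:
  assumes d0: "0 < d" and n: "3 \<le> n" and x: "x \<in> space (data_law n p)" "good n x" and small: "4 * c\<^sup>2 * (4 + 2 * K) * eps n \<le> 1"
  obtains Bad where "Bad \<in> sets (gauss_sample_law n p x)" "measure (gauss_sample_law n p x) Bad \<le> real d ^ 2 * (2 * (1 + gauss_const) / real n ^ 3)"
    "\<And>z i j. z \<in> space (gauss_sample_law n p x) \<Longrightarrow> z \<notin> Bad \<Longrightarrow> i < d \<Longrightarrow> j < d \<Longrightarrow>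
      \<bar>u i \<bullet> (sample_cov n d z *\<^sub>v u j) - u i \<bullet> (sample_cov n d x *\<^sub>v u j)\<bar> \<le> 2 * (4 + 2 * gauss_const) * eps n * sqrt (l i * l j)"
proof -
  define S where "S = sample_cov n d x"
  define R where "R = psd_sqrt d S"
  have psd: "is_psd d S" unfolding S_def by (rule sample_cov_psd) (rule data_carrier[OF x(1)])
  have R: "R \<in> carrier_mat d d" "R\<^sup>T = R" "R * R = S"
    using psd_sqrt_props[OF psd] by (auto simp: R_def is_psd_def)
  define C where "C = compose {1..n} (\<lambda>g. R *\<^sub>v vec d g)"
  note law = gauss_sample_law_distr[of p n x, folded S_def, folded R_def, OF R(1), folded C_def]
  let ?P = "Pi\<^sub>M {1..n} (\<lambda>_. gauss_prod d)" and ?B = "Pi\<^sub>M {1..n} (\<lambda>_. borel_vec d)"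
  have sl: "sets (gauss_sample_law n p x) = sets ?B" "space (gauss_sample_law n p x) = space ?B" unfolding law(1) by simp_all
  define s where "s i j = sqrt (l i * l j)" for i j
  define A where "A i j = {z \<in> space ?B. 2 * s i j * (4 + 2 * gauss_const) * eps n
    < \<bar>(\<Sum>k=1..n. (u i \<bullet> z k) * (u j \<bullet> z k)) / n - u i \<bullet> (S *\<^sub>v u j)\<bar>}" for i j
  have Am: "A i j \<in> sets ?B" for i j
  proof -
    have um: "(\<lambda>z. u i \<bullet> z k) \<in> borel_measurable ?B" if "k \<in> {1..n}" for i k
      using measurable_component_singleton[OF that, of "\<lambda>_. borel_vec d"] borel_vec_scalar_prod[of "u i" d] by (rule measurable_compose)
    have "(\<lambda>z. \<Sum>k=1..n. (u i \<bullet> z k) * (u j \<bullet> z k)) \<in> borel_measurable ?B"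
      using um by (intro borel_measurable_sum borel_measurable_times)
    then have "(\<lambda>z. \<bar>(\<Sum>k=1..n. (u i \<bullet> z k) * (u j \<bullet> z k)) / n - u i \<bullet> (S *\<^sub>v u j)\<bar>) \<in> borel_measurable ?B" by simp
    with borel_measurable_const show ?thesis unfolding A_def by (rule borel_measurable_less)
  qed
  have Ru: "R *\<^sub>v u i \<in> carrier_vec d" if "i < d" for i using R(1) u_carrier[OF that] by simp
  have RR: "(R *\<^sub>v u i) \<bullet> (R *\<^sub>v u j) = u i \<bullet> (S *\<^sub>v u j)" if ij: "i < d" "j < d" for i j
  proof -
    have "u i \<bullet> (S *\<^sub>v u j) = u i \<bullet> (R *\<^sub>v (R *\<^sub>v u j))"
      using R(3) assoc_mult_mat_vec[OF R(1) R(1) u_carrier[OF ij(2)]] by simp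
    also have "\<dots> = (R *\<^sub>v u i) \<bullet> (R *\<^sub>v u j)" by (rule sym_scalar_prod[OF R(1,2) u_carrier[OF ij(1)] Ru[OF ij(2)]])
    finally show ?thesis by simp
  qed
  have lin: "u i \<bullet> (R *\<^sub>v vec d g) = (\<Sum>q<d. (R *\<^sub>v u i) $ q * g q)" if i: "i < d" for i g
  proof -
    have "u i \<bullet> (R *\<^sub>v vec d g) = (R *\<^sub>v u i) \<bullet> vec d g" by (rule sym_scalar_prod[OF R(1,2) u_carrier[OF i]]) simp
    then show ?thesis by (simp add: scalar_prod_sum)
  qed
  have norm: "(\<Sum>q<d. ((R *\<^sub>v u i) $ q)\<^sup>2) \<le> (sqrt (2 * l i))\<^sup>2" if i: "i < d" for i
  proof -
    have "(\<Sum>q<d. ((R *\<^sub>v u i) $ q)\<^sup>2) = u i \<bullet> (S *\<^sub>v u i)"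
      unfolding RR[OF i i, symmetric] using scalar_prod_sum[OF Ru[OF i], of "R *\<^sub>v u i"] by (simp add: power2_eq_square)
    moreover have "\<bar>u i \<bullet> (S *\<^sub>v u i) - l i\<bar> \<le> 1 * l i"
    proof -
      have "\<bar>u i \<bullet> (S *\<^sub>v u i) - l i\<bar> \<le> 4 * c\<^sup>2 * (4 + 2 * K) * eps n * sqrt (l i * l i)"
        using good_sample_cov[OF d0 x i i] cov_eigen[OF i i] by (simp add: S_def)
      also have "\<dots> \<le> 1 * l i" using small pos[OF i] by (intro mult_mono) auto
      finally show ?thesis .
    qed
    ultimately show ?thesis using pos[OF i] by simp
  qed
  have Ab: "measure (gauss_sample_law n p x) (A i j) \<le> 2 * (1 + gauss_const) / real n ^ 3" if ij: "i < d" "j < d" for i j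
  proof -
    have "measure (gauss_sample_law n p x) (A i j) = measure ?P (C -` A i j \<inter> space ?P)"
      unfolding law(1) using law(2) Am by (rule measure_distr)
    also have "C -` A i j \<inter> space ?P = {g \<in> space ?P. sqrt (2 * l i) * sqrt (2 * l j) * (4 + 2 * gauss_const) * sqrt (ln n / n)
      < \<bar>(\<Sum>k\<in>{1..n}. (\<Sum>q<d. (R *\<^sub>v u i) $ q * g k q) * (\<Sum>q<d. (R *\<^sub>v u j) $ q * g k q)) / n - (\<Sum>q<d. (R *\<^sub>v u i) $ q * (R *\<^sub>v u j) $ q)\<bar>}"
    proof -
      have s2: "2 * s i j = sqrt (2 * l i) * sqrt (2 * l j)" by (simp add: s_def real_sqrt_mult)
      have cross: "(\<Sum>q<d. (R *\<^sub>v u i) $ q * (R *\<^sub>v u j) $ q) = u i \<bullet> (S *\<^sub>v u j)"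
        unfolding RR[OF ij, symmetric] by (rule scalar_prod_sum[OF Ru[OF ij(2)], symmetric])
      have sum: "(\<Sum>k=1..n. (u i \<bullet> C g k) * (u j \<bullet> C g k))
        = (\<Sum>k\<in>{1..n}. (\<Sum>q<d. (R *\<^sub>v u i) $ q * g k q) * (\<Sum>q<d. (R *\<^sub>v u j) $ q * g k q))" for g
        by (rule sum.cong[OF refl]) (simp add: C_def compose_def lin[OF ij(1)] lin[OF ij(2)])
      show ?thesis
        using measurable_space[OF law(2)] unfolding A_def cross s2 eps_def by (auto simp: sum simp del: One_nat_def)
    qed
    also have "measure ?P \<dots> \<le> 2 * (1 + gauss_const) / real n ^ 3"
      by (rule gauss_sample_deviation[OF norm[OF ij(1)] _ norm[OF ij(2)] _ finite_atLeastAtMost _ n]) (use pos ij in auto)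
    finally show ?thesis .
  qed
  show thesis
  proof (rule that[of "\<Union>i<d. \<Union>j<d. A i j"])
    show "(\<Union>i<d. \<Union>j<d. A i j) \<in> sets (gauss_sample_law n p x)"
      unfolding sl by (rule sets.finite_UN, simp, rule sets.finite_UN, simp, rule Am)
    show "measure (gauss_sample_law n p x) (\<Union>i<d. \<Union>j<d. A i j) \<le> real d ^ 2 * (2 * (1 + gauss_const) / real n ^ 3)"
      by (rule measure_double_union_le(1)) (use Am Ab sl in auto)
    fix z i j assume z: "z \<in> space (gauss_sample_law n p x)" "z \<notin> (\<Union>i<d. \<Union>j<d. A i j)" and ij: "i < d" "j < d"
    have "z \<notin> A i j" using z(2) ij by blast
    then have "\<bar>(\<Sum>k=1..n. (u i \<bullet> z k) * (u j \<bullet> z k)) / n - u i \<bullet> (S *\<^sub>v u j)\<bar> \<le> 2 * s i j * (4 + 2 * gauss_const) * eps n"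
      using z(1) unfolding sl by (simp add: A_def)
    moreover have "u i \<bullet> (sample_cov n d z *\<^sub>v u j) = (\<Sum>k=1..n. (u i \<bullet> z k) * (u j \<bullet> z k)) / n"
      using z(1) unfolding sl by (intro sample_cov_bilinear ij sample_borel_carrier)
    ultimately show "\<bar>u i \<bullet> (sample_cov n d z *\<^sub>v u j) - u i \<bullet> (sample_cov n d x *\<^sub>v u j)\<bar> \<le> 2 * (4 + 2 * gauss_const) * eps n * sqrt (l i * l j)"
      by (simp add: S_def s_def algebra_simps)
  qed
qed

lemma pnorm_measurable:
  assumes M: "mmat N d M"
  shows "(\<lambda>x. pnorm p (M x)) \<in> borel_measurable N"
proof (rule mmat_lipschitz[OF M, where L = 2])
  fix A B :: "real mat" assume A: "A \<in> carrier_mat d d" and B: "B \<in> carrier_mat d d"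
  have AB: "A - B \<in> carrier_mat d d" using B by (rule minus_carrier_mat)
  have "\<bar>pnorm p A - pnorm p B\<bar> \<le> pnorm p (A - B)" unfolding pnorm_def by (rule frame_norm_diff[OF A B])
  also have "\<dots> \<le> 2 * frob (A - B)" unfolding pnorm_def by (rule frame_norm_le_frob[OF AB])
  also have "\<dots> \<le> 2 * (\<Sum>q\<in>{..<d} \<times> {..<d}. \<bar>(A - B) $$ q\<bar>)" using frob_le_sum[OF AB] by simp
  also have "(\<Sum>q\<in>{..<d} \<times> {..<d}. \<bar>(A - B) $$ q\<bar>) = (\<Sum>q\<in>{..<d} \<times> {..<d}. \<bar>A $$ q - B $$ q\<bar>)"
    using A B by (intro sum.cong refl) auto
  finally show "\<bar>pnorm p A - pnorm p B\<bar> \<le> 2 * (\<Sum>q\<in>{..<d} \<times> {..<d}. \<bar>A $$ q - B $$ q\<bar>)" .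
qed

end

lemma mmat_diff:
  assumes A: "mmat N d A" and B: "mmat N d B"
  shows "mmat N d (\<lambda>x. A x - B x)"
  unfolding mmat_def
proof (intro conjI ballI allI impI)
  fix x assume "x \<in> space N"
  then show "A x - B x \<in> carrier_mat d d" by (intro minus_carrier_mat mmatD(1)[OF B])
next
  fix a b assume ab: "a < d" "b < d"
  have m: "(\<lambda>x. A x $$ (a, b) - B x $$ (a, b)) \<in> borel_measurable N"
    using mmatD(2)[OF A ab] mmatD(2)[OF B ab] by (rule borel_measurable_diff)
  have "(\<lambda>x. (A x - B x) $$ (a, b)) \<in> borel_measurable N \<longleftrightarrow> (\<lambda>x. A x $$ (a, b) - B x $$ (a, b)) \<in> borel_measurable N"
  proof (rule measurable_cong)
    fix x assume x: "x \<in> space N"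
    show "(A x - B x) $$ (a, b) = A x $$ (a, b) - B x $$ (a, b)"
      using mmatD(1)[OF A x] mmatD(1)[OF B x] ab by simp
  qed
  then show "(\<lambda>x. (A x - B x) $$ (a, b)) \<in> borel_measurable N" using m by (rule iffD2)
qed

lemma mmat_compose:
  assumes f: "mmat N d f" and h: "h \<in> measurable M N"
  shows "mmat M d (\<lambda>x. f (h x))"
  unfolding mmat_def
proof (intro conjI ballI allI impI)
  fix x assume "x \<in> space M"
  then show "f (h x) \<in> carrier_mat d d" by (intro mmatD(1)[OF f] measurable_space[OF h])
next
  fix a b assume ab: "a < d" "b < d"
  show "(\<lambda>x. f (h x) $$ (a, b)) \<in> borel_measurable M" using h mmatD(2)[OF f ab] by (rule measurable_compose)
qed

lemma mmat_const: "A \<in> carrier_mat d d \<Longrightarrow> mmat N d (\<lambda>_. A)"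
  by (simp add: mmat_def)

section \<open>Measurability of the test statistic and of the conditional quantiles\<close>

context problem_moments
begin

lemma idx_subset: "idx p \<subseteq> {1..d}"
  by (auto simp: idx_def grp_def)

lemma index_proj_weighted_mmat:
  assumes x: "\<And>k \<omega>. k \<in> {1..n} \<Longrightarrow> \<omega> \<in> space N \<Longrightarrow> x \<omega> k \<in> carrier_vec d"
    and xm: "\<And>k a. k \<in> {1..n} \<Longrightarrow> a < d \<Longrightarrow> (\<lambda>\<omega>. x \<omega> k $ a) \<in> borel_measurable N"
    and wm: "\<And>k. k \<in> {1..n} \<Longrightarrow> (\<lambda>\<omega>. w \<omega> k) \<in> borel_measurable N"
  shows "mmat N d (\<lambda>\<omega>. index_proj d (weighted_cov n d (w \<omega>) (x \<omega>)) (idx p))"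
proof (rule index_proj_mmat[OF weighted_cov_mmat[OF x xm wm] _ idx_subset])
  fix \<omega> assume "\<omega> \<in> space N"
  then show "(weighted_cov n d (w \<omega>) (x \<omega>))\<^sup>T = weighted_cov n d (w \<omega>) (x \<omega>)" by (intro weighted_cov_sym x)
qed

lemma data_coord: "k \<in> {1..n} \<Longrightarrow> a < d \<Longrightarrow> (\<lambda>x. x k $ a) \<in> borel_measurable (data_law n p)"
proof -
  assume k: "k \<in> {1..n}" and a: "a < d"
  have "(\<lambda>v. v $ a) \<in> borel_measurable (law p)" using borel_vec_coord[OF a] by (simp add: measurable_cong_sets[OF sets_law refl])
  with measurable_component_singleton[OF k, of "\<lambda>_. law p"] show ?thesis
    unfolding data_law_def by (rule measurable_compose)
qed

lemma P_hat_mmat: "mmat (data_law n p) d (P_hat n p)"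
proof -
  have "mmat (data_law n p) d (\<lambda>x. index_proj d (weighted_cov n d (\<lambda>_. 1) x) (idx p))"
    by (rule index_proj_weighted_mmat) (auto intro: data_carrier data_coord)
  then show ?thesis unfolding P_hat_def sample_cov_def by (simp add: P_hat_def[abs_def] sample_cov_def)
qed

lemma Q1_measurable: "Q1 n p \<in> borel_measurable (data_law n p)"
proof -
  have "(\<lambda>x. pnorm p (P_hat n p x - P0 p)) \<in> borel_measurable (data_law n p)"
    by (rule pnorm_measurable[OF mmat_diff[OF P_hat_mmat mmat_const[OF P0_carrier]]])
  with borel_measurable_const have "(\<lambda>x. sqrt n * pnorm p (P_hat n p x - P0 p)) \<in> borel_measurable (data_law n p)"
    by (rule borel_measurable_times)
  then show ?thesis by (simp add: Q1_def[abs_def])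
qed

lemma prob_space_multiplier: "prob_space (multiplier_law n)"
  unfolding multiplier_law_def by (intro prob_space_PiM prob_space_normal_density) simp

lemma q_B_measurable:
  assumes \<alpha>: "0 < \<alpha>"
  shows "q_B n p \<alpha> \<in> borel_measurable (data_law n p)"
proof -
  let ?N = "data_law n p \<Otimes>\<^sub>M multiplier_law n"
  have P: "mmat ?N d (\<lambda>\<omega>. index_proj d (weighted_cov n d (snd \<omega>) (fst \<omega>)) (idx p))"
  proof (rule index_proj_weighted_mmat)
    fix k assume k: "k \<in> {1..n}"
    show "fst \<omega> k \<in> carrier_vec d" if "\<omega> \<in> space ?N" for \<omega>
      using that by (intro data_carrier[OF _ k]) (auto simp: space_pair_measure)
    show "(\<lambda>\<omega>. fst \<omega> k $ a) \<in> borel_measurable ?N" if "a < d" for a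
      using measurable_fst data_coord[OF k that] by (rule measurable_compose)
    have "(\<lambda>\<eta>. \<eta> k) \<in> borel_measurable (multiplier_law n)"
      using measurable_component_singleton[OF k, of "\<lambda>_. density lborel (\<lambda>t. ennreal (normal_density 1 1 t))"]
      by (simp add: multiplier_law_def measurable_cong_sets[OF refl sets_density])
    with measurable_snd show "(\<lambda>\<omega>. snd \<omega> k) \<in> borel_measurable ?N" by (rule measurable_compose)
  qed
  have H: "mmat ?N d (\<lambda>\<omega>. P_hat n p (fst \<omega>))" by (rule mmat_compose[OF P_hat_mmat measurable_fst])
  have "(\<lambda>\<omega>. pnorm p (index_proj d (weighted_cov n d (snd \<omega>) (fst \<omega>)) (idx p) - P_hat n p (fst \<omega>))) \<in> borel_measurable ?N"
    by (rule pnorm_measurable[OF mmat_diff[OF P H]])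
  with borel_measurable_const have "(\<lambda>\<omega>. sqrt n * pnorm p (index_proj d (weighted_cov n d (snd \<omega>) (fst \<omega>)) (idx p) - P_hat n p (fst \<omega>))) \<in> borel_measurable ?N"
    by (rule borel_measurable_times)
  then have "(\<lambda>(x, \<eta>). sqrt n * pnorm p (P_B n p x \<eta> - P_hat n p x)) \<in> borel_measurable ?N"
    by (simp add: P_B_def case_prod_beta)
  from upper_quantile_measurable[OF prob_space_multiplier this \<alpha>] show ?thesis by (simp add: q_B_def[abs_def])
qed

lemma sample_sqrt_carrier:
  assumes "x \<in> space (data_law n p)"
  shows "psd_sqrt d (sample_cov n d x) \<in> carrier_mat d d"
  using psd_sqrt_props(1)[OF sample_cov_psd[OF data_carrier[OF assms]]] by (simp add: is_psd_def)

text \<open>The quantile is taken under a law that varies with the data, whereas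
  \<open>upper_quantile_measurable\<close> wants a fixed law. The dependence on the data is moved
  from the law into the random variable.\<close>

lemma q_F_pullback:
  assumes x: "x \<in> space (data_law n p)"
  shows "q_F n p \<alpha> x = upper_quantile (Pi\<^sub>M {1..n} (\<lambda>_. gauss_prod d))
    (\<lambda>g. sqrt n * pnorm p (P_F n p (compose {1..n} (\<lambda>g. psd_sqrt d (sample_cov n d x) *\<^sub>v vec d g) g) - P_hat n p x)) \<alpha>"
proof -
  let ?P = "Pi\<^sub>M {1..n} (\<lambda>_. gauss_prod d)" and ?B = "Pi\<^sub>M {1..n} (\<lambda>_. borel_vec d)"
  define C where "C = compose {1..n} (\<lambda>g. psd_sqrt d (sample_cov n d x) *\<^sub>v vec d g)"
  note law = gauss_sample_law_distr[OF sample_sqrt_carrier[OF x], folded C_def]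
  define W where "W z = sqrt n * pnorm p (P_F n p z - P_hat n p x)" for z
  have PF: "mmat ?B d (\<lambda>z. index_proj d (weighted_cov n d (\<lambda>_. 1) z) (idx p))"
    by (rule index_proj_weighted_mmat) (rule sample_borel_carrier sample_borel_coord borel_measurable_const | assumption)+
  have "(\<lambda>z. pnorm p (index_proj d (weighted_cov n d (\<lambda>_. 1) z) (idx p) - P_hat n p x)) \<in> borel_measurable ?B"
    by (rule pnorm_measurable[OF mmat_diff[OF PF mmat_const[OF mmatD(1)[OF P_hat_mmat x]]]])
  with borel_measurable_const have "(\<lambda>z. sqrt n * pnorm p (index_proj d (weighted_cov n d (\<lambda>_. 1) z) (idx p) - P_hat n p x)) \<in> borel_measurable ?B"
    by (rule borel_measurable_times)
  then have W: "W \<in> borel_measurable ?B" by (simp add: W_def[abs_def] P_F_def sample_cov_def)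
  have "measure (gauss_sample_law n p x) {z \<in> space (gauss_sample_law n p x). W z > \<gamma>} = measure ?P {g \<in> space ?P. W (C g) > \<gamma>}" for \<gamma>
  proof -
    have m: "{z \<in> space ?B. \<gamma> < W z} \<in> sets ?B" by (rule borel_measurable_less[OF borel_measurable_const W])
    have "measure (gauss_sample_law n p x) {z \<in> space ?B. \<gamma> < W z} = measure ?P (C -` {z \<in> space ?B. \<gamma> < W z} \<inter> space ?P)"
      unfolding law(1) using law(2) m by (rule measure_distr)
    moreover have "C -` {z \<in> space ?B. \<gamma> < W z} \<inter> space ?P = {g \<in> space ?P. \<gamma> < W (C g)}"
      using measurable_space[OF law(2)] by auto
    moreover have "space (gauss_sample_law n p x) = space ?B" unfolding law(1) by simp
    ultimately show ?thesis by simp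
  qed
  then show ?thesis by (simp add: q_F_def upper_quantile_def W_def C_def)
qed

lemma q_F_measurable:
  assumes \<alpha>: "0 < \<alpha>"
  shows "q_F n p \<alpha> \<in> borel_measurable (data_law n p)"
proof -
  let ?G = "Pi\<^sub>M {1..n} (\<lambda>_. gauss_prod d)"
  let ?N = "data_law n p \<Otimes>\<^sub>M ?G"
  define R where "R x = psd_sqrt d (sample_cov n d x)" for x
  define z where "z \<omega> = compose {1..n} (\<lambda>g. R (fst \<omega>) *\<^sub>v vec d g) (snd \<omega>)" for \<omega> :: "(nat \<Rightarrow> real vec) \<times> (nat \<Rightarrow> nat \<Rightarrow> real)"
  have Rm: "mmat (data_law n p) d R"
    unfolding R_def
  proof (rule psd_sqrt_mmat)
    have "mmat (data_law n p) d (\<lambda>x. weighted_cov n d (\<lambda>_. 1) x)"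
      by (rule weighted_cov_mmat) (auto intro: data_carrier data_coord)
    then show "mmat (data_law n p) d (sample_cov n d)" by (simp add: sample_cov_def[abs_def])
    show "is_psd d (sample_cov n d x)" if "x \<in> space (data_law n p)" for x
      by (rule sample_cov_psd) (rule data_carrier[OF that])
  qed
  have RN: "mmat ?N d (\<lambda>\<omega>. R (fst \<omega>))" by (rule mmat_compose[OF Rm measurable_fst])
  have P: "mmat ?N d (\<lambda>\<omega>. index_proj d (weighted_cov n d (\<lambda>_. 1) (z \<omega>)) (idx p))"
  proof (rule index_proj_weighted_mmat)
    fix k assume k: "k \<in> {1..n}"
    show "z \<omega> k \<in> carrier_vec d" if "\<omega> \<in> space ?N" for \<omega>
      using mmatD(1)[OF RN that] k by (simp add: z_def compose_def)
    show "(\<lambda>\<omega>. z \<omega> k $ a) \<in> borel_measurable ?N" if a: "a < d" for a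
    proof -
      have g: "(\<lambda>\<omega>. snd \<omega> k j) \<in> borel_measurable ?N" if j: "j < d" for j
      proof -
        have "(\<lambda>h. h j) \<in> borel_measurable (gauss_prod d)"
          using measurable_component_singleton[of j "{..<d}" "\<lambda>_. std_gauss"] j by (simp add: measurable_cong_sets[OF refl sets_std_gauss])
        with measurable_component_singleton[OF k, of "\<lambda>_. gauss_prod d"] have "(\<lambda>h. h k j) \<in> borel_measurable ?G"
          by (rule measurable_compose)
        with measurable_snd show ?thesis by (rule measurable_compose)
      qed
      have s: "(\<lambda>\<omega>. \<Sum>j<d. R (fst \<omega>) $$ (a, j) * snd \<omega> k j) \<in> borel_measurable ?N"
      proof (rule borel_measurable_sum)
        fix j assume "j \<in> {..<d}"
        then have j: "j < d" by simp
        from mmatD(2)[OF RN a j] g[OF j] show "(\<lambda>\<omega>. R (fst \<omega>) $$ (a, j) * snd \<omega> k j) \<in> borel_measurable ?N"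
          by (rule borel_measurable_times)
      qed
      have "(\<lambda>\<omega>. z \<omega> k $ a) \<in> borel_measurable ?N \<longleftrightarrow> (\<lambda>\<omega>. \<Sum>j<d. R (fst \<omega>) $$ (a, j) * snd \<omega> k j) \<in> borel_measurable ?N"
      proof (rule measurable_cong)
        fix \<omega> assume "\<omega> \<in> space ?N"
        from mmatD(1)[OF RN this] show "z \<omega> k $ a = (\<Sum>j<d. R (fst \<omega>) $$ (a, j) * snd \<omega> k j)"
          using k a by (simp add: z_def compose_def scalar_prod_def lessThan_atLeast0)
      qed
      then show ?thesis using s by (rule iffD2)
    qed
  qed simp
  have H: "mmat ?N d (\<lambda>\<omega>. P_hat n p (fst \<omega>))" by (rule mmat_compose[OF P_hat_mmat measurable_fst])
  have "(\<lambda>\<omega>. pnorm p (index_proj d (weighted_cov n d (\<lambda>_. 1) (z \<omega>)) (idx p) - P_hat n p (fst \<omega>))) \<in> borel_measurable ?N"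
    by (rule pnorm_measurable[OF mmat_diff[OF P H]])
  with borel_measurable_const have "(\<lambda>\<omega>. sqrt n * pnorm p (index_proj d (weighted_cov n d (\<lambda>_. 1) (z \<omega>)) (idx p) - P_hat n p (fst \<omega>))) \<in> borel_measurable ?N"
    by (rule borel_measurable_times)
  then have "(\<lambda>(x, g). sqrt n * pnorm p (P_F n p (z (x, g)) - P_hat n p x)) \<in> borel_measurable ?N"
    by (simp add: P_F_def sample_cov_def case_prod_unfold)
  note m = upper_quantile_measurable[OF prob_space_PiM[OF prob_space_gauss_prod] this \<alpha>]
  have "q_F n p \<alpha> \<in> borel_measurable (data_law n p) \<longleftrightarrow>
    (\<lambda>x. upper_quantile ?G (\<lambda>g. sqrt n * pnorm p (P_F n p (z (x, g)) - P_hat n p x)) \<alpha>) \<in> borel_measurable (data_law n p)"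
  proof (rule measurable_cong)
    fix x assume "x \<in> space (data_law n p)"
    then show "q_F n p \<alpha> x = upper_quantile ?G (\<lambda>g. sqrt n * pnorm p (P_F n p (z (x, g)) - P_hat n p x)) \<alpha>"
      using q_F_pullback by (simp add: z_def R_def)
  qed
  then show ?thesis using m by (rule iffD2)
qed

end

section \<open>Power of the resampling tests\<close>

text \<open>One summand per source of error, each in units of \<open>c\<^sup>2 * eps n\<close>: the
  sample covariance, the multipliers (\<open>sqrt (6 * V)\<close> is \<open>c\<^sup>2\<close> times
  the second summand) and the Gaussian sample.\<close>

definition kappa :: "real \<Rightarrow> real" where
  "kappa \<beta> = (let K = 2 * (1 + moment_const \<beta>) in
    4 * (4 + 2 * K) + 4 * sqrt (6 * (5 + 3 * K)) + 8 * K * (4 + 2 * gauss_const))"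

lemma gauss_const_pos: "0 < gauss_const"
  by (simp add: gauss_const_def)

context problem_moments
begin

lemma kappa_eq: "kappa \<beta> = 4 * (4 + 2 * K) + 4 * sqrt (6 * (5 + 3 * K)) + 8 * K * (4 + 2 * gauss_const)"
  by (simp add: kappa_def Let_def K_def)

lemma kappa_parts:
  assumes d0: "0 < d"
  shows "4 * c\<^sup>2 * (4 + 2 * K) \<le> kappa \<beta> * c\<^sup>2"
    "4 * c\<^sup>2 * (4 + 2 * K) + sqrt (6 * V) \<le> kappa \<beta> * c\<^sup>2"
    "4 * c\<^sup>2 * (4 + 2 * K) + 2 * (4 + 2 * gauss_const) \<le> kappa \<beta> * c\<^sup>2"
proof -
  have c0: "0 < c" by (rule c_pos[OF d0])
  have g: "0 \<le> 4 + 2 * gauss_const" using gauss_const_pos by simp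
  have "sqrt (6 * V) = sqrt ((4 * c\<^sup>2)\<^sup>2 * (6 * (5 + 3 * K)))" by (simp add: V_def power_mult_distrib flip: power_mult)
  also have "\<dots> = 4 * c\<^sup>2 * sqrt (6 * (5 + 3 * K))" unfolding real_sqrt_mult[of "_\<^sup>2"] real_sqrt_abs by simp
  finally have sV: "sqrt (6 * V) = 4 * c\<^sup>2 * sqrt (6 * (5 + 3 * K))" .
  have s0: "0 \<le> sqrt (6 * (5 + 3 * K))" using K_ge by simp
  \<comment> \<open>The Gaussian deviation carries no factor \<open>c\<^sup>2\<close>. Since
    \<open>4 * c\<^sup>2 * K\<close> is at least 1, multiplying by it brings the bound to the common
    form, hence the factor \<open>8 * K\<close> in \<open>kappa\<close>.\<close>
  have "1 \<le> (2 * c)\<^sup>2 * (1 + moment_const \<beta>)" using c0 by (intro scale_bound[OF d0]) auto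
  also have "\<dots> \<le> (2 * c)\<^sup>2 * K" using K_ge by (intro mult_left_mono) auto
  finally have "1 * (2 * (4 + 2 * gauss_const)) \<le> (4 * c\<^sup>2 * K) * (2 * (4 + 2 * gauss_const))"
    using g by (intro mult_right_mono) (auto simp: power_mult_distrib)
  moreover have "(4 * c\<^sup>2 * K) * (2 * G) = 8 * K * G * c\<^sup>2" for G by simp
  ultimately have gK: "2 * (4 + 2 * gauss_const) \<le> 8 * K * (4 + 2 * gauss_const) * c\<^sup>2" by (simp only: mult_1)
  have k: "kappa \<beta> * c\<^sup>2 = 4 * c\<^sup>2 * (4 + 2 * K) + 4 * c\<^sup>2 * sqrt (6 * (5 + 3 * K)) + 8 * K * (4 + 2 * gauss_const) * c\<^sup>2"
    by (simp add: kappa_eq algebra_simps)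
  have p1: "0 \<le> 4 * c\<^sup>2 * sqrt (6 * (5 + 3 * K))" using s0 by simp
  have p2: "0 \<le> 8 * K * (4 + 2 * gauss_const) * c\<^sup>2" using K_ge g by simp
  show "4 * c\<^sup>2 * (4 + 2 * K) \<le> kappa \<beta> * c\<^sup>2" using p1 p2 unfolding k by linarith
  show "4 * c\<^sup>2 * (4 + 2 * K) + sqrt (6 * V) \<le> kappa \<beta> * c\<^sup>2" using p2 unfolding k sV by linarith
  show "4 * c\<^sup>2 * (4 + 2 * K) + 2 * (4 + 2 * gauss_const) \<le> kappa \<beta> * c\<^sup>2" using p1 gK unfolding k by linarith
qed

lemma upper_quantile_le:
  assumes "0 < h" "measure M {y \<in> space M. h < W y} \<le> \<alpha>"
  shows "upper_quantile M W \<alpha> \<le> h"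
  unfolding upper_quantile_def using assms by (intro cInf_lower bdd_belowI[of _ 0]) auto

text \<open>On the good event every spectral projector involved is within \<open>b\<close> of
  \<open>PJ p\<close>, which caps the resampled statistics at \<open>h\<close> and, by
  \<open>sep\<close>, keeps \<open>Q1\<close> above \<open>h\<close>. The threshold \<open>h\<close>
  is separate from \<open>sqrt n * (2 * b)\<close> because the quantile is an infimum over positive
  numbers: positivity is asked of \<open>h\<close>, not of \<open>b\<close>.\<close>

lemma power_bound:
  fixes \<alpha> h :: real and n :: nat
  defines "X \<equiv> kappa \<beta> * c\<^sup>2 * eps n"
  defines "b \<equiv> 48 * (X * dbar d (Cov p) (grps p) powr (1/2) + X\<^sup>2 * dsf d (Cov p) (grps p) powr (3/2))"
  assumes n: "3 \<le> n" and d: "0 < d" "d \<le> n + 1"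
    and small: "4 * c\<^sup>2 * (4 + 2 * K) * eps n \<le> 1"
    and \<alpha>: "0 < \<alpha>" "real (n + 1) ^ 2 * (2 * (1 + gauss_const) / real n ^ 3) \<le> \<alpha>"
    and rel: "\<And>r. r \<in> grps p \<Longrightarrow> 4 * X * rel_rank d (Cov p) r \<le> 1"
    and h: "0 < h" "sqrt n * (2 * b) \<le> h" and sep: "h + sqrt n * b < sqrt n * pnorm p (PJ p - P0 p)"
  shows "1 - real (n + 1) ^ 2 * (4 * (1 + K) / real n ^ 3) \<le> measure (data_law n p) {x \<in> space (data_law n p). Q1 n p x > q_B n p \<alpha> x}"
    and "1 - real (n + 1) ^ 2 * (4 * (1 + K) / real n ^ 3) \<le> measure (data_law n p) {x \<in> space (data_law n p). Q1 n p x > q_F n p \<alpha> x}"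
proof -
  interpret D: prob_space "data_law n p" unfolding data_law_def by (intro prob_space_PiM prob_law)
  have c0: "0 < c" by (rule c_pos[OF d(1)])
  note kp = kappa_parts[OF d(1)]
  have kpos: "0 \<le> kappa \<beta> * c\<^sup>2" using order_trans[OF _ kp(1)] K_ge by simp
  have X0: "0 \<le> X" unfolding X_def by (rule mult_nonneg_nonneg[OF kpos eps_nonneg])
  have mono: "y \<le> X * sqrt (l i * l j)" if "y \<le> a * eps n * sqrt (l i * l j)" "a \<le> kappa \<beta> * c\<^sup>2" "i < d" "j < d" for y a i j
  proof -
    have "a * eps n * sqrt (l i * l j) \<le> kappa \<beta> * c\<^sup>2 * eps n * sqrt (l i * l j)"
      using that eps_nonneg pos by (intro mult_right_mono) (auto simp: less_imp_le)
    then show ?thesis using that(1) by (simp add: X_def)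
  qed
  have d2: "real d ^ 2 \<le> real (n + 1) ^ 2" using d(2) by (intro power_mono) auto
  obtain Bad where Bad: "Bad \<in> sets (data_law n p)" "measure (data_law n p) Bad \<le> real d ^ 2 * (4 * (1 + K) / real n ^ 3)"
    and good: "\<And>x. x \<in> space (data_law n p) \<Longrightarrow> x \<notin> Bad \<Longrightarrow> good n x" using good_event[OF d(1) n] by blast
  have key: "Q1 n p x > q_B n p \<alpha> x" "Q1 n p x > q_F n p \<alpha> x" if x: "x \<in> space (data_law n p)" "x \<notin> Bad" for x
  proof -
    have gx: "good n x" by (rule good[OF x])
    define S where "S = sample_cov n d x"
    have S: "S \<in> carrier_mat d d" "S\<^sup>T = S"
      unfolding S_def sample_cov_def by (simp, rule weighted_cov_sym, rule data_carrier[OF x(1)])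
    have SE: "\<bar>u i \<bullet> (S *\<^sub>v u j) - u i \<bullet> (Cov p *\<^sub>v u j)\<bar> \<le> 4 * c\<^sup>2 * (4 + 2 * K) * eps n * sqrt (l i * l j)" if "i < d" "j < d" for i j
      unfolding S_def by (rule good_sample_cov[OF d(1) x(1) gx that])
    have "\<bar>u i \<bullet> (S *\<^sub>v u j) - u i \<bullet> (Cov p *\<^sub>v u j)\<bar> \<le> X * sqrt (l i * l j)" if "i < d" "j < d" for i j
      by (rule mono[OF SE[OF that] kp(1) that])
    note hat = pnorm_perturbation[OF S this X0 rel, folded b_def]
    have Ph: "P_hat n p x = index_proj d S (idx p)" by (simp add: P_hat_def S_def)
    have hatc: "P_hat n p x \<in> carrier_mat d d" unfolding Ph by (rule hat(2))
    have hatb: "pnorm p (P_hat n p x - PJ p) \<le> b" unfolding Ph by (rule hat(1))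
    have tri: "pnorm p (A - C) \<le> pnorm p (A - B) + pnorm p (B - C)"
      if "A \<in> carrier_mat d d" "B \<in> carrier_mat d d" "C \<in> carrier_mat d d" for A B C
    proof -
      have "(A - B) + (B - C) = A - C" using that by (intro eq_matI) auto
      moreover have "A - B \<in> carrier_mat d d" "B - C \<in> carrier_mat d d" using that by (auto intro: minus_carrier_mat)
      ultimately show ?thesis using frame_norm_mono_sum[of "A - B" "B - C"] by (simp add: pnorm_def)
    qed
    have symm: "pnorm p (A - B) = pnorm p (B - A)" if "A \<in> carrier_mat d d" "B \<in> carrier_mat d d" for A B
    proof -
      have "- (B - A) = A - B" using that by (intro eq_matI) auto
      moreover have "B - A \<in> carrier_mat d d" using that by (auto intro: minus_carrier_mat)
      ultimately show ?thesis using frame_norm_uminus[of "B - A"] by (simp add: pnorm_def)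
    qed
    have Q: "h < Q1 n p x"
    proof -
      have "pnorm p (PJ p - P0 p) \<le> pnorm p (P_hat n p x - PJ p) + pnorm p (P_hat n p x - P0 p)"
        using tri[OF PJ_carrier hatc P0_carrier] symm[OF PJ_carrier hatc] by simp
      then have "pnorm p (PJ p - P0 p) \<le> b + pnorm p (P_hat n p x - P0 p)" using hatb by simp
      then have "sqrt n * pnorm p (PJ p - P0 p) \<le> sqrt n * (b + pnorm p (P_hat n p x - P0 p))" by (intro mult_left_mono) auto
      then show ?thesis using sep by (simp add: Q1_def distrib_left)
    qed
    \<comment> \<open>The relative errors of the sample covariance against \<open>Cov p\<close> and
      of the resampled one against the sample covariance add up; \<open>kappa\<close> was chosen to
      cover each such sum.\<close>
    have close: "sqrt n * pnorm p (index_proj d B (idx p) - P_hat n p x) \<le> h"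
      if B: "B \<in> carrier_mat d d" "B\<^sup>T = B" and a: "4 * c\<^sup>2 * (4 + 2 * K) + a \<le> kappa \<beta> * c\<^sup>2"
        and BE: "\<And>i j. i < d \<Longrightarrow> j < d \<Longrightarrow> \<bar>u i \<bullet> (B *\<^sub>v u j) - u i \<bullet> (S *\<^sub>v u j)\<bar> \<le> a * eps n * sqrt (l i * l j)" for B a
    proof -
      have "\<bar>u i \<bullet> (B *\<^sub>v u j) - u i \<bullet> (Cov p *\<^sub>v u j)\<bar> \<le> X * sqrt (l i * l j)" if ij: "i < d" "j < d" for i j
      proof (rule mono[OF _ a ij])
        show "\<bar>u i \<bullet> (B *\<^sub>v u j) - u i \<bullet> (Cov p *\<^sub>v u j)\<bar> \<le> (4 * c\<^sup>2 * (4 + 2 * K) + a) * eps n * sqrt (l i * l j)"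
          using BE[OF ij] SE[OF ij] unfolding distrib_right by linarith
      qed
      note pb = pnorm_perturbation[OF B this X0 rel, folded b_def]
      have "pnorm p (index_proj d B (idx p) - P_hat n p x) \<le> b + b"
        using tri[OF pb(2) PJ_carrier hatc] symm[OF PJ_carrier hatc] pb(1) hatb by linarith
      then have "sqrt n * pnorm p (index_proj d B (idx p) - P_hat n p x) \<le> sqrt n * (2 * b)" by (intro mult_left_mono) auto
      then show ?thesis using h(2) by simp
    qed
    have "q_B n p \<alpha> x \<le> h"
      unfolding q_B_def
    proof (rule upper_quantile_le[OF h(1)])
      interpret B: prob_space "multiplier_law n" by (rule prob_space_multiplier)
      have n1: "1 \<le> n" using n by simp
      obtain BB where BB: "BB \<in> sets (multiplier_law n)" "measure (multiplier_law n) BB \<le> real d ^ 2 * (2 / real n ^ 3)"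
        and BE: "\<And>\<eta> i j. \<eta> \<in> space (multiplier_law n) \<Longrightarrow> \<eta> \<notin> BB \<Longrightarrow> i < d \<Longrightarrow> j < d \<Longrightarrow>
          \<bar>u i \<bullet> (weighted_cov n d \<eta> x *\<^sub>v u j) - u i \<bullet> (sample_cov n d x *\<^sub>v u j)\<bar> \<le> sqrt (6 * V) * eps n * sqrt (l i * l j)"
        using multiplier_event[OF d(1) n1 x(1) gx] by blast
      have "{\<eta> \<in> space (multiplier_law n). h < sqrt n * pnorm p (P_B n p x \<eta> - P_hat n p x)} \<subseteq> BB"
      proof (rule ccontr)
        assume "\<not> ?thesis"
        then obtain \<eta> where \<eta>: "\<eta> \<in> space (multiplier_law n)" "\<eta> \<notin> BB" and big: "h < sqrt n * pnorm p (P_B n p x \<eta> - P_hat n p x)" by auto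
        have wS: "(weighted_cov n d \<eta> x)\<^sup>T = weighted_cov n d \<eta> x"
          by (rule weighted_cov_sym) (rule data_carrier[OF x(1)])
        have "sqrt n * pnorm p (index_proj d (weighted_cov n d \<eta> x) (idx p) - P_hat n p x) \<le> h"
          by (rule close[OF weighted_cov_carrier wS kp(2)]) (unfold S_def, rule BE[OF \<eta>], assumption+)
        then show False using big by (simp add: P_B_def)
      qed
      then have "measure (multiplier_law n) {\<eta> \<in> space (multiplier_law n). h < sqrt n * pnorm p (P_B n p x \<eta> - P_hat n p x)} \<le> measure (multiplier_law n) BB"
        by (rule B.finite_measure_mono[OF _ BB(1)])
      also have "\<dots> \<le> real d ^ 2 * (2 / real n ^ 3)" by (rule BB(2))
      also have "\<dots> \<le> real (n + 1) ^ 2 * (2 * (1 + gauss_const) / real n ^ 3)"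
        using d2 gauss_const_pos by (intro mult_mono divide_right_mono) auto
      finally show "measure (multiplier_law n) {\<eta> \<in> space (multiplier_law n). h < sqrt n * pnorm p (P_B n p x \<eta> - P_hat n p x)} \<le> \<alpha>"
        using \<alpha>(2) by simp
    qed
    then show "Q1 n p x > q_B n p \<alpha> x" using Q by simp
    have "q_F n p \<alpha> x \<le> h"
      unfolding q_F_def
    proof (rule upper_quantile_le[OF h(1)])
      let ?L = "gauss_sample_law n p x"
      note gl = gauss_sample_law_distr[OF sample_sqrt_carrier[OF x(1)]]
      have "prob_space ?L" unfolding gl(1)
        by (rule prob_space.prob_space_distr[OF prob_space_PiM[OF prob_space_gauss_prod] gl(2)])
      then interpret F: prob_space ?L .
      have zc: "z k \<in> carrier_vec d" if "z \<in> space ?L" "k \<in> {1..n}" for z k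
        using that unfolding gl(1) by (intro sample_borel_carrier) auto
      obtain BB where BB: "BB \<in> sets ?L" "measure ?L BB \<le> real d ^ 2 * (2 * (1 + gauss_const) / real n ^ 3)"
        and BE: "\<And>z i j. z \<in> space ?L \<Longrightarrow> z \<notin> BB \<Longrightarrow> i < d \<Longrightarrow> j < d \<Longrightarrow>
          \<bar>u i \<bullet> (sample_cov n d z *\<^sub>v u j) - u i \<bullet> (sample_cov n d x *\<^sub>v u j)\<bar> \<le> 2 * (4 + 2 * gauss_const) * eps n * sqrt (l i * l j)"
        using gauss_event[OF d(1) n x(1) gx small] by blast
      have "{z \<in> space ?L. h < sqrt n * pnorm p (P_F n p z - P_hat n p x)} \<subseteq> BB"
      proof (rule ccontr)
        assume "\<not> ?thesis"
        then obtain z where z: "z \<in> space ?L" "z \<notin> BB" and big: "h < sqrt n * pnorm p (P_F n p z - P_hat n p x)" by auto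
        have zS: "sample_cov n d z \<in> carrier_mat d d" "(sample_cov n d z)\<^sup>T = sample_cov n d z"
          unfolding sample_cov_def by (simp, rule weighted_cov_sym, rule zc[OF z(1)])
        have "sqrt n * pnorm p (index_proj d (sample_cov n d z) (idx p) - P_hat n p x) \<le> h"
          by (rule close[OF zS kp(3)]) (unfold S_def, rule BE[OF z], assumption+)
        then show False using big by (simp add: P_F_def)
      qed
      then have "measure ?L {z \<in> space ?L. h < sqrt n * pnorm p (P_F n p z - P_hat n p x)} \<le> measure ?L BB"
        by (rule F.finite_measure_mono[OF _ BB(1)])
      also have "\<dots> \<le> real d ^ 2 * (2 * (1 + gauss_const) / real n ^ 3)" by (rule BB(2))
      also have "\<dots> \<le> real (n + 1) ^ 2 * (2 * (1 + gauss_const) / real n ^ 3)"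
        using d2 gauss_const_pos by (intro mult_right_mono divide_nonneg_nonneg) auto
      finally show "measure ?L {z \<in> space ?L. h < sqrt n * pnorm p (P_F n p z - P_hat n p x)} \<le> \<alpha>" using \<alpha>(2) by simp
    qed
    then show "Q1 n p x > q_F n p \<alpha> x" using Q by simp
  qed
  \<comment> \<open>Bounding a measure from below by that of a subset requires the larger set to be
    measurable; the measurability of \<open>Q1\<close> and of the quantiles enters here.\<close>
  have fin: "1 - real (n + 1) ^ 2 * (4 * (1 + K) / real n ^ 3) \<le> measure (data_law n p) {x \<in> space (data_law n p). Q1 n p x > q x}"
    if q: "q \<in> borel_measurable (data_law n p)" and k: "\<And>x. x \<in> space (data_law n p) \<Longrightarrow> x \<notin> Bad \<Longrightarrow> Q1 n p x > q x" for q
  proof -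
    have "1 - real (n + 1) ^ 2 * (4 * (1 + K) / real n ^ 3) \<le> 1 - real d ^ 2 * (4 * (1 + K) / real n ^ 3)"
      using d2 K_ge by (intro diff_left_mono mult_right_mono divide_nonneg_nonneg) auto
    also have "\<dots> \<le> 1 - measure (data_law n p) Bad" using Bad(2) by simp
    also have "\<dots> = measure (data_law n p) (space (data_law n p) - Bad)" by (rule D.prob_compl[OF Bad(1), symmetric])
    also have "\<dots> \<le> measure (data_law n p) {x \<in> space (data_law n p). Q1 n p x > q x}"
      by (rule D.finite_measure_mono) (use k borel_measurable_less[OF q Q1_measurable] in auto)
    finally show ?thesis .
  qed
  show "1 - real (n + 1) ^ 2 * (4 * (1 + K) / real n ^ 3) \<le> measure (data_law n p) {x \<in> space (data_law n p). Q1 n p x > q_B n p \<alpha> x}"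
    by (rule fin[OF q_B_measurable[OF \<alpha>(1)] key(1)])
  show "1 - real (n + 1) ^ 2 * (4 * (1 + K) / real n ^ 3) \<le> measure (data_law n p) {x \<in> space (data_law n p). Q1 n p x > q_F n p \<alpha> x}"
    by (rule fin[OF q_F_measurable[OF \<alpha>(1)] key(2)])
qed

end

section \<open>Passage to the limit along the sequence of problems\<close>

lemma kappa_pos: "0 < kappa \<beta>"
proof -
  have "0 \<le> moment_const \<beta>" by (simp add: moment_const_def)
  then show ?thesis
    unfolding kappa_def Let_def using gauss_const_pos
    by (intro add_pos_nonneg mult_pos_pos mult_nonneg_nonneg add_nonneg_nonneg) auto
qed

lemma Cov_eigsys:
  obtains l u where "eigsys (dim p) (Cov p) l u"
proof -
  have "Cov p \<in> carrier_mat (dim p) (dim p)" by (simp add: Cov_def cov_mat_def)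
  moreover have "(Cov p)\<^sup>T = Cov p"
    by (rule eq_matI) (auto simp: Cov_def cov_mat_def mult.commute)
  ultimately show thesis using symmetric_eigsys that by blast
qed

text \<open>An almost sure property of a probability space holds at some point, and a single data
  set with simple spectrum already yields the deterministic dimension bound.\<close>

lemma simple_spectra_dim:
  assumes valid: "valid_problem p" and simple: "simple_spectra n p"
  shows "dim p \<le> n + 1"
proof -
  obtain l u where es: "eigsys (dim p) (Cov p) l u" by (rule Cov_eigsys)
  interpret problem_setting p l u by unfold_locales (fact valid es)+
  interpret D: prob_space "data_law n p" unfolding data_law_def by (intro prob_space_PiM prob_law)
  have ae: "AE x in data_law n p. distinct (eigs (sample_cov n (dim p) x))" using simple by (simp add: simple_spectra_def)
  have "\<exists>x\<in>space (data_law n p). distinct (eigs (sample_cov n (dim p) x))"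
  proof (rule ccontr)
    assume "\<not> ?thesis"
    then have "AE x in data_law n p. \<not> distinct (eigs (sample_cov n (dim p) x))" by (intro AE_I2) auto
    with ae have "AE x in data_law n p. False" by eventually_elim auto
    then show False by simp
  qed
  then obtain x where x: "x \<in> space (data_law n p)" "distinct (eigs (sample_cov n (dim p) x))" by blast
  have "x k \<in> carrier_vec (dim p)" if "k \<in> {1..n}" for k
    using x(1) that by (auto simp: data_law_def space_PiM space_law PiE_iff)
  then show ?thesis using distinct_sample_cov_dim x(2) by blast
qed

lemma psi_lower:
  assumes n: "1 \<le> n" and d: "1 \<le> d" and C: "0 \<le> C"
  shows "C * c\<^sup>2 * sqrt (ln (real n) / real n) \<le> psi C \<beta> c n d"
proof -
  have "ln (real n) / real n \<le> (ln (real n) + ln (real d)) / real n" using n d by (intro divide_right_mono) auto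
  then have "sqrt (ln (real n) / real n) \<le> sqrt ((ln (real n) + ln (real d)) / real n)" by simp
  moreover have "0 \<le> ln (real n) powr (1/\<beta>) * (ln (real n) + ln (real d)) powr (2/\<beta>) / real n" by simp
  ultimately have "sqrt (ln (real n) / real n) \<le> sqrt ((ln (real n) + ln (real d)) / real n) + ln (real n) powr (1/\<beta>) * (ln (real n) + ln (real d)) powr (2/\<beta>) / real n"
    by linarith
  then show ?thesis unfolding psi_def using C by (intro mult_left_mono) auto
qed

lemma rate_tendsto_0: "(\<lambda>n. real (n + 1) ^ 2 * (a / real n ^ 3)) \<longlonglongrightarrow> 0" if "0 \<le> a"
proof (rule tendsto_sandwich)
  show "\<forall>\<^sub>F n in sequentially. 0 \<le> real (n + 1) ^ 2 * (a / real n ^ 3)" using that by simp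
  show "\<forall>\<^sub>F n in sequentially. real (n + 1) ^ 2 * (a / real n ^ 3) \<le> (4 * a) / real n"
    using eventually_ge_at_top[of 1]
  proof eventually_elim
    case (elim n)
    have "real (n + 1) ^ 2 \<le> (2 * real n) ^ 2" using elim by (intro power_mono) auto
    then have "real (n + 1) ^ 2 * (a / real n ^ 3) \<le> (2 * real n) ^ 2 * (a / real n ^ 3)" using that by (intro mult_right_mono) auto
    also have "\<dots> = (4 * a) / real n" using elim by (simp add: power2_eq_square power3_eq_cube)
    finally show ?case .
  qed
  show "(\<lambda>n. (4 * a) / real n) \<longlonglongrightarrow> 0" by (rule lim_const_over_n)
qed simp

lemma eps_tendsto_0: "(\<lambda>n. a * sqrt (ln (real n) / real n)) \<longlonglongrightarrow> 0"
  using tendsto_mult_right_zero[OF tendsto_real_sqrt[OF lim_ln_over_n, simplified], of a] .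

text \<open>\<open>C\<beta>\<close> is 6 times the 48 of \<open>pnorm_perturbation\<close>, times
  \<open>kappa\<close>. Hence each perturbation error is at most \<open>D / 6\<close>, the quantiles
  are at most \<open>D / 3\<close>, and together they reach \<open>D / 2\<close>, below the
  separation \<open>lam\<close>. The quadratic term has room to spare, since only one of its two
  factors 288 is used.\<close>

lemma power_at_n:
  fixes p :: problem and n :: nat and \<alpha> \<beta> c lam C :: real
  defines "C\<beta> \<equiv> 288 * kappa \<beta>"
  defines "M \<equiv> psi C\<beta> \<beta> c n (dim p) + psi_tilde C \<beta> c n (dim p)"
  defines "D \<equiv> sqrt n * (M * dbar (dim p) (Cov p) (grps p) powr (1/2) + M\<^sup>2 * dsf (dim p) (Cov p) (grps p) powr (3/2))"
  assumes \<beta>: "0 < \<beta>" and C: "0 \<le> C" and \<alpha>: "0 < \<alpha>" and n: "3 \<le> n"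
    and valid: "valid_problem p" and simple: "simple_spectra n p" and psi: "psi_norm_sup \<beta> p \<le> ennreal c"
    and rel: "psi C\<beta> \<beta> c n (dim p) * max_rel_rank p \<le> 1/12"
    and sep: "pnorm p (PJ p - P0 p) \<ge> lam / sqrt n" and ratio: "1 < lam / D"
    and small: "4 * c\<^sup>2 * (4 + 2 * (2 * (1 + moment_const \<beta>))) * sqrt (ln (real n) / real n) \<le> 1"
    and \<alpha>n: "real (n + 1) ^ 2 * (2 * (1 + gauss_const) / real n ^ 3) \<le> \<alpha>"
  shows "1 - real (n + 1) ^ 2 * (4 * (1 + 2 * (1 + moment_const \<beta>)) / real n ^ 3) \<le> \<P>(x in data_law n p. Q1 n p x > q_B n p \<alpha> x)"
    and "1 - real (n + 1) ^ 2 * (4 * (1 + 2 * (1 + moment_const \<beta>)) / real n ^ 3) \<le> \<P>(x in data_law n p. Q1 n p x > q_F n p \<alpha> x)"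
    and "\<P>(x in data_law n p. Q1 n p x > q_B n p \<alpha> x) \<le> 1" "\<P>(x in data_law n p. Q1 n p x > q_F n p \<alpha> x) \<le> 1"
proof -
  obtain l u where es: "eigsys (dim p) (Cov p) l u" by (rule Cov_eigsys)
  interpret problem_moments p l u \<beta> c by unfold_locales (fact valid es \<beta> psi)+
  interpret L: prob_space "data_law n p" unfolding data_law_def by (intro prob_space_PiM prob_law)
  have dn: "d \<le> n + 1" by (rule simple_spectra_dim[OF valid simple])
  \<comment> \<open>In dimension zero there are no eigenvalue groups, and \<open>grps p\<close>
    could not be a proper subset of the empty set.\<close>
  have d0: "0 < d"
  proof (rule ccontr)
    assume "\<not> 0 < d"
    then have "spectrum (Cov p) = {}" using spectrum_eq[OF es] by simp
    then have "{1..q} = {}" by (simp add: num_groups_def)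
    then show False using valid unfolding valid_problem_def by auto
  qed
  define X where "X = kappa \<beta> * c\<^sup>2 * eps n"
  define P where "P = psi C\<beta> \<beta> c n d"
  have X0: "0 \<le> X" using kappa_pos[of \<beta>] eps_nonneg[of n] by (simp add: X_def)
  have PX: "288 * X \<le> P"
    using psi_lower[of n d C\<beta> c \<beta>] n d0 kappa_pos[of \<beta>] by (simp add: X_def P_def C\<beta>_def eps_def mult.assoc)
  have T0: "0 \<le> psi_tilde C \<beta> c n d" using C by (simp add: psi_tilde_def)
  have PM: "P \<le> M" using T0 by (simp add: M_def P_def)
  have M0: "0 \<le> M" using X0 PX PM by linarith
  define a where "a = dbar d (Cov p) (grps p) powr (1/2)"
  define b where "b = dsf d (Cov p) (grps p) powr (3/2)"
  have ab: "0 \<le> a" "0 \<le> b" by (simp_all add: a_def b_def)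
  have D0: "0 \<le> D" using M0 ab by (simp add: D_def a_def b_def)
  \<comment> \<open>Division by zero yields zero, so a ratio above 1 excludes
    \<open>D = 0\<close>.\<close>
  have Dpos: "0 < D" "D < lam" using ratio D0 by (cases "D = 0"; simp add: less_divide_eq)+
  have XM: "X \<le> M / 288" using PX PM by simp
  have X2: "X\<^sup>2 \<le> M\<^sup>2 / 288"
  proof -
    have "X\<^sup>2 \<le> (M / 288)\<^sup>2" using X0 XM by (rule power_mono[rotated])
    also have "\<dots> \<le> M\<^sup>2 / 288" by (simp add: power_divide divide_left_mono)
    finally show ?thesis .
  qed
  have bnd: "sqrt n * (48 * (X * a + X\<^sup>2 * b)) \<le> D / 6"
  proof -
    have "48 * (X * a + X\<^sup>2 * b) \<le> 48 * (M / 288 * a + M\<^sup>2 / 288 * b)"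
      using XM X2 ab by (intro mult_left_mono add_mono mult_right_mono) auto
    also have "\<dots> = (M * a + M\<^sup>2 * b) / 6" by simp
    finally have "sqrt n * (48 * (X * a + X\<^sup>2 * b)) \<le> sqrt n * ((M * a + M\<^sup>2 * b) / 6)" by (intro mult_left_mono) auto
    then show ?thesis by (simp add: D_def a_def b_def)
  qed
  have rank: "4 * X * rel_rank d (Cov p) r \<le> 1" if r: "r \<in> grps p" for r
  proof -
    have "rel_rank d (Cov p) r \<le> max_rel_rank p"
      unfolding max_rel_rank_def using r by (intro Max_ge) (auto simp: grps_def)
    moreover have "0 \<le> rel_rank d (Cov p) r" using rel_rank_ge_1[of r] r grps_subset by auto
    ultimately have "(4 * X) * rel_rank d (Cov p) r \<le> P * max_rel_rank p"
      using X0 PX by (intro mult_mono) auto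
    then show ?thesis using rel by (simp add: P_def)
  qed
  have sn: "0 < sqrt (real n)" using n by simp
  have "lam \<le> sqrt n * pnorm p (PJ p - P0 p)" using sep sn by (simp add: pos_divide_le_eq mult.commute)
  then have sep': "D / 3 + sqrt n * (48 * (X * a + X\<^sup>2 * b)) < sqrt n * pnorm p (PJ p - P0 p)" using bnd Dpos by linarith
  have "sqrt n * (2 * (48 * (X * a + X\<^sup>2 * b))) = 2 * (sqrt n * (48 * (X * a + X\<^sup>2 * b)))" by (simp only: mult.left_commute)
  then have h: "0 < D / 3" "sqrt n * (2 * (48 * (X * a + X\<^sup>2 * b))) \<le> D / 3" using bnd Dpos by linarith+
  note pb = power_bound[OF n d0 dn small[folded K_def eps_def] \<alpha> \<alpha>n rank[unfolded X_def] h[unfolded X_def a_def b_def] sep'[unfolded X_def a_def b_def]]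
  show "1 - real (n + 1) ^ 2 * (4 * (1 + 2 * (1 + moment_const \<beta>)) / real n ^ 3) \<le> \<P>(x in data_law n p. Q1 n p x > q_B n p \<alpha> x)"
    "1 - real (n + 1) ^ 2 * (4 * (1 + 2 * (1 + moment_const \<beta>)) / real n ^ 3) \<le> \<P>(x in data_law n p. Q1 n p x > q_F n p \<alpha> x)"
    using pb unfolding K_def by simp_all
  show "\<P>(x in data_law n p. Q1 n p x > q_B n p \<alpha> x) \<le> 1" "\<P>(x in data_law n p. Q1 n p x > q_F n p \<alpha> x) \<le> 1"
    by (rule L.prob_le_1)+
qed

theorem theorem4p9:
  shows "\<exists>C::real>0. \<exists>C'::real>0. \<forall>\<beta>::real. 0 < \<beta> \<and> \<beta> \<le> 2 \<longrightarrow> (\<exists>C\<beta>::real>0.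
    \<forall>(c::real) (p::nat \<Rightarrow> problem) (lam::nat \<Rightarrow> real) (\<alpha>::real).
      0 < \<alpha> \<and> \<alpha> < 1
      \<and> (\<forall>\<^sub>F n in sequentially.
            valid_problem (p n) \<and> simple_spectra n (p n)
            \<and> uncorrelated_blocks (p n)
            \<and> psi_norm_sup \<beta> (p n) \<le> ennreal c
            \<and> psi C\<beta> \<beta> c n (dim (p n)) * max_rel_rank (p n) \<le> 1/12
            \<and> psi_tilde C \<beta> c n (dim (p n)) * max_rel_rank (p n) \<le> 1/12
            \<and> PJ (p n) \<noteq> P0 (p n)
            \<and> pnorm (p n) (PJ (p n) - P0 (p n)) \<ge> lam n / sqrt n)
      \<and> liminf (\<lambda>n. ereal (lam n /
            (sqrt n *
              ((psi C\<beta> \<beta> c n (dim (p n)) + psi_tilde C \<beta> c n (dim (p n)))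
                  * dbar (dim (p n)) (Cov (p n)) (grps (p n)) powr (1/2)
               + (psi C\<beta> \<beta> c n (dim (p n)) + psi_tilde C \<beta> c n (dim (p n)))\<^sup>2
                  * dsf (dim (p n)) (Cov (p n)) (grps (p n)) powr (3/2))))) \<ge> ereal C'
      \<longrightarrow>
        ((\<lambda>n. \<P>(x in data_law n (p n). Q1 n (p n) x > q_B n (p n) \<alpha> x)) \<longlonglongrightarrow> 1)
        \<and> ((\<lambda>n. \<P>(x in data_law n (p n). Q1 n (p n) x > q_F n (p n) \<alpha> x)) \<longlonglongrightarrow> 1))"
\<comment> \<open>With \<open>C = 1\<close> the second rate is nonnegative, so the sum of the two
  rates dominates the first. \<open>C' = 2\<close> leaves a margin to pass from the liminf to the
  eventual strict inequality \<open>1 < lam n / D\<close>. All dependence on \<beta> is carried by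
  \<open>C\<beta>\<close>, so both constants can be fixed before \<beta>.\<close>
proof (rule exI[of _ "1::real"], rule conjI, simp, rule exI[of _ "2::real"], rule conjI, simp, intro allI impI)
  fix \<beta> :: real assume \<beta>: "0 < \<beta> \<and> \<beta> \<le> 2"
  let ?C = "288 * kappa \<beta>"
  let ?K = "2 * (1 + moment_const \<beta>)"
  show "\<exists>C\<beta>>0. \<forall>c p lam \<alpha>.
      0 < \<alpha> \<and> \<alpha> < 1
      \<and> (\<forall>\<^sub>F n in sequentially.
            valid_problem (p n) \<and> simple_spectra n (p n)
            \<and> uncorrelated_blocks (p n)
            \<and> psi_norm_sup \<beta> (p n) \<le> ennreal c
            \<and> psi C\<beta> \<beta> c n (dim (p n)) * max_rel_rank (p n) \<le> 1/12
            \<and> psi_tilde 1 \<beta> c n (dim (p n)) * max_rel_rank (p n) \<le> 1/12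
            \<and> PJ (p n) \<noteq> P0 (p n)
            \<and> pnorm (p n) (PJ (p n) - P0 (p n)) \<ge> lam n / sqrt n)
      \<and> liminf (\<lambda>n. ereal (lam n /
            (sqrt n *
              ((psi C\<beta> \<beta> c n (dim (p n)) + psi_tilde 1 \<beta> c n (dim (p n)))
                  * dbar (dim (p n)) (Cov (p n)) (grps (p n)) powr (1/2)
               + (psi C\<beta> \<beta> c n (dim (p n)) + psi_tilde 1 \<beta> c n (dim (p n)))\<^sup>2
                  * dsf (dim (p n)) (Cov (p n)) (grps (p n)) powr (3/2))))) \<ge> ereal 2
      \<longrightarrow>
        ((\<lambda>n. \<P>(x in data_law n (p n). Q1 n (p n) x > q_B n (p n) \<alpha> x)) \<longlonglongrightarrow> 1)
        \<and> ((\<lambda>n. \<P>(x in data_law n (p n). Q1 n (p n) x > q_F n (p n) \<alpha> x)) \<longlonglongrightarrow> 1)"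
  proof (rule exI[of _ ?C], rule conjI, use kappa_pos[of \<beta>] in simp, intro allI impI)
    fix c :: real and p :: "nat \<Rightarrow> problem" and lam :: "nat \<Rightarrow> real" and \<alpha> :: real
    let ?D = "\<lambda>n. sqrt n *
              ((psi ?C \<beta> c n (dim (p n)) + psi_tilde 1 \<beta> c n (dim (p n)))
                  * dbar (dim (p n)) (Cov (p n)) (grps (p n)) powr (1/2)
               + (psi ?C \<beta> c n (dim (p n)) + psi_tilde 1 \<beta> c n (dim (p n)))\<^sup>2
                  * dsf (dim (p n)) (Cov (p n)) (grps (p n)) powr (3/2))"
    assume H: "0 < \<alpha> \<and> \<alpha> < 1
      \<and> (\<forall>\<^sub>F n in sequentially.
            valid_problem (p n) \<and> simple_spectra n (p n)
            \<and> uncorrelated_blocks (p n)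
            \<and> psi_norm_sup \<beta> (p n) \<le> ennreal c
            \<and> psi ?C \<beta> c n (dim (p n)) * max_rel_rank (p n) \<le> 1/12
            \<and> psi_tilde 1 \<beta> c n (dim (p n)) * max_rel_rank (p n) \<le> 1/12
            \<and> PJ (p n) \<noteq> P0 (p n)
            \<and> pnorm (p n) (PJ (p n) - P0 (p n)) \<ge> lam n / sqrt n)
      \<and> liminf (\<lambda>n. ereal (lam n / ?D n)) \<ge> ereal 2"
    have \<alpha>: "0 < \<alpha>" and hyp: "\<forall>\<^sub>F n in sequentially.
            valid_problem (p n) \<and> simple_spectra n (p n)
            \<and> uncorrelated_blocks (p n)
            \<and> psi_norm_sup \<beta> (p n) \<le> ennreal c
            \<and> psi ?C \<beta> c n (dim (p n)) * max_rel_rank (p n) \<le> 1/12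
            \<and> psi_tilde 1 \<beta> c n (dim (p n)) * max_rel_rank (p n) \<le> 1/12
            \<and> PJ (p n) \<noteq> P0 (p n)
            \<and> pnorm (p n) (PJ (p n) - P0 (p n)) \<ge> lam n / sqrt n"
      and lim: "liminf (\<lambda>n. ereal (lam n / ?D n)) \<ge> ereal 2" using H by blast+
    have "ereal 1 < liminf (\<lambda>n. ereal (lam n / ?D n))" by (rule less_le_trans[OF _ lim]) simp
    from less_LiminfD[OF this] have ratio: "\<forall>\<^sub>F n in sequentially. 1 < lam n / ?D n" by simp
    have K0: "0 \<le> 4 * (1 + ?K)" "0 \<le> 2 * (1 + gauss_const)" using gauss_const_pos by (auto simp: moment_const_def)
    have ev1: "\<forall>\<^sub>F n in sequentially. 4 * c\<^sup>2 * (4 + 2 * ?K) * sqrt (ln (real n) / real n) < 1"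
      by (rule order_tendstoD(2)[OF eps_tendsto_0]) simp
    have ev2: "\<forall>\<^sub>F n in sequentially. real (n + 1) ^ 2 * (2 * (1 + gauss_const) / real n ^ 3) < \<alpha>"
      by (rule order_tendstoD(2)[OF rate_tendsto_0[OF K0(2)] \<alpha>])
    have main: "\<forall>\<^sub>F n in sequentially.
        1 - real (n + 1) ^ 2 * (4 * (1 + ?K) / real n ^ 3) \<le> \<P>(x in data_law n (p n). Q1 n (p n) x > q_B n (p n) \<alpha> x)
        \<and> 1 - real (n + 1) ^ 2 * (4 * (1 + ?K) / real n ^ 3) \<le> \<P>(x in data_law n (p n). Q1 n (p n) x > q_F n (p n) \<alpha> x)
        \<and> \<P>(x in data_law n (p n). Q1 n (p n) x > q_B n (p n) \<alpha> x) \<le> 1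
        \<and> \<P>(x in data_law n (p n). Q1 n (p n) x > q_F n (p n) \<alpha> x) \<le> 1"
      using hyp ratio ev1 ev2 eventually_ge_at_top[of 3]
    proof eventually_elim
      case (elim n)
      from elim(1) have 1: "valid_problem (p n)" "simple_spectra n (p n)" "psi_norm_sup \<beta> (p n) \<le> ennreal c"
        "psi ?C \<beta> c n (dim (p n)) * max_rel_rank (p n) \<le> 1/12" "pnorm (p n) (PJ (p n) - P0 (p n)) \<ge> lam n / sqrt n" by blast+
      have b: "0 < \<beta>" using \<beta> by simp
      show ?case
        using power_at_n[OF b zero_le_one \<alpha> elim(5) 1 elim(2) less_imp_le[OF elim(3)] less_imp_le[OF elim(4)]] by blast
    qed
    have low: "(\<lambda>n. 1 - real (n + 1) ^ 2 * (4 * (1 + ?K) / real n ^ 3)) \<longlonglongrightarrow> 1"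
      using tendsto_diff[OF tendsto_const[of 1] rate_tendsto_0[OF K0(1)]] by simp
    show "((\<lambda>n. \<P>(x in data_law n (p n). Q1 n (p n) x > q_B n (p n) \<alpha> x)) \<longlonglongrightarrow> 1)
        \<and> ((\<lambda>n. \<P>(x in data_law n (p n). Q1 n (p n) x > q_F n (p n) \<alpha> x)) \<longlonglongrightarrow> 1)"
    proof
      show "(\<lambda>n. \<P>(x in data_law n (p n). Q1 n (p n) x > q_B n (p n) \<alpha> x)) \<longlonglongrightarrow> 1"
        by (rule tendsto_sandwich[OF _ _ low tendsto_const]) (use main in \<open>auto elim: eventually_mono\<close>)
      show "(\<lambda>n. \<P>(x in data_law n (p n). Q1 n (p n) x > q_F n (p n) \<alpha> x)) \<longlonglongrightarrow> 1"
        by (rule tendsto_sandwich[OF _ _ low tendsto_const]) (use main in \<open>auto elim: eventually_mono\<close>)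
    qed
  qed
qed

end
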